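(* (1) The biadjunction $\mathrm{C}^{\cong}\dashv\mathrm{EM}^{\cong}$ between $\mathbf{Cmd}$ and $\mathbf{LAdj}^{\cong}$ lifts, along the forgetful 2-functors $\mathbf{WCmd}\to\mathbf{Cmd}$ and $\mathbf{GCwF}^{\cong}\to\mathbf{LAdj}^{\cong}$, to an adjoint biequivalence $$\hat{\mathrm{C}}{}^{\cong}\colon\mathbf{GCwF}^{\cong}\rightleftarrows\mathbf{WCmd}\,\colon\hat{\mathrm{EM}}{}^{\cong}$$ whose counit components are identities. In particular $\hat{\mathrm{C}}{}^{\cong}\circ\hat{\mathrm{EM}}{}^{\cong}=\mathrm{Id}$. (2) The biequivalence restricts along the inclusion $\mathbf{GCwF}\hookrightarrow\mathbf{GCwF}^{\cong}$ to a 2-reflection $\hat{\mathrm C}\dashv\hat{\mathrm{EM}}$, with $\hat{\mathrm C}\colon\mathbf{GCwF}\to\mathbf{WCmd}$ and $\hat{\mathrm{EM}}\colon\mathbf{WCmd}\to\mathbf{GCwF}$, lifting the 2-adjunction $\mathrm C\dashv\mathrm{EM}$ between $\mathbf{Cmd}$ and $\mathbf{LAdj}$. (3) The biequivalence also restricts to the wide 2-full sub-2-categories $\mathbf{WCmd}_{\mathbf{ps}}$ and $\mathbf{GCwF}^{\cong}_{\mathbf{ps}}$ on the pseudo morphisms, and the 2-reflection restricts to the wide 2-full sub-2-categories on the pseudo morphisms ($\mathbf{WCmd}_{\mathbf{ps}}$ and $\mathbf{GCwF}_{\mathbf{ps}}$) and on the strict morphisms ($\mathbf{WCmd}_{\mathbf{str}}$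 and $\mathbf{GCwF}_{\mathbf{str}}$).
   Context: "Wide" means with the same 0-cells; "2-full" means with all 2-cells between the retained 1-cells. A 2-reflection is a strict 2-adjunction whose right adjoint is fully faithful. An adjoint biequivalence consists of 2-functors in both directions, with a pseudo-natural unit and counit whose components are equivalences and which satisfy the triangle identities (up to invertible modification). "Lifts" means that the lifted 2-functors, unit and counit are strictly compatible with the forgetful 2-functors. **Fibrations.** "Fibration" means Grothendieck fibration. Standing assumption: fibrations are cloven, but morphisms are not required to preserve cleavages. $\mathbf{Fib}$: a 1-cell $p\to p'$ is a pair of functors $(B,E)$ with $p'E=Bp$ and $E$ preserving cartesian arrows; a 2-cell $(B_1,E_1)\Rightarrow(B_2,E_2)$ is a pair $(\psi\colon B_1\Rightarrow B_2,\phi\colon E_1\Rightarrow E_2)$ with $p'\phi=\psi p$. **Comonads.** $\mathbf{Cmd}$: 0-cells are categories with a comonad $(K,\epsilon,\nu)$; a 1-cell $(K,\epsilon,\nu)\to(K',\epsilon',\nu')$ is $(H,\theta\colon HK\Rightarrow K'H)$ with $\epsilon'H\circ\theta=H\epsilon$ and $\nu'H\circ\theta=K'\theta\circ\theta K\circ H\nu$, pseudo (strict) if $\theta$ is invertible (identity); composition $(H_2H_1,(\theta_2H_1)(H_2\theta_1))$; 2-cells $(H_1,\theta_1)\to(H_2,\theta_2)$ are $\phi\colon H_1\Rightarrow H_2$ with $(K'\phi)\theta_1=\theta_2(\phi K)$. **Adjunctions.** $\mathbf{LAdj}^{\cong}$: 0-cells are adjunctions $(L,R,\eta,\epsilon)$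 with $L\colon\mathcal D\to\mathcal C$ left adjoint to $R$; a 1-cell (left loose morphism) $(L,R,\eta,\epsilon)\to(L',R',\eta',\epsilon')$ is $(F\colon\mathcal C\to\mathcal C',G\colon\mathcal D\to\mathcal D',\zeta)$ with $\zeta\colon L'G\Rightarrow FL$ a natural isomorphism; its mate is $\zeta^\#=(R'F\epsilon)(R'\zeta R)(\eta'GR)\colon GR\Rightarrow R'F$; it is pseudo (strict) if $\zeta^\#$ is invertible (identity); composition $(F_2F_1,G_2G_1,(F_2\zeta_1)(\zeta_2G_1))$; 2-cells are pairs $(\phi\colon F_1\Rightarrow F_2,\psi\colon G_1\Rightarrow G_2)$ with $\phi L\circ\zeta_1=\zeta_2\circ L'\psi$. $\mathbf{LAdj}$ is the wide 2-full sub-2-category on 1-cells with $\zeta=\mathrm{id}$. **The biadjunction.** $\mathrm{EM}\colon\mathbf{Cmd}\to\mathbf{LAdj}$ sends $K$ to the Eilenberg–Moore adjunction $\mathrm U_K\dashv\mathrm R_K$ ($\mathrm U_K\colon\mathrm{CoAlg}(K)\to\mathcal C$), $(H,\theta)$ to $(H,\mathrm{CoAlg}(H,\theta))$ where $\mathrm{CoAlg}(H,\theta)(A,a)=(HA,\theta_A\circ Ha)$, and $\phi$ to $(\phi,\mathrm{CoAlg}(\phi))$ with $\mathrm{CoAlg}(\phi)_{(A,a)}=\phi_A$; $\mathrm{EM}^{\cong}$ is its composite with $\mathbf{LAdj}\hookrightarrow\mathbf{LAdj}^{\cong}$. $\mathrm C^{\cong}\colon\mathbf{LAdj}^{\cong}\to\mathbf{Cmd}$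 sends $(L,R,\eta,\epsilon)$ to $(LR,\epsilon,L\eta R)$, $(F,G,\zeta)$ to $(F,L'\zeta^\#\circ\zeta^{-1}R)$ and $(\phi,\psi)$ to $\phi$; $\mathrm C$ is its restriction to $\mathbf{LAdj}$. There is a biadjunction $\mathrm C^{\cong}\dashv\mathrm{EM}^{\cong}$ with identity counit and unit component at $(L,R)$ given by $(\mathrm{Id},\mathrm K_{L,R},\mathrm{id})$, where $\mathrm K_{L,R}\colon\mathcal D\to\mathrm{CoAlg}(LR)$, $A\mapsto(LA,L\eta_A)$ is the comparison functor; it restricts to a 2-adjunction $\mathrm C\dashv\mathrm{EM}$. **W-comonads.** A w-comonad on a fibration $p\colon\mathcal E\to\mathcal B$ is a comonad $(K,\epsilon,\nu)$ on $\mathcal E$ such that every component of $\epsilon$ is $p$-cartesian and, for every cartesian $f\colon A\to B$ in $\mathcal E$, the image under $p$ of the naturality square of $\epsilon$ at $f$ is a pullback. $\mathbf{WCmd}$: 0-cells are pairs $(p,K)$; 1-cells $(p,K)\to(p',K')$ are triples $(C,H,\theta)$ with $(C,H)$ a 1-cell in $\mathbf{Fib}$ and $(H,\theta)$ a 1-cell in $\mathbf{Cmd}$, pseudo/strict if $(H,\theta)$ is; 2-cells are pairs $(\psi,\phi)$ that are 2-cells in $\mathbf{Fib}$ with $\phi$ a 2-cell in $\mathbf{Cmd}$. The forgetful 2-functor sends $(p,K)$ to $K$. **Generalised categories with families.** A gcwf $(u,\dot u,\Sigma\dashv\Delta)$ consists of fibrations $u\colon\mathcal U\to\mathcal B$ and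 $\dot u\colon\dot{\mathcal U}\to\mathcal B$, a functor $\Sigma\colon\dot{\mathcal U}\to\mathcal U$ with $u\Sigma=\dot u$ preserving cartesian arrows, and a right adjoint $\Delta$ of $\Sigma$ (not required to commute with the fibrations) such that the unit components are $\dot u$-cartesian and the counit components are $u$-cartesian. A loose gcwf morphism is $(C,H,\dot H,\zeta)$ with $(C,H)\colon u\to u'$, $(C,\dot H)\colon\dot u\to\dot u'$ 1-cells in $\mathbf{Fib}$ and $(H,\dot H,\zeta)\colon(\Sigma,\Delta)\to(\Sigma',\Delta')$ a left loose morphism of adjunctions with $\zeta\colon\Sigma'\dot H\Rightarrow H\Sigma$ having $u'$-vertical components; it is pseudo/strict if $(H,\dot H,\zeta)$ is, and a gcwf morphism if $\zeta=\mathrm{id}$. 2-cells are triples $(\psi,\phi,\dot\phi)$ with $(\psi,\phi)$ and $(\psi,\dot\phi)$ 2-cells in $\mathbf{Fib}$ and $(\phi,\dot\phi)$ a 2-cell in $\mathbf{LAdj}^{\cong}$. This gives the 2-category $\mathbf{GCwF}^{\cong}$; $\mathbf{GCwF}$ is its wide 2-full sub-2-category on gcwf morphisms. The forgetful 2-functor sends $(u,\dot u,\Sigma\dashv\Delta)$ to $\Sigma\dashv\Delta$. Subscripts $\mathbf{ps}$ and $\mathbf{str}$ denote the wide 2-full sub-2-categories on pseudo and strict morphisms. *)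

theory Defs
  imports Main "HOL-Library.FuncSet"
begin

text \<open>
  Size convention.  A category has its objects in a type and its arrows in a type, so the 0-cells of
  the 2-categories below are all categories living in fixed (but arbitrary) types.  Throughout,
  \<^typ>\<open>'o\<close>, \<^typ>\<open>'a\<close> hold the category carrying a comonad (the codomain of the left adjoint, the
  total category of \<open>u\<close>), \<^typ>\<open>'d\<close>, \<^typ>\<open>'e\<close> hold the domain of the left adjoint (the total category
  of \<open>u\<close>-dot), and \<^typ>\<open>'b\<close>, \<^typ>\<open>'n\<close> hold base categories.  The Eilenberg--Moore construction must
  stay inside these types; it is therefore taken relative to injections
  \<open>eo :: 'o \<times> 'a \<Rightarrow> 'd\<close> (codes of coalgebras) and \<open>ea :: 'd \<times> 'a \<times> 'd \<Rightarrow> 'e\<close> (codes of coalgebra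
  morphisms).  Taking all six types equal to one type with an injective pairing gives categories
  that are small relative to a single universe.

  All functions that are part of the data of a category, functor or natural transformation are
  \<^const>\<open>undefined\<close> outside their domain, so that HOL equality is equality of these structures.
\<close>

section \<open>Categories, functors, natural transformations\<close>

record ('o, 'a) cat =
  Ob :: "'o set"
  Ar :: "'a set"
  Dom :: "'a \<Rightarrow> 'o"
  Cod :: "'a \<Rightarrow> 'o"
  Ident :: "'o \<Rightarrow> 'a"
  Comp :: "'a \<Rightarrow> 'a \<Rightarrow> 'a" (infixr "\<cdot>\<index>" 70)

definition hom :: "('o, 'a) cat \<Rightarrow> 'o \<Rightarrow> 'o \<Rightarrow> 'a set" where
  "hom C A B = {f \<in> Ar C. Dom C f = A \<and> Cod C f = B}"

locale category =
  fixes C :: "('o, 'a) cat"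
  assumes Dom_ext: "Dom C \<in> Ar C \<rightarrow>\<^sub>E Ob C"
    and Cod_ext: "Cod C \<in> Ar C \<rightarrow>\<^sub>E Ob C"
    and Ident_ext: "Ident C \<in> extensional (Ob C)"
    and Ident_hom: "A \<in> Ob C \<Longrightarrow> Ident C A \<in> hom C A A"
    and Comp_ext: "\<not> (f \<in> Ar C \<and> g \<in> Ar C \<and> Cod C f = Dom C g) \<Longrightarrow> g \<cdot>\<^bsub>C\<^esub> f = undefined"
    and Comp_hom: "\<lbrakk>f \<in> hom C A B; g \<in> hom C B D\<rbrakk> \<Longrightarrow> g \<cdot>\<^bsub>C\<^esub> f \<in> hom C A D"
    and Comp_Ident: "f \<in> hom C A B \<Longrightarrow> f \<cdot>\<^bsub>C\<^esub> Ident C A = f"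
    and Ident_Comp: "f \<in> hom C A B \<Longrightarrow> Ident C B \<cdot>\<^bsub>C\<^esub> f = f"
    and Comp_assoc: "\<lbrakk>f \<in> hom C A B; g \<in> hom C B D; h \<in> hom C D E\<rbrakk>
      \<Longrightarrow> (h \<cdot>\<^bsub>C\<^esub> g) \<cdot>\<^bsub>C\<^esub> f = h \<cdot>\<^bsub>C\<^esub> (g \<cdot>\<^bsub>C\<^esub> f)"

definition is_inverse :: "('o, 'a) cat \<Rightarrow> 'a \<Rightarrow> 'a \<Rightarrow> bool" where
  "is_inverse C f g \<longleftrightarrow> f \<in> Ar C \<and> g \<in> hom C (Cod C f) (Dom C f) \<and>
    g \<cdot>\<^bsub>C\<^esub> f = Ident C (Dom C f) \<and> f \<cdot>\<^bsub>C\<^esub> g = Ident C (Cod C f)"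

definition iso :: "('o, 'a) cat \<Rightarrow> 'a \<Rightarrow> bool" where
  "iso C f \<longleftrightarrow> (\<exists>g. is_inverse C f g)"

definition inv_ar :: "('o, 'a) cat \<Rightarrow> 'a \<Rightarrow> 'a" where
  "inv_ar C f = (THE g. is_inverse C f g)"

definition is_pullback :: "('o, 'a) cat \<Rightarrow> 'a \<Rightarrow> 'a \<Rightarrow> 'a \<Rightarrow> 'a \<Rightarrow> bool" where
  \<comment> \<open>\<open>f \<circ> p = g \<circ> q\<close> is a pullback square with projections \<open>p\<close> and \<open>q\<close>\<close>
  "is_pullback C p q f g \<longleftrightarrow>
    {p, q, f, g} \<subseteq> Ar C \<and> Dom C p = Dom C q \<and> Cod C p = Dom C f \<and> Cod C q = Dom C g \<and>
    Cod C f = Cod C g \<and> f \<cdot>\<^bsub>C\<^esub> p = g \<cdot>\<^bsub>C\<^esub> q \<and>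
    (\<forall>X \<in> Ob C. \<forall>x \<in> hom C X (Dom C f). \<forall>y \<in> hom C X (Dom C g). f \<cdot>\<^bsub>C\<^esub> x = g \<cdot>\<^bsub>C\<^esub> y \<longrightarrow>
      (\<exists>!z. z \<in> hom C X (Dom C p) \<and> p \<cdot>\<^bsub>C\<^esub> z = x \<and> q \<cdot>\<^bsub>C\<^esub> z = y))"

record ('o, 'a, 'p, 'c) fctr =
  onO :: "'o \<Rightarrow> 'p"
  onA :: "'a \<Rightarrow> 'c"

locale is_functor = C: category C + D: category D
  for C :: "('o, 'a) cat" and D :: "('p, 'c) cat" +
  fixes F :: "('o, 'a, 'p, 'c) fctr"
  assumes onO_ext: "onO F \<in> Ob C \<rightarrow>\<^sub>E Ob D"
    and onA_ext: "onA F \<in> extensional (Ar C)"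
    and onA_hom: "f \<in> hom C A B \<Longrightarrow> onA F f \<in> hom D (onO F A) (onO F B)"
    and onA_Ident: "A \<in> Ob C \<Longrightarrow> onA F (Ident C A) = Ident D (onO F A)"
    and onA_Comp: "\<lbrakk>f \<in> hom C A B; g \<in> hom C B E\<rbrakk>
      \<Longrightarrow> onA F (g \<cdot>\<^bsub>C\<^esub> f) = onA F g \<cdot>\<^bsub>D\<^esub> onA F f"

definition id_fct :: "('o, 'a) cat \<Rightarrow> ('o, 'a, 'o, 'a) fctr" where
  "id_fct C = \<lparr>onO = \<lambda>A \<in> Ob C. A, onA = \<lambda>f \<in> Ar C. f\<rparr>"

definition comp_fct ::
  "('o, 'a) cat \<Rightarrow> ('p, 'c, 'q, 'k) fctr \<Rightarrow> ('o, 'a, 'p, 'c) fctr \<Rightarrow> ('o, 'a, 'q, 'k) fctr" where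
  \<comment> \<open>\<open>G \<circ> F\<close> for \<open>F\<close> with domain \<open>C\<close>\<close>
  "comp_fct C G F = \<lparr>onO = \<lambda>A \<in> Ob C. onO G (onO F A), onA = \<lambda>f \<in> Ar C. onA G (onA F f)\<rparr>"

locale nat_trans = F: is_functor C D F + G: is_functor C D G
  for C :: "('o, 'a) cat" and D :: "('p, 'c) cat" and F G +
  fixes \<tau> :: "'o \<Rightarrow> 'c"
  assumes nt_ext: "\<tau> \<in> extensional (Ob C)"
    and nt_hom: "A \<in> Ob C \<Longrightarrow> \<tau> A \<in> hom D (onO F A) (onO G A)"
    and nt_natural: "f \<in> hom C A B \<Longrightarrow> \<tau> B \<cdot>\<^bsub>D\<^esub> onA F f = onA G f \<cdot>\<^bsub>D\<^esub> \<tau> A"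

definition nat_iso where
  "nat_iso C D F G \<tau> \<longleftrightarrow> nat_trans C D F G \<tau> \<and> (\<forall>A \<in> Ob C. iso D (\<tau> A))"

definition id_nt :: "('o, 'a) cat \<Rightarrow> ('p, 'c) cat \<Rightarrow> ('o, 'a, 'p, 'c) fctr \<Rightarrow> 'o \<Rightarrow> 'c" where
  "id_nt C D F = (\<lambda>A \<in> Ob C. Ident D (onO F A))"

definition vcomp_nt :: "('o, 'a) cat \<Rightarrow> ('p, 'c) cat \<Rightarrow> ('o \<Rightarrow> 'c) \<Rightarrow> ('o \<Rightarrow> 'c) \<Rightarrow> 'o \<Rightarrow> 'c" where
  "vcomp_nt C D \<tau> \<sigma> = (\<lambda>A \<in> Ob C. \<tau> A \<cdot>\<^bsub>D\<^esub> \<sigma> A)"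

definition hcomp_nt :: "('o, 'a) cat \<Rightarrow> ('q, 'k) cat \<Rightarrow> ('p, 'c, 'q, 'k) fctr \<Rightarrow>
    ('o, 'a, 'p, 'c) fctr \<Rightarrow> ('p \<Rightarrow> 'k) \<Rightarrow> ('o \<Rightarrow> 'c) \<Rightarrow> 'o \<Rightarrow> 'k" where
  \<comment> \<open>for \<open>\<sigma> : F \<Rightarrow> F'\<close> between functors \<open>C \<rightarrow> D\<close> and \<open>\<tau> : G \<Rightarrow> G'\<close> between functors \<open>D \<rightarrow> E\<close>,
    this is \<open>hcomp_nt C E G F' \<tau> \<sigma> : GF \<Rightarrow> G'F'\<close>\<close>
  "hcomp_nt C E G F' \<tau> \<sigma> = (\<lambda>A \<in> Ob C. \<tau> (onO F' A) \<cdot>\<^bsub>E\<^esub> onA G (\<sigma> A))"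


section \<open>Strict 2-categories\<close>

record ('x, 'y, 'z) twocat =
  Zero :: "'x set"
  One :: "'y set"
  Two :: "'z set"
  src1 :: "'y \<Rightarrow> 'x"
  tgt1 :: "'y \<Rightarrow> 'x"
  src2 :: "'z \<Rightarrow> 'y"
  tgt2 :: "'z \<Rightarrow> 'y"
  id1 :: "'x \<Rightarrow> 'y"
  id2 :: "'y \<Rightarrow> 'z"
  comp1 :: "'y \<Rightarrow> 'y \<Rightarrow> 'y" (infixr "\<odot>\<index>" 70)
  vcomp :: "'z \<Rightarrow> 'z \<Rightarrow> 'z" (infixr "\<bullet>\<index>" 65)
  hcomp :: "'z \<Rightarrow> 'z \<Rightarrow> 'z" (infixr "\<star>\<index>" 70)

definition hom1 :: "('x, 'y, 'z) twocat \<Rightarrow> 'x \<Rightarrow> 'x \<Rightarrow> 'y set" where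
  "hom1 A x y = {f \<in> One A. src1 A f = x \<and> tgt1 A f = y}"

definition hom2 :: "('x, 'y, 'z) twocat \<Rightarrow> 'y \<Rightarrow> 'y \<Rightarrow> 'z set" where
  "hom2 A f g = {\<alpha> \<in> Two A. src2 A \<alpha> = f \<and> tgt2 A \<alpha> = g}"

locale two_category =
  fixes A :: "('x, 'y, 'z) twocat"
  assumes src1_Zero: "f \<in> One A \<Longrightarrow> src1 A f \<in> Zero A"
    and tgt1_Zero: "f \<in> One A \<Longrightarrow> tgt1 A f \<in> Zero A"
    and src2_One: "\<alpha> \<in> Two A \<Longrightarrow> src2 A \<alpha> \<in> One A"
    and tgt2_One: "\<alpha> \<in> Two A \<Longrightarrow> tgt2 A \<alpha> \<in> One A"
    and globular_src: "\<alpha> \<in> Two A \<Longrightarrow> src1 A (src2 A \<alpha>) = src1 A (tgt2 A \<alpha>)"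
    and globular_tgt: "\<alpha> \<in> Two A \<Longrightarrow> tgt1 A (src2 A \<alpha>) = tgt1 A (tgt2 A \<alpha>)"
    and id1_hom: "x \<in> Zero A \<Longrightarrow> id1 A x \<in> hom1 A x x"
    and id2_hom: "f \<in> One A \<Longrightarrow> id2 A f \<in> hom2 A f f"
    and comp1_hom: "\<lbrakk>f \<in> hom1 A x y; g \<in> hom1 A y z\<rbrakk> \<Longrightarrow> g \<odot>\<^bsub>A\<^esub> f \<in> hom1 A x z"
    and comp1_id1: "f \<in> hom1 A x y \<Longrightarrow> f \<odot>\<^bsub>A\<^esub> id1 A x = f"
    and id1_comp1: "f \<in> hom1 A x y \<Longrightarrow> id1 A y \<odot>\<^bsub>A\<^esub> f = f"
    and comp1_assoc: "\<lbrakk>f \<in> hom1 A x y; g \<in> hom1 A y z; h \<in> hom1 A z w\<rbrakk>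
      \<Longrightarrow> (h \<odot>\<^bsub>A\<^esub> g) \<odot>\<^bsub>A\<^esub> f = h \<odot>\<^bsub>A\<^esub> (g \<odot>\<^bsub>A\<^esub> f)"
    and vcomp_hom: "\<lbrakk>\<alpha> \<in> hom2 A f g; \<beta> \<in> hom2 A g h\<rbrakk> \<Longrightarrow> \<beta> \<bullet>\<^bsub>A\<^esub> \<alpha> \<in> hom2 A f h"
    and vcomp_id2: "\<alpha> \<in> hom2 A f g \<Longrightarrow> \<alpha> \<bullet>\<^bsub>A\<^esub> id2 A f = \<alpha>"
    and id2_vcomp: "\<alpha> \<in> hom2 A f g \<Longrightarrow> id2 A g \<bullet>\<^bsub>A\<^esub> \<alpha> = \<alpha>"
    and vcomp_assoc: "\<lbrakk>\<alpha> \<in> hom2 A f g; \<beta> \<in> hom2 A g h; \<gamma> \<in> hom2 A h k\<rbrakk>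
      \<Longrightarrow> (\<gamma> \<bullet>\<^bsub>A\<^esub> \<beta>) \<bullet>\<^bsub>A\<^esub> \<alpha> = \<gamma> \<bullet>\<^bsub>A\<^esub> (\<beta> \<bullet>\<^bsub>A\<^esub> \<alpha>)"
    and hcomp_hom: "\<lbrakk>f \<in> hom1 A x y; g \<in> hom1 A y z; \<alpha> \<in> hom2 A f f'; \<beta> \<in> hom2 A g g'\<rbrakk>
      \<Longrightarrow> \<beta> \<star>\<^bsub>A\<^esub> \<alpha> \<in> hom2 A (g \<odot>\<^bsub>A\<^esub> f) (g' \<odot>\<^bsub>A\<^esub> f')"
    and hcomp_id1: "\<lbrakk>f \<in> hom1 A x y; \<alpha> \<in> hom2 A f f'\<rbrakk> \<Longrightarrow> \<alpha> \<star>\<^bsub>A\<^esub> id2 A (id1 A x) = \<alpha>"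
    and id1_hcomp: "\<lbrakk>f \<in> hom1 A x y; \<alpha> \<in> hom2 A f f'\<rbrakk> \<Longrightarrow> id2 A (id1 A y) \<star>\<^bsub>A\<^esub> \<alpha> = \<alpha>"
    and hcomp_assoc: "\<lbrakk>f \<in> hom1 A x y; g \<in> hom1 A y z; h \<in> hom1 A z w;
        \<alpha> \<in> hom2 A f f'; \<beta> \<in> hom2 A g g'; \<gamma> \<in> hom2 A h h'\<rbrakk>
      \<Longrightarrow> (\<gamma> \<star>\<^bsub>A\<^esub> \<beta>) \<star>\<^bsub>A\<^esub> \<alpha> = \<gamma> \<star>\<^bsub>A\<^esub> (\<beta> \<star>\<^bsub>A\<^esub> \<alpha>)"
    and hcomp_id2: "\<lbrakk>f \<in> hom1 A x y; g \<in> hom1 A y z\<rbrakk>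
      \<Longrightarrow> id2 A g \<star>\<^bsub>A\<^esub> id2 A f = id2 A (g \<odot>\<^bsub>A\<^esub> f)"
    and interchange: "\<lbrakk>f \<in> hom1 A x y; g \<in> hom1 A y z;
        \<alpha> \<in> hom2 A f f'; \<alpha>' \<in> hom2 A f' f''; \<beta> \<in> hom2 A g g'; \<beta>' \<in> hom2 A g' g''\<rbrakk>
      \<Longrightarrow> (\<beta>' \<bullet>\<^bsub>A\<^esub> \<beta>) \<star>\<^bsub>A\<^esub> (\<alpha>' \<bullet>\<^bsub>A\<^esub> \<alpha>) = (\<beta>' \<star>\<^bsub>A\<^esub> \<alpha>') \<bullet>\<^bsub>A\<^esub> (\<beta> \<star>\<^bsub>A\<^esub> \<alpha>)"

definition invertible2 :: "('x, 'y, 'z) twocat \<Rightarrow> 'z \<Rightarrow> bool" where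
  "invertible2 A \<alpha> \<longleftrightarrow> \<alpha> \<in> Two A \<and> (\<exists>\<beta> \<in> hom2 A (tgt2 A \<alpha>) (src2 A \<alpha>).
    \<beta> \<bullet>\<^bsub>A\<^esub> \<alpha> = id2 A (src2 A \<alpha>) \<and> \<alpha> \<bullet>\<^bsub>A\<^esub> \<beta> = id2 A (tgt2 A \<alpha>))"

definition equivalence1 :: "('x, 'y, 'z) twocat \<Rightarrow> 'y \<Rightarrow> bool" where
  "equivalence1 A f \<longleftrightarrow> f \<in> One A \<and> (\<exists>g \<in> hom1 A (tgt1 A f) (src1 A f).
    (\<exists>\<alpha> \<in> hom2 A (id1 A (src1 A f)) (g \<odot>\<^bsub>A\<^esub> f). invertible2 A \<alpha>) \<and>
    (\<exists>\<beta> \<in> hom2 A (f \<odot>\<^bsub>A\<^esub> g) (id1 A (tgt1 A f)). invertible2 A \<beta>))"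

definition wide_full_sub :: "('x, 'y, 'z) twocat \<Rightarrow> ('y \<Rightarrow> bool) \<Rightarrow> ('x, 'y, 'z) twocat" where
  "wide_full_sub A P = A\<lparr>One := {f \<in> One A. P f}, Two := {\<alpha> \<in> Two A. P (src2 A \<alpha>) \<and> P (tgt2 A \<alpha>)}\<rparr>"

text \<open>
  2-functors and transformations are only considered on the cells of their source.  Hence the same
  data can be read on a wide 2-full sub-2-category, which is how restrictions are expressed:
  the restriction of \<open>F : A \<rightarrow> B\<close> to \<open>A' \<rightarrow> B'\<close> exists iff \<open>two_functor A' B' F\<close>.  Equality of
  2-functors is \<open>eq_2fun\<close>.
\<close>

record ('x, 'y, 'z, 'u, 'v, 'w) twofun =
  F0 :: "'x \<Rightarrow> 'u"
  F1 :: "'y \<Rightarrow> 'v"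
  F2 :: "'z \<Rightarrow> 'w"

locale two_functor = A: two_category A + B: two_category B
  for A :: "('x, 'y, 'z) twocat" and B :: "('u, 'v, 'w) twocat" +
  fixes F :: "('x, 'y, 'z, 'u, 'v, 'w) twofun"
  assumes F0_Zero: "x \<in> Zero A \<Longrightarrow> F0 F x \<in> Zero B"
    and F1_hom: "f \<in> hom1 A x y \<Longrightarrow> F1 F f \<in> hom1 B (F0 F x) (F0 F y)"
    and F2_hom: "\<alpha> \<in> hom2 A f g \<Longrightarrow> F2 F \<alpha> \<in> hom2 B (F1 F f) (F1 F g)"
    and F1_id: "x \<in> Zero A \<Longrightarrow> F1 F (id1 A x) = id1 B (F0 F x)"
    and F1_comp: "\<lbrakk>f \<in> hom1 A x y; g \<in> hom1 A y z\<rbrakk> \<Longrightarrow> F1 F (g \<odot>\<^bsub>A\<^esub> f) = F1 F g \<odot>\<^bsub>B\<^esub> F1 F f"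
    and F2_id: "f \<in> One A \<Longrightarrow> F2 F (id2 A f) = id2 B (F1 F f)"
    and F2_vcomp: "\<lbrakk>\<alpha> \<in> hom2 A f g; \<beta> \<in> hom2 A g h\<rbrakk>
      \<Longrightarrow> F2 F (\<beta> \<bullet>\<^bsub>A\<^esub> \<alpha>) = F2 F \<beta> \<bullet>\<^bsub>B\<^esub> F2 F \<alpha>"
    and F2_hcomp: "\<lbrakk>f \<in> hom1 A x y; g \<in> hom1 A y z; \<alpha> \<in> hom2 A f f'; \<beta> \<in> hom2 A g g'\<rbrakk>
      \<Longrightarrow> F2 F (\<beta> \<star>\<^bsub>A\<^esub> \<alpha>) = F2 F \<beta> \<star>\<^bsub>B\<^esub> F2 F \<alpha>"

definition id_2fun :: "('x, 'y, 'z, 'x, 'y, 'z) twofun" where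
  "id_2fun = \<lparr>F0 = \<lambda>x. x, F1 = \<lambda>f. f, F2 = \<lambda>\<alpha>. \<alpha>\<rparr>"

definition comp_2fun where
  "comp_2fun G F = \<lparr>F0 = F0 G \<circ> F0 F, F1 = F1 G \<circ> F1 F, F2 = F2 G \<circ> F2 F\<rparr>"

definition eq_2fun where
  "eq_2fun A F G \<longleftrightarrow> (\<forall>x \<in> Zero A. F0 F x = F0 G x) \<and> (\<forall>f \<in> One A. F1 F f = F1 G f) \<and>
    (\<forall>\<alpha> \<in> Two A. F2 F \<alpha> = F2 G \<alpha>)"

text \<open>
  A pseudo-natural transformation \<open>\<sigma> : F \<Rightarrow> G\<close> has 1-cells \<open>\<sigma>\<^sub>x : F x \<rightarrow> G x\<close> and invertible 2-cells
  \<open>\<sigma>\<^sub>f : \<sigma>\<^sub>y \<circ> F f \<Rightarrow> G f \<circ> \<sigma>\<^sub>x\<close> for \<open>f : x \<rightarrow> y\<close>.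
\<close>

record ('x, 'y, 'v, 'w) pnat =
  pn1 :: "'x \<Rightarrow> 'v"
  pn2 :: "'y \<Rightarrow> 'w"

locale pseudonat = F: two_functor A B F + G: two_functor A B G
  for A :: "('x, 'y, 'z) twocat" and B :: "('u, 'v, 'w) twocat" and F G +
  fixes \<sigma> :: "('x, 'y, 'v, 'w) pnat"
  assumes pn1_hom: "x \<in> Zero A \<Longrightarrow> pn1 \<sigma> x \<in> hom1 B (F0 F x) (F0 G x)"
    and pn2_hom: "f \<in> hom1 A x y
      \<Longrightarrow> pn2 \<sigma> f \<in> hom2 B (pn1 \<sigma> y \<odot>\<^bsub>B\<^esub> F1 F f) (F1 G f \<odot>\<^bsub>B\<^esub> pn1 \<sigma> x)"
    and pn2_invertible: "f \<in> One A \<Longrightarrow> invertible2 B (pn2 \<sigma> f)"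
    and pn2_natural: "\<lbrakk>f \<in> hom1 A x y; \<alpha> \<in> hom2 A f g\<rbrakk>
      \<Longrightarrow> pn2 \<sigma> g \<bullet>\<^bsub>B\<^esub> (id2 B (pn1 \<sigma> y) \<star>\<^bsub>B\<^esub> F2 F \<alpha>)
        = (F2 G \<alpha> \<star>\<^bsub>B\<^esub> id2 B (pn1 \<sigma> x)) \<bullet>\<^bsub>B\<^esub> pn2 \<sigma> f"
    and pn2_id: "x \<in> Zero A \<Longrightarrow> pn2 \<sigma> (id1 A x) = id2 B (pn1 \<sigma> x)"
    and pn2_comp: "\<lbrakk>f \<in> hom1 A x y; g \<in> hom1 A y z\<rbrakk>
      \<Longrightarrow> pn2 \<sigma> (g \<odot>\<^bsub>A\<^esub> f)
        = (id2 B (F1 G g) \<star>\<^bsub>B\<^esub> pn2 \<sigma> f) \<bullet>\<^bsub>B\<^esub> (pn2 \<sigma> g \<star>\<^bsub>B\<^esub> id2 B (F1 F f))"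

definition two_natural where
  "two_natural A B F G \<sigma> \<longleftrightarrow> pseudonat A B F G \<sigma> \<and>
    (\<forall>f \<in> One A. pn2 \<sigma> f = id2 B (pn1 \<sigma> (tgt1 A f) \<odot>\<^bsub>B\<^esub> F1 F f))"

definition id_pn :: "('u, 'v, 'w) twocat \<Rightarrow> ('x, 'y, 'z, 'u, 'v, 'w) twofun \<Rightarrow> ('x, 'y, 'v, 'w) pnat" where
  "id_pn B F = \<lparr>pn1 = \<lambda>x. id1 B (F0 F x), pn2 = \<lambda>f. id2 B (F1 F f)\<rparr>"

definition vcomp_pn :: "('x, 'y, 'z) twocat \<Rightarrow> ('u, 'v, 'w) twocat \<Rightarrow>
    ('x, 'y, 'v, 'w) pnat \<Rightarrow> ('x, 'y, 'v, 'w) pnat \<Rightarrow> ('x, 'y, 'v, 'w) pnat" where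
  "vcomp_pn A B \<tau> \<sigma> = \<lparr>pn1 = \<lambda>x. pn1 \<tau> x \<odot>\<^bsub>B\<^esub> pn1 \<sigma> x,
    pn2 = \<lambda>f. (pn2 \<tau> f \<star>\<^bsub>B\<^esub> id2 B (pn1 \<sigma> (src1 A f))) \<bullet>\<^bsub>B\<^esub> (id2 B (pn1 \<tau> (tgt1 A f)) \<star>\<^bsub>B\<^esub> pn2 \<sigma> f)\<rparr>"

definition whisker_left :: "('u, 'v, 'w, 'r, 's, 't) twofun \<Rightarrow> ('x, 'y, 'v, 'w) pnat \<Rightarrow>
    ('x, 'y, 's, 't) pnat" where
  "whisker_left H \<sigma> = \<lparr>pn1 = F1 H \<circ> pn1 \<sigma>, pn2 = F2 H \<circ> pn2 \<sigma>\<rparr>"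

definition whisker_right :: "('x, 'y, 'v, 'w) pnat \<Rightarrow> ('r, 's, 't, 'x, 'y, 'z) twofun \<Rightarrow>
    ('r, 's, 'v, 'w) pnat" where
  "whisker_right \<sigma> K = \<lparr>pn1 = pn1 \<sigma> \<circ> F0 K, pn2 = pn2 \<sigma> \<circ> F1 K\<rparr>"

definition eq_pn where
  "eq_pn A \<sigma> \<tau> \<longleftrightarrow> (\<forall>x \<in> Zero A. pn1 \<sigma> x = pn1 \<tau> x) \<and> (\<forall>f \<in> One A. pn2 \<sigma> f = pn2 \<tau> f)"

definition invertible_modification where
  "invertible_modification A B F G \<sigma> \<tau> \<Gamma> \<longleftrightarrow>
    pseudonat A B F G \<sigma> \<and> pseudonat A B F G \<tau> \<and>
    (\<forall>x \<in> Zero A. \<Gamma> x \<in> hom2 B (pn1 \<sigma> x) (pn1 \<tau> x) \<and> invertible2 B (\<Gamma> x)) \<and>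
    (\<forall>x \<in> Zero A. \<forall>y \<in> Zero A. \<forall>f \<in> hom1 A x y.
      pn2 \<tau> f \<bullet>\<^bsub>B\<^esub> (\<Gamma> y \<star>\<^bsub>B\<^esub> id2 B (F1 F f)) = (id2 B (F1 G f) \<star>\<^bsub>B\<^esub> \<Gamma> x) \<bullet>\<^bsub>B\<^esub> pn2 \<sigma> f)"

definition biadjunction where
  \<comment> \<open>\<open>F : A \<rightarrow> B\<close> is left biadjoint to \<open>G : B \<rightarrow> A\<close>, with unit \<open>\<eta>\<close> and counit \<open>\<epsilon>\<close>\<close>
  "biadjunction A B F G \<eta> \<epsilon> \<longleftrightarrow>
    two_functor A B F \<and> two_functor B A G \<and>
    pseudonat A A id_2fun (comp_2fun G F) \<eta> \<and> pseudonat B B (comp_2fun F G) id_2fun \<epsilon> \<and>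
    (\<exists>\<Gamma>. invertible_modification A B F F
      (vcomp_pn A B (whisker_right \<epsilon> F) (whisker_left F \<eta>)) (id_pn B F) \<Gamma>) \<and>
    (\<exists>\<Gamma>. invertible_modification B A G G
      (vcomp_pn B A (whisker_left G \<epsilon>) (whisker_right \<eta> G)) (id_pn A G) \<Gamma>)"

definition adjoint_biequivalence where
  "adjoint_biequivalence A B F G \<eta> \<epsilon> \<longleftrightarrow> biadjunction A B F G \<eta> \<epsilon> \<and>
    (\<forall>x \<in> Zero A. equivalence1 A (pn1 \<eta> x)) \<and> (\<forall>x \<in> Zero B. equivalence1 B (pn1 \<epsilon> x))"

definition two_adjunction where
  "two_adjunction A B F G \<eta> \<epsilon> \<longleftrightarrow>
    two_functor A B F \<and> two_functor B A G \<and>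
    two_natural A A id_2fun (comp_2fun G F) \<eta> \<and> two_natural B B (comp_2fun F G) id_2fun \<epsilon> \<and>
    (\<forall>x \<in> Zero A. pn1 \<epsilon> (F0 F x) \<odot>\<^bsub>B\<^esub> F1 F (pn1 \<eta> x) = id1 B (F0 F x)) \<and>
    (\<forall>x \<in> Zero B. F1 G (pn1 \<epsilon> x) \<odot>\<^bsub>A\<^esub> pn1 \<eta> (F0 G x) = id1 A (F0 G x))"

definition fully_faithful_2fun where
  \<comment> \<open>isomorphism on hom-categories\<close>
  "fully_faithful_2fun A B F \<longleftrightarrow> two_functor A B F \<and>
    (\<forall>x \<in> Zero A. \<forall>y \<in> Zero A. bij_betw (F1 F) (hom1 A x y) (hom1 B (F0 F x) (F0 F y))) \<and>
    (\<forall>x \<in> Zero A. \<forall>y \<in> Zero A. \<forall>f \<in> hom1 A x y. \<forall>g \<in> hom1 A x y.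
      bij_betw (F2 F) (hom2 A f g) (hom2 B (F1 F f) (F1 F g)))"

definition two_reflection where
  "two_reflection A B F G \<eta> \<epsilon> \<longleftrightarrow> two_adjunction A B F G \<eta> \<epsilon> \<and> fully_faithful_2fun B A G"

definition lifts where
  \<comment> \<open>the data \<open>F : A \<rightarrow> B\<close>, \<open>G : B \<rightarrow> A\<close>, \<open>\<eta>\<close>, \<open>\<epsilon>\<close> lie strictly over \<open>F'\<close>, \<open>G'\<close>, \<open>\<eta>'\<close>, \<open>\<epsilon>'\<close>
    (between \<open>A'\<close> and \<open>B'\<close>) along \<open>U : A \<rightarrow> A'\<close> and \<open>V : B \<rightarrow> B'\<close>\<close>
  "lifts A B U V A' B' F G \<eta> \<epsilon> F' G' \<eta>' \<epsilon>' \<longleftrightarrow>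
    two_functor A A' U \<and> two_functor B B' V \<and>
    eq_2fun A (comp_2fun V F) (comp_2fun F' U) \<and>
    eq_2fun B (comp_2fun U G) (comp_2fun G' V) \<and>
    eq_pn A (whisker_left U \<eta>) (whisker_right \<eta>' U) \<and>
    eq_pn B (whisker_left V \<epsilon>) (whisker_right \<epsilon>' V)"


section \<open>The 2-category of comonads\<close>

record ('o, 'a) comonad =
  cmC :: "('o, 'a) cat"
  cmK :: "('o, 'a, 'o, 'a) fctr"
  cmeps :: "'o \<Rightarrow> 'a"
  cmnu :: "'o \<Rightarrow> 'a"

definition is_comonad :: "('o, 'a) comonad \<Rightarrow> bool" where
  "is_comonad T \<longleftrightarrow> (let C = cmC T; K = cmK T; \<epsilon> = cmeps T; \<nu> = cmnu T in
    nat_trans C C K (id_fct C) \<epsilon> \<and> nat_trans C C K (comp_fct C K K) \<nu> \<and>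
    (\<forall>A \<in> Ob C. \<epsilon> (onO K A) \<cdot>\<^bsub>C\<^esub> \<nu> A = Ident C (onO K A) \<and>
      onA K (\<epsilon> A) \<cdot>\<^bsub>C\<^esub> \<nu> A = Ident C (onO K A) \<and>
      onA K (\<nu> A) \<cdot>\<^bsub>C\<^esub> \<nu> A = \<nu> (onO K A) \<cdot>\<^bsub>C\<^esub> \<nu> A))"

record 'x cell =
  Src :: 'x
  Tgt :: 'x

record ('o, 'a) cmd_1cell = "('o, 'a) comonad cell" +
  cmH :: "('o, 'a, 'o, 'a) fctr"
  cmth :: "'o \<Rightarrow> 'a"

record ('o, 'a) cmd_2cell = "('o, 'a) cmd_1cell cell" +
  cmphi :: "'o \<Rightarrow> 'a"

definition is_cmd_1cell :: "('o, 'a) cmd_1cell \<Rightarrow> bool" where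
  "is_cmd_1cell f \<longleftrightarrow> is_comonad (Src f) \<and> is_comonad (Tgt f) \<and>
    (let C = cmC (Src f); K = cmK (Src f); C' = cmC (Tgt f); K' = cmK (Tgt f);
         H = cmH f; \<theta> = cmth f in
    is_functor C C' H \<and>
    nat_trans C C' (comp_fct C H K) (comp_fct C K' H) \<theta> \<and>
    (\<forall>A \<in> Ob C.
      cmeps (Tgt f) (onO H A) \<cdot>\<^bsub>C'\<^esub> \<theta> A = onA H (cmeps (Src f) A) \<and>
      cmnu (Tgt f) (onO H A) \<cdot>\<^bsub>C'\<^esub> \<theta> A
        = onA K' (\<theta> A) \<cdot>\<^bsub>C'\<^esub> \<theta> (onO K A) \<cdot>\<^bsub>C'\<^esub> onA H (cmnu (Src f) A)))"

definition is_cmd_2cell :: "('o, 'a) cmd_2cell \<Rightarrow> bool" where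
  "is_cmd_2cell \<alpha> \<longleftrightarrow> is_cmd_1cell (Src \<alpha>) \<and> is_cmd_1cell (Tgt \<alpha>) \<and>
    Src (Src \<alpha>) = Src (Tgt \<alpha>) \<and> Tgt (Src \<alpha>) = Tgt (Tgt \<alpha>) \<and>
    (let T = Src (Src \<alpha>); T' = Tgt (Src \<alpha>); C' = cmC T' in
    nat_trans (cmC T) C' (cmH (Src \<alpha>)) (cmH (Tgt \<alpha>)) (cmphi \<alpha>) \<and>
    (\<forall>A \<in> Ob (cmC T). onA (cmK T') (cmphi \<alpha> A) \<cdot>\<^bsub>C'\<^esub> cmth (Src \<alpha>) A
      = cmth (Tgt \<alpha>) A \<cdot>\<^bsub>C'\<^esub> cmphi \<alpha> (onO (cmK T) A)))"

definition cmd_id1 :: "('o, 'a) comonad \<Rightarrow> ('o, 'a) cmd_1cell" where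
  "cmd_id1 T = \<lparr>Src = T, Tgt = T, cmH = id_fct (cmC T), cmth = id_nt (cmC T) (cmC T) (cmK T)\<rparr>"

definition cmd_comp1 :: "('o, 'a) cmd_1cell \<Rightarrow> ('o, 'a) cmd_1cell \<Rightarrow> ('o, 'a) cmd_1cell" where
  "cmd_comp1 g f = \<lparr>Src = Src f, Tgt = Tgt g, cmH = comp_fct (cmC (Src f)) (cmH g) (cmH f),
    cmth = \<lambda>A \<in> Ob (cmC (Src f)). cmth g (onO (cmH f) A) \<cdot>\<^bsub>cmC (Tgt g)\<^esub> onA (cmH g) (cmth f A)\<rparr>"

definition cmd_id2 :: "('o, 'a) cmd_1cell \<Rightarrow> ('o, 'a) cmd_2cell" where
  "cmd_id2 f = \<lparr>Src = f, Tgt = f, cmphi = id_nt (cmC (Src f)) (cmC (Tgt f)) (cmH f)\<rparr>"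

definition cmd_vcomp :: "('o, 'a) cmd_2cell \<Rightarrow> ('o, 'a) cmd_2cell \<Rightarrow> ('o, 'a) cmd_2cell" where
  "cmd_vcomp \<beta> \<alpha> = \<lparr>Src = Src \<alpha>, Tgt = Tgt \<beta>,
    cmphi = vcomp_nt (cmC (Src (Src \<alpha>))) (cmC (Tgt (Src \<alpha>))) (cmphi \<beta>) (cmphi \<alpha>)\<rparr>"

definition cmd_hcomp :: "('o, 'a) cmd_2cell \<Rightarrow> ('o, 'a) cmd_2cell \<Rightarrow> ('o, 'a) cmd_2cell" where
  "cmd_hcomp \<beta> \<alpha> = \<lparr>Src = cmd_comp1 (Src \<beta>) (Src \<alpha>), Tgt = cmd_comp1 (Tgt \<beta>) (Tgt \<alpha>),
    cmphi = hcomp_nt (cmC (Src (Src \<alpha>))) (cmC (Tgt (Src \<beta>))) (cmH (Src \<beta>)) (cmH (Tgt \<alpha>))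
      (cmphi \<beta>) (cmphi \<alpha>)\<rparr>"

definition Cmd :: "(('o, 'a) comonad, ('o, 'a) cmd_1cell, ('o, 'a) cmd_2cell) twocat" where
  "Cmd = \<lparr>Zero = Collect is_comonad, One = Collect is_cmd_1cell, Two = Collect is_cmd_2cell,
    src1 = Src, tgt1 = Tgt, src2 = Src, tgt2 = Tgt, id1 = cmd_id1, id2 = cmd_id2,
    comp1 = cmd_comp1, vcomp = cmd_vcomp, hcomp = cmd_hcomp\<rparr>"

definition cmd_pseudo :: "('o, 'a) cmd_1cell \<Rightarrow> bool" where
  "cmd_pseudo f \<longleftrightarrow> (\<forall>A \<in> Ob (cmC (Src f)). iso (cmC (Tgt f)) (cmth f A))"

definition cmd_strict :: "('o, 'a) cmd_1cell \<Rightarrow> bool" where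
  "cmd_strict f \<longleftrightarrow> (let C = cmC (Src f); HK = comp_fct C (cmH f) (cmK (Src f)) in
    HK = comp_fct C (cmK (Tgt f)) (cmH f) \<and> cmth f = id_nt C (cmC (Tgt f)) HK)"


section \<open>The 2-categories of adjunctions\<close>

record ('o, 'a, 'd, 'e) adj =
  adC :: "('o, 'a) cat"
  adD :: "('d, 'e) cat"
  adL :: "('d, 'e, 'o, 'a) fctr"
  adR :: "('o, 'a, 'd, 'e) fctr"
  adeta :: "'d \<Rightarrow> 'e"
  adeps :: "'o \<Rightarrow> 'a"

definition is_adj :: "('o, 'a, 'd, 'e) adj \<Rightarrow> bool" where
  "is_adj T \<longleftrightarrow> (let C = adC T; D = adD T; L = adL T; R = adR T; \<eta> = adeta T; \<epsilon> = adeps T in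
    is_functor D C L \<and> is_functor C D R \<and>
    nat_trans D D (id_fct D) (comp_fct D R L) \<eta> \<and>
    nat_trans C C (comp_fct C L R) (id_fct C) \<epsilon> \<and>
    (\<forall>A \<in> Ob D. \<epsilon> (onO L A) \<cdot>\<^bsub>C\<^esub> onA L (\<eta> A) = Ident C (onO L A)) \<and>
    (\<forall>X \<in> Ob C. onA R (\<epsilon> X) \<cdot>\<^bsub>D\<^esub> \<eta> (onO R X) = Ident D (onO R X)))"

record ('o, 'a, 'd, 'e) adj_1cell = "('o, 'a, 'd, 'e) adj cell" +
  amF :: "('o, 'a, 'o, 'a) fctr"
  amG :: "('d, 'e, 'd, 'e) fctr"
  amz :: "'d \<Rightarrow> 'a"

record ('o, 'a, 'd, 'e) adj_2cell = "('o, 'a, 'd, 'e) adj_1cell cell" +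
  amphi :: "'o \<Rightarrow> 'a"
  ampsi :: "'d \<Rightarrow> 'e"

definition is_adj_1cell :: "('o, 'a, 'd, 'e) adj_1cell \<Rightarrow> bool" where
  "is_adj_1cell f \<longleftrightarrow> is_adj (Src f) \<and> is_adj (Tgt f) \<and>
    is_functor (adC (Src f)) (adC (Tgt f)) (amF f) \<and>
    is_functor (adD (Src f)) (adD (Tgt f)) (amG f) \<and>
    nat_iso (adD (Src f)) (adC (Tgt f))
      (comp_fct (adD (Src f)) (adL (Tgt f)) (amG f)) (comp_fct (adD (Src f)) (amF f) (adL (Src f)))
      (amz f)"

definition mate :: "('o, 'a, 'd, 'e) adj_1cell \<Rightarrow> 'o \<Rightarrow> 'e" where
  "mate f = (let R = adR (Src f); R' = adR (Tgt f); D' = adD (Tgt f) in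
    (\<lambda>X \<in> Ob (adC (Src f)).
      onA R' (onA (amF f) (adeps (Src f) X)) \<cdot>\<^bsub>D'\<^esub> onA R' (amz f (onO R X)) \<cdot>\<^bsub>D'\<^esub>
      adeta (Tgt f) (onO (amG f) (onO R X))))"

definition is_adj_2cell :: "('o, 'a, 'd, 'e) adj_2cell \<Rightarrow> bool" where
  "is_adj_2cell \<alpha> \<longleftrightarrow> is_adj_1cell (Src \<alpha>) \<and> is_adj_1cell (Tgt \<alpha>) \<and>
    Src (Src \<alpha>) = Src (Tgt \<alpha>) \<and> Tgt (Src \<alpha>) = Tgt (Tgt \<alpha>) \<and>
    (let T = Src (Src \<alpha>); T' = Tgt (Src \<alpha>); C' = adC T' in
    nat_trans (adC T) C' (amF (Src \<alpha>)) (amF (Tgt \<alpha>)) (amphi \<alpha>) \<and>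
    nat_trans (adD T) (adD T') (amG (Src \<alpha>)) (amG (Tgt \<alpha>)) (ampsi \<alpha>) \<and>
    (\<forall>A \<in> Ob (adD T). amphi \<alpha> (onO (adL T) A) \<cdot>\<^bsub>C'\<^esub> amz (Src \<alpha>) A
      = amz (Tgt \<alpha>) A \<cdot>\<^bsub>C'\<^esub> onA (adL T') (ampsi \<alpha> A)))"

definition adj_id1 :: "('o, 'a, 'd, 'e) adj \<Rightarrow> ('o, 'a, 'd, 'e) adj_1cell" where
  "adj_id1 T = \<lparr>Src = T, Tgt = T, amF = id_fct (adC T), amG = id_fct (adD T),
    amz = id_nt (adD T) (adC T) (adL T)\<rparr>"

definition adj_comp1 ::
  "('o, 'a, 'd, 'e) adj_1cell \<Rightarrow> ('o, 'a, 'd, 'e) adj_1cell \<Rightarrow> ('o, 'a, 'd, 'e) adj_1cell" where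
  "adj_comp1 g f = \<lparr>Src = Src f, Tgt = Tgt g,
    amF = comp_fct (adC (Src f)) (amF g) (amF f), amG = comp_fct (adD (Src f)) (amG g) (amG f),
    amz = \<lambda>A \<in> Ob (adD (Src f)). onA (amF g) (amz f A) \<cdot>\<^bsub>adC (Tgt g)\<^esub> amz g (onO (amG f) A)\<rparr>"

definition adj_id2 :: "('o, 'a, 'd, 'e) adj_1cell \<Rightarrow> ('o, 'a, 'd, 'e) adj_2cell" where
  "adj_id2 f = \<lparr>Src = f, Tgt = f, amphi = id_nt (adC (Src f)) (adC (Tgt f)) (amF f),
    ampsi = id_nt (adD (Src f)) (adD (Tgt f)) (amG f)\<rparr>"

definition adj_vcomp ::
  "('o, 'a, 'd, 'e) adj_2cell \<Rightarrow> ('o, 'a, 'd, 'e) adj_2cell \<Rightarrow> ('o, 'a, 'd, 'e) adj_2cell" where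
  "adj_vcomp \<beta> \<alpha> = (let T = Src (Src \<alpha>); T' = Tgt (Src \<alpha>) in
    \<lparr>Src = Src \<alpha>, Tgt = Tgt \<beta>, amphi = vcomp_nt (adC T) (adC T') (amphi \<beta>) (amphi \<alpha>),
     ampsi = vcomp_nt (adD T) (adD T') (ampsi \<beta>) (ampsi \<alpha>)\<rparr>)"

definition adj_hcomp ::
  "('o, 'a, 'd, 'e) adj_2cell \<Rightarrow> ('o, 'a, 'd, 'e) adj_2cell \<Rightarrow> ('o, 'a, 'd, 'e) adj_2cell" where
  "adj_hcomp \<beta> \<alpha> = (let T = Src (Src \<alpha>); T'' = Tgt (Src \<beta>) in
    \<lparr>Src = adj_comp1 (Src \<beta>) (Src \<alpha>), Tgt = adj_comp1 (Tgt \<beta>) (Tgt \<alpha>),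
     amphi = hcomp_nt (adC T) (adC T'') (amF (Src \<beta>)) (amF (Tgt \<alpha>)) (amphi \<beta>) (amphi \<alpha>),
     ampsi = hcomp_nt (adD T) (adD T'') (amG (Src \<beta>)) (amG (Tgt \<alpha>)) (ampsi \<beta>) (ampsi \<alpha>)\<rparr>)"

definition LAdj_iso :: "(('o, 'a, 'd, 'e) adj, ('o, 'a, 'd, 'e) adj_1cell, ('o, 'a, 'd, 'e) adj_2cell) twocat" where
  "LAdj_iso = \<lparr>Zero = Collect is_adj, One = Collect is_adj_1cell, Two = Collect is_adj_2cell,
    src1 = Src, tgt1 = Tgt, src2 = Src, tgt2 = Tgt, id1 = adj_id1, id2 = adj_id2,
    comp1 = adj_comp1, vcomp = adj_vcomp, hcomp = adj_hcomp\<rparr>"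

definition adj_tight :: "('o, 'a, 'd, 'e) adj_1cell \<Rightarrow> bool" where
  \<comment> \<open>\<open>\<zeta>\<close> is an identity\<close>
  "adj_tight f \<longleftrightarrow> (let D = adD (Src f); FL = comp_fct D (amF f) (adL (Src f)) in
    comp_fct D (adL (Tgt f)) (amG f) = FL \<and> amz f = id_nt D (adC (Tgt f)) FL)"

definition adj_pseudo :: "('o, 'a, 'd, 'e) adj_1cell \<Rightarrow> bool" where
  "adj_pseudo f \<longleftrightarrow> (\<forall>X \<in> Ob (adC (Src f)). iso (adD (Tgt f)) (mate f X))"

definition adj_strict :: "('o, 'a, 'd, 'e) adj_1cell \<Rightarrow> bool" where
  "adj_strict f \<longleftrightarrow> (let C = adC (Src f); GR = comp_fct C (amG f) (adR (Src f)) in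
    GR = comp_fct C (adR (Tgt f)) (amF f) \<and> mate f = id_nt C (adD (Tgt f)) GR)"

definition LAdj :: "(('o, 'a, 'd, 'e) adj, ('o, 'a, 'd, 'e) adj_1cell, ('o, 'a, 'd, 'e) adj_2cell) twocat" where
  "LAdj = wide_full_sub LAdj_iso adj_tight"


section \<open>The Eilenberg--Moore construction\<close>

definition coalg :: "('o, 'a) comonad \<Rightarrow> ('o \<times> 'a) set" where
  "coalg T = {(A, a). A \<in> Ob (cmC T) \<and> a \<in> hom (cmC T) A (onO (cmK T) A) \<and>
    cmeps T A \<cdot>\<^bsub>cmC T\<^esub> a = Ident (cmC T) A \<and>
    cmnu T A \<cdot>\<^bsub>cmC T\<^esub> a = onA (cmK T) a \<cdot>\<^bsub>cmC T\<^esub> a}"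

definition coalg_mor :: "('o, 'a) comonad \<Rightarrow> ('o \<times> 'a) \<Rightarrow> ('o \<times> 'a) \<Rightarrow> 'a set" where
  "coalg_mor T = (\<lambda>(A, a) (B, b).
    {f \<in> hom (cmC T) A B. onA (cmK T) f \<cdot>\<^bsub>cmC T\<^esub> a = b \<cdot>\<^bsub>cmC T\<^esub> f})"

text \<open>Components of a coded coalgebra morphism, and of a coded coalgebra.\<close>

definition mor_src :: "('d \<times> 'a \<times> 'd \<Rightarrow> 'e) \<Rightarrow> 'e \<Rightarrow> 'd" where
  "mor_src ea u = fst (inv ea u)"

definition mor_ar :: "('d \<times> 'a \<times> 'd \<Rightarrow> 'e) \<Rightarrow> 'e \<Rightarrow> 'a" where
  "mor_ar ea u = fst (snd (inv ea u))"

definition mor_tgt :: "('d \<times> 'a \<times> 'd \<Rightarrow> 'e) \<Rightarrow> 'e \<Rightarrow> 'd" where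
  "mor_tgt ea u = snd (snd (inv ea u))"

definition carrier_of :: "('o \<times> 'a \<Rightarrow> 'd) \<Rightarrow> 'd \<Rightarrow> 'o" where
  "carrier_of eo x = fst (inv eo x)"

definition struct_of :: "('o \<times> 'a \<Rightarrow> 'd) \<Rightarrow> 'd \<Rightarrow> 'a" where
  "struct_of eo x = snd (inv eo x)"

definition CoAlg_Ar :: "('o \<times> 'a \<Rightarrow> 'd) \<Rightarrow> ('d \<times> 'a \<times> 'd \<Rightarrow> 'e) \<Rightarrow> ('o, 'a) comonad \<Rightarrow> 'e set" where
  "CoAlg_Ar eo ea T = {ea (eo X, f, eo Y) | X f Y. X \<in> coalg T \<and> Y \<in> coalg T \<and> f \<in> coalg_mor T X Y}"

definition CoAlg :: "('o \<times> 'a \<Rightarrow> 'd) \<Rightarrow> ('d \<times> 'a \<times> 'd \<Rightarrow> 'e) \<Rightarrow> ('o, 'a) comonad \<Rightarrow> ('d, 'e) cat" where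
  "CoAlg eo ea T =
    \<lparr>Ob = eo ` coalg T, Ar = CoAlg_Ar eo ea T,
     Dom = \<lambda>u \<in> CoAlg_Ar eo ea T. mor_src ea u, Cod = \<lambda>u \<in> CoAlg_Ar eo ea T. mor_tgt ea u,
     Ident = \<lambda>x \<in> eo ` coalg T. ea (x, Ident (cmC T) (carrier_of eo x), x),
     Comp = \<lambda>v u. if u \<in> CoAlg_Ar eo ea T \<and> v \<in> CoAlg_Ar eo ea T \<and> mor_tgt ea u = mor_src ea v
       then ea (mor_src ea u, mor_ar ea v \<cdot>\<^bsub>cmC T\<^esub> mor_ar ea u, mor_tgt ea v) else undefined\<rparr>"

definition EM_U :: "('o \<times> 'a \<Rightarrow> 'd) \<Rightarrow> ('d \<times> 'a \<times> 'd \<Rightarrow> 'e) \<Rightarrow> ('o, 'a) comonad \<Rightarrow> ('d, 'e, 'o, 'a) fctr" where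
  "EM_U eo ea T = \<lparr>onO = \<lambda>x \<in> eo ` coalg T. carrier_of eo x, onA = \<lambda>u \<in> CoAlg_Ar eo ea T. mor_ar ea u\<rparr>"

definition EM_R :: "('o \<times> 'a \<Rightarrow> 'd) \<Rightarrow> ('d \<times> 'a \<times> 'd \<Rightarrow> 'e) \<Rightarrow> ('o, 'a) comonad \<Rightarrow> ('o, 'a, 'd, 'e) fctr" where
  "EM_R eo ea T = (let R = \<lambda>A. eo (onO (cmK T) A, cmnu T A) in
    \<lparr>onO = \<lambda>A \<in> Ob (cmC T). R A,
     onA = \<lambda>f \<in> Ar (cmC T). ea (R (Dom (cmC T) f), onA (cmK T) f, R (Cod (cmC T) f))\<rparr>)"

definition EM_adj :: "('o \<times> 'a \<Rightarrow> 'd) \<Rightarrow> ('d \<times> 'a \<times> 'd \<Rightarrow> 'e) \<Rightarrow> ('o, 'a) comonad \<Rightarrow> ('o, 'a, 'd, 'e) adj" where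
  \<comment> \<open>the unit at a coalgebra \<open>(A, a)\<close> is \<open>a : (A, a) \<rightarrow> (K A, \<nu>\<^sub>A)\<close>\<close>
  "EM_adj eo ea T = \<lparr>adC = cmC T, adD = CoAlg eo ea T, adL = EM_U eo ea T, adR = EM_R eo ea T,
    adeta = \<lambda>x \<in> eo ` coalg T. ea (x, struct_of eo x, onO (EM_R eo ea T) (carrier_of eo x)),
    adeps = cmeps T\<rparr>"

definition CoAlg_fct :: "('o \<times> 'a \<Rightarrow> 'd) \<Rightarrow> ('d \<times> 'a \<times> 'd \<Rightarrow> 'e) \<Rightarrow> ('o, 'a) cmd_1cell \<Rightarrow> ('d, 'e, 'd, 'e) fctr" where
  "CoAlg_fct eo ea f = (let H = cmH f;
      H' = \<lambda>x. eo (onO H (carrier_of eo x),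
        cmth f (carrier_of eo x) \<cdot>\<^bsub>cmC (Tgt f)\<^esub> onA H (struct_of eo x)) in
    \<lparr>onO = \<lambda>x \<in> eo ` coalg (Src f). H' x,
     onA = \<lambda>u \<in> CoAlg_Ar eo ea (Src f). ea (H' (mor_src ea u), onA H (mor_ar ea u), H' (mor_tgt ea u))\<rparr>)"

definition EM_1 :: "('o \<times> 'a \<Rightarrow> 'd) \<Rightarrow> ('d \<times> 'a \<times> 'd \<Rightarrow> 'e) \<Rightarrow> ('o, 'a) cmd_1cell \<Rightarrow> ('o, 'a, 'd, 'e) adj_1cell" where
  "EM_1 eo ea f = \<lparr>Src = EM_adj eo ea (Src f), Tgt = EM_adj eo ea (Tgt f),
    amF = cmH f, amG = CoAlg_fct eo ea f,
    amz = id_nt (CoAlg eo ea (Src f)) (cmC (Tgt f))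
      (comp_fct (CoAlg eo ea (Src f)) (cmH f) (EM_U eo ea (Src f)))\<rparr>"

definition EM_2 :: "('o \<times> 'a \<Rightarrow> 'd) \<Rightarrow> ('d \<times> 'a \<times> 'd \<Rightarrow> 'e) \<Rightarrow> ('o, 'a) cmd_2cell \<Rightarrow> ('o, 'a, 'd, 'e) adj_2cell" where
  "EM_2 eo ea \<alpha> = \<lparr>Src = EM_1 eo ea (Src \<alpha>), Tgt = EM_1 eo ea (Tgt \<alpha>), amphi = cmphi \<alpha>,
    ampsi = \<lambda>x \<in> eo ` coalg (Src (Src \<alpha>)).
      ea (onO (CoAlg_fct eo ea (Src \<alpha>)) x, cmphi \<alpha> (carrier_of eo x), onO (CoAlg_fct eo ea (Tgt \<alpha>)) x)\<rparr>"

text \<open>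
  The same data serve as the 2-functor into \<^const>\<open>LAdj\<close> and, composed with the inclusion, into
  \<^const>\<open>LAdj_iso\<close>; likewise for \<open>C_2fun\<close> and the unit below.
\<close>

definition EM where
  "EM eo ea = \<lparr>F0 = EM_adj eo ea, F1 = EM_1 eo ea, F2 = EM_2 eo ea\<rparr>"

definition adj_comonad :: "('o, 'a, 'd, 'e) adj \<Rightarrow> ('o, 'a) comonad" where
  "adj_comonad T = \<lparr>cmC = adC T, cmK = comp_fct (adC T) (adL T) (adR T), cmeps = adeps T,
    cmnu = \<lambda>X \<in> Ob (adC T). onA (adL T) (adeta T (onO (adR T) X))\<rparr>"

definition C_1 :: "('o, 'a, 'd, 'e) adj_1cell \<Rightarrow> ('o, 'a) cmd_1cell" where
  "C_1 f = \<lparr>Src = adj_comonad (Src f), Tgt = adj_comonad (Tgt f), cmH = amF f,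
    cmth = \<lambda>X \<in> Ob (adC (Src f)). onA (adL (Tgt f)) (mate f X) \<cdot>\<^bsub>adC (Tgt f)\<^esub>
      inv_ar (adC (Tgt f)) (amz f (onO (adR (Src f)) X))\<rparr>"

definition C_2 :: "('o, 'a, 'd, 'e) adj_2cell \<Rightarrow> ('o, 'a) cmd_2cell" where
  "C_2 \<alpha> = \<lparr>Src = C_1 (Src \<alpha>), Tgt = C_1 (Tgt \<alpha>), cmphi = amphi \<alpha>\<rparr>"

definition C_2fun where
  "C_2fun = \<lparr>F0 = adj_comonad, F1 = C_1, F2 = C_2\<rparr>"

definition comparison :: "('o \<times> 'a \<Rightarrow> 'd) \<Rightarrow> ('d \<times> 'a \<times> 'd \<Rightarrow> 'e) \<Rightarrow> ('o, 'a, 'd, 'e) adj \<Rightarrow> ('d, 'e, 'd, 'e) fctr" where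
  "comparison eo ea T = (let L = adL T; K = \<lambda>A. eo (onO L A, onA L (adeta T A)) in
    \<lparr>onO = \<lambda>A \<in> Ob (adD T). K A,
     onA = \<lambda>f \<in> Ar (adD T). ea (K (Dom (adD T) f), onA L f, K (Cod (adD T) f))\<rparr>)"

definition EM_unit1 :: "('o \<times> 'a \<Rightarrow> 'd) \<Rightarrow> ('d \<times> 'a \<times> 'd \<Rightarrow> 'e) \<Rightarrow> ('o, 'a, 'd, 'e) adj \<Rightarrow> ('o, 'a, 'd, 'e) adj_1cell" where
  "EM_unit1 eo ea T = \<lparr>Src = T, Tgt = EM_adj eo ea (adj_comonad T), amF = id_fct (adC T),
    amG = comparison eo ea T, amz = id_nt (adD T) (adC T) (adL T)\<rparr>"

definition EM_unit2 :: "('o \<times> 'a \<Rightarrow> 'd) \<Rightarrow> ('d \<times> 'a \<times> 'd \<Rightarrow> 'e) \<Rightarrow> ('o, 'a, 'd, 'e) adj_1cell \<Rightarrow> ('o, 'a, 'd, 'e) adj_2cell" where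
  \<comment> \<open>the 2-cell \<open>(id\<^sub>F, \<zeta>) : \<eta> \<circ> (F, G, \<zeta>) \<Rightarrow> EM (C (F, G, \<zeta>)) \<circ> \<eta>\<close>, where \<open>\<zeta>\<^sub>A : L' G A \<rightarrow> F L A\<close> is
    regarded as a coalgebra morphism\<close>
  "EM_unit2 eo ea f =
    (let s = adj_comp1 (EM_unit1 eo ea (Tgt f)) f;
         t = adj_comp1 (EM_1 eo ea (C_1 f)) (EM_unit1 eo ea (Src f)) in
    \<lparr>Src = s, Tgt = t, amphi = id_nt (adC (Src f)) (adC (Tgt f)) (amF f),
     ampsi = \<lambda>A \<in> Ob (adD (Src f)). ea (onO (amG s) A, amz f A, onO (amG t) A)\<rparr>)"

definition EM_unit where
  "EM_unit eo ea = \<lparr>pn1 = EM_unit1 eo ea, pn2 = EM_unit2 eo ea\<rparr>"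

definition EM_counit :: "(('o, 'a) comonad, ('o, 'a) cmd_1cell, ('o, 'a) cmd_1cell, ('o, 'a) cmd_2cell) pnat" where
  "EM_counit = \<lparr>pn1 = id1 Cmd, pn2 = id2 Cmd\<rparr>"


section \<open>Fibrations and w-comonads\<close>

record ('b, 'n, 'o, 'a) fibr =
  fB :: "('b, 'n) cat"
  fE :: "('o, 'a) cat"
  fp :: "('o, 'a, 'b, 'n) fctr"
  fcl :: "'o \<Rightarrow> 'n \<Rightarrow> 'a"  \<comment> \<open>cleavage\<close>

definition cartesian :: "('b, 'n, 'o, 'a) fibr \<Rightarrow> 'a \<Rightarrow> bool" where
  "cartesian p f \<longleftrightarrow> f \<in> Ar (fE p) \<and>
    (\<forall>X \<in> Ob (fE p). \<forall>g \<in> hom (fE p) X (Cod (fE p) f).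
      \<forall>w \<in> hom (fB p) (onO (fp p) X) (onO (fp p) (Dom (fE p) f)).
      onA (fp p) f \<cdot>\<^bsub>fB p\<^esub> w = onA (fp p) g \<longrightarrow>
      (\<exists>!h. h \<in> hom (fE p) X (Dom (fE p) f) \<and> onA (fp p) h = w \<and> f \<cdot>\<^bsub>fE p\<^esub> h = g))"

definition is_fibration :: "('b, 'n, 'o, 'a) fibr \<Rightarrow> bool" where
  "is_fibration p \<longleftrightarrow> is_functor (fE p) (fB p) (fp p) \<and>
    (\<forall>A s. if A \<in> Ob (fE p) \<and> s \<in> Ar (fB p) \<and> Cod (fB p) s = onO (fp p) A
      then cartesian p (fcl p A s) \<and> Cod (fE p) (fcl p A s) = A \<and> onA (fp p) (fcl p A s) = s
      else fcl p A s = undefined)"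

definition is_fib_1cell :: "('b, 'n, 'o, 'a) fibr \<Rightarrow> ('b, 'n, 'o, 'a) fibr \<Rightarrow>
    ('b, 'n, 'b, 'n) fctr \<Rightarrow> ('o, 'a, 'o, 'a) fctr \<Rightarrow> bool" where
  "is_fib_1cell p p' B E \<longleftrightarrow> is_fibration p \<and> is_fibration p' \<and>
    is_functor (fB p) (fB p') B \<and> is_functor (fE p) (fE p') E \<and>
    comp_fct (fE p) (fp p') E = comp_fct (fE p) B (fp p) \<and>
    (\<forall>f. cartesian p f \<longrightarrow> cartesian p' (onA E f))"

definition is_fib_2cell where
  "is_fib_2cell p p' B1 E1 B2 E2 \<psi> \<phi> \<longleftrightarrow>
    is_fib_1cell p p' B1 E1 \<and> is_fib_1cell p p' B2 E2 \<and>
    nat_trans (fB p) (fB p') B1 B2 \<psi> \<and> nat_trans (fE p) (fE p') E1 E2 \<phi> \<and>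
    (\<forall>A \<in> Ob (fE p). onA (fp p') (\<phi> A) = \<psi> (onO (fp p) A))"

record ('b, 'n, 'o, 'a) wcomonad =
  wp :: "('b, 'n, 'o, 'a) fibr"
  wK :: "('o, 'a) comonad"

definition is_wcomonad :: "('b, 'n, 'o, 'a) wcomonad \<Rightarrow> bool" where
  "is_wcomonad W \<longleftrightarrow> (let p = wp W; E = fE p; K = cmK (wK W); \<epsilon> = cmeps (wK W) in
    is_fibration p \<and> is_comonad (wK W) \<and> cmC (wK W) = E \<and>
    (\<forall>A \<in> Ob E. cartesian p (\<epsilon> A)) \<and>
    (\<forall>f. cartesian p f \<longrightarrow>
      is_pullback (fB p) (onA (fp p) (\<epsilon> (Dom E f))) (onA (fp p) (onA K f))
        (onA (fp p) f) (onA (fp p) (\<epsilon> (Cod E f)))))"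

record ('b, 'n, 'o, 'a) wcmd_1cell = "('b, 'n, 'o, 'a) wcomonad cell" +
  wmC :: "('b, 'n, 'b, 'n) fctr"
  wmH :: "('o, 'a, 'o, 'a) fctr"
  wmth :: "'o \<Rightarrow> 'a"

record ('b, 'n, 'o, 'a) wcmd_2cell = "('b, 'n, 'o, 'a) wcmd_1cell cell" +
  wmpsi :: "'b \<Rightarrow> 'n"
  wmphi :: "'o \<Rightarrow> 'a"

definition wcmd_to_cmd1 :: "('b, 'n, 'o, 'a) wcmd_1cell \<Rightarrow> ('o, 'a) cmd_1cell" where
  "wcmd_to_cmd1 f = \<lparr>Src = wK (Src f), Tgt = wK (Tgt f), cmH = wmH f, cmth = wmth f\<rparr>"

definition wcmd_to_cmd2 :: "('b, 'n, 'o, 'a) wcmd_2cell \<Rightarrow> ('o, 'a) cmd_2cell" where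
  "wcmd_to_cmd2 \<alpha> = \<lparr>Src = wcmd_to_cmd1 (Src \<alpha>), Tgt = wcmd_to_cmd1 (Tgt \<alpha>), cmphi = wmphi \<alpha>\<rparr>"

definition is_wcmd_1cell :: "('b, 'n, 'o, 'a) wcmd_1cell \<Rightarrow> bool" where
  "is_wcmd_1cell f \<longleftrightarrow> is_wcomonad (Src f) \<and> is_wcomonad (Tgt f) \<and>
    is_fib_1cell (wp (Src f)) (wp (Tgt f)) (wmC f) (wmH f) \<and> is_cmd_1cell (wcmd_to_cmd1 f)"

definition is_wcmd_2cell :: "('b, 'n, 'o, 'a) wcmd_2cell \<Rightarrow> bool" where
  "is_wcmd_2cell \<alpha> \<longleftrightarrow> is_wcmd_1cell (Src \<alpha>) \<and> is_wcmd_1cell (Tgt \<alpha>) \<and>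
    Src (Src \<alpha>) = Src (Tgt \<alpha>) \<and> Tgt (Src \<alpha>) = Tgt (Tgt \<alpha>) \<and>
    is_fib_2cell (wp (Src (Src \<alpha>))) (wp (Tgt (Src \<alpha>)))
      (wmC (Src \<alpha>)) (wmH (Src \<alpha>)) (wmC (Tgt \<alpha>)) (wmH (Tgt \<alpha>)) (wmpsi \<alpha>) (wmphi \<alpha>) \<and>
    is_cmd_2cell (wcmd_to_cmd2 \<alpha>)"

definition wcmd_id1 :: "('b, 'n, 'o, 'a) wcomonad \<Rightarrow> ('b, 'n, 'o, 'a) wcmd_1cell" where
  "wcmd_id1 W = (let E = fE (wp W) in
    \<lparr>Src = W, Tgt = W, wmC = id_fct (fB (wp W)), wmH = id_fct E, wmth = id_nt E E (cmK (wK W))\<rparr>)"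

definition wcmd_comp1 ::
  "('b, 'n, 'o, 'a) wcmd_1cell \<Rightarrow> ('b, 'n, 'o, 'a) wcmd_1cell \<Rightarrow> ('b, 'n, 'o, 'a) wcmd_1cell" where
  "wcmd_comp1 g f = \<lparr>Src = Src f, Tgt = Tgt g, wmC = comp_fct (fB (wp (Src f))) (wmC g) (wmC f),
    wmH = comp_fct (fE (wp (Src f))) (wmH g) (wmH f),
    wmth = cmth (cmd_comp1 (wcmd_to_cmd1 g) (wcmd_to_cmd1 f))\<rparr>"

definition wcmd_id2 :: "('b, 'n, 'o, 'a) wcmd_1cell \<Rightarrow> ('b, 'n, 'o, 'a) wcmd_2cell" where
  "wcmd_id2 f = \<lparr>Src = f, Tgt = f, wmpsi = id_nt (fB (wp (Src f))) (fB (wp (Tgt f))) (wmC f),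
    wmphi = id_nt (fE (wp (Src f))) (fE (wp (Tgt f))) (wmH f)\<rparr>"

definition wcmd_vcomp ::
  "('b, 'n, 'o, 'a) wcmd_2cell \<Rightarrow> ('b, 'n, 'o, 'a) wcmd_2cell \<Rightarrow> ('b, 'n, 'o, 'a) wcmd_2cell" where
  "wcmd_vcomp \<beta> \<alpha> = (let p = wp (Src (Src \<alpha>)); p' = wp (Tgt (Src \<alpha>)) in
    \<lparr>Src = Src \<alpha>, Tgt = Tgt \<beta>, wmpsi = vcomp_nt (fB p) (fB p') (wmpsi \<beta>) (wmpsi \<alpha>),
     wmphi = vcomp_nt (fE p) (fE p') (wmphi \<beta>) (wmphi \<alpha>)\<rparr>)"

definition wcmd_hcomp ::
  "('b, 'n, 'o, 'a) wcmd_2cell \<Rightarrow> ('b, 'n, 'o, 'a) wcmd_2cell \<Rightarrow> ('b, 'n, 'o, 'a) wcmd_2cell" where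
  "wcmd_hcomp \<beta> \<alpha> = (let p = wp (Src (Src \<alpha>)); p'' = wp (Tgt (Src \<beta>)) in
    \<lparr>Src = wcmd_comp1 (Src \<beta>) (Src \<alpha>), Tgt = wcmd_comp1 (Tgt \<beta>) (Tgt \<alpha>),
     wmpsi = hcomp_nt (fB p) (fB p'') (wmC (Src \<beta>)) (wmC (Tgt \<alpha>)) (wmpsi \<beta>) (wmpsi \<alpha>),
     wmphi = hcomp_nt (fE p) (fE p'') (wmH (Src \<beta>)) (wmH (Tgt \<alpha>)) (wmphi \<beta>) (wmphi \<alpha>)\<rparr>)"

definition WCmd :: "(('b, 'n, 'o, 'a) wcomonad, ('b, 'n, 'o, 'a) wcmd_1cell, ('b, 'n, 'o, 'a) wcmd_2cell) twocat" where
  "WCmd = \<lparr>Zero = Collect is_wcomonad, One = Collect is_wcmd_1cell, Two = Collect is_wcmd_2cell,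
    src1 = Src, tgt1 = Tgt, src2 = Src, tgt2 = Tgt, id1 = wcmd_id1, id2 = wcmd_id2,
    comp1 = wcmd_comp1, vcomp = wcmd_vcomp, hcomp = wcmd_hcomp\<rparr>"

definition WCmd_ps :: "(('b, 'n, 'o, 'a) wcomonad, ('b, 'n, 'o, 'a) wcmd_1cell, ('b, 'n, 'o, 'a) wcmd_2cell) twocat" where
  "WCmd_ps = wide_full_sub WCmd (\<lambda>f. cmd_pseudo (wcmd_to_cmd1 f))"

definition WCmd_str :: "(('b, 'n, 'o, 'a) wcomonad, ('b, 'n, 'o, 'a) wcmd_1cell, ('b, 'n, 'o, 'a) wcmd_2cell) twocat" where
  "WCmd_str = wide_full_sub WCmd (\<lambda>f. cmd_strict (wcmd_to_cmd1 f))"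

definition forget_WCmd where
  "forget_WCmd = \<lparr>F0 = wK, F1 = wcmd_to_cmd1, F2 = wcmd_to_cmd2\<rparr>"


section \<open>Generalised categories with families\<close>

record ('b, 'n, 'o, 'a, 'd, 'e) gcwf =
  gu :: "('b, 'n, 'o, 'a) fibr"
  gud :: "('b, 'n, 'd, 'e) fibr"
  gadj :: "('o, 'a, 'd, 'e) adj"

definition is_gcwf :: "('b, 'n, 'o, 'a, 'd, 'e) gcwf \<Rightarrow> bool" where
  "is_gcwf W \<longleftrightarrow> (let u = gu W; ud = gud W; T = gadj W in
    is_fibration u \<and> is_fibration ud \<and> is_adj T \<and>
    fB ud = fB u \<and> adC T = fE u \<and> adD T = fE ud \<and>
    comp_fct (fE ud) (fp u) (adL T) = fp ud \<and>
    (\<forall>f. cartesian ud f \<longrightarrow> cartesian u (onA (adL T) f)) \<and>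
    (\<forall>A \<in> Ob (fE ud). cartesian ud (adeta T A)) \<and>
    (\<forall>X \<in> Ob (fE u). cartesian u (adeps T X)))"

record ('b, 'n, 'o, 'a, 'd, 'e) gcwf_1cell = "('b, 'n, 'o, 'a, 'd, 'e) gcwf cell" +
  gmC :: "('b, 'n, 'b, 'n) fctr"
  gmH :: "('o, 'a, 'o, 'a) fctr"
  gmHd :: "('d, 'e, 'd, 'e) fctr"
  gmz :: "'d \<Rightarrow> 'a"

record ('b, 'n, 'o, 'a, 'd, 'e) gcwf_2cell = "('b, 'n, 'o, 'a, 'd, 'e) gcwf_1cell cell" +
  gmpsi :: "'b \<Rightarrow> 'n"
  gmphi :: "'o \<Rightarrow> 'a"
  gmphid :: "'d \<Rightarrow> 'e"

definition gcwf_to_adj1 :: "('b, 'n, 'o, 'a, 'd, 'e) gcwf_1cell \<Rightarrow> ('o, 'a, 'd, 'e) adj_1cell" where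
  "gcwf_to_adj1 f = \<lparr>Src = gadj (Src f), Tgt = gadj (Tgt f), amF = gmH f, amG = gmHd f, amz = gmz f\<rparr>"

definition gcwf_to_adj2 :: "('b, 'n, 'o, 'a, 'd, 'e) gcwf_2cell \<Rightarrow> ('o, 'a, 'd, 'e) adj_2cell" where
  "gcwf_to_adj2 \<alpha> = \<lparr>Src = gcwf_to_adj1 (Src \<alpha>), Tgt = gcwf_to_adj1 (Tgt \<alpha>),
    amphi = gmphi \<alpha>, ampsi = gmphid \<alpha>\<rparr>"

definition is_gcwf_1cell :: "('b, 'n, 'o, 'a, 'd, 'e) gcwf_1cell \<Rightarrow> bool" where
  "is_gcwf_1cell f \<longleftrightarrow> is_gcwf (Src f) \<and> is_gcwf (Tgt f) \<and>
    is_fib_1cell (gu (Src f)) (gu (Tgt f)) (gmC f) (gmH f) \<and>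
    is_fib_1cell (gud (Src f)) (gud (Tgt f)) (gmC f) (gmHd f) \<and>
    is_adj_1cell (gcwf_to_adj1 f) \<and>
    (let u' = gu (Tgt f) in \<forall>A \<in> Ob (fE (gud (Src f))).
      onA (fp u') (gmz f A) = Ident (fB u') (onO (fp u') (Dom (fE u') (gmz f A))))"

definition is_gcwf_2cell :: "('b, 'n, 'o, 'a, 'd, 'e) gcwf_2cell \<Rightarrow> bool" where
  "is_gcwf_2cell \<alpha> \<longleftrightarrow> is_gcwf_1cell (Src \<alpha>) \<and> is_gcwf_1cell (Tgt \<alpha>) \<and>
    Src (Src \<alpha>) = Src (Tgt \<alpha>) \<and> Tgt (Src \<alpha>) = Tgt (Tgt \<alpha>) \<and>
    is_fib_2cell (gu (Src (Src \<alpha>))) (gu (Tgt (Src \<alpha>)))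
      (gmC (Src \<alpha>)) (gmH (Src \<alpha>)) (gmC (Tgt \<alpha>)) (gmH (Tgt \<alpha>)) (gmpsi \<alpha>) (gmphi \<alpha>) \<and>
    is_fib_2cell (gud (Src (Src \<alpha>))) (gud (Tgt (Src \<alpha>)))
      (gmC (Src \<alpha>)) (gmHd (Src \<alpha>)) (gmC (Tgt \<alpha>)) (gmHd (Tgt \<alpha>)) (gmpsi \<alpha>) (gmphid \<alpha>) \<and>
    is_adj_2cell (gcwf_to_adj2 \<alpha>)"

definition gcwf_id1 :: "('b, 'n, 'o, 'a, 'd, 'e) gcwf \<Rightarrow> ('b, 'n, 'o, 'a, 'd, 'e) gcwf_1cell" where
  "gcwf_id1 W = \<lparr>Src = W, Tgt = W, gmC = id_fct (fB (gu W)), gmH = id_fct (fE (gu W)),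
    gmHd = id_fct (fE (gud W)), gmz = id_nt (fE (gud W)) (fE (gu W)) (adL (gadj W))\<rparr>"

definition gcwf_comp1 :: "('b, 'n, 'o, 'a, 'd, 'e) gcwf_1cell \<Rightarrow>
    ('b, 'n, 'o, 'a, 'd, 'e) gcwf_1cell \<Rightarrow> ('b, 'n, 'o, 'a, 'd, 'e) gcwf_1cell" where
  "gcwf_comp1 g f = \<lparr>Src = Src f, Tgt = Tgt g, gmC = comp_fct (fB (gu (Src f))) (gmC g) (gmC f),
    gmH = comp_fct (fE (gu (Src f))) (gmH g) (gmH f),
    gmHd = comp_fct (fE (gud (Src f))) (gmHd g) (gmHd f),
    gmz = amz (adj_comp1 (gcwf_to_adj1 g) (gcwf_to_adj1 f))\<rparr>"

definition gcwf_id2 :: "('b, 'n, 'o, 'a, 'd, 'e) gcwf_1cell \<Rightarrow> ('b, 'n, 'o, 'a, 'd, 'e) gcwf_2cell" where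
  "gcwf_id2 f = \<lparr>Src = f, Tgt = f, gmpsi = id_nt (fB (gu (Src f))) (fB (gu (Tgt f))) (gmC f),
    gmphi = id_nt (fE (gu (Src f))) (fE (gu (Tgt f))) (gmH f),
    gmphid = id_nt (fE (gud (Src f))) (fE (gud (Tgt f))) (gmHd f)\<rparr>"

definition gcwf_vcomp :: "('b, 'n, 'o, 'a, 'd, 'e) gcwf_2cell \<Rightarrow>
    ('b, 'n, 'o, 'a, 'd, 'e) gcwf_2cell \<Rightarrow> ('b, 'n, 'o, 'a, 'd, 'e) gcwf_2cell" where
  "gcwf_vcomp \<beta> \<alpha> = (let W = Src (Src \<alpha>); W' = Tgt (Src \<alpha>) in
    \<lparr>Src = Src \<alpha>, Tgt = Tgt \<beta>,
     gmpsi = vcomp_nt (fB (gu W)) (fB (gu W')) (gmpsi \<beta>) (gmpsi \<alpha>),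
     gmphi = vcomp_nt (fE (gu W)) (fE (gu W')) (gmphi \<beta>) (gmphi \<alpha>),
     gmphid = vcomp_nt (fE (gud W)) (fE (gud W')) (gmphid \<beta>) (gmphid \<alpha>)\<rparr>)"

definition gcwf_hcomp :: "('b, 'n, 'o, 'a, 'd, 'e) gcwf_2cell \<Rightarrow>
    ('b, 'n, 'o, 'a, 'd, 'e) gcwf_2cell \<Rightarrow> ('b, 'n, 'o, 'a, 'd, 'e) gcwf_2cell" where
  "gcwf_hcomp \<beta> \<alpha> = (let W = Src (Src \<alpha>); W'' = Tgt (Src \<beta>) in
    \<lparr>Src = gcwf_comp1 (Src \<beta>) (Src \<alpha>), Tgt = gcwf_comp1 (Tgt \<beta>) (Tgt \<alpha>),
     gmpsi = hcomp_nt (fB (gu W)) (fB (gu W'')) (gmC (Src \<beta>)) (gmC (Tgt \<alpha>)) (gmpsi \<beta>) (gmpsi \<alpha>),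
     gmphi = hcomp_nt (fE (gu W)) (fE (gu W'')) (gmH (Src \<beta>)) (gmH (Tgt \<alpha>)) (gmphi \<beta>) (gmphi \<alpha>),
     gmphid = hcomp_nt (fE (gud W)) (fE (gud W'')) (gmHd (Src \<beta>)) (gmHd (Tgt \<alpha>))
       (gmphid \<beta>) (gmphid \<alpha>)\<rparr>)"

definition GCwF_iso :: "(('b, 'n, 'o, 'a, 'd, 'e) gcwf, ('b, 'n, 'o, 'a, 'd, 'e) gcwf_1cell,
    ('b, 'n, 'o, 'a, 'd, 'e) gcwf_2cell) twocat" where
  "GCwF_iso = \<lparr>Zero = Collect is_gcwf, One = Collect is_gcwf_1cell, Two = Collect is_gcwf_2cell,
    src1 = Src, tgt1 = Tgt, src2 = Src, tgt2 = Tgt, id1 = gcwf_id1, id2 = gcwf_id2,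
    comp1 = gcwf_comp1, vcomp = gcwf_vcomp, hcomp = gcwf_hcomp\<rparr>"

definition GCwF :: "(('b, 'n, 'o, 'a, 'd, 'e) gcwf, ('b, 'n, 'o, 'a, 'd, 'e) gcwf_1cell,
    ('b, 'n, 'o, 'a, 'd, 'e) gcwf_2cell) twocat" where
  "GCwF = wide_full_sub GCwF_iso (\<lambda>f. adj_tight (gcwf_to_adj1 f))"

definition GCwF_iso_ps :: "(('b, 'n, 'o, 'a, 'd, 'e) gcwf, ('b, 'n, 'o, 'a, 'd, 'e) gcwf_1cell,
    ('b, 'n, 'o, 'a, 'd, 'e) gcwf_2cell) twocat" where
  "GCwF_iso_ps = wide_full_sub GCwF_iso (\<lambda>f. adj_pseudo (gcwf_to_adj1 f))"

definition GCwF_ps :: "(('b, 'n, 'o, 'a, 'd, 'e) gcwf, ('b, 'n, 'o, 'a, 'd, 'e) gcwf_1cell,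
    ('b, 'n, 'o, 'a, 'd, 'e) gcwf_2cell) twocat" where
  "GCwF_ps = wide_full_sub GCwF (\<lambda>f. adj_pseudo (gcwf_to_adj1 f))"

definition GCwF_str :: "(('b, 'n, 'o, 'a, 'd, 'e) gcwf, ('b, 'n, 'o, 'a, 'd, 'e) gcwf_1cell,
    ('b, 'n, 'o, 'a, 'd, 'e) gcwf_2cell) twocat" where
  "GCwF_str = wide_full_sub GCwF (\<lambda>f. adj_strict (gcwf_to_adj1 f))"

definition forget_GCwF where
  "forget_GCwF = \<lparr>F0 = gadj, F1 = gcwf_to_adj1, F2 = gcwf_to_adj2\<rparr>"

end

theory Submission
  imports Defs
begin

text \<open>
  A coalgebra structure transports along cartesian arrows of \<open>p\<close>, because the base images of the
  naturality squares of \<open>\<epsilon>\<close> are pullbacks; hence \<open>p U\<^sub>K\<close> is a fibration, whose cartesian arrows are the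
  coalgebra morphisms with cartesian underlying arrow.  Conversely, for a gcwf the mediating arrows of
  the pullbacks required of \<open>\<Sigma>\<Delta>\<close> are obtained by transposing cartesian lifts along the adjunction.
  Both constructions are strict lifts, the counit is the identity, and the unit is the comparison
  functor.  The latter is an equivalence: a quasi-inverse sends a coalgebra \<open>(A, a)\<close> to the domain of a
  cartesian lift of \<open>p a\<close> to \<open>\<Delta> A\<close>; as \<open>a\<close> is itself cartesian, comparing it with the image of this lift
  under \<open>\<Sigma>\<close> gives the vertical isomorphism \<open>\<zeta>\<close>.  Since \<open>C EM\<close>, \<open>C \<eta>\<close> and \<open>\<eta> EM\<close> are all strictly
  trivial, the triangle modifications are identities, and restricting the biadjunction to a class of
  1-cells only requires that \<open>C\<close>, \<open>EM\<close> and the components of \<open>\<eta>\<close> respect that class.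
\<close>

section \<open>Formal 2-category theory: restriction to classes of 1-cells, biadjunctions with
  strict unit laws\<close>

section \<open>Restriction to wide 2-full sub-2-categories\<close>

text \<open>The biadjunction is built twice on one abstract skeleton: over \<open>Cmd\<close> and
  \<open>LAdj_iso\<close>, then over \<open>WCmd\<close> and \<open>GCwF_iso\<close>. A fibred cell
  is determined by its base component and its underlying cell, so at the second level the new work
  is typing (cartesian arrows, verticality, compatibility with the base); the equations are
  inherited. Equations stay small by three cancellations: coalgebra morphisms are compared through
  underlying arrows, arrows into \<open>R X\<close> through their transposes, and comonad 1-cells
  after composing with the invertible \<open>\<zeta>\<close>. The pullback condition enters twice:
  existence builds coalgebra structures, uniqueness makes \<open>\<epsilon>\<close> and
  \<open>K f\<close> jointly monic for cartesian \<open>f\<close>. The quasi-inverse of the unit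
  comes with an invertible \<open>\<zeta>\<close>, which is why the biequivalence is formulated with
  loose morphisms; among tight ones the unit is 2-natural and gives the reflection. Pseudo and
  strict refer to the mate on one side and to \<open>\<theta>\<close> on the other. As
  \<open>\<theta>\<close> also contains the inverse of \<open>\<zeta>\<close>, strictness is treated
  over tight 1-cells, while the pseudo case needs the mate of the quasi-inverse to be
  invertible.\<close>

lemma wide_full_sub_simps [simp]:
  "Zero (wide_full_sub A P) = Zero A"
  "One (wide_full_sub A P) = {f \<in> One A. P f}"
  "Two (wide_full_sub A P) = {\<alpha> \<in> Two A. P (src2 A \<alpha>) \<and> P (tgt2 A \<alpha>)}"
  "src1 (wide_full_sub A P) = src1 A" "tgt1 (wide_full_sub A P) = tgt1 A"
  "src2 (wide_full_sub A P) = src2 A" "tgt2 (wide_full_sub A P) = tgt2 A"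
  "id1 (wide_full_sub A P) = id1 A" "id2 (wide_full_sub A P) = id2 A"
  "comp1 (wide_full_sub A P) = comp1 A" "vcomp (wide_full_sub A P) = vcomp A"
  "hcomp (wide_full_sub A P) = hcomp A"
  by (simp_all add: wide_full_sub_def)

lemma hom1_sub [simp]: "f \<in> hom1 (wide_full_sub A P) x y \<longleftrightarrow> f \<in> hom1 A x y \<and> P f"
  by (auto simp: hom1_def)

lemma hom2_sub [simp]: "\<alpha> \<in> hom2 (wide_full_sub A P) f g \<longleftrightarrow> \<alpha> \<in> hom2 A f g \<and> P f \<and> P g"
  by (auto simp: hom2_def)

lemma wide_full_sub_True: "wide_full_sub A (\<lambda>_. True) = A"
  by (simp add: wide_full_sub_def)

text \<open>\<open>GCwF_ps\<close> and \<open>GCwF_str\<close> are restrictions of a restriction.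
  Merging the predicates lets a restriction argument run once, directly on
  \<open>GCwF_iso\<close>.\<close>

lemma wide_full_sub_twice:
  "wide_full_sub (wide_full_sub A P) Q = wide_full_sub A (\<lambda>f. P f \<and> Q f)"
  by (simp add: wide_full_sub_def) (rule twocat.equality; auto)

text \<open>The closure that makes the restricted structure a 2-category. Nothing is asked of
  2-cells, because all 2-cells between retained 1-cells are kept.\<close>

definition closed_1cells where
  "closed_1cells A P \<longleftrightarrow> (\<forall>x \<in> Zero A. P (id1 A x)) \<and>
    (\<forall>x y z f g. f \<in> hom1 A x y \<longrightarrow> g \<in> hom1 A y z \<longrightarrow> P f \<longrightarrow> P g \<longrightarrow> P (g \<odot>\<^bsub>A\<^esub> f))"

lemma closed_1cells_True: "closed_1cells A (\<lambda>_. True)"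
  by (simp add: closed_1cells_def)

lemma closed_1cells_conj:
  "\<lbrakk>closed_1cells A P; closed_1cells A Q\<rbrakk> \<Longrightarrow> closed_1cells A (\<lambda>f. P f \<and> Q f)"
  unfolding closed_1cells_def by blast

lemma two_category_sub:
  assumes "two_category A" and P: "closed_1cells A P"
  shows "two_category (wide_full_sub A P)"
proof -
  interpret two_category A by fact
  \<comment> \<open>The axioms type a 2-cell through its source 1-cell; globularity supplies the
    type of the target 1-cell, so that the target of a horizontal composite can be seen to be
    retained.\<close>
  have hom1_target: "\<And>f x y \<alpha> f'. \<lbrakk>f \<in> hom1 A x y; \<alpha> \<in> hom2 A f f'\<rbrakk> \<Longrightarrow> f' \<in> hom1 A x y"
    using globular_src globular_tgt tgt2_One by (auto simp: hom1_def hom2_def)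
  note P' = P[unfolded closed_1cells_def]
  show ?thesis
    apply unfold_locales
                        apply (auto simp: src1_Zero tgt1_Zero src2_One tgt2_One globular_src globular_tgt)[6]
                  apply (use P' in \<open>auto simp: id1_hom id2_hom\<close>)[2]
                apply (use P' comp1_hom in \<open>simp; blast\<close>)
    subgoal by (simp, elim conjE, rule comp1_id1)
    subgoal by (simp, elim conjE, rule id1_comp1)
    subgoal by (simp, elim conjE, rule comp1_assoc)
    subgoal by (simp; blast intro: vcomp_hom)
    subgoal by (simp, elim conjE, rule vcomp_id2)
    subgoal by (simp, elim conjE, rule id2_vcomp)
    subgoal by (simp, elim conjE, rule vcomp_assoc)
    subgoal for f x y g z \<alpha> f' \<beta> g'
      using P' hcomp_hom[of f x y g z \<alpha> f' \<beta> g'] hom1_target[of f x y \<alpha> f'] hom1_target[of g y z \<beta> g']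
      by auto
    subgoal by (simp, elim conjE, rule hcomp_id1)
    subgoal by (simp, elim conjE, rule id1_hcomp)
    subgoal by (simp, elim conjE, rule hcomp_assoc)
    subgoal by (simp, elim conjE, rule hcomp_id2)
    subgoal by (simp, elim conjE, rule interchange)
    done
qed

lemma two_functor_sub:
  assumes "two_functor A B F" and "closed_1cells A P" "closed_1cells B Q"
    and PQ: "\<And>f. \<lbrakk>f \<in> One A; P f\<rbrakk> \<Longrightarrow> Q (F1 F f)"
  shows "two_functor (wide_full_sub A P) (wide_full_sub B Q) F"
proof -
  interpret two_functor A B F by fact
  interpret A': two_category "wide_full_sub A P" by (intro two_category_sub A.two_category_axioms assms)
  interpret B': two_category "wide_full_sub B Q" by (intro two_category_sub B.two_category_axioms assms)
  have PQ': "\<And>f g \<alpha>. \<lbrakk>\<alpha> \<in> hom2 A f g; P f; P g\<rbrakk> \<Longrightarrow> Q (F1 F f) \<and> Q (F1 F g)"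
    using PQ A.src2_One A.tgt2_One by (auto simp: hom2_def)
  have PQ'': "\<And>f x y. \<lbrakk>f \<in> hom1 A x y; P f\<rbrakk> \<Longrightarrow> Q (F1 F f)"
    using PQ by (auto simp: hom1_def)
  show ?thesis
    by unfold_locales
      (auto simp: F0_Zero F1_hom F2_hom F1_id F1_comp F2_id F2_vcomp F2_hcomp PQ' PQ'')
qed

lemma two_category_hom1D: "\<lbrakk>two_category A; f \<in> hom1 A x y\<rbrakk> \<Longrightarrow> x \<in> Zero A \<and> y \<in> Zero A \<and> f \<in> One A"
  using two_category.src1_Zero two_category.tgt1_Zero by (fastforce simp: hom1_def)

lemma two_category_hom2D: "\<lbrakk>two_category A; \<alpha> \<in> hom2 A f g\<rbrakk> \<Longrightarrow> f \<in> One A \<and> g \<in> One A \<and> \<alpha> \<in> Two A"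
  using two_category.src2_One two_category.tgt2_One by (fastforce simp: hom2_def)

text \<open>An inverse runs between the same two retained 1-cells, so 2-fullness keeps it.\<close>

lemma invertible2_sub:
  assumes "invertible2 A \<alpha>" "P (src2 A \<alpha>)" "P (tgt2 A \<alpha>)"
  shows "invertible2 (wide_full_sub A P) \<alpha>"
  using assms by (auto simp: invertible2_def)

lemma two_functor_comp:
  assumes "two_functor A B F" "two_functor B D G"
  shows "two_functor A D (comp_2fun G F)"
proof -
  interpret F: two_functor A B F by fact
  interpret G: two_functor B D G by fact
  have one: "\<And>f. f \<in> One A \<Longrightarrow> F1 F f \<in> One B" using F.F1_hom by (auto simp: hom1_def)
  show ?thesis
    by unfold_locales
      (auto simp: comp_2fun_def F.F0_Zero G.F0_Zero F.F1_id G.F1_id F.F2_id G.F2_id one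
        intro!: G.F1_hom F.F1_hom G.F2_hom F.F2_hom
        simp: F.F1_comp G.F1_comp[OF F.F1_hom F.F1_hom] F.F2_vcomp G.F2_vcomp[OF F.F2_hom F.F2_hom]
           F.F2_hcomp G.F2_hcomp[OF F.F1_hom F.F1_hom F.F2_hom F.F2_hom])
qed

lemma two_functor_id: "two_category A \<Longrightarrow> two_functor A A id_2fun"
  by (auto simp: two_functor_def two_functor_axioms_def id_2fun_def)

text \<open>Only the 1-cell components have to be checked. The boundary of
  \<open>pn2 \<sigma> f\<close> consists of composites of retained 1-cells, so the structure cells
  and their inverses survive by 2-fullness.\<close>

lemma pseudonat_sub:
  assumes \<sigma>: "pseudonat A B F G \<sigma>"
    and F: "two_functor (wide_full_sub A P) (wide_full_sub B Q) F"
    and G: "two_functor (wide_full_sub A P) (wide_full_sub B Q) G"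
    and pn1: "\<And>x. x \<in> Zero A \<Longrightarrow> Q (pn1 \<sigma> x)"
  shows "pseudonat (wide_full_sub A P) (wide_full_sub B Q) F G \<sigma>"
proof -
  interpret \<sigma>: pseudonat A B F G \<sigma> by fact
  interpret F: two_functor "wide_full_sub A P" "wide_full_sub B Q" F by fact
  interpret G: two_functor "wide_full_sub A P" "wide_full_sub B Q" G by fact
  have Q: "Q (pn1 \<sigma> y \<odot>\<^bsub>B\<^esub> F1 F f) \<and> Q (F1 G f \<odot>\<^bsub>B\<^esub> pn1 \<sigma> x)" if f: "f \<in> hom1 A x y" "P f" for f x y
  proof -
    have xy: "x \<in> Zero A" "y \<in> Zero A" using f two_category_hom1D[OF \<sigma>.F.A.two_category_axioms] by blast+
    have "pn1 \<sigma> x \<in> hom1 (wide_full_sub B Q) (F0 F x) (F0 G x)" "pn1 \<sigma> y \<in> hom1 (wide_full_sub B Q) (F0 F y) (F0 G y)"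
      using xy \<sigma>.pn1_hom pn1 by auto
    moreover have "F1 F f \<in> hom1 (wide_full_sub B Q) (F0 F x) (F0 F y)"
        "F1 G f \<in> hom1 (wide_full_sub B Q) (F0 G x) (F0 G y)"
      using F.F1_hom[of f x y] G.F1_hom[of f x y] f by auto
    ultimately show ?thesis using F.B.comp1_hom by fastforce
  qed
  have inv: "invertible2 (wide_full_sub B Q) (pn2 \<sigma> f)" if f: "f \<in> One A" "P f" for f
  proof -
    have f1: "f \<in> hom1 A (src1 A f) (tgt1 A f)" using f by (simp add: hom1_def)
    from Q[OF f1 f(2)] \<sigma>.pn2_hom[OF f1] show ?thesis
      by (intro invertible2_sub \<sigma>.pn2_invertible f) (auto simp: hom2_def)
  qed
  show ?thesis
    by unfold_locales
     (use pn1 \<sigma>.pn1_hom \<sigma>.pn2_hom Q inv \<sigma>.pn2_natural \<sigma>.pn2_id \<sigma>.pn2_comp in auto)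
qed


section \<open>Biadjunctions with identity counit and strict triangle identities\<close>

lemma (in two_category) id2_of_id1_laws:
  assumes "\<alpha> \<in> hom2 A f g"
  shows "\<alpha> \<star>\<^bsub>A\<^esub> id2 A (id1 A (src1 A f)) = \<alpha>" "id2 A (id1 A (tgt1 A f)) \<star>\<^bsub>A\<^esub> \<alpha> = \<alpha>"
proof -
  have "f \<in> hom1 A (src1 A f) (tgt1 A f)" using assms src2_One by (auto simp: hom1_def hom2_def)
  from hcomp_id1[OF this assms] id1_hcomp[OF this assms]
  show "\<alpha> \<star>\<^bsub>A\<^esub> id2 A (id1 A (src1 A f)) = \<alpha>" "id2 A (id1 A (tgt1 A f)) \<star>\<^bsub>A\<^esub> \<alpha> = \<alpha>" by auto
qed

lemma (in two_category) invertible2_id2: "f \<in> One A \<Longrightarrow> invertible2 A (id2 A f)"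
  using id2_hom[of f] vcomp_id2[of "id2 A f" f f] unfolding invertible2_def hom2_def by auto

lemma (in two_category) equivalence1_id1: "x \<in> Zero A \<Longrightarrow> equivalence1 A (id1 A x)"
  unfolding equivalence1_def
  using id1_hom[of x] comp1_id1[of "id1 A x" x x] id2_hom[of "id1 A x"] invertible2_id2[of "id1 A x"]
  by (auto simp: hom1_def intro!: bexI[of _ "id1 A x"] bexI[of _ "id2 A (id1 A x)"])

lemma pseudonat_id_pn:
  assumes "two_functor A B F" shows "pseudonat A B F F (id_pn B F)"
proof -
  interpret two_functor A B F by fact
  have one: "F1 F f \<in> One B" if "f \<in> One A" for f using F1_hom that by (auto simp: hom1_def)
  have z: "x \<in> Zero A \<and> y \<in> Zero A \<and> f \<in> One A" if "f \<in> hom1 A x y" for f x y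
    using two_category_hom1D[OF A.two_category_axioms that] by blast
  show ?thesis
  proof unfold_locales
    fix f x y \<alpha> g assume f: "f \<in> hom1 A x y" and a: "\<alpha> \<in> hom2 A f g"
    note F1 = F1_hom[OF f] and F2 = F2_hom[OF a]
    show "pn2 (id_pn B F) g \<bullet>\<^bsub>B\<^esub> (id2 B (pn1 (id_pn B F) y) \<star>\<^bsub>B\<^esub> F2 F \<alpha>) =
       (F2 F \<alpha> \<star>\<^bsub>B\<^esub> id2 B (pn1 (id_pn B F) x)) \<bullet>\<^bsub>B\<^esub> pn2 (id_pn B F) f"
      by (simp add: id_pn_def B.hcomp_id1[OF F1 F2] B.id1_hcomp[OF F1 F2] B.vcomp_id2[OF F2] B.id2_vcomp[OF F2])
  next
    fix f g x y w assume f: "f \<in> hom1 A x y" "g \<in> hom1 A y w"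
    show "pn2 (id_pn B F) (g \<odot>\<^bsub>A\<^esub> f) =
       (id2 B (F1 F g) \<star>\<^bsub>B\<^esub> pn2 (id_pn B F) f) \<bullet>\<^bsub>B\<^esub> (pn2 (id_pn B F) g \<star>\<^bsub>B\<^esub> id2 B (F1 F f))"
      using F1_hom[OF f(1)] F1_hom[OF f(2)] B.comp1_hom[OF F1_hom[OF f(1)] F1_hom[OF f(2)]]
      by (simp add: id_pn_def F1_comp[OF f] B.hcomp_id2 B.vcomp_id2[OF B.id2_hom] hom1_def)
  next
    fix f x y assume f: "f \<in> hom1 A x y"
    show "pn2 (id_pn B F) f \<in> hom2 B (pn1 (id_pn B F) y \<odot>\<^bsub>B\<^esub> F1 F f) (F1 F f \<odot>\<^bsub>B\<^esub> pn1 (id_pn B F) x)"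
      using B.id2_hom[OF one, of f] z[OF f]
      by (simp add: id_pn_def B.comp1_id1[OF F1_hom[OF f]] B.id1_comp1[OF F1_hom[OF f]])
  qed (auto simp: id_pn_def B.id1_hom F0_Zero one B.invertible2_id2 F1_id)
qed

text \<open>Transformations matter only on the cells of the source 2-category, so the records of a
  triangle composite and of an identity may differ elsewhere. Agreement in the sense of
  \<open>eq_pn\<close> is enough to transfer every axiom.\<close>

lemma pseudonat_cong:
  assumes "pseudonat A B F G \<sigma>" "eq_pn A \<sigma> \<tau>" shows "pseudonat A B F G \<tau>"
proof -
  interpret pseudonat A B F G \<sigma> by fact
  have z: "x \<in> Zero A" "y \<in> Zero A" "f \<in> One A" if "f \<in> hom1 A x y" for f x y
    using two_category_hom1D[OF F.A.two_category_axioms that] by blast+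
  have z2: "f \<in> One A" "g \<in> One A" if "\<alpha> \<in> hom2 A f g" for f g \<alpha>
    using two_category_hom2D[OF F.A.two_category_axioms that] by blast+
  have e1: "\<And>x. x \<in> Zero A \<Longrightarrow> pn1 \<tau> x = pn1 \<sigma> x" and e2: "\<And>f. f \<in> One A \<Longrightarrow> pn2 \<tau> f = pn2 \<sigma> f"
    using assms(2) by (simp_all add: eq_pn_def)
  show ?thesis
    apply unfold_locales
    subgoal using pn1_hom e1 by simp
    subgoal for f x y using pn2_hom[of f x y] z[of f x y] by (simp add: e1 e2)
    subgoal using pn2_invertible e2 by simp
    subgoal for f x y \<alpha> g using pn2_natural[of f x y \<alpha> g] z[of f x y] z2[of \<alpha> f g] by (simp add: e1 e2)
    subgoal using pn2_id F.A.id1_hom by (simp add: e1 e2 hom1_def)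
    subgoal for f x y g w using pn2_comp[of f x y g w] F.A.comp1_hom[of f x y g w] z[of f x y] z[of g y w]
      by (simp add: e1 e2 hom1_def)
    done
qed

text \<open>A biadjunction asks for a modification; when a triangle composite agrees with the
  identity, identity 2-cells provide one, and the modification axiom reduces to unit laws.\<close>

lemma invertible_modification_id_pn:
  assumes F: "two_functor A B F" and e: "eq_pn A \<sigma> (id_pn B F)"
  shows "\<exists>\<Gamma>. invertible_modification A B F F \<sigma> (id_pn B F) \<Gamma>"
proof -
  interpret two_functor A B F by fact
  have "pseudonat A B F F \<sigma>"
    by (rule pseudonat_cong[OF pseudonat_id_pn[OF F]]) (use e in \<open>auto simp: eq_pn_def\<close>)
  moreover have "id2 B (F1 F f) \<bullet>\<^bsub>B\<^esub> (id2 B (id1 B (F0 F y)) \<star>\<^bsub>B\<^esub> id2 B (F1 F f)) =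
       (id2 B (F1 F f) \<star>\<^bsub>B\<^esub> id2 B (id1 B (F0 F x))) \<bullet>\<^bsub>B\<^esub> id2 B (F1 F f)" if f: "f \<in> hom1 A x y" for f x y
  proof -
    have "F1 F f \<in> One B" using F1_hom[OF f] by (simp add: hom1_def)
    from B.id2_hom[OF this] show ?thesis
      using F1_hom[OF f] by (simp add: B.id1_hcomp B.hcomp_id1)
  qed
  moreover have id1_One: "id1 B (F0 F x) \<in> One B" if "x \<in> Zero A" for x
    using B.id1_hom[OF F0_Zero[OF that]] by (simp add: hom1_def)
  ultimately show ?thesis
    using e pseudonat_id_pn[OF F]
    by (intro exI[of _ "\<lambda>x. id2 B (id1 B (F0 F x))"])
      (auto simp: invertible_modification_def id_pn_def eq_pn_def hom1_def F0_Zero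
        intro!: B.id2_hom B.invertible2_id2 id1_One)
qed

text \<open>The situation common to the base level and the fibred level: \<open>F G\<close> is the
  identity, \<open>F\<close> sends the unit to identities, and the unit is an identity on the image
  of \<open>G\<close>. Pseudo-naturality is demanded of the unit only; that of the counit, both
  triangles and stability under restriction are consequences.\<close>

locale strict_biadjunction =
  F: two_functor A B F + G: two_functor B A G + \<eta>: pseudonat A A id_2fun "comp_2fun G F" \<eta>
  for A :: "('x, 'y, 'z) twocat" and B :: "('u, 'v, 'w) twocat" and F G \<eta> +
  fixes \<epsilon> :: "('u, 'v, 'v, 'w) pnat"
  assumes FG0: "y \<in> Zero B \<Longrightarrow> F0 F (F0 G y) = y"
    and FG1: "g \<in> One B \<Longrightarrow> F1 F (F1 G g) = g"
    and FG2: "\<beta> \<in> Two B \<Longrightarrow> F2 F (F2 G \<beta>) = \<beta>"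
    and F_unit1: "x \<in> Zero A \<Longrightarrow> F1 F (pn1 \<eta> x) = id1 B (F0 F x)"
    and F_unit2: "f \<in> One A \<Longrightarrow> F2 F (pn2 \<eta> f) = id2 B (F1 F f)"
    and unit_G1: "y \<in> Zero B \<Longrightarrow> pn1 \<eta> (F0 G y) = id1 A (F0 G y)"
    and unit_G2: "g \<in> One B \<Longrightarrow> pn2 \<eta> (F1 G g) = id2 A (F1 G g)"
    and counit1: "y \<in> Zero B \<Longrightarrow> pn1 \<epsilon> y = id1 B y"
    and counit2: "g \<in> One B \<Longrightarrow> pn2 \<epsilon> g = id2 B g"
begin

lemma eq_2fun_FG: "eq_2fun B (comp_2fun F G) id_2fun"
  by (simp add: eq_2fun_def comp_2fun_def id_2fun_def FG0 FG1 FG2)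

lemma F1_One: "f \<in> One A \<Longrightarrow> F1 F f \<in> One B"
  and G1_One: "g \<in> One B \<Longrightarrow> F1 G g \<in> One A"
  using F.F1_hom G.F1_hom by (auto simp: hom1_def)

lemma F1_src: "f \<in> One A \<Longrightarrow> src1 B (F1 F f) = F0 F (src1 A f) \<and> tgt1 B (F1 F f) = F0 F (tgt1 A f)"
  and G1_src: "g \<in> One B \<Longrightarrow> src1 A (F1 G g) = F0 G (src1 B g) \<and> tgt1 A (F1 G g) = F0 G (tgt1 B g)"
  using F.F1_hom G.F1_hom by (auto simp: hom1_def)

text \<open>Since \<open>F G\<close> acts as the identity on all cells, the axioms are those of the
  identity transformation of \<open>id_2fun\<close>, rewritten cell by cell.\<close>

lemma pseudonat_counit: "pseudonat B B (comp_2fun F G) id_2fun \<epsilon>"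
proof -
  interpret FG: two_functor B B "comp_2fun F G"
    by (rule two_functor_comp) unfold_locales
  interpret I: two_functor B B id_2fun
    by (rule two_functor_id) unfold_locales
  interpret I: pseudonat B B id_2fun id_2fun "id_pn B id_2fun"
    by (rule pseudonat_id_pn) unfold_locales
  have z: "x \<in> Zero B" "y \<in> Zero B" "f \<in> One B" if "f \<in> hom1 B x y" for f x y
    using two_category_hom1D[OF F.B.two_category_axioms that] by blast+
  have z2: "f \<in> One B" "g \<in> One B" "\<alpha> \<in> Two B" if "\<alpha> \<in> hom2 B f g" for f g \<alpha>
    using two_category_hom2D[OF F.B.two_category_axioms that] by blast+
  have e: "pn1 \<epsilon> x = id1 B x" "F0 (comp_2fun F G) x = x" if "x \<in> Zero B" for x
    using that by (simp_all add: id_pn_def id_2fun_def comp_2fun_def FG0 counit1)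
  have e1: "pn2 \<epsilon> f = id2 B f" "F1 (comp_2fun F G) f = f" if "f \<in> One B" for f
    using that by (simp_all add: id_pn_def id_2fun_def comp_2fun_def FG1 counit2)
  have e2: "F2 (comp_2fun F G) \<alpha> = \<alpha>" if "\<alpha> \<in> Two B" for \<alpha>
    using that by (simp add: id_2fun_def comp_2fun_def FG2)
  note I' = id_pn_def id_2fun_def
  show ?thesis
    apply unfold_locales
    subgoal using I.pn1_hom by (simp add: e I')
    subgoal for f x y using I.pn2_hom[of f x y] z[of f x y] by (simp add: e e1 I')
    subgoal using I.pn2_invertible by (simp add: e1 I')
    subgoal for f x y \<alpha> g using I.pn2_natural[of f x y \<alpha> g] z[of f x y] z2[of \<alpha> f g] by (simp add: e e1 e2 I')
    subgoal for x using I.pn2_id[of x] F.B.id1_hom[of x] by (simp add: e e1 hom1_def I')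
    subgoal for f x y g w using I.pn2_comp[of f x y g w] F.B.comp1_hom[of f x y g w] z[of f x y] z[of g y w]
      by (simp add: e e1 hom1_def I')
    done
qed

lemma triangle_F: "x \<in> Zero A \<Longrightarrow> pn1 \<epsilon> (F0 F x) \<odot>\<^bsub>B\<^esub> F1 F (pn1 \<eta> x) = id1 B (F0 F x)"
  using F.B.comp1_id1[OF F.B.id1_hom, of "F0 F x"] by (simp add: F_unit1 counit1 F.F0_Zero)

lemma triangle_G: "x \<in> Zero B \<Longrightarrow> F1 G (pn1 \<epsilon> x) \<odot>\<^bsub>A\<^esub> pn1 \<eta> (F0 G x) = id1 A (F0 G x)"
  using F.A.comp1_id1[OF F.A.id1_hom, of "F0 G x"] by (simp add: unit_G1 counit1 G.F0_Zero G.F1_id)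

lemma biadjunction: "biadjunction A B F G \<eta> \<epsilon>"
proof -
  have "eq_pn A (vcomp_pn A B (whisker_right \<epsilon> F) (whisker_left F \<eta>)) (id_pn B F)"
    unfolding eq_pn_def
  proof safe
    fix f assume f: "f \<in> One A"
    have f': "F1 F f \<in> One B" using f by (rule F1_One)
    have z: "src1 A f \<in> Zero A" "tgt1 A f \<in> Zero A" using f F.A.src1_Zero F.A.tgt1_Zero by auto
    note h = F.B.id2_hom[OF f']
    show "pn2 (vcomp_pn A B (whisker_right \<epsilon> F) (whisker_left F \<eta>)) f = pn2 (id_pn B F) f"
      using f f' z F1_src[OF f] F.B.id2_of_id1_laws[OF h] F.B.vcomp_id2[OF h]
      by (simp add: vcomp_pn_def whisker_right_def whisker_left_def id_pn_def F_unit2 F_unit1 counit1 counit2 F.F0_Zero)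
  qed (simp add: vcomp_pn_def whisker_right_def whisker_left_def id_pn_def triangle_F)
  moreover have "eq_pn B (vcomp_pn B A (whisker_left G \<epsilon>) (whisker_right \<eta> G)) (id_pn A G)"
    unfolding eq_pn_def
  proof safe
    fix f assume f: "f \<in> One B"
    have f': "F1 G f \<in> One A" using f by (rule G1_One)
    have z: "src1 B f \<in> Zero B" "tgt1 B f \<in> Zero B" using f F.B.src1_Zero F.B.tgt1_Zero by auto
    note h = F.A.id2_hom[OF f']
    show "pn2 (vcomp_pn B A (whisker_left G \<epsilon>) (whisker_right \<eta> G)) f = pn2 (id_pn A G) f"
      using f f' z G1_src[OF f] F.A.id2_of_id1_laws[OF h] F.A.vcomp_id2[OF h]
      by (simp add: vcomp_pn_def whisker_right_def whisker_left_def id_pn_def unit_G1 unit_G2 counit1 counit2 G.F1_id G.F2_id G.F0_Zero)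
  qed (simp add: vcomp_pn_def whisker_right_def whisker_left_def id_pn_def triangle_G)
  ultimately show ?thesis
    unfolding biadjunction_def
    using invertible_modification_id_pn[OF F.two_functor_axioms] invertible_modification_id_pn[OF G.two_functor_axioms]
      pseudonat_counit F.two_functor_axioms G.two_functor_axioms \<eta>.pseudonat_axioms by blast
qed

lemma adjoint_biequivalence:
  "(\<And>x. x \<in> Zero A \<Longrightarrow> equivalence1 A (pn1 \<eta> x)) \<Longrightarrow> adjoint_biequivalence A B F G \<eta> \<epsilon>"
  by (simp add: adjoint_biequivalence_def biadjunction counit1 F.B.equivalence1_id1)

lemma restrict:
  assumes P: "closed_1cells A P" and Q: "closed_1cells B Q"
    and PQ: "\<And>f. \<lbrakk>f \<in> One A; P f\<rbrakk> \<Longrightarrow> Q (F1 F f)" and QP: "\<And>f. \<lbrakk>f \<in> One B; Q f\<rbrakk> \<Longrightarrow> P (F1 G f)"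
    and unit: "\<And>x. x \<in> Zero A \<Longrightarrow> P (pn1 \<eta> x)"
  shows "strict_biadjunction (wide_full_sub A P) (wide_full_sub B Q) F G \<eta> \<epsilon>"
proof -
  let ?A = "wide_full_sub A P" and ?B = "wide_full_sub B Q"
  interpret F': two_functor ?A ?B F
    by (rule two_functor_sub[OF F.two_functor_axioms P Q PQ])
  interpret G': two_functor ?B ?A G
    by (rule two_functor_sub[OF G.two_functor_axioms Q P QP])
  interpret \<eta>': pseudonat ?A ?A id_2fun "comp_2fun G F" \<eta>
  proof (rule pseudonat_sub)
    show "pseudonat A A id_2fun (comp_2fun G F) \<eta>" by unfold_locales
    show "two_functor ?A ?A id_2fun" by (rule two_functor_id) unfold_locales
    show "two_functor ?A ?A (comp_2fun G F)" by (rule two_functor_comp) unfold_locales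
  qed (rule unit)
  show ?thesis
    by unfold_locales (auto simp: FG0 FG1 FG2 F_unit1 F_unit2 unit_G1 unit_G2 counit1 counit2)
qed

text \<open>The right adjoint is fully faithful because naturality of the unit, whose components are
  identities on the image of \<open>G\<close>, forces \<open>G F f = f\<close> for every cell \<open>f\<close> between objects of that
  image.\<close>

lemma two_reflection:
  assumes nat: "\<And>f. f \<in> One A \<Longrightarrow> pn2 \<eta> f = id2 A (pn1 \<eta> (tgt1 A f) \<odot>\<^bsub>A\<^esub> f)"
  shows "two_adjunction A B F G \<eta> \<epsilon>" "two_reflection A B F G \<eta> \<epsilon>"
proof -
  have zB: "F1 F (F1 G f) = f" if "f \<in> hom1 B x y" for f x y
    using FG1 that by (simp add: hom1_def)
  show *: "two_adjunction A B F G \<eta> \<epsilon>"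
    unfolding two_adjunction_def two_natural_def
  proof (intro conjI ballI)
    fix f assume f: "f \<in> One B"
    have "id1 B (tgt1 B f) \<odot>\<^bsub>B\<^esub> f = f"
      using F.B.id1_comp1 f by (auto simp: hom1_def)
    then show "pn2 \<epsilon> f = id2 B (pn1 \<epsilon> (tgt1 B f) \<odot>\<^bsub>B\<^esub> F1 (comp_2fun F G) f)"
      using f F.B.tgt1_Zero by (simp add: counit1 counit2 comp_2fun_def FG1)
  qed (use nat triangle_F triangle_G F.two_functor_axioms G.two_functor_axioms \<eta>.pseudonat_axioms pseudonat_counit
      in \<open>auto simp: id_2fun_def\<close>)
  have GF1: "F1 G (F1 F f) = f" if x: "x \<in> Zero B" "y \<in> Zero B" and f: "f \<in> hom1 A (F0 G x) (F0 G y)" for f x y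
  proof -
    have f1: "f \<in> One A" "tgt1 A f = F0 G y" using f by (auto simp: hom1_def)
    have "F1 F f \<in> hom1 B x y" using F.F1_hom[OF f] by (simp add: FG0 x)
    then have "F1 G (F1 F f) \<in> hom1 A (F0 G x) (F0 G y)" by (rule G.F1_hom)
    moreover have "pn2 \<eta> f \<in> hom2 A (pn1 \<eta> (F0 G y) \<odot>\<^bsub>A\<^esub> f) (F1 G (F1 F f) \<odot>\<^bsub>A\<^esub> pn1 \<eta> (F0 G x))"
      using \<eta>.pn2_hom[OF f] by (simp add: id_2fun_def comp_2fun_def)
    ultimately have "pn2 \<eta> f \<in> hom2 A f (F1 G (F1 F f))"
      using F.A.comp1_id1 F.A.id1_comp1[OF f] by (simp add: unit_G1 x)
    moreover have "pn2 \<eta> f = id2 A f"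
      using nat[OF f1(1)] F.A.id1_comp1[OF f] by (simp add: f1 unit_G1 x)
    \<comment> \<open>The same 2-cell has target \<open>G F f\<close> by its typing and target
      \<open>f\<close> as an identity; the equality of 1-cells is read off from this.\<close>
    ultimately show ?thesis using F.A.id2_hom[OF f1(1)] by (simp add: hom2_def)
  qed
  have GF2: "F2 G (F2 F \<alpha>) = \<alpha>" if x: "x \<in> Zero B" "y \<in> Zero B" and f: "f \<in> hom1 A (F0 G x) (F0 G y)"
    and a: "\<alpha> \<in> hom2 A f g" for f x y g \<alpha>
  proof -
    have g: "g \<in> hom1 A (F0 G x) (F0 G y)"
      using f a F.A.globular_src F.A.globular_tgt F.A.tgt2_One by (auto simp: hom1_def hom2_def)
    have eta: "pn2 \<eta> h = id2 A h" if "h \<in> hom1 A (F0 G x) (F0 G y)" for h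
    proof -
      have "F1 F h \<in> One B" using F1_One that by (simp add: hom1_def)
      from unit_G2[OF this] show ?thesis by (simp add: GF1[OF x that])
    qed
    have a2: "F2 G (F2 F \<alpha>) \<in> hom2 A f g"
      using G.F2_hom[OF F.F2_hom[OF a]] by (simp add: GF1[OF x f] GF1[OF x g])
    have "id2 A g \<bullet>\<^bsub>A\<^esub> (id2 A (id1 A (F0 G y)) \<star>\<^bsub>A\<^esub> \<alpha>) = (F2 G (F2 F \<alpha>) \<star>\<^bsub>A\<^esub> id2 A (id1 A (F0 G x))) \<bullet>\<^bsub>A\<^esub> id2 A f"
      using \<eta>.pn2_natural[OF f a] by (simp add: eta f g unit_G1 x id_2fun_def comp_2fun_def)
    then show ?thesis
      by (simp add: F.A.id1_hcomp[OF f a] F.A.hcomp_id1[OF f a2] F.A.id2_vcomp[OF a] F.A.vcomp_id2[OF a2])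
  qed
  have "fully_faithful_2fun B A G"
    unfolding fully_faithful_2fun_def
  proof (intro conjI ballI)
    fix x y assume x: "x \<in> Zero B" "y \<in> Zero B"
    show "bij_betw (F1 G) (hom1 B x y) (hom1 A (F0 G x) (F0 G y))"
      by (rule bij_betw_byWitness[where f' = "F1 F"])
        (use zB GF1[OF x] G.F1_hom F.F1_hom[of _ "F0 G x" "F0 G y"] in \<open>auto simp: FG0 x\<close>)
    fix f g assume f: "f \<in> hom1 B x y" "g \<in> hom1 B x y"
    show "bij_betw (F2 G) (hom2 B f g) (hom2 A (F1 G f) (F1 G g))"
      by (rule bij_betw_byWitness[where f' = "F2 F"])
        (use GF2[OF x G.F1_hom[OF f(1)]] G.F2_hom F.F2_hom[of _ "F1 G f" "F1 G g"] FG2 in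
         \<open>auto simp: zB[OF f(1)] zB[OF f(2)] hom2_def\<close>)
  qed unfold_locales
  with * show "two_reflection A B F G \<eta> \<epsilon>" by (simp add: two_reflection_def)
qed

end

section \<open>Elementary category theory: isomorphisms, extensionality, calculus of natural
  transformations\<close>

section \<open>Categories, functors and natural transformations\<close>

text \<open>Typing is turned into conditions that rewriting can decide: membership in
  \<open>Ar\<close>, domain and codomain. Most rules that follow are stated in this form.\<close>

lemma in_hom_iff [simp]: "f \<in> hom C A B \<longleftrightarrow> f \<in> Ar C \<and> Dom C f = A \<and> Cod C f = B"
  by (auto simp: hom_def)

context category
begin

lemma Dom_Ob [simp]: "f \<in> Ar C \<Longrightarrow> Dom C f \<in> Ob C"
  and Cod_Ob [simp]: "f \<in> Ar C \<Longrightarrow> Cod C f \<in> Ob C"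
  using Dom_ext Cod_ext by auto

lemma Ident_Ar [simp]: "A \<in> Ob C \<Longrightarrow> Ident C A \<in> Ar C"
  and Dom_Ident [simp]: "A \<in> Ob C \<Longrightarrow> Dom C (Ident C A) = A"
  and Cod_Ident [simp]: "A \<in> Ob C \<Longrightarrow> Cod C (Ident C A) = A"
  using Ident_hom[of A] by auto

lemma Comp_Ar [simp]: "\<lbrakk>f \<in> Ar C; g \<in> Ar C; Cod C f = Dom C g\<rbrakk> \<Longrightarrow> g \<cdot>\<^bsub>C\<^esub> f \<in> Ar C"
  and Dom_Comp [simp]: "\<lbrakk>f \<in> Ar C; g \<in> Ar C; Cod C f = Dom C g\<rbrakk> \<Longrightarrow> Dom C (g \<cdot>\<^bsub>C\<^esub> f) = Dom C f"
  and Cod_Comp [simp]: "\<lbrakk>f \<in> Ar C; g \<in> Ar C; Cod C f = Dom C g\<rbrakk> \<Longrightarrow> Cod C (g \<cdot>\<^bsub>C\<^esub> f) = Cod C g"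
  using Comp_hom[of f "Dom C f" "Dom C g" g "Cod C g"] by auto

lemma Comp_Ident_right [simp]: "\<lbrakk>f \<in> Ar C; Dom C f = A\<rbrakk> \<Longrightarrow> f \<cdot>\<^bsub>C\<^esub> Ident C A = f"
  and Ident_Comp_left [simp]: "\<lbrakk>f \<in> Ar C; Cod C f = B\<rbrakk> \<Longrightarrow> Ident C B \<cdot>\<^bsub>C\<^esub> f = f"
  using Comp_Ident[of f A "Cod C f"] Ident_Comp[of f "Dom C f" B] by auto

lemma assoc [simp]:
  "\<lbrakk>f \<in> Ar C; g \<in> Ar C; h \<in> Ar C; Cod C f = Dom C g; Cod C g = Dom C h\<rbrakk>
    \<Longrightarrow> (h \<cdot>\<^bsub>C\<^esub> g) \<cdot>\<^bsub>C\<^esub> f = h \<cdot>\<^bsub>C\<^esub> (g \<cdot>\<^bsub>C\<^esub> f)"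
  using Comp_assoc[of f "Dom C f" "Dom C g" g "Dom C h" h "Cod C h"] by auto

declare category_axioms [simp]

end

text \<open>Turns an equation between composites into a rewrite rule for composites associated to the right.\<close>

lemma reassoc:
  "\<lbrakk>g \<cdot>\<^bsub>C\<^esub> f = h; category C; f \<in> Ar C; g \<in> Ar C; Cod C f = Dom C g; k \<in> Ar C; Cod C k = Dom C f\<rbrakk>
    \<Longrightarrow> g \<cdot>\<^bsub>C\<^esub> (f \<cdot>\<^bsub>C\<^esub> k) = h \<cdot>\<^bsub>C\<^esub> k"
  using category.assoc[of C k f g] by simp

context category
begin

lemma is_inverse_unique:
  assumes "is_inverse C f g" "is_inverse C f h" shows "g = h"
proof -
  have [simp]: "f \<in> Ar C" "g \<in> Ar C" "h \<in> Ar C" "Dom C g = Cod C f" "Cod C g = Dom C f" "Dom C h = Cod C f"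
    "Cod C h = Dom C f" and e: "g \<cdot>\<^bsub>C\<^esub> f = Ident C (Dom C f)" "f \<cdot>\<^bsub>C\<^esub> h = Ident C (Cod C f)"
    using assms by (auto simp: is_inverse_def)
  have "g = g \<cdot>\<^bsub>C\<^esub> (f \<cdot>\<^bsub>C\<^esub> h)" by (simp add: e)
  also have "\<dots> = h" using e(1) reassoc[OF e(1), of h] by simp
  finally show ?thesis .
qed

lemma inv_ar_eqI: "is_inverse C f g \<Longrightarrow> inv_ar C f = g"
  unfolding inv_ar_def using is_inverse_unique by blast

lemma inv_ar_inverse: "iso C f \<Longrightarrow> is_inverse C f (inv_ar C f)"
  unfolding iso_def using inv_ar_eqI by auto

lemma iso_Ar: "iso C f \<Longrightarrow> f \<in> Ar C"
  by (auto simp: iso_def is_inverse_def)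

lemma inv_ar_Ar [simp]: "iso C f \<Longrightarrow> inv_ar C f \<in> Ar C"
  and Dom_inv_ar [simp]: "iso C f \<Longrightarrow> Dom C (inv_ar C f) = Cod C f"
  and Cod_inv_ar [simp]: "iso C f \<Longrightarrow> Cod C (inv_ar C f) = Dom C f"
  and inv_ar_Comp [simp]: "iso C f \<Longrightarrow> inv_ar C f \<cdot>\<^bsub>C\<^esub> f = Ident C (Dom C f)"
  and Comp_inv_ar [simp]: "iso C f \<Longrightarrow> f \<cdot>\<^bsub>C\<^esub> inv_ar C f = Ident C (Cod C f)"
  using inv_ar_inverse[of f] by (auto simp: is_inverse_def)

lemma inv_ar_Comp_assoc [simp]:
  "\<lbrakk>iso C f; k \<in> Ar C; Cod C k = Dom C f\<rbrakk> \<Longrightarrow> inv_ar C f \<cdot>\<^bsub>C\<^esub> (f \<cdot>\<^bsub>C\<^esub> k) = k"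
  using iso_Ar by (simp add: reassoc[OF inv_ar_Comp])

lemma Comp_inv_ar_assoc [simp]:
  "\<lbrakk>iso C f; k \<in> Ar C; Cod C k = Cod C f\<rbrakk> \<Longrightarrow> f \<cdot>\<^bsub>C\<^esub> (inv_ar C f \<cdot>\<^bsub>C\<^esub> k) = k"
  using iso_Ar by (simp add: reassoc[OF Comp_inv_ar])

lemma is_inverse_sym: "is_inverse C f g \<Longrightarrow> is_inverse C g f"
  by (auto simp: is_inverse_def)

lemma iso_inv_ar: "iso C f \<Longrightarrow> iso C (inv_ar C f)"
  by (meson inv_ar_inverse is_inverse_sym iso_def)

lemma is_inverse_Ident: "A \<in> Ob C \<Longrightarrow> is_inverse C (Ident C A) (Ident C A)"
  by (simp add: is_inverse_def)

lemma iso_Ident [simp]: "A \<in> Ob C \<Longrightarrow> iso C (Ident C A)"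
  by (meson is_inverse_Ident iso_def)

lemma inv_ar_Ident [simp]: "A \<in> Ob C \<Longrightarrow> inv_ar C (Ident C A) = Ident C A"
  by (rule inv_ar_eqI[OF is_inverse_Ident])

lemma is_inverse_Comp:
  assumes "is_inverse C f f'" "is_inverse C g g'" "Cod C f = Dom C g"
  shows "is_inverse C (g \<cdot>\<^bsub>C\<^esub> f) (f' \<cdot>\<^bsub>C\<^esub> g')"
proof -
  have d: "f \<in> Ar C" "f' \<in> Ar C" "Dom C f' = Cod C f" "Cod C f' = Dom C f"
      and e: "f' \<cdot>\<^bsub>C\<^esub> f = Ident C (Dom C f)" "f \<cdot>\<^bsub>C\<^esub> f' = Ident C (Cod C f)" if "is_inverse C f f'" for f f'
    using that unfolding is_inverse_def in_hom_iff by blast+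
  note [simp] = d[OF assms(1)] d[OF assms(2)] assms(3)
  show ?thesis
    using e[OF assms(1)] e[OF assms(2)] reassoc[OF e(2)[OF assms(1)], of g'] reassoc[OF e(1)[OF assms(2)], of f]
    by (simp add: is_inverse_def)
qed

lemma iso_Comp [intro]: "\<lbrakk>iso C f; iso C g; Cod C f = Dom C g\<rbrakk> \<Longrightarrow> iso C (g \<cdot>\<^bsub>C\<^esub> f)"
  unfolding iso_def using is_inverse_Comp by blast

lemma iso_cancel:
  "\<lbrakk>iso C f; f \<cdot>\<^bsub>C\<^esub> g = f \<cdot>\<^bsub>C\<^esub> h; g \<in> Ar C; h \<in> Ar C; Cod C g = Dom C f; Cod C h = Dom C f\<rbrakk> \<Longrightarrow> g = h"
  by (metis inv_ar_Comp_assoc)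

end

context is_functor
begin

lemma onO_Ob [simp]: "A \<in> Ob C \<Longrightarrow> onO F A \<in> Ob D"
  using onO_ext by auto

lemma onA_Ar [simp]: "f \<in> Ar C \<Longrightarrow> onA F f \<in> Ar D"
  and Dom_onA [simp]: "f \<in> Ar C \<Longrightarrow> Dom D (onA F f) = onO F (Dom C f)"
  and Cod_onA [simp]: "f \<in> Ar C \<Longrightarrow> Cod D (onA F f) = onO F (Cod C f)"
  using onA_hom[of f "Dom C f" "Cod C f"] by auto

declare onA_Ident [simp] is_functor_axioms [simp]

lemma onA_comp [simp]:
  "\<lbrakk>f \<in> Ar C; g \<in> Ar C; Cod C f = Dom C g\<rbrakk> \<Longrightarrow> onA F (g \<cdot>\<^bsub>C\<^esub> f) = onA F g \<cdot>\<^bsub>D\<^esub> onA F f"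
  using onA_Comp[of f "Dom C f" "Dom C g" g "Cod C g"] by auto

lemma onA_inverse: "is_inverse C f g \<Longrightarrow> is_inverse D (onA F f) (onA F g)"
  by (auto simp: is_inverse_def simp flip: onA_comp)

lemma onA_iso [simp]: "iso C f \<Longrightarrow> iso D (onA F f)"
  unfolding iso_def using onA_inverse by blast

end

context nat_trans
begin

declare nat_trans_axioms [simp]

lemma nt_Ar [simp]: "A \<in> Ob C \<Longrightarrow> \<tau> A \<in> Ar D"
  and Dom_nt [simp]: "A \<in> Ob C \<Longrightarrow> Dom D (\<tau> A) = onO F A"
  and Cod_nt [simp]: "A \<in> Ob C \<Longrightarrow> Cod D (\<tau> A) = onO G A"
  using nt_hom by auto

lemma natural: "\<lbrakk>f \<in> Ar C; Cod C f = B\<rbrakk> \<Longrightarrow> \<tau> B \<cdot>\<^bsub>D\<^esub> onA F f = onA G f \<cdot>\<^bsub>D\<^esub> \<tau> (Dom C f)"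
  using nt_natural[of f "Dom C f" B] by simp

end

lemma is_functorI:
  assumes "category C" "category D"
    and "onO F \<in> extensional (Ob C)" "onA F \<in> extensional (Ar C)"
    and "\<And>A. A \<in> Ob C \<Longrightarrow> onO F A \<in> Ob D"
    and "\<And>f. f \<in> Ar C \<Longrightarrow> onA F f \<in> Ar D \<and> Dom D (onA F f) = onO F (Dom C f) \<and> Cod D (onA F f) = onO F (Cod C f)"
    and "\<And>A. A \<in> Ob C \<Longrightarrow> onA F (Ident C A) = Ident D (onO F A)"
    and "\<And>f g. \<lbrakk>f \<in> Ar C; g \<in> Ar C; Cod C f = Dom C g\<rbrakk> \<Longrightarrow> onA F (g \<cdot>\<^bsub>C\<^esub> f) = onA F g \<cdot>\<^bsub>D\<^esub> onA F f"
  shows "is_functor C D F"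
  using assms by (auto simp: is_functor_def is_functor_axioms_def PiE_iff)

lemma nat_transI:
  assumes "is_functor C D F" "is_functor C D G" "\<tau> \<in> extensional (Ob C)"
    and "\<And>A. A \<in> Ob C \<Longrightarrow> \<tau> A \<in> Ar D \<and> Dom D (\<tau> A) = onO F A \<and> Cod D (\<tau> A) = onO G A"
    and "\<And>f. f \<in> Ar C \<Longrightarrow> \<tau> (Cod C f) \<cdot>\<^bsub>D\<^esub> onA F f = onA G f \<cdot>\<^bsub>D\<^esub> \<tau> (Dom C f)"
  shows "nat_trans C D F G \<tau>"
  using assms by (auto simp: nat_trans_def nat_trans_axioms_def)

text \<open>Extensionality: the data are \<open>undefined\<close> off the domain, so agreement on
  objects and arrows is equality of the records. It allows strict equalities of functors to be
  proved pointwise.\<close>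

lemma fctr_eqI:
  assumes "is_functor C D F" "is_functor C D G"
    and "\<And>A. A \<in> Ob C \<Longrightarrow> onO F A = onO G A" "\<And>f. f \<in> Ar C \<Longrightarrow> onA F f = onA G f"
  shows "F = G"
proof -
  interpret F: is_functor C D F by fact
  interpret G: is_functor C D G by fact
  show ?thesis
    using F.onO_ext G.onO_ext F.onA_ext G.onA_ext assms(3,4)
    by (intro fctr.equality) (auto simp: PiE_iff intro: extensionalityI)
qed

lemma id_fct_simps [simp]:
  "A \<in> Ob C \<Longrightarrow> onO (id_fct C) A = A" "f \<in> Ar C \<Longrightarrow> onA (id_fct C) f = f"
  by (simp_all add: id_fct_def)

lemma comp_fct_simps [simp]:
  "A \<in> Ob C \<Longrightarrow> onO (comp_fct C G F) A = onO G (onO F A)"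
  "f \<in> Ar C \<Longrightarrow> onA (comp_fct C G F) f = onA G (onA F f)"
  by (simp_all add: comp_fct_def)

lemma fct_ext [simp]:
  "onO (id_fct C) \<in> extensional (Ob C)" "onA (id_fct C) \<in> extensional (Ar C)"
  "onO (comp_fct C G F) \<in> extensional (Ob C)" "onA (comp_fct C G F) \<in> extensional (Ar C)"
  by (simp_all add: id_fct_def comp_fct_def)

lemma nt_simps [simp]:
  "A \<in> Ob C \<Longrightarrow> id_nt C M F A = Ident M (onO F A)"
  "A \<in> Ob C \<Longrightarrow> vcomp_nt C D \<tau> \<sigma> A = \<tau> A \<cdot>\<^bsub>D\<^esub> \<sigma> A"
  "A \<in> Ob C \<Longrightarrow> hcomp_nt C E G F' \<beta> \<alpha> A = \<beta> (onO F' A) \<cdot>\<^bsub>E\<^esub> onA G (\<alpha> A)"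
  by (simp_all add: id_nt_def vcomp_nt_def hcomp_nt_def)

lemma nt_extensional [simp]:
  "id_nt C M F \<in> extensional (Ob C)" "vcomp_nt C D \<tau> \<sigma> \<in> extensional (Ob C)"
  "hcomp_nt C E G F' \<beta> \<alpha> \<in> extensional (Ob C)"
  by (simp_all add: id_nt_def vcomp_nt_def hcomp_nt_def)

lemma nt_eqI:
  assumes "\<sigma> \<in> extensional (Ob C)" "\<tau> \<in> extensional (Ob C)" "\<And>A. A \<in> Ob C \<Longrightarrow> \<sigma> A = \<tau> A"
  shows "\<sigma> = \<tau>"
  using assms by (rule extensionalityI)

lemma is_functor_id: "category C \<Longrightarrow> is_functor C C (id_fct C)"
proof -
  assume "category C"
  then interpret category C .
  show ?thesis by (rule is_functorI) (simp_all add: category_axioms)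
qed

lemma is_functor_comp:
  assumes "is_functor C D F" "is_functor D E G" shows "is_functor C E (comp_fct C G F)"
proof -
  interpret F: is_functor C D F by fact
  interpret G: is_functor D E G by fact
  show ?thesis by (rule is_functorI) (simp_all add: F.C.category_axioms G.D.category_axioms)
qed

lemma comp_fct_id_right: "is_functor C D F \<Longrightarrow> comp_fct C F (id_fct C) = F"
proof -
  assume F: "is_functor C D F"
  then interpret is_functor C D F .
  show ?thesis
    by (rule fctr_eqI[OF is_functor_comp[OF is_functor_id F] F]) (simp_all add: C.category_axioms)
qed

lemma comp_fct_id_left: "is_functor C D F \<Longrightarrow> comp_fct C (id_fct D) F = F"
proof -
  assume F: "is_functor C D F"
  then interpret is_functor C D F .
  show ?thesis
    by (rule fctr_eqI[OF is_functor_comp[OF F is_functor_id] F]) (simp_all add: D.category_axioms)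
qed

lemma comp_fct_assoc:
  assumes "is_functor C D F"
  shows "comp_fct C (comp_fct D H G) F = comp_fct C H (comp_fct C G F)"
proof -
  interpret is_functor C D F by fact
  show ?thesis
    by (intro fctr.equality) (auto simp: comp_fct_def fun_eq_iff)
qed

lemma nat_trans_id: "is_functor C D F \<Longrightarrow> nat_trans C D F F (id_nt C D F)"
proof -
  assume F: "is_functor C D F"
  then interpret is_functor C D F .
  show ?thesis by (rule nat_transI[OF F F]) simp_all
qed

lemma nat_trans_vcomp:
  assumes "nat_trans C D F G \<sigma>" "nat_trans C D G H \<tau>"
  shows "nat_trans C D F H (vcomp_nt C D \<tau> \<sigma>)"
proof -
  interpret \<sigma>: nat_trans C D F G \<sigma> by fact
  interpret \<tau>: nat_trans C D G H \<tau> by fact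
  show ?thesis
    by (rule nat_transI) (simp_all add: \<sigma>.F.is_functor_axioms \<tau>.G.is_functor_axioms \<sigma>.natural
      reassoc[OF \<tau>.natural])
qed

lemma nat_trans_hcomp:
  assumes "nat_trans C D F F' \<sigma>" "nat_trans D E G G' \<tau>"
  shows "nat_trans C E (comp_fct C G F) (comp_fct C G' F') (hcomp_nt C E G F' \<tau> \<sigma>)"
proof -
  interpret \<sigma>: nat_trans C D F F' \<sigma> by fact
  interpret \<tau>: nat_trans D E G G' \<tau> by fact
  have *: "onA G' (\<sigma> (Cod C f)) \<cdot>\<^bsub>E\<^esub> onA G' (onA F f) = onA G' (onA F' f) \<cdot>\<^bsub>E\<^esub> onA G' (\<sigma> (Dom C f))"
    if "f \<in> Ar C" for f
    using \<sigma>.natural[of f] that by (simp flip: \<tau>.G.onA_comp)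
  show ?thesis
    by (rule nat_transI[OF is_functor_comp is_functor_comp, OF \<sigma>.F.is_functor_axioms \<tau>.F.is_functor_axioms
          \<sigma>.G.is_functor_axioms \<tau>.G.is_functor_axioms])
      (simp_all add: reassoc[OF \<tau>.natural] reassoc[OF *] \<tau>.natural)
qed

lemma vcomp_nt_id_right:
  assumes "nat_trans C D F G \<sigma>" shows "vcomp_nt C D \<sigma> (id_nt C D F) = \<sigma>"
proof -
  interpret nat_trans C D F G \<sigma> by fact
  show ?thesis by (rule nt_eqI[of _ C]) (simp_all add: nt_ext)
qed

lemma vcomp_nt_id_left:
  assumes "nat_trans C D F G \<sigma>" shows "vcomp_nt C D (id_nt C D G) \<sigma> = \<sigma>"
proof -
  interpret nat_trans C D F G \<sigma> by fact
  show ?thesis by (rule nt_eqI[of _ C]) (simp_all add: nt_ext)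
qed

lemma vcomp_nt_assoc:
  assumes "nat_trans C D F G \<sigma>" "nat_trans C D G H \<tau>" "nat_trans C D H K \<rho>"
  shows "vcomp_nt C D (vcomp_nt C D \<rho> \<tau>) \<sigma> = vcomp_nt C D \<rho> (vcomp_nt C D \<tau> \<sigma>)"
proof -
  interpret \<sigma>: nat_trans C D F G \<sigma> by fact
  interpret \<tau>: nat_trans C D G H \<tau> by fact
  interpret \<rho>: nat_trans C D H K \<rho> by fact
  show ?thesis by (rule nt_eqI[of _ C]) simp_all
qed

lemma hcomp_nt_id_right:
  assumes "nat_trans C D F G \<sigma>"
  shows "hcomp_nt C D F (id_fct C) \<sigma> (id_nt C C (id_fct C)) = \<sigma>"
proof -
  interpret nat_trans C D F G \<sigma> by fact
  show ?thesis by (rule nt_eqI[of _ C]) (simp_all add: nt_ext)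
qed

lemma hcomp_nt_id_left:
  assumes "nat_trans C D F G \<sigma>"
  shows "hcomp_nt C D (id_fct D) G (id_nt D D (id_fct D)) \<sigma> = \<sigma>"
proof -
  interpret nat_trans C D F G \<sigma> by fact
  show ?thesis by (rule nt_eqI[of _ C]) (simp_all add: nt_ext)
qed

lemma hcomp_nt_assoc:
  assumes "nat_trans C D F F' \<sigma>" "nat_trans D E G G' \<tau>" "nat_trans E M H H' \<rho>"
  shows "hcomp_nt C M (comp_fct D H G) F' (hcomp_nt D M H G' \<rho> \<tau>) \<sigma>
    = hcomp_nt C M H (comp_fct C G' F') \<rho> (hcomp_nt C E G F' \<tau> \<sigma>)"
proof -
  interpret \<sigma>: nat_trans C D F F' \<sigma> by fact
  interpret \<tau>: nat_trans D E G G' \<tau> by fact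
  interpret \<rho>: nat_trans E M H H' \<rho> by fact
  show ?thesis by (rule nt_eqI[of _ C]) simp_all
qed

lemma hcomp_nt_id_id:
  assumes "is_functor C D F" "is_functor D E G"
  shows "hcomp_nt C E G F (id_nt D E G) (id_nt C D F) = id_nt C E (comp_fct C G F)"
proof -
  interpret F: is_functor C D F by fact
  interpret G: is_functor D E G by fact
  show ?thesis by (rule nt_eqI[of _ C]) simp_all
qed

lemma hcomp_nt_interchange:
  assumes "nat_trans C D F F' \<sigma>" "nat_trans C D F' F'' \<sigma>'" "nat_trans D E G G' \<tau>" "nat_trans D E G' G'' \<tau>'"
  shows "hcomp_nt C E G F'' (vcomp_nt D E \<tau>' \<tau>) (vcomp_nt C D \<sigma>' \<sigma>)
    = vcomp_nt C E (hcomp_nt C E G' F'' \<tau>' \<sigma>') (hcomp_nt C E G F' \<tau> \<sigma>)"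
proof -
  interpret \<sigma>: nat_trans C D F F' \<sigma> by fact
  interpret \<sigma>': nat_trans C D F' F'' \<sigma>' by fact
  interpret \<tau>: nat_trans D E G G' \<tau> by fact
  interpret \<tau>': nat_trans D E G' G'' \<tau>' by fact
  show ?thesis by (rule nt_eqI[of _ C]) (simp_all add: reassoc[OF \<tau>.natural])
qed

lemma is_functor_categories: "is_functor C D F \<Longrightarrow> category C" "is_functor C D F \<Longrightarrow> category D"
  by (simp_all add: is_functor_def)

section \<open>The base level: the 2-categories of comonads and of adjunctions, and the calculus of
  mates\<close>

section \<open>The 2-category of comonads\<close>

locale comonad =
  K: is_functor "cmC T" "cmC T" "cmK T" +
  eps: nat_trans "cmC T" "cmC T" "cmK T" "id_fct (cmC T)" "cmeps T" +
  nu: nat_trans "cmC T" "cmC T" "cmK T" "comp_fct (cmC T) (cmK T) (cmK T)" "cmnu T"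
  for T :: "('o, 'a) comonad" +
  assumes counit_left [simp]: "A \<in> Ob (cmC T)
      \<Longrightarrow> cmeps T (onO (cmK T) A) \<cdot>\<^bsub>cmC T\<^esub> cmnu T A = Ident (cmC T) (onO (cmK T) A)"
    and counit_right [simp]: "A \<in> Ob (cmC T)
      \<Longrightarrow> onA (cmK T) (cmeps T A) \<cdot>\<^bsub>cmC T\<^esub> cmnu T A = Ident (cmC T) (onO (cmK T) A)"
    and coassoc: "A \<in> Ob (cmC T)
      \<Longrightarrow> onA (cmK T) (cmnu T A) \<cdot>\<^bsub>cmC T\<^esub> cmnu T A = cmnu T (onO (cmK T) A) \<cdot>\<^bsub>cmC T\<^esub> cmnu T A"
begin

lemma eps_natural: "\<lbrakk>f \<in> Ar (cmC T); Cod (cmC T) f = B\<rbrakk>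
    \<Longrightarrow> cmeps T B \<cdot>\<^bsub>cmC T\<^esub> onA (cmK T) f = f \<cdot>\<^bsub>cmC T\<^esub> cmeps T (Dom (cmC T) f)"
  using eps.natural[of f B] by simp

lemma nu_natural: "\<lbrakk>f \<in> Ar (cmC T); Cod (cmC T) f = B\<rbrakk>
    \<Longrightarrow> cmnu T B \<cdot>\<^bsub>cmC T\<^esub> onA (cmK T) f = onA (cmK T) (onA (cmK T) f) \<cdot>\<^bsub>cmC T\<^esub> cmnu T (Dom (cmC T) f)"
  using nu.natural[of f B] by simp

end

lemma is_comonad_iff: "is_comonad T \<longleftrightarrow> comonad T"
proof
  assume T: "is_comonad T"
  then interpret eps: nat_trans "cmC T" "cmC T" "cmK T" "id_fct (cmC T)" "cmeps T"
    by (simp add: is_comonad_def Let_def)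
  interpret nu: nat_trans "cmC T" "cmC T" "cmK T" "comp_fct (cmC T) (cmK T) (cmK T)" "cmnu T"
    using T by (simp add: is_comonad_def Let_def)
  show "comonad T" by unfold_locales (use T in \<open>simp_all add: is_comonad_def Let_def\<close>)
next
  assume "comonad T"
  then interpret comonad T .
  show "is_comonad T"
    by (simp add: is_comonad_def Let_def eps.nat_trans_axioms nu.nat_trans_axioms coassoc)
qed

text \<open>A 1-cell of \<open>Cmd\<close> with source, target and components as separate
  parameters, so that composites and images under other constructions can be interpreted before a
  record exists for them.\<close>

locale cmd_arrow =
  S: comonad T + T: comonad T' + H: is_functor "cmC T" "cmC T'" H +
  th: nat_trans "cmC T" "cmC T'" "comp_fct (cmC T) H (cmK T)" "comp_fct (cmC T) (cmK T') H" \<theta>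
  for T T' :: "('o, 'a) comonad" and H \<theta> +
  assumes theta_eps: "A \<in> Ob (cmC T) \<Longrightarrow> cmeps T' (onO H A) \<cdot>\<^bsub>cmC T'\<^esub> \<theta> A = onA H (cmeps T A)"
    and theta_nu: "A \<in> Ob (cmC T) \<Longrightarrow> cmnu T' (onO H A) \<cdot>\<^bsub>cmC T'\<^esub> \<theta> A
        = onA (cmK T') (\<theta> A) \<cdot>\<^bsub>cmC T'\<^esub> \<theta> (onO (cmK T) A) \<cdot>\<^bsub>cmC T'\<^esub> onA H (cmnu T A)"
begin

lemma theta_simps [simp]:
  "A \<in> Ob (cmC T) \<Longrightarrow> Dom (cmC T') (\<theta> A) = onO H (onO (cmK T) A)"
  "A \<in> Ob (cmC T) \<Longrightarrow> Cod (cmC T') (\<theta> A) = onO (cmK T') (onO H A)"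
  by simp_all

lemma theta_natural: "\<lbrakk>f \<in> Ar (cmC T); Cod (cmC T) f = B\<rbrakk>
    \<Longrightarrow> \<theta> B \<cdot>\<^bsub>cmC T'\<^esub> onA H (onA (cmK T) f) = onA (cmK T') (onA H f) \<cdot>\<^bsub>cmC T'\<^esub> \<theta> (Dom (cmC T) f)"
  using th.natural[of f B] by simp

end

lemma is_cmd_1cell_iff: "is_cmd_1cell f \<longleftrightarrow> cmd_arrow (Src f) (Tgt f) (cmH f) (cmth f)"
  by (auto simp: is_cmd_1cell_def Let_def is_comonad_iff cmd_arrow_def cmd_arrow_axioms_def)

lemma cmd_arrow_id: "comonad T \<Longrightarrow> cmd_arrow T T (id_fct (cmC T)) (id_nt (cmC T) (cmC T) (cmK T))"
proof -
  assume T: "comonad T"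
  then interpret comonad T .
  have "nat_trans (cmC T) (cmC T) (comp_fct (cmC T) (id_fct (cmC T)) (cmK T))
      (comp_fct (cmC T) (cmK T) (id_fct (cmC T))) (id_nt (cmC T) (cmC T) (cmK T))"
    by (simp add: comp_fct_id_left[OF K.is_functor_axioms] comp_fct_id_right[OF K.is_functor_axioms] nat_trans_id K.is_functor_axioms)
  then show ?thesis
    by (simp add: cmd_arrow_def cmd_arrow_axioms_def T is_functor_id K.C.category_axioms)
qed

text \<open>The laws paste: \<open>H'\<close> applied to the law of \<open>\<theta>\<close> meets
  the law of \<open>\<theta>'\<close> at \<open>H A\<close>, and naturality of
  \<open>\<theta>'\<close> at the arrow \<open>\<theta> A\<close> brings the factors into the
  required order.\<close>

lemma cmd_arrow_comp:
  assumes "cmd_arrow T T' H \<theta>" "cmd_arrow T' T'' H' \<theta>'"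
  shows "cmd_arrow T T'' (comp_fct (cmC T) H' H)
    (\<lambda>A \<in> Ob (cmC T). \<theta>' (onO H A) \<cdot>\<^bsub>cmC T''\<^esub> onA H' (\<theta> A))"
proof -
  interpret F: cmd_arrow T T' H \<theta> by fact
  interpret G: cmd_arrow T' T'' H' \<theta>' by fact
  have nat: "onA H' (\<theta> (Cod (cmC T) f)) \<cdot>\<^bsub>cmC T''\<^esub> onA H' (onA H (onA (cmK T) f))
      = onA H' (onA (cmK T') (onA H f)) \<cdot>\<^bsub>cmC T''\<^esub> onA H' (\<theta> (Dom (cmC T) f))" if "f \<in> Ar (cmC T)" for f
    using F.theta_natural[of f] that by (simp flip: G.H.onA_comp)
  have nat': "\<theta>' (onO H (Cod (cmC T) f)) \<cdot>\<^bsub>cmC T''\<^esub> onA H' (onA (cmK T') (onA H f))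
      = onA (cmK T'') (onA H' (onA H f)) \<cdot>\<^bsub>cmC T''\<^esub> \<theta>' (onO H (Dom (cmC T) f))" if "f \<in> Ar (cmC T)" for f
    using G.theta_natural[of "onA H f"] that by simp
  have nt: "nat_trans (cmC T) (cmC T'') (comp_fct (cmC T) (comp_fct (cmC T) H' H) (cmK T))
      (comp_fct (cmC T) (cmK T'') (comp_fct (cmC T) H' H)) (\<lambda>A \<in> Ob (cmC T). \<theta>' (onO H A) \<cdot>\<^bsub>cmC T''\<^esub> onA H' (\<theta> A))"
    by (rule nat_transI[OF is_functor_comp[OF F.S.K.is_functor_axioms is_functor_comp[OF F.H.is_functor_axioms G.H.is_functor_axioms]]
          is_functor_comp[OF is_functor_comp[OF F.H.is_functor_axioms G.H.is_functor_axioms] G.T.K.is_functor_axioms]])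
      (simp_all add: nat reassoc[OF nat'])
  have eps: "cmeps T'' (onO H' (onO H A)) \<cdot>\<^bsub>cmC T''\<^esub> (\<theta>' (onO H A) \<cdot>\<^bsub>cmC T''\<^esub> onA H' (\<theta> A)) = onA H' (onA H (cmeps T A))"
    if "A \<in> Ob (cmC T)" for A
    using that reassoc[OF G.theta_eps, of "onO H A"] F.theta_eps[of A] by (simp flip: G.H.onA_comp)
  have nu: "cmnu T'' (onO H' (onO H A)) \<cdot>\<^bsub>cmC T''\<^esub> (\<theta>' (onO H A) \<cdot>\<^bsub>cmC T''\<^esub> onA H' (\<theta> A))
    = onA (cmK T'') (\<theta>' (onO H A) \<cdot>\<^bsub>cmC T''\<^esub> onA H' (\<theta> A)) \<cdot>\<^bsub>cmC T''\<^esub>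
      (\<theta>' (onO H (onO (cmK T) A)) \<cdot>\<^bsub>cmC T''\<^esub> onA H' (\<theta> (onO (cmK T) A))) \<cdot>\<^bsub>cmC T''\<^esub> onA H' (onA H (cmnu T A))"
    if A: "A \<in> Ob (cmC T)" for A
  proof -
    have 1: "onA H' (cmnu T' (onO H A)) \<cdot>\<^bsub>cmC T''\<^esub> onA H' (\<theta> A)
        = onA H' (onA (cmK T') (\<theta> A)) \<cdot>\<^bsub>cmC T''\<^esub> onA H' (\<theta> (onO (cmK T) A)) \<cdot>\<^bsub>cmC T''\<^esub> onA H' (onA H (cmnu T A))"
      using F.theta_nu[OF A] A by (simp flip: G.H.onA_comp)
    have 2: "\<theta>' (onO (cmK T') (onO H A)) \<cdot>\<^bsub>cmC T''\<^esub> onA H' (onA (cmK T') (\<theta> A))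
        = onA (cmK T'') (onA H' (\<theta> A)) \<cdot>\<^bsub>cmC T''\<^esub> \<theta>' (onO H (onO (cmK T) A))"
      using G.theta_natural[of "\<theta> A"] A by simp
    show ?thesis
      using A reassoc[OF G.theta_nu, of "onO H A"] by (simp add: 1 reassoc[OF 2])
  qed
  show ?thesis
    by (intro cmd_arrow.intro cmd_arrow_axioms.intro F.S.comonad_axioms G.T.comonad_axioms nt is_functor_comp[OF F.H.is_functor_axioms G.H.is_functor_axioms])
      (use eps nu in simp_all)
qed

definition cmd_2arrow where
  "cmd_2arrow T T' H \<theta> H' \<theta>' \<phi> \<longleftrightarrow> cmd_arrow T T' H \<theta> \<and> cmd_arrow T T' H' \<theta>' \<and>
    nat_trans (cmC T) (cmC T') H H' \<phi> \<and>
    (\<forall>A \<in> Ob (cmC T). onA (cmK T') (\<phi> A) \<cdot>\<^bsub>cmC T'\<^esub> \<theta> A = \<theta>' A \<cdot>\<^bsub>cmC T'\<^esub> \<phi> (onO (cmK T) A))"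

lemma is_cmd_2cell_iff: "is_cmd_2cell \<alpha> \<longleftrightarrow> Src (Src \<alpha>) = Src (Tgt \<alpha>) \<and> Tgt (Src \<alpha>) = Tgt (Tgt \<alpha>) \<and>
    cmd_2arrow (Src (Src \<alpha>)) (Tgt (Src \<alpha>)) (cmH (Src \<alpha>)) (cmth (Src \<alpha>)) (cmH (Tgt \<alpha>)) (cmth (Tgt \<alpha>)) (cmphi \<alpha>)"
  by (auto simp: is_cmd_2cell_def is_cmd_1cell_iff cmd_2arrow_def Let_def)

lemma cmd_2arrow_id: "cmd_arrow T T' H \<theta> \<Longrightarrow> cmd_2arrow T T' H \<theta> H \<theta> (id_nt (cmC T) (cmC T') H)"
proof -
  assume H: "cmd_arrow T T' H \<theta>"
  then interpret cmd_arrow T T' H \<theta> .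
  show ?thesis using H by (simp add: cmd_2arrow_def nat_trans_id H.is_functor_axioms)
qed

lemma cmd_2arrow_vcomp:
  assumes "cmd_2arrow T T' H \<theta> H' \<theta>' \<phi>" "cmd_2arrow T T' H' \<theta>' H'' \<theta>'' \<psi>"
  shows "cmd_2arrow T T' H \<theta> H'' \<theta>'' (vcomp_nt (cmC T) (cmC T') \<psi> \<phi>)"
proof -
  interpret H: cmd_arrow T T' H \<theta> using assms by (simp add: cmd_2arrow_def)
  interpret H': cmd_arrow T T' H' \<theta>' using assms by (simp add: cmd_2arrow_def)
  interpret H'': cmd_arrow T T' H'' \<theta>'' using assms by (simp add: cmd_2arrow_def)
  interpret \<phi>: nat_trans "cmC T" "cmC T'" H H' \<phi> using assms by (simp add: cmd_2arrow_def)
  interpret \<psi>: nat_trans "cmC T" "cmC T'" H' H'' \<psi> using assms by (simp add: cmd_2arrow_def)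
  have e: "onA (cmK T') (\<phi> A) \<cdot>\<^bsub>cmC T'\<^esub> \<theta> A = \<theta>' A \<cdot>\<^bsub>cmC T'\<^esub> \<phi> (onO (cmK T) A)"
    "onA (cmK T') (\<psi> A) \<cdot>\<^bsub>cmC T'\<^esub> \<theta>' A = \<theta>'' A \<cdot>\<^bsub>cmC T'\<^esub> \<psi> (onO (cmK T) A)" if "A \<in> Ob (cmC T)" for A
    using assms that by (simp_all add: cmd_2arrow_def)
  show ?thesis
    by (simp add: cmd_2arrow_def H.cmd_arrow_axioms H''.cmd_arrow_axioms e reassoc[OF e(2)]
        nat_trans_vcomp[OF \<phi>.nat_trans_axioms \<psi>.nat_trans_axioms])
qed

lemma cmd_2arrow_hcomp:
  assumes "cmd_2arrow T T' H \<theta> H' \<theta>' \<phi>" "cmd_2arrow T' T'' M \<chi> M' \<chi>' \<psi>"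
  shows "cmd_2arrow T T'' (comp_fct (cmC T) M H) (\<lambda>A \<in> Ob (cmC T). \<chi> (onO H A) \<cdot>\<^bsub>cmC T''\<^esub> onA M (\<theta> A))
    (comp_fct (cmC T) M' H') (\<lambda>A \<in> Ob (cmC T). \<chi>' (onO H' A) \<cdot>\<^bsub>cmC T''\<^esub> onA M' (\<theta>' A))
    (hcomp_nt (cmC T) (cmC T'') M H' \<psi> \<phi>)"
proof -
  interpret H: cmd_arrow T T' H \<theta> using assms by (simp add: cmd_2arrow_def)
  interpret H': cmd_arrow T T' H' \<theta>' using assms by (simp add: cmd_2arrow_def)
  interpret M: cmd_arrow T' T'' M \<chi> using assms by (simp add: cmd_2arrow_def)
  interpret M': cmd_arrow T' T'' M' \<chi>' using assms by (simp add: cmd_2arrow_def)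
  interpret \<phi>: nat_trans "cmC T" "cmC T'" H H' \<phi> using assms by (simp add: cmd_2arrow_def)
  interpret \<psi>: nat_trans "cmC T'" "cmC T''" M M' \<psi> using assms by (simp add: cmd_2arrow_def)
  have e1: "onA (cmK T'') (\<psi> B) \<cdot>\<^bsub>cmC T''\<^esub> \<chi> B = \<chi>' B \<cdot>\<^bsub>cmC T''\<^esub> \<psi> (onO (cmK T') B)" if "B \<in> Ob (cmC T')" for B
    using assms that by (simp add: cmd_2arrow_def)
  have e: "onA M (onA (cmK T') (\<phi> A)) \<cdot>\<^bsub>cmC T''\<^esub> onA M (\<theta> A) = onA M (\<theta>' A) \<cdot>\<^bsub>cmC T''\<^esub> onA M (\<phi> (onO (cmK T) A))"
    if "A \<in> Ob (cmC T)" for A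
    using assms that by (simp add: cmd_2arrow_def flip: M.H.onA_comp)
  have n: "\<chi> (onO H' A) \<cdot>\<^bsub>cmC T''\<^esub> onA M (onA (cmK T') (\<phi> A)) = onA (cmK T'') (onA M (\<phi> A)) \<cdot>\<^bsub>cmC T''\<^esub> \<chi> (onO H A)"
    if "A \<in> Ob (cmC T)" for A
    using M.theta_natural[of "\<phi> A"] that by simp
  have n2: "\<psi> (onO (cmK T') (onO H' A)) \<cdot>\<^bsub>cmC T''\<^esub> onA M (\<theta>' A) = onA M' (\<theta>' A) \<cdot>\<^bsub>cmC T''\<^esub> \<psi> (onO H' (onO (cmK T) A))"
    if "A \<in> Ob (cmC T)" for A
    using \<psi>.natural[of "\<theta>' A"] that by simp
  have "onA (cmK T'') (\<psi> (onO H' A) \<cdot>\<^bsub>cmC T''\<^esub> onA M (\<phi> A)) \<cdot>\<^bsub>cmC T''\<^esub> \<chi> (onO H A) \<cdot>\<^bsub>cmC T''\<^esub> onA M (\<theta> A)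
    = (\<chi>' (onO H' A) \<cdot>\<^bsub>cmC T''\<^esub> onA M' (\<theta>' A)) \<cdot>\<^bsub>cmC T''\<^esub> \<psi> (onO H' (onO (cmK T) A)) \<cdot>\<^bsub>cmC T''\<^esub> onA M (\<phi> (onO (cmK T) A))"
    if A: "A \<in> Ob (cmC T)" for A
  proof -
    have "onA (cmK T'') (\<psi> (onO H' A) \<cdot>\<^bsub>cmC T''\<^esub> onA M (\<phi> A)) \<cdot>\<^bsub>cmC T''\<^esub> \<chi> (onO H A) \<cdot>\<^bsub>cmC T''\<^esub> onA M (\<theta> A)
      = onA (cmK T'') (\<psi> (onO H' A)) \<cdot>\<^bsub>cmC T''\<^esub> \<chi> (onO H' A) \<cdot>\<^bsub>cmC T''\<^esub> onA M (onA (cmK T') (\<phi> A)) \<cdot>\<^bsub>cmC T''\<^esub> onA M (\<theta> A)"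
      using A by (simp add: reassoc[OF n])
    also have "\<dots> = \<chi>' (onO H' A) \<cdot>\<^bsub>cmC T''\<^esub> \<psi> (onO (cmK T') (onO H' A)) \<cdot>\<^bsub>cmC T''\<^esub> onA M (\<theta>' A) \<cdot>\<^bsub>cmC T''\<^esub> onA M (\<phi> (onO (cmK T) A))"
      using A by (simp add: e reassoc[OF e1])
    also have "\<dots> = (\<chi>' (onO H' A) \<cdot>\<^bsub>cmC T''\<^esub> onA M' (\<theta>' A)) \<cdot>\<^bsub>cmC T''\<^esub> \<psi> (onO H' (onO (cmK T) A)) \<cdot>\<^bsub>cmC T''\<^esub> onA M (\<phi> (onO (cmK T) A))"
      using A by (simp add: reassoc[OF n2])
    finally show ?thesis .
  qed
  then show ?thesis
    by (simp add: cmd_2arrow_def cmd_arrow_comp[OF H.cmd_arrow_axioms M.cmd_arrow_axioms] cmd_arrow_comp[OF H'.cmd_arrow_axioms M'.cmd_arrow_axioms]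
        nat_trans_hcomp[OF \<phi>.nat_trans_axioms \<psi>.nat_trans_axioms])
qed

lemma Cmd_simps [simp]:
  "Zero Cmd = Collect is_comonad" "One Cmd = Collect is_cmd_1cell" "Two Cmd = Collect is_cmd_2cell"
  "src1 Cmd = Src" "tgt1 Cmd = Tgt" "src2 Cmd = Src" "tgt2 Cmd = Tgt"
  "id1 Cmd = cmd_id1" "id2 Cmd = cmd_id2" "comp1 Cmd = cmd_comp1" "vcomp Cmd = cmd_vcomp" "hcomp Cmd = cmd_hcomp"
  by (simp_all add: Cmd_def)

lemma hom1_Cmd: "f \<in> hom1 Cmd x y \<longleftrightarrow> cmd_arrow x y (cmH f) (cmth f) \<and> Src f = x \<and> Tgt f = y"
  by (auto simp: hom1_def is_cmd_1cell_iff)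

lemma hom2_Cmd: "\<alpha> \<in> hom2 Cmd f g \<longleftrightarrow> Src \<alpha> = f \<and> Tgt \<alpha> = g \<and> Src f = Src g \<and> Tgt f = Tgt g \<and>
    cmd_2arrow (Src f) (Tgt f) (cmH f) (cmth f) (cmH g) (cmth g) (cmphi \<alpha>)"
  by (auto simp: hom2_def is_cmd_2cell_iff)

lemma cmd_2arrowD:
  assumes "cmd_2arrow T T' H \<theta> H' \<theta>' \<phi>"
  shows "cmd_arrow T T' H \<theta>" "cmd_arrow T T' H' \<theta>'" "nat_trans (cmC T) (cmC T') H H' \<phi>"
  using assms by (simp_all add: cmd_2arrow_def)

lemma cmd_arrowD:
  assumes "cmd_arrow T T' H \<theta>"
  shows "comonad T" "comonad T'" "is_functor (cmC T) (cmC T') H" "\<theta> \<in> extensional (Ob (cmC T))"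
  using assms by (simp_all add: cmd_arrow_def nat_trans_def nat_trans_axioms_def)

lemma cmd_comp1_id1:
  assumes "f \<in> hom1 Cmd x y" shows "cmd_comp1 f (cmd_id1 x) = f" "cmd_comp1 (cmd_id1 y) f = f"
proof -
  interpret cmd_arrow x y "cmH f" "cmth f" using assms by (simp add: hom1_Cmd)
  note [simp] = comp_fct_id_right[OF H.is_functor_axioms] comp_fct_id_left[OF H.is_functor_axioms]
  have 1: "(\<lambda>A \<in> Ob (cmC x). cmth f (onO (id_fct (cmC x)) A) \<cdot>\<^bsub>cmC y\<^esub> onA (cmH f) (id_nt (cmC x) (cmC x) (cmK x) A)) = cmth f"
    by (rule nt_eqI[of _ "cmC x"]) (simp_all add: th.nt_ext)
  have 2: "(\<lambda>A \<in> Ob (cmC x). id_nt (cmC y) (cmC y) (cmK y) (onO (cmH f) A) \<cdot>\<^bsub>cmC y\<^esub> onA (id_fct (cmC y)) (cmth f A)) = cmth f"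
    by (rule nt_eqI[of _ "cmC x"]) (simp_all add: th.nt_ext)
  show "cmd_comp1 f (cmd_id1 x) = f" "cmd_comp1 (cmd_id1 y) f = f"
    using assms by (auto simp: hom1_Cmd cmd_comp1_def cmd_id1_def 1 2)
qed

lemma cmd_comp1_assoc:
  assumes "f \<in> hom1 Cmd x y" "g \<in> hom1 Cmd y z" "h \<in> hom1 Cmd z w"
  shows "cmd_comp1 (cmd_comp1 h g) f = cmd_comp1 h (cmd_comp1 g f)"
proof -
  interpret f: cmd_arrow x y "cmH f" "cmth f" using assms by (simp add: hom1_Cmd)
  interpret g: cmd_arrow y z "cmH g" "cmth g" using assms by (simp add: hom1_Cmd)
  interpret h: cmd_arrow z w "cmH h" "cmth h" using assms by (simp add: hom1_Cmd)
  have [simp]: "Src f = x" "Src g = y" "Src h = z" "Tgt f = y" "Tgt g = z" "Tgt h = w"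
    using assms by (simp_all add: hom1_Cmd)
  show ?thesis
    by (simp add: cmd_comp1_def comp_fct_assoc[OF f.H.is_functor_axioms] cong: restrict_cong)
qed

lemma cmd_id1_hom: "comonad x \<Longrightarrow> cmd_id1 x \<in> hom1 Cmd x x"
  by (simp add: hom1_Cmd cmd_id1_def cmd_arrow_id)

lemma cmd_comp1_hom: "\<lbrakk>f \<in> hom1 Cmd x y; g \<in> hom1 Cmd y z\<rbrakk> \<Longrightarrow> cmd_comp1 g f \<in> hom1 Cmd x z"
  by (auto simp: hom1_Cmd cmd_comp1_def intro: cmd_arrow_comp)

lemma cmd_id1_simps [simp]:
  "Src (cmd_id1 T) = T" "Tgt (cmd_id1 T) = T" "cmH (cmd_id1 T) = id_fct (cmC T)"
  by (simp_all add: cmd_id1_def)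

lemma cmd_comp1_simps [simp]:
  "Src (cmd_comp1 g f) = Src f" "Tgt (cmd_comp1 g f) = Tgt g" "cmH (cmd_comp1 g f) = comp_fct (cmC (Src f)) (cmH g) (cmH f)"
  by (simp_all add: cmd_comp1_def)

text \<open>A 2-cell record contains its boundary 1-cells. The unit and associativity laws of
  horizontal composition therefore include strict equality of composite 1-cells, on the source side
  and, once the target 1-cells are typed, on the target side.\<close>

lemma two_category_Cmd: "two_category Cmd"
proof (unfold_locales, goal_cases)
  case (7 x) then show ?case by (simp add: is_comonad_iff cmd_id1_hom)
next
  case (8 f) then show ?case by (auto simp: hom2_Cmd is_cmd_1cell_iff cmd_id2_def intro: cmd_2arrow_id)
next
  case (9 f x y g z) then show ?case by (simp add: cmd_comp1_hom)
next
  case (13 \<alpha> f g \<beta> h) then show ?case by (auto simp: hom2_Cmd cmd_vcomp_def intro: cmd_2arrow_vcomp)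
next
  case (14 \<alpha> f g) then show ?case
    by (auto simp: hom2_Cmd cmd_vcomp_def cmd_id2_def vcomp_nt_id_right[OF cmd_2arrowD(3)])
next
  case (15 \<alpha> f g) then show ?case
    by (auto simp: hom2_Cmd cmd_vcomp_def cmd_id2_def vcomp_nt_id_left[OF cmd_2arrowD(3)])
next
  case (16 \<alpha> f g \<beta> h \<gamma> k) then show ?case
    by (auto simp: hom2_Cmd cmd_vcomp_def dest!: cmd_2arrowD(3) intro: vcomp_nt_assoc)
next
  case (17 f x y g z \<alpha> f' \<beta> g') then show ?case
    by (auto simp: hom1_Cmd hom2_Cmd cmd_hcomp_def cmd_comp1_def intro: cmd_2arrow_hcomp)
next
  case (18 f x y \<alpha> f')
  then have "f' \<in> hom1 Cmd x y" by (auto simp: hom1_Cmd hom2_Cmd dest: cmd_2arrowD)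
  with 18 show ?case
    by (intro cmd_2cell.equality)
      (auto simp: cmd_comp1_id1 hom2_Cmd hom1_Cmd cmd_hcomp_def cmd_id2_def hcomp_nt_id_right[OF cmd_2arrowD(3)])
next
  case (19 f x y \<alpha> f')
  then have "f' \<in> hom1 Cmd x y" by (auto simp: hom1_Cmd hom2_Cmd dest: cmd_2arrowD)
  with 19 show ?case
    by (intro cmd_2cell.equality)
      (auto simp: cmd_comp1_id1 hom2_Cmd hom1_Cmd cmd_hcomp_def cmd_id2_def hcomp_nt_id_left[OF cmd_2arrowD(3)])
next
  case (20 f x y g z h w \<alpha> f' \<beta> g' \<gamma> h')
  then have "f' \<in> hom1 Cmd x y" "g' \<in> hom1 Cmd y z" "h' \<in> hom1 Cmd z w"
    by (auto simp: hom1_Cmd hom2_Cmd dest: cmd_2arrowD)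
  with 20 show ?case
    by (intro cmd_2cell.equality)
      (auto simp: cmd_comp1_assoc hom2_Cmd hom1_Cmd cmd_hcomp_def
        hcomp_nt_assoc[OF cmd_2arrowD(3) cmd_2arrowD(3) cmd_2arrowD(3)])
next
  case (21 f x y g z)
  then show ?case
    by (auto simp: hom1_Cmd cmd_hcomp_def cmd_comp1_def cmd_id2_def hcomp_nt_id_id[OF cmd_arrowD(3) cmd_arrowD(3)])
next
  case (22 f x y g z \<alpha> f' \<alpha>' f'' \<beta> g' \<beta>' g'')
  then show ?case
    by (auto simp: hom1_Cmd hom2_Cmd cmd_hcomp_def cmd_vcomp_def cmd_comp1_def
        hcomp_nt_interchange[OF cmd_2arrowD(3) cmd_2arrowD(3) cmd_2arrowD(3) cmd_2arrowD(3)])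
qed (auto simp: is_cmd_1cell_iff is_cmd_2cell_iff cmd_comp1_id1 cmd_comp1_assoc is_comonad_iff dest: cmd_arrowD cmd_2arrowD)

section \<open>The 2-categories of adjunctions\<close>

locale adjunction =
  L: is_functor "adD T" "adC T" "adL T" + R: is_functor "adC T" "adD T" "adR T" +
  eta: nat_trans "adD T" "adD T" "id_fct (adD T)" "comp_fct (adD T) (adR T) (adL T)" "adeta T" +
  eps: nat_trans "adC T" "adC T" "comp_fct (adC T) (adL T) (adR T)" "id_fct (adC T)" "adeps T"
  for T :: "('o, 'a, 'd, 'e) adj" +
  assumes triangle_L [simp]: "A \<in> Ob (adD T)
      \<Longrightarrow> adeps T (onO (adL T) A) \<cdot>\<^bsub>adC T\<^esub> onA (adL T) (adeta T A) = Ident (adC T) (onO (adL T) A)"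
    and triangle_R [simp]: "X \<in> Ob (adC T)
      \<Longrightarrow> onA (adR T) (adeps T X) \<cdot>\<^bsub>adD T\<^esub> adeta T (onO (adR T) X) = Ident (adD T) (onO (adR T) X)"
begin

lemma Dom_eps [simp]: "X \<in> Ob (adC T) \<Longrightarrow> Dom (adC T) (adeps T X) = onO (adL T) (onO (adR T) X)"
  and Cod_eps [simp]: "X \<in> Ob (adC T) \<Longrightarrow> Cod (adC T) (adeps T X) = X"
  and Dom_eta [simp]: "A \<in> Ob (adD T) \<Longrightarrow> Dom (adD T) (adeta T A) = A"
  and Cod_eta [simp]: "A \<in> Ob (adD T) \<Longrightarrow> Cod (adD T) (adeta T A) = onO (adR T) (onO (adL T) A)"
  by simp_all

lemma eta_natural: "\<lbrakk>f \<in> Ar (adD T); Cod (adD T) f = B\<rbrakk>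
    \<Longrightarrow> adeta T B \<cdot>\<^bsub>adD T\<^esub> f = onA (adR T) (onA (adL T) f) \<cdot>\<^bsub>adD T\<^esub> adeta T (Dom (adD T) f)"
  using eta.natural[of f B] by simp

lemma eps_natural: "\<lbrakk>f \<in> Ar (adC T); Cod (adC T) f = B\<rbrakk>
    \<Longrightarrow> adeps T B \<cdot>\<^bsub>adC T\<^esub> onA (adL T) (onA (adR T) f) = f \<cdot>\<^bsub>adC T\<^esub> adeps T (Dom (adC T) f)"
  using eps.natural[of f B] by simp

lemma eps_transpose:
  assumes "A \<in> Ob (adD T)" "g \<in> Ar (adC T)" "Dom (adC T) g = onO (adL T) A" "Cod (adC T) g = X"
  shows "adeps T X \<cdot>\<^bsub>adC T\<^esub> onA (adL T) (onA (adR T) g \<cdot>\<^bsub>adD T\<^esub> adeta T A) = g"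
  using assms by (auto simp: reassoc[OF eps_natural])

lemma transpose_eps:
  assumes "f \<in> Ar (adD T)" "X \<in> Ob (adC T)" "Cod (adD T) f = onO (adR T) X"
  shows "onA (adR T) (adeps T X \<cdot>\<^bsub>adC T\<^esub> onA (adL T) f) \<cdot>\<^bsub>adD T\<^esub> adeta T (Dom (adD T) f) = f"
  using assms by (simp add: eta_natural[symmetric] reassoc[OF triangle_R])

text \<open>Arrows into \<open>R X\<close> are determined by their transposes. Equations in the
  domain of the left adjoint are proved by moving them across the adjunction in this way.\<close>

lemma transpose_cancel:
  assumes "f \<in> Ar (adD T)" "g \<in> Ar (adD T)" "Dom (adD T) f = Dom (adD T) g" "X \<in> Ob (adC T)"
    "Cod (adD T) f = onO (adR T) X" "Cod (adD T) g = onO (adR T) X"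
    and "adeps T X \<cdot>\<^bsub>adC T\<^esub> onA (adL T) f = adeps T X \<cdot>\<^bsub>adC T\<^esub> onA (adL T) g"
  shows "f = g"
  using transpose_eps[of f X] transpose_eps[of g X] assms by metis

end

lemma is_adj_iff: "is_adj T \<longleftrightarrow> adjunction T"
proof
  assume T: "is_adj T"
  then interpret L: is_functor "adD T" "adC T" "adL T" by (simp add: is_adj_def Let_def)
  interpret R: is_functor "adC T" "adD T" "adR T" using T by (simp add: is_adj_def Let_def)
  interpret eta: nat_trans "adD T" "adD T" "id_fct (adD T)" "comp_fct (adD T) (adR T) (adL T)" "adeta T"
    using T by (simp add: is_adj_def Let_def)
  interpret eps: nat_trans "adC T" "adC T" "comp_fct (adC T) (adL T) (adR T)" "id_fct (adC T)" "adeps T"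
    using T by (simp add: is_adj_def Let_def)
  show "adjunction T" by unfold_locales (use T in \<open>simp_all add: is_adj_def Let_def\<close>)
next
  assume "adjunction T"
  then interpret adjunction T .
  show "is_adj T" by (simp add: is_adj_def Let_def)
qed

definition adj_mate where
  "adj_mate T T' F G \<zeta> = (\<lambda>X \<in> Ob (adC T).
    onA (adR T') (onA F (adeps T X)) \<cdot>\<^bsub>adD T'\<^esub> onA (adR T') (\<zeta> (onO (adR T) X)) \<cdot>\<^bsub>adD T'\<^esub>
      adeta T' (onO G (onO (adR T) X)))"

lemma mate_eq: "mate f = adj_mate (Src f) (Tgt f) (amF f) (amG f) (amz f)"
  by (simp add: mate_def adj_mate_def Let_def)

locale adj_arrow =
  S: adjunction T + T: adjunction T' + F: is_functor "adC T" "adC T'" F + G: is_functor "adD T" "adD T'" G +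
  ze: nat_trans "adD T" "adC T'" "comp_fct (adD T) (adL T') G" "comp_fct (adD T) F (adL T)" \<zeta>
  for T T' :: "('o, 'a, 'd, 'e) adj" and F G \<zeta> +
  assumes ze_iso [simp]: "A \<in> Ob (adD T) \<Longrightarrow> iso (adC T') (\<zeta> A)"
begin

lemma zeta_simps [simp]:
  "A \<in> Ob (adD T) \<Longrightarrow> Dom (adC T') (\<zeta> A) = onO (adL T') (onO G A)"
  "A \<in> Ob (adD T) \<Longrightarrow> Cod (adC T') (\<zeta> A) = onO F (onO (adL T) A)"
  by simp_all

lemma zeta_natural: "\<lbrakk>f \<in> Ar (adD T); Cod (adD T) f = B\<rbrakk>
    \<Longrightarrow> \<zeta> B \<cdot>\<^bsub>adC T'\<^esub> onA (adL T') (onA G f) = onA F (onA (adL T) f) \<cdot>\<^bsub>adC T'\<^esub> \<zeta> (Dom (adD T) f)"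
  using ze.natural[of f B] by simp

abbreviation mt where "mt \<equiv> adj_mate T T' F G \<zeta>"

lemma mate_simps [simp]:
  assumes "X \<in> Ob (adC T)"
  shows "mt X \<in> Ar (adD T')" "Dom (adD T') (mt X) = onO G (onO (adR T) X)"
    "Cod (adD T') (mt X) = onO (adR T') (onO F X)"
  using assms by (simp_all add: adj_mate_def)

text \<open>By its formula the mate is the transpose of \<open>F \<epsilon>\<close> after
  \<open>\<zeta>\<close>. With \<open>transpose_cancel\<close> this characterises it, and its
  naturality, its compatibility with the units and its composition law follow from this
  property.\<close>

lemma mate_eps: "X \<in> Ob (adC T) \<Longrightarrow> adeps T' (onO F X) \<cdot>\<^bsub>adC T'\<^esub> onA (adL T') (mt X)
    = onA F (adeps T X) \<cdot>\<^bsub>adC T'\<^esub> \<zeta> (onO (adR T) X)"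
  using T.eps_transpose[of "onO G (onO (adR T) X)" "onA F (adeps T X) \<cdot>\<^bsub>adC T'\<^esub> \<zeta> (onO (adR T) X)"]
  by (simp add: adj_mate_def)

lemma mate_natural:
  assumes [simp]: "f \<in> Ar (adC T)" "Cod (adC T) f = Y"
  shows "mt Y \<cdot>\<^bsub>adD T'\<^esub> onA G (onA (adR T) f) = onA (adR T') (onA F f) \<cdot>\<^bsub>adD T'\<^esub> mt (Dom (adC T) f)"
proof (rule T.transpose_cancel[of _ _ "onO F Y"])
  have [simp]: "Y \<in> Ob (adC T)" using category.Cod_Ob[of "adC T" f] by simp
  note e = mate_eps[of Y] mate_eps[of "Dom (adC T) f"]
  have n: "onA F (adeps T Y) \<cdot>\<^bsub>adC T'\<^esub> onA F (onA (adL T) (onA (adR T) f)) = onA F f \<cdot>\<^bsub>adC T'\<^esub> onA F (adeps T (Dom (adC T) f))"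
    by (simp add: S.eps_natural flip: F.onA_comp)
  have n': "adeps T' (onO F Y) \<cdot>\<^bsub>adC T'\<^esub> onA (adL T') (onA (adR T') (onA F f)) = onA F f \<cdot>\<^bsub>adC T'\<^esub> adeps T' (onO F (Dom (adC T) f))"
    by (simp add: T.eps_natural)
  show "adeps T' (onO F Y) \<cdot>\<^bsub>adC T'\<^esub> onA (adL T') (mt Y \<cdot>\<^bsub>adD T'\<^esub> onA G (onA (adR T) f)) =
    adeps T' (onO F Y) \<cdot>\<^bsub>adC T'\<^esub> onA (adL T') (onA (adR T') (onA F f) \<cdot>\<^bsub>adD T'\<^esub> mt (Dom (adC T) f))"
    by (simp add: e reassoc[OF mate_eps] reassoc[OF n'] zeta_natural reassoc[OF n])
qed (use category.Cod_Ob[of "adC T" f] in simp_all)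

text \<open>Compatibility of the mate with the two units. Applying \<open>L'\<close> to it is what
  later turns \<open>\<zeta>\<close> into a morphism of coalgebras.\<close>

lemma mate_eta:
  assumes [simp]: "A \<in> Ob (adD T)"
  shows "mt (onO (adL T) A) \<cdot>\<^bsub>adD T'\<^esub> onA G (adeta T A) = onA (adR T') (\<zeta> A) \<cdot>\<^bsub>adD T'\<^esub> adeta T' (onO G A)"
proof (rule T.transpose_cancel[of _ _ "onO F (onO (adL T) A)"])
  have n: "onA F (adeps T (onO (adL T) A)) \<cdot>\<^bsub>adC T'\<^esub> onA F (onA (adL T) (adeta T A)) = Ident (adC T') (onO F (onO (adL T) A))"
    by (simp flip: F.onA_comp)
  show "adeps T' (onO F (onO (adL T) A)) \<cdot>\<^bsub>adC T'\<^esub> onA (adL T') (mt (onO (adL T) A) \<cdot>\<^bsub>adD T'\<^esub> onA G (adeta T A)) =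
    adeps T' (onO F (onO (adL T) A)) \<cdot>\<^bsub>adC T'\<^esub> onA (adL T') (onA (adR T') (\<zeta> A) \<cdot>\<^bsub>adD T'\<^esub> adeta T' (onO G A))"
    by (simp add: reassoc[OF mate_eps] zeta_natural reassoc[OF n] reassoc[OF T.eps_natural])
qed simp_all

end

lemma is_adj_1cell_iff: "is_adj_1cell f \<longleftrightarrow> adj_arrow (Src f) (Tgt f) (amF f) (amG f) (amz f)"
  by (auto simp: is_adj_1cell_def nat_iso_def is_adj_iff adj_arrow_def adj_arrow_axioms_def)

lemma adj_arrow_id:
  assumes "adjunction T" shows "adj_arrow T T (id_fct (adC T)) (id_fct (adD T)) (id_nt (adD T) (adC T) (adL T))"
proof -
  interpret adjunction T by fact
  show ?thesis
    by (simp add: adj_arrow_def adj_arrow_axioms_def assms is_functor_id comp_fct_id_left[OF L.is_functor_axioms]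
        comp_fct_id_right[OF L.is_functor_axioms] nat_trans_id)
qed

lemma adj_arrow_comp:
  assumes "adj_arrow T T' F G \<zeta>" "adj_arrow T' T'' F' G' \<zeta>'"
  shows "adj_arrow T T'' (comp_fct (adC T) F' F) (comp_fct (adD T) G' G)
    (\<lambda>A \<in> Ob (adD T). onA F' (\<zeta> A) \<cdot>\<^bsub>adC T''\<^esub> \<zeta>' (onO G A))"
proof -
  interpret f: adj_arrow T T' F G \<zeta> by fact
  interpret g: adj_arrow T' T'' F' G' \<zeta>' by fact
  note fF = is_functor_comp[OF f.F.is_functor_axioms g.F.is_functor_axioms]
  note fG = is_functor_comp[OF f.G.is_functor_axioms g.G.is_functor_axioms]
  have n: "onA F' (\<zeta> (Cod (adD T) f)) \<cdot>\<^bsub>adC T''\<^esub> onA F' (onA (adL T') (onA G f))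
      = onA F' (onA F (onA (adL T) f)) \<cdot>\<^bsub>adC T''\<^esub> onA F' (\<zeta> (Dom (adD T) f))" if "f \<in> Ar (adD T)" for f
    using f.zeta_natural[of f] that by (simp flip: g.F.onA_comp)
  have nt: "nat_trans (adD T) (adC T'') (comp_fct (adD T) (adL T'') (comp_fct (adD T) G' G))
     (comp_fct (adD T) (comp_fct (adC T) F' F) (adL T)) (\<lambda>A \<in> Ob (adD T). onA F' (\<zeta> A) \<cdot>\<^bsub>adC T''\<^esub> \<zeta>' (onO G A))"
    by (rule nat_transI[OF is_functor_comp[OF fG g.T.L.is_functor_axioms] is_functor_comp[OF f.S.L.is_functor_axioms fF]])
      (simp_all add: g.zeta_natural reassoc[OF n])
  show ?thesis
    by (intro adj_arrow.intro adj_arrow_axioms.intro f.S.adjunction_axioms g.T.adjunction_axioms fF fG nt)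
      (simp add: category.iso_Comp)
qed

lemma adj_mate_id:
  assumes "adjunction T"
  shows "adj_mate T T (id_fct (adC T)) (id_fct (adD T)) (id_nt (adD T) (adC T) (adL T)) = id_nt (adC T) (adD T) (adR T)"
proof -
  interpret adjunction T by fact
  show ?thesis by (rule nt_eqI[of _ "adC T"]) (simp_all add: adj_mate_def)
qed

text \<open>Mates of pasted squares paste. Invertible mates and identity mates are therefore closed
  under composition, and \<open>C\<close> respects composition of 1-cells.\<close>

lemma adj_mate_comp:
  assumes "adj_arrow T T' F G \<zeta>" "adj_arrow T' T'' F' G' \<zeta>'" and [simp]: "X \<in> Ob (adC T)"
  shows "adj_mate T T'' (comp_fct (adC T) F' F) (comp_fct (adD T) G' G)
      (\<lambda>A \<in> Ob (adD T). onA F' (\<zeta> A) \<cdot>\<^bsub>adC T''\<^esub> \<zeta>' (onO G A)) X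
    = adj_mate T' T'' F' G' \<zeta>' (onO F X) \<cdot>\<^bsub>adD T''\<^esub> onA G' (adj_mate T T' F G \<zeta> X)"
proof -
  interpret f: adj_arrow T T' F G \<zeta> by fact
  interpret g: adj_arrow T' T'' F' G' \<zeta>' by fact
  define \<chi> where "\<chi> = (\<lambda>A \<in> Ob (adD T). onA F' (\<zeta> A) \<cdot>\<^bsub>adC T''\<^esub> \<zeta>' (onO G A))"
  interpret gf: adj_arrow T T'' "comp_fct (adC T) F' F" "comp_fct (adD T) G' G" \<chi>
    unfolding \<chi>_def by (rule adj_arrow_comp) fact+
  have "gf.mt X = g.mt (onO F X) \<cdot>\<^bsub>adD T''\<^esub> onA G' (f.mt X)"
  proof (rule g.T.transpose_cancel[of _ _ "onO F' (onO F X)"])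
    have "adeps T'' (onO F' (onO F X)) \<cdot>\<^bsub>adC T''\<^esub> onA (adL T'') (gf.mt X)
       = onA F' (onA F (adeps T X)) \<cdot>\<^bsub>adC T''\<^esub> onA F' (\<zeta> (onO (adR T) X)) \<cdot>\<^bsub>adC T''\<^esub> \<zeta>' (onO G (onO (adR T) X))"
      using gf.mate_eps[of X] by (simp add: \<chi>_def)
    also have "\<dots> = onA F' (onA F (adeps T X) \<cdot>\<^bsub>adC T'\<^esub> \<zeta> (onO (adR T) X)) \<cdot>\<^bsub>adC T''\<^esub> \<zeta>' (onO G (onO (adR T) X))"
      by simp
    also have "\<dots> = onA F' (adeps T' (onO F X) \<cdot>\<^bsub>adC T'\<^esub> onA (adL T') (f.mt X)) \<cdot>\<^bsub>adC T''\<^esub> \<zeta>' (onO G (onO (adR T) X))"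
      by (simp only: f.mate_eps assms(3))
    also have "\<dots> = adeps T'' (onO F' (onO F X)) \<cdot>\<^bsub>adC T''\<^esub> onA (adL T'') (g.mt (onO F X) \<cdot>\<^bsub>adD T''\<^esub> onA G' (f.mt X))"
      by (simp add: reassoc[OF g.mate_eps] g.zeta_natural)
    finally show "adeps T'' (onO F' (onO F X)) \<cdot>\<^bsub>adC T''\<^esub> onA (adL T'') (gf.mt X) =
        adeps T'' (onO F' (onO F X)) \<cdot>\<^bsub>adC T''\<^esub> onA (adL T'') (g.mt (onO F X) \<cdot>\<^bsub>adD T''\<^esub> onA G' (f.mt X))" .
  qed simp_all
  then show ?thesis by (simp only: \<chi>_def)
qed

definition adj_2arrow where
  "adj_2arrow T T' F G \<zeta> F' G' \<zeta>' \<phi> \<psi> \<longleftrightarrow> adj_arrow T T' F G \<zeta> \<and> adj_arrow T T' F' G' \<zeta>' \<and>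
    nat_trans (adC T) (adC T') F F' \<phi> \<and> nat_trans (adD T) (adD T') G G' \<psi> \<and>
    (\<forall>A \<in> Ob (adD T). \<phi> (onO (adL T) A) \<cdot>\<^bsub>adC T'\<^esub> \<zeta> A = \<zeta>' A \<cdot>\<^bsub>adC T'\<^esub> onA (adL T') (\<psi> A))"

lemma is_adj_2cell_iff: "is_adj_2cell \<alpha> \<longleftrightarrow> Src (Src \<alpha>) = Src (Tgt \<alpha>) \<and> Tgt (Src \<alpha>) = Tgt (Tgt \<alpha>) \<and>
    adj_2arrow (Src (Src \<alpha>)) (Tgt (Src \<alpha>)) (amF (Src \<alpha>)) (amG (Src \<alpha>)) (amz (Src \<alpha>))
      (amF (Tgt \<alpha>)) (amG (Tgt \<alpha>)) (amz (Tgt \<alpha>)) (amphi \<alpha>) (ampsi \<alpha>)"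
  by (auto simp: is_adj_2cell_def is_adj_1cell_iff adj_2arrow_def Let_def)

lemma adj_2arrowD:
  assumes "adj_2arrow T T' F G \<zeta> F' G' \<zeta>' \<phi> \<psi>"
  shows "adj_arrow T T' F G \<zeta>" "adj_arrow T T' F' G' \<zeta>'" "nat_trans (adC T) (adC T') F F' \<phi>"
    "nat_trans (adD T) (adD T') G G' \<psi>"
    "A \<in> Ob (adD T) \<Longrightarrow> \<phi> (onO (adL T) A) \<cdot>\<^bsub>adC T'\<^esub> \<zeta> A = \<zeta>' A \<cdot>\<^bsub>adC T'\<^esub> onA (adL T') (\<psi> A)"
  using assms by (simp_all add: adj_2arrow_def)

lemma adj_arrowD:
  assumes "adj_arrow T T' F G \<zeta>"
  shows "adjunction T" "adjunction T'" "is_functor (adC T) (adC T') F" "is_functor (adD T) (adD T') G"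
    "\<zeta> \<in> extensional (Ob (adD T))"
  using assms by (simp_all add: adj_arrow_def nat_trans_def nat_trans_axioms_def)

lemma adj_2arrow_id:
  assumes "adj_arrow T T' F G \<zeta>"
  shows "adj_2arrow T T' F G \<zeta> F G \<zeta> (id_nt (adC T) (adC T') F) (id_nt (adD T) (adD T') G)"
proof -
  interpret adj_arrow T T' F G \<zeta> by fact
  show ?thesis using assms by (simp add: adj_2arrow_def nat_trans_id)
qed

lemma adj_2arrow_vcomp:
  assumes "adj_2arrow T T' F G \<zeta> F' G' \<zeta>' \<phi> \<psi>" "adj_2arrow T T' F' G' \<zeta>' F'' G'' \<zeta>'' \<phi>' \<psi>'"
  shows "adj_2arrow T T' F G \<zeta> F'' G'' \<zeta>'' (vcomp_nt (adC T) (adC T') \<phi>' \<phi>) (vcomp_nt (adD T) (adD T') \<psi>' \<psi>)"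
proof -
  interpret f: adj_arrow T T' F G \<zeta> by (rule adj_2arrowD[OF assms(1)])
  interpret f': adj_arrow T T' F' G' \<zeta>' by (rule adj_2arrowD[OF assms(1)])
  interpret f'': adj_arrow T T' F'' G'' \<zeta>'' by (rule adj_2arrowD[OF assms(2)])
  interpret \<phi>: nat_trans "adC T" "adC T'" F F' \<phi> by (rule adj_2arrowD[OF assms(1)])
  interpret \<psi>: nat_trans "adD T" "adD T'" G G' \<psi> by (rule adj_2arrowD[OF assms(1)])
  interpret \<phi>': nat_trans "adC T" "adC T'" F' F'' \<phi>' by (rule adj_2arrowD[OF assms(2)])
  interpret \<psi>': nat_trans "adD T" "adD T'" G' G'' \<psi>' by (rule adj_2arrowD[OF assms(2)])
  show ?thesis
    using adj_2arrowD[OF assms(1)] adj_2arrowD[OF assms(2)]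
    by (simp add: adj_2arrow_def nat_trans_vcomp[OF \<phi>.nat_trans_axioms \<phi>'.nat_trans_axioms]
       nat_trans_vcomp[OF \<psi>.nat_trans_axioms \<psi>'.nat_trans_axioms] reassoc[OF adj_2arrowD(5)[OF assms(2)]])
qed

lemma adj_2arrow_hcomp:
  assumes "adj_2arrow T T' F G \<zeta> F' G' \<zeta>' \<phi> \<psi>" "adj_2arrow T' T'' M N \<chi> M' N' \<chi>' \<phi>' \<psi>'"
  shows "adj_2arrow T T'' (comp_fct (adC T) M F) (comp_fct (adD T) N G) (\<lambda>A \<in> Ob (adD T). onA M (\<zeta> A) \<cdot>\<^bsub>adC T''\<^esub> \<chi> (onO G A))
    (comp_fct (adC T) M' F') (comp_fct (adD T) N' G') (\<lambda>A \<in> Ob (adD T). onA M' (\<zeta>' A) \<cdot>\<^bsub>adC T''\<^esub> \<chi>' (onO G' A))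
    (hcomp_nt (adC T) (adC T'') M F' \<phi>' \<phi>) (hcomp_nt (adD T) (adD T'') N G' \<psi>' \<psi>)"
proof -
  interpret f: adj_arrow T T' F G \<zeta> by (rule adj_2arrowD[OF assms(1)])
  interpret f': adj_arrow T T' F' G' \<zeta>' by (rule adj_2arrowD[OF assms(1)])
  interpret m: adj_arrow T' T'' M N \<chi> by (rule adj_2arrowD[OF assms(2)])
  interpret m': adj_arrow T' T'' M' N' \<chi>' by (rule adj_2arrowD[OF assms(2)])
  interpret \<phi>: nat_trans "adC T" "adC T'" F F' \<phi> by (rule adj_2arrowD[OF assms(1)])
  interpret \<psi>: nat_trans "adD T" "adD T'" G G' \<psi> by (rule adj_2arrowD[OF assms(1)])
  interpret \<phi>': nat_trans "adC T'" "adC T''" M M' \<phi>' by (rule adj_2arrowD[OF assms(2)])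
  interpret \<psi>': nat_trans "adD T'" "adD T''" N N' \<psi>' by (rule adj_2arrowD[OF assms(2)])
  have "(\<phi>' (onO F' (onO (adL T) A)) \<cdot>\<^bsub>adC T''\<^esub> onA M (\<phi> (onO (adL T) A))) \<cdot>\<^bsub>adC T''\<^esub> onA M (\<zeta> A) \<cdot>\<^bsub>adC T''\<^esub> \<chi> (onO G A)
     = (onA M' (\<zeta>' A) \<cdot>\<^bsub>adC T''\<^esub> \<chi>' (onO G' A)) \<cdot>\<^bsub>adC T''\<^esub> onA (adL T'') (\<psi>' (onO G' A)) \<cdot>\<^bsub>adC T''\<^esub> onA (adL T'') (onA N (\<psi> A))"
    if A [simp]: "A \<in> Ob (adD T)" for A
  proof -
    have 1: "onA M (\<phi> (onO (adL T) A)) \<cdot>\<^bsub>adC T''\<^esub> onA M (\<zeta> A) = onA M (\<zeta>' A) \<cdot>\<^bsub>adC T''\<^esub> onA M (onA (adL T') (\<psi> A))"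
      using adj_2arrowD(5)[OF assms(1)] by (simp flip: m.F.onA_comp)
    have 2: "onA M (onA (adL T') (\<psi> A)) \<cdot>\<^bsub>adC T''\<^esub> \<chi> (onO G A) = \<chi> (onO G' A) \<cdot>\<^bsub>adC T''\<^esub> onA (adL T'') (onA N (\<psi> A))"
      using m.zeta_natural[of "\<psi> A"] by simp
    have 3: "\<phi>' (onO F' (onO (adL T) A)) \<cdot>\<^bsub>adC T''\<^esub> onA M (\<zeta>' A) = onA M' (\<zeta>' A) \<cdot>\<^bsub>adC T''\<^esub> \<phi>' (onO (adL T') (onO G' A))"
      using \<phi>'.natural[of "\<zeta>' A"] by simp
    show ?thesis
      by (simp add: reassoc[OF 1] 2 reassoc[OF 3] reassoc[OF adj_2arrowD(5)[OF assms(2)]])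
  qed
  then show ?thesis
    by (simp add: adj_2arrow_def nat_trans_hcomp[OF \<phi>.nat_trans_axioms \<phi>'.nat_trans_axioms]
       nat_trans_hcomp[OF \<psi>.nat_trans_axioms \<psi>'.nat_trans_axioms] adj_arrow_comp[OF f.adj_arrow_axioms m.adj_arrow_axioms]
       adj_arrow_comp[OF f'.adj_arrow_axioms m'.adj_arrow_axioms])
qed

lemma LAdj_iso_simps [simp]:
  "Zero LAdj_iso = Collect is_adj" "One LAdj_iso = Collect is_adj_1cell" "Two LAdj_iso = Collect is_adj_2cell"
  "src1 LAdj_iso = Src" "tgt1 LAdj_iso = Tgt" "src2 LAdj_iso = Src" "tgt2 LAdj_iso = Tgt"
  "id1 LAdj_iso = adj_id1" "id2 LAdj_iso = adj_id2" "comp1 LAdj_iso = adj_comp1" "vcomp LAdj_iso = adj_vcomp"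
  "hcomp LAdj_iso = adj_hcomp"
  by (simp_all add: LAdj_iso_def)

lemma adj_cell_simps [simp]:
  "Src (adj_id1 T) = T" "Tgt (adj_id1 T) = T" "amF (adj_id1 T) = id_fct (adC T)" "amG (adj_id1 T) = id_fct (adD T)"
  "Src (adj_comp1 g f) = Src f" "Tgt (adj_comp1 g f) = Tgt g"
  "amF (adj_comp1 g f) = comp_fct (adC (Src f)) (amF g) (amF f)"
  "amG (adj_comp1 g f) = comp_fct (adD (Src f)) (amG g) (amG f)"
  by (simp_all add: adj_id1_def adj_comp1_def)

lemma hom1_LAdj: "f \<in> hom1 LAdj_iso x y \<longleftrightarrow> adj_arrow x y (amF f) (amG f) (amz f) \<and> Src f = x \<and> Tgt f = y"
  by (auto simp: hom1_def is_adj_1cell_iff)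

lemma hom2_LAdj: "\<alpha> \<in> hom2 LAdj_iso f g \<longleftrightarrow> Src \<alpha> = f \<and> Tgt \<alpha> = g \<and> Src f = Src g \<and> Tgt f = Tgt g \<and>
    adj_2arrow (Src f) (Tgt f) (amF f) (amG f) (amz f) (amF g) (amG g) (amz g) (amphi \<alpha>) (ampsi \<alpha>)"
  by (auto simp: hom2_def is_adj_2cell_iff)

lemma adj_comp1_id1:
  assumes "f \<in> hom1 LAdj_iso x y" shows "adj_comp1 f (adj_id1 x) = f" "adj_comp1 (adj_id1 y) f = f"
proof -
  interpret adj_arrow x y "amF f" "amG f" "amz f" using assms by (simp add: hom1_LAdj)
  note [simp] = comp_fct_id_right[OF F.is_functor_axioms] comp_fct_id_left[OF F.is_functor_axioms]
    comp_fct_id_right[OF G.is_functor_axioms] comp_fct_id_left[OF G.is_functor_axioms]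
  have 1: "amz (adj_comp1 f (adj_id1 x)) = amz f" and 2: "amz (adj_comp1 (adj_id1 y) f) = amz f"
    by (rule nt_eqI[of _ "adD x"]; use assms in \<open>simp add: ze.nt_ext adj_comp1_def adj_id1_def hom1_LAdj\<close>)+
  show "adj_comp1 f (adj_id1 x) = f" "adj_comp1 (adj_id1 y) f = f"
    by (rule adj_1cell.equality; use assms 1 2 in \<open>simp add: hom1_LAdj\<close>)+
qed

lemma adj_comp1_assoc:
  assumes "f \<in> hom1 LAdj_iso x y" "g \<in> hom1 LAdj_iso y z" "h \<in> hom1 LAdj_iso z w"
  shows "adj_comp1 (adj_comp1 h g) f = adj_comp1 h (adj_comp1 g f)"
proof -
  interpret f: adj_arrow x y "amF f" "amG f" "amz f" using assms by (simp add: hom1_LAdj)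
  interpret g: adj_arrow y z "amF g" "amG g" "amz g" using assms by (simp add: hom1_LAdj)
  interpret h: adj_arrow z w "amF h" "amG h" "amz h" using assms by (simp add: hom1_LAdj)
  have [simp]: "Src f = x" "Src g = y" "Src h = z" "Tgt f = y" "Tgt g = z" "Tgt h = w"
    using assms by (simp_all add: hom1_LAdj)
  show ?thesis
    by (simp add: adj_comp1_def comp_fct_assoc[OF f.F.is_functor_axioms] comp_fct_assoc[OF f.G.is_functor_axioms]
       cong: restrict_cong)
qed

lemma adj_id1_hom: "adjunction x \<Longrightarrow> adj_id1 x \<in> hom1 LAdj_iso x x"
  by (simp add: hom1_LAdj adj_id1_def adj_arrow_id)

lemma adj_comp1_hom: "\<lbrakk>f \<in> hom1 LAdj_iso x y; g \<in> hom1 LAdj_iso y z\<rbrakk> \<Longrightarrow> adj_comp1 g f \<in> hom1 LAdj_iso x z"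
  by (auto simp: hom1_LAdj adj_comp1_def intro: adj_arrow_comp)

lemma two_category_LAdj_iso: "two_category LAdj_iso"
proof (unfold_locales, goal_cases)
  case (7 x) then show ?case by (simp add: is_adj_iff adj_id1_hom)
next
  case (8 f) then show ?case by (auto simp: hom2_LAdj is_adj_1cell_iff adj_id2_def intro: adj_2arrow_id)
next
  case (9 f x y g z) then show ?case by (simp add: adj_comp1_hom)
next
  case (13 \<alpha> f g \<beta> h) then show ?case by (auto simp: hom2_LAdj adj_vcomp_def Let_def intro: adj_2arrow_vcomp)
next
  case (14 \<alpha> f g) then show ?case
    by (auto simp: hom2_LAdj adj_vcomp_def adj_id2_def Let_def vcomp_nt_id_right[OF adj_2arrowD(3)] vcomp_nt_id_right[OF adj_2arrowD(4)])
next
  case (15 \<alpha> f g) then show ?case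
    by (auto simp: hom2_LAdj adj_vcomp_def adj_id2_def Let_def vcomp_nt_id_left[OF adj_2arrowD(3)] vcomp_nt_id_left[OF adj_2arrowD(4)])
next
  case (16 \<alpha> f g \<beta> h \<gamma> k) then show ?case
    by (auto simp: hom2_LAdj adj_vcomp_def Let_def vcomp_nt_assoc[OF adj_2arrowD(3) adj_2arrowD(3) adj_2arrowD(3)]
       vcomp_nt_assoc[OF adj_2arrowD(4) adj_2arrowD(4) adj_2arrowD(4)])
next
  case (17 f x y g z \<alpha> f' \<beta> g') then show ?case
    by (auto simp: hom1_LAdj hom2_LAdj adj_hcomp_def adj_comp1_def Let_def intro: adj_2arrow_hcomp)
next
  case (18 f x y \<alpha> f')
  then have "f' \<in> hom1 LAdj_iso x y" by (auto simp: hom1_LAdj hom2_LAdj dest: adj_2arrowD)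
  with 18 show ?case
    by (intro adj_2cell.equality)
      (auto simp: adj_comp1_id1 hom2_LAdj hom1_LAdj adj_hcomp_def adj_id2_def Let_def
        hcomp_nt_id_right[OF adj_2arrowD(3)] hcomp_nt_id_right[OF adj_2arrowD(4)])
next
  case (19 f x y \<alpha> f')
  then have "f' \<in> hom1 LAdj_iso x y" by (auto simp: hom1_LAdj hom2_LAdj dest: adj_2arrowD)
  with 19 show ?case
    by (intro adj_2cell.equality)
      (auto simp: adj_comp1_id1 hom2_LAdj hom1_LAdj adj_hcomp_def adj_id2_def Let_def
        hcomp_nt_id_left[OF adj_2arrowD(3)] hcomp_nt_id_left[OF adj_2arrowD(4)])
next
  case (20 f x y g z h w \<alpha> f' \<beta> g' \<gamma> h')
  then have "f' \<in> hom1 LAdj_iso x y" "g' \<in> hom1 LAdj_iso y z" "h' \<in> hom1 LAdj_iso z w"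
    by (auto simp: hom1_LAdj hom2_LAdj dest: adj_2arrowD)
  with 20 show ?case
    by (intro adj_2cell.equality)
      (auto simp: adj_comp1_assoc hom2_LAdj hom1_LAdj adj_hcomp_def Let_def
        hcomp_nt_assoc[OF adj_2arrowD(3) adj_2arrowD(3) adj_2arrowD(3)]
        hcomp_nt_assoc[OF adj_2arrowD(4) adj_2arrowD(4) adj_2arrowD(4)])
next
  case (21 f x y g z)
  then show ?case
    by (auto simp: hom1_LAdj adj_hcomp_def adj_comp1_def adj_id2_def Let_def hcomp_nt_id_id[OF adj_arrowD(3) adj_arrowD(3)]
       hcomp_nt_id_id[OF adj_arrowD(4) adj_arrowD(4)])
next
  case (22 f x y g z \<alpha> f' \<alpha>' f'' \<beta> g' \<beta>' g'')
  then show ?case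
    by (auto simp: hom1_LAdj hom2_LAdj adj_hcomp_def adj_vcomp_def adj_comp1_def Let_def
        hcomp_nt_interchange[OF adj_2arrowD(3) adj_2arrowD(3) adj_2arrowD(3) adj_2arrowD(3)]
        hcomp_nt_interchange[OF adj_2arrowD(4) adj_2arrowD(4) adj_2arrowD(4) adj_2arrowD(4)])
qed (auto simp: is_adj_1cell_iff is_adj_2cell_iff adj_comp1_id1 adj_comp1_assoc is_adj_iff dest: adj_arrowD adj_2arrowD)

lemma (in category) iso_cancel_right:
  "\<lbrakk>g \<cdot>\<^bsub>C\<^esub> f = h \<cdot>\<^bsub>C\<^esub> f; iso C f; g \<in> Ar C; h \<in> Ar C; Dom C g = Cod C f; Dom C h = Cod C f\<rbrakk> \<Longrightarrow> g = h"
proof -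
  assume e: "g \<cdot>\<^bsub>C\<^esub> f = h \<cdot>\<^bsub>C\<^esub> f" and f: "iso C f" and gh: "g \<in> Ar C" "h \<in> Ar C" "Dom C g = Cod C f" "Dom C h = Cod C f"
  have "(g \<cdot>\<^bsub>C\<^esub> f) \<cdot>\<^bsub>C\<^esub> inv_ar C f = (h \<cdot>\<^bsub>C\<^esub> f) \<cdot>\<^bsub>C\<^esub> inv_ar C f" by (simp add: e)
  then show "g = h" using f gh iso_Ar[OF f] by simp
qed

section \<open>The 2-functor \<open>C\<close>, and the classes of tight, pseudo and strict
  1-cells\<close>

section \<open>The comonad of an adjunction\<close>

lemma adj_comonad_simps [simp]:
  "cmC (adj_comonad T) = adC T" "cmK (adj_comonad T) = comp_fct (adC T) (adL T) (adR T)" "cmeps (adj_comonad T) = adeps T"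
  "X \<in> Ob (adC T) \<Longrightarrow> cmnu (adj_comonad T) X = onA (adL T) (adeta T (onO (adR T) X))"
  by (simp_all add: adj_comonad_def)

lemma cmnu_adj_comonad_ext [simp]: "cmnu (adj_comonad T) \<in> extensional (Ob (adC T))"
  by (simp add: adj_comonad_def)

lemma comonad_adj_comonad:
  assumes "adjunction T" shows "comonad (adj_comonad T)"
proof -
  interpret adjunction T by fact
  note K = is_functor_comp[OF R.is_functor_axioms L.is_functor_axioms]
  have K_eps: "onA (adL T) (onA (adR T) (adeps T X)) \<cdot>\<^bsub>adC T\<^esub> onA (adL T) (adeta T (onO (adR T) X)) = Ident (adC T) (onO (adL T) (onO (adR T) X))"
    if "X \<in> Ob (adC T)" for X
    using that by (simp flip: L.onA_comp)
  have eta_nat: "onA (adL T) (adeta T (Cod (adD T) f)) \<cdot>\<^bsub>adC T\<^esub> onA (adL T) f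
      = onA (adL T) (onA (adR T) (onA (adL T) f)) \<cdot>\<^bsub>adC T\<^esub> onA (adL T) (adeta T (Dom (adD T) f))"
    if "f \<in> Ar (adD T)" for f
    using eta_natural[of f] that by (simp flip: L.onA_comp)
  have nu: "nat_trans (adC T) (adC T) (comp_fct (adC T) (adL T) (adR T))
    (comp_fct (adC T) (comp_fct (adC T) (adL T) (adR T)) (comp_fct (adC T) (adL T) (adR T))) (cmnu (adj_comonad T))"
  proof (rule nat_transI[OF K is_functor_comp[OF K K]])
    fix f assume "f \<in> Ar (adC T)"
    then show "cmnu (adj_comonad T) (Cod (adC T) f) \<cdot>\<^bsub>adC T\<^esub> onA (comp_fct (adC T) (adL T) (adR T)) f =
      onA (comp_fct (adC T) (comp_fct (adC T) (adL T) (adR T)) (comp_fct (adC T) (adL T) (adR T))) f \<cdot>\<^bsub>adC T\<^esub> cmnu (adj_comonad T) (Dom (adC T) f)"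
      using eta_nat[of "onA (adR T) f"] by simp
  qed simp_all
  have "onA (adL T) (onA (adR T) (onA (adL T) (adeta T (onO (adR T) X)))) \<cdot>\<^bsub>adC T\<^esub> onA (adL T) (adeta T (onO (adR T) X)) =
      onA (adL T) (adeta T (onO (adR T) (onO (adL T) (onO (adR T) X)))) \<cdot>\<^bsub>adC T\<^esub> onA (adL T) (adeta T (onO (adR T) X))"
    if "X \<in> Ob (adC T)" for X
    using eta_nat[of "adeta T (onO (adR T) X)"] that by simp
  then show ?thesis
    by (simp add: comonad_def comonad_axioms_def K nu K_eps)
qed

text \<open>The mate starts at \<open>G R\<close>, so its image under \<open>L'\<close> starts at
  \<open>L' G R\<close>; the inverse of \<open>\<zeta>\<close> moves the start to
  \<open>F L R\<close>, the source that a 1-cell of \<open>Cmd\<close> needs. Invertibility of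
  \<open>\<zeta>\<close> is what makes this possible.\<close>

definition adj_theta where
  "adj_theta T T' F G \<zeta> = (\<lambda>X \<in> Ob (adC T).
    onA (adL T') (adj_mate T T' F G \<zeta> X) \<cdot>\<^bsub>adC T'\<^esub> inv_ar (adC T') (\<zeta> (onO (adR T) X)))"

lemma C_1_eq: "C_1 f = \<lparr>Src = adj_comonad (Src f), Tgt = adj_comonad (Tgt f), cmH = amF f,
    cmth = adj_theta (Src f) (Tgt f) (amF f) (amG f) (amz f)\<rparr>"
  by (simp add: C_1_def adj_theta_def mate_eq)

lemma adj_theta_ext [simp]: "adj_theta T T' F G \<zeta> \<in> extensional (Ob (adC T))"
  by (simp add: adj_theta_def)

context adj_arrow
begin

abbreviation tht where "tht \<equiv> adj_theta T T' F G \<zeta>"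

lemma adj_theta_simps [simp]:
  assumes "X \<in> Ob (adC T)"
  shows "tht X \<in> Ar (adC T')" "Dom (adC T') (tht X) = onO F (onO (adL T) (onO (adR T) X))"
    "Cod (adC T') (tht X) = onO (adL T') (onO (adR T') (onO F X))"
  using assms by (simp_all add: adj_theta_def)

lemma theta_zeta: "X \<in> Ob (adC T) \<Longrightarrow> tht X \<cdot>\<^bsub>adC T'\<^esub> \<zeta> (onO (adR T) X) = onA (adL T') (mt X)"
  by (simp add: adj_theta_def)

text \<open>Being invertible, \<open>\<zeta>\<close> can be cancelled on the right. After composing
  with it, \<open>\<theta>\<close> becomes \<open>L'\<close> of the mate and no inverse is left, so
  equations about \<open>\<theta>\<close> reduce to equations about mates.\<close>

lemma theta_eqI:
  assumes "X \<in> Ob (adC T)" "f \<in> Ar (adC T')" "Dom (adC T') f = onO F (onO (adL T) (onO (adR T) X))"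
    "f \<cdot>\<^bsub>adC T'\<^esub> \<zeta> (onO (adR T) X) = onA (adL T') (mt X)"
  shows "tht X = f"
  by (rule category.iso_cancel_right[of "adC T'" _ "\<zeta> (onO (adR T) X)"]) (use assms theta_zeta in simp_all)

lemma theta_natural':
  assumes [simp]: "f \<in> Ar (adC T)"
  shows "tht (Cod (adC T) f) \<cdot>\<^bsub>adC T'\<^esub> onA F (onA (adL T) (onA (adR T) f))
    = onA (adL T') (onA (adR T') (onA F f)) \<cdot>\<^bsub>adC T'\<^esub> tht (Dom (adC T) f)"
proof (rule category.iso_cancel_right[of "adC T'" _ "\<zeta> (onO (adR T) (Dom (adC T) f))"])
  have "onA (adL T') (mt (Cod (adC T) f)) \<cdot>\<^bsub>adC T'\<^esub> onA (adL T') (onA G (onA (adR T) f))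
    = onA (adL T') (onA (adR T') (onA F f)) \<cdot>\<^bsub>adC T'\<^esub> onA (adL T') (mt (Dom (adC T) f))"
    using mate_natural[of f] by (simp flip: T.L.onA_comp)
  then show "(tht (Cod (adC T) f) \<cdot>\<^bsub>adC T'\<^esub> onA F (onA (adL T) (onA (adR T) f))) \<cdot>\<^bsub>adC T'\<^esub> \<zeta> (onO (adR T) (Dom (adC T) f)) =
    (onA (adL T') (onA (adR T') (onA F f)) \<cdot>\<^bsub>adC T'\<^esub> tht (Dom (adC T) f)) \<cdot>\<^bsub>adC T'\<^esub> \<zeta> (onO (adR T) (Dom (adC T) f))"
    using zeta_natural[of "onA (adR T) f", symmetric] by (simp add: theta_zeta reassoc[OF theta_zeta])
qed simp_all

text \<open>Read with the coalgebra structures \<open>L' \<eta>'\<close> on \<open>L' G A\<close>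
  and \<open>\<theta> (F L \<eta>)\<close> on \<open>F L A\<close>, this says that
  \<open>\<zeta> A\<close> is a coalgebra morphism. It is the source of the 2-cells of the
  unit.\<close>

lemma theta_unit:
  assumes [simp]: "A \<in> Ob (adD T)"
  shows "tht (onO (adL T) A) \<cdot>\<^bsub>adC T'\<^esub> onA F (onA (adL T) (adeta T A)) \<cdot>\<^bsub>adC T'\<^esub> \<zeta> A
    = onA (adL T') (onA (adR T') (\<zeta> A)) \<cdot>\<^bsub>adC T'\<^esub> onA (adL T') (adeta T' (onO G A))"
proof -
  have "onA (adL T') (mt (onO (adL T) A)) \<cdot>\<^bsub>adC T'\<^esub> onA (adL T') (onA G (adeta T A)) =
    onA (adL T') (onA (adR T') (\<zeta> A)) \<cdot>\<^bsub>adC T'\<^esub> onA (adL T') (adeta T' (onO G A))"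
    using mate_eta[of A] by (simp flip: T.L.onA_comp)
  then show ?thesis
    using zeta_natural[of "adeta T A", symmetric] by (simp add: reassoc[OF theta_zeta])
qed

lemma cmd_arrow_theta: "cmd_arrow (adj_comonad T) (adj_comonad T') F tht"
proof -
  note K = is_functor_comp[OF S.R.is_functor_axioms S.L.is_functor_axioms]
    is_functor_comp[OF T.R.is_functor_axioms T.L.is_functor_axioms]
  have "nat_trans (adC T) (adC T') (comp_fct (adC T) F (comp_fct (adC T) (adL T) (adR T)))
     (comp_fct (adC T) (comp_fct (adC T') (adL T') (adR T')) F) tht"
    by (rule nat_transI[OF is_functor_comp[OF K(1) F.is_functor_axioms] is_functor_comp[OF F.is_functor_axioms K(2)]])
      (simp_all add: theta_natural')
  moreover have "adeps T' (onO F X) \<cdot>\<^bsub>adC T'\<^esub> tht X = onA F (adeps T X)" if [simp]: "X \<in> Ob (adC T)" for X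
    by (rule category.iso_cancel_right[of "adC T'" _ "\<zeta> (onO (adR T) X)"]) (simp_all add: theta_zeta mate_eps)
  \<comment> \<open>Comultiplication law, tested after \<open>\<zeta>\<close>:
    \<open>theta_unit\<close> at the object \<open>R X\<close> rewrites the right-hand side,
    naturality of \<open>\<eta>'\<close> at the mate rewrites the left-hand side, and both become
    \<open>L' R' L'\<close> of the mate after \<open>L' \<eta>'\<close>.\<close>
  moreover have "onA (adL T') (adeta T' (onO (adR T') (onO F X))) \<cdot>\<^bsub>adC T'\<^esub> tht X =
      onA (adL T') (onA (adR T') (tht X)) \<cdot>\<^bsub>adC T'\<^esub> tht (onO (adL T) (onO (adR T) X)) \<cdot>\<^bsub>adC T'\<^esub> onA F (onA (adL T) (adeta T (onO (adR T) X)))"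
    if [simp]: "X \<in> Ob (adC T)" for X
  proof (rule category.iso_cancel_right[of "adC T'" _ "\<zeta> (onO (adR T) X)"])
    have 1: "onA (adL T') (onA (adR T') (tht X)) \<cdot>\<^bsub>adC T'\<^esub> onA (adL T') (onA (adR T') (\<zeta> (onO (adR T) X)))
       = onA (adL T') (onA (adR T') (onA (adL T') (mt X)))"
      using theta_zeta[of X] by (simp flip: T.L.onA_comp T.R.onA_comp)
    have 2: "onA (adL T') (adeta T' (onO (adR T') (onO F X))) \<cdot>\<^bsub>adC T'\<^esub> onA (adL T') (mt X)
       = onA (adL T') (onA (adR T') (onA (adL T') (mt X))) \<cdot>\<^bsub>adC T'\<^esub> onA (adL T') (adeta T' (onO G (onO (adR T) X)))"
      using T.eta_natural[of "mt X"] by (simp flip: T.L.onA_comp)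
    show "(onA (adL T') (adeta T' (onO (adR T') (onO F X))) \<cdot>\<^bsub>adC T'\<^esub> tht X) \<cdot>\<^bsub>adC T'\<^esub> \<zeta> (onO (adR T) X) =
      (onA (adL T') (onA (adR T') (tht X)) \<cdot>\<^bsub>adC T'\<^esub> tht (onO (adL T) (onO (adR T) X)) \<cdot>\<^bsub>adC T'\<^esub> onA F (onA (adL T) (adeta T (onO (adR T) X)))) \<cdot>\<^bsub>adC T'\<^esub> \<zeta> (onO (adR T) X)"
      using theta_unit[of "onO (adR T) X"] by (simp add: theta_zeta 2 reassoc[OF 1])
  qed simp_all
  ultimately show ?thesis
    by (simp add: cmd_arrow_def cmd_arrow_axioms_def comonad_adj_comonad S.adjunction_axioms T.adjunction_axioms)
qed

end

lemma adj_theta_id: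
  assumes "adjunction T"
  shows "adj_theta T T (id_fct (adC T)) (id_fct (adD T)) (id_nt (adD T) (adC T) (adL T))
    = id_nt (adC T) (adC T) (comp_fct (adC T) (adL T) (adR T))"
proof -
  interpret adjunction T by fact
  show ?thesis by (rule nt_eqI[of _ "adC T"]) (simp_all add: adj_theta_def adj_mate_id[OF assms])
qed

text \<open>Functoriality of \<open>C\<close> on 1-cells. Cancelling the composite
  \<open>\<zeta>\<close> leaves the composition law for mates and naturality of the second
  \<open>\<zeta>\<close> at the first mate.\<close>

lemma adj_theta_comp:
  assumes "adj_arrow T T' F G \<zeta>" "adj_arrow T' T'' F' G' \<zeta>'"
  shows "adj_theta T T'' (comp_fct (adC T) F' F) (comp_fct (adD T) G' G)
      (\<lambda>A \<in> Ob (adD T). onA F' (\<zeta> A) \<cdot>\<^bsub>adC T''\<^esub> \<zeta>' (onO G A))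
    = (\<lambda>X \<in> Ob (adC T). adj_theta T' T'' F' G' \<zeta>' (onO F X) \<cdot>\<^bsub>adC T''\<^esub> onA F' (adj_theta T T' F G \<zeta> X))"
proof -
  interpret f: adj_arrow T T' F G \<zeta> by fact
  interpret g: adj_arrow T' T'' F' G' \<zeta>' by fact
  define \<chi> where "\<chi> = (\<lambda>A \<in> Ob (adD T). onA F' (\<zeta> A) \<cdot>\<^bsub>adC T''\<^esub> \<zeta>' (onO G A))"
  interpret gf: adj_arrow T T'' "comp_fct (adC T) F' F" "comp_fct (adD T) G' G" \<chi>
    unfolding \<chi>_def by (rule adj_arrow_comp) fact+
  have m: "gf.mt X = g.mt (onO F X) \<cdot>\<^bsub>adD T''\<^esub> onA G' (f.mt X)" if "X \<in> Ob (adC T)" for X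
    unfolding \<chi>_def by (rule adj_mate_comp) fact+
  have "gf.tht = (\<lambda>X \<in> Ob (adC T). g.tht (onO F X) \<cdot>\<^bsub>adC T''\<^esub> onA F' (f.tht X))"
  proof (rule nt_eqI[of _ "adC T"])
    fix X assume [simp]: "X \<in> Ob (adC T)"
    have 1: "onA F' (f.tht X) \<cdot>\<^bsub>adC T''\<^esub> onA F' (\<zeta> (onO (adR T) X)) = onA F' (onA (adL T') (f.mt X))"
      using f.theta_zeta[of X] by (simp flip: g.F.onA_comp)
    have 2: "onA F' (onA (adL T') (f.mt X)) \<cdot>\<^bsub>adC T''\<^esub> \<zeta>' (onO G (onO (adR T) X)) = \<zeta>' (onO (adR T') (onO F X)) \<cdot>\<^bsub>adC T''\<^esub> onA (adL T'') (onA G' (f.mt X))"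
      using g.zeta_natural[of "f.mt X"] by simp
    show "gf.tht X = (\<lambda>X \<in> Ob (adC T). g.tht (onO F X) \<cdot>\<^bsub>adC T''\<^esub> onA F' (f.tht X)) X"
      by (rule gf.theta_eqI) (simp_all add: \<chi>_def reassoc[OF 1] 2 reassoc[OF g.theta_zeta] m[unfolded \<chi>_def])
  qed simp_all
  then show ?thesis by (simp only: \<chi>_def)
qed

text \<open>Only \<open>\<phi>\<close> remains in \<open>Cmd\<close>, but \<open>\<psi>\<close> is
  needed on the way: the mates intertwine \<open>\<psi>\<close> with \<open>R' \<phi>\<close>, and
  composing with \<open>\<zeta>\<close> trades \<open>\<psi>\<close> for \<open>\<phi>\<close>
  again.\<close>

lemma cmd_2arrow_of_adj:
  assumes "adj_2arrow T T' F G \<zeta> F' G' \<zeta>' \<phi> \<psi>"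
  shows "cmd_2arrow (adj_comonad T) (adj_comonad T') F (adj_theta T T' F G \<zeta>) F' (adj_theta T T' F' G' \<zeta>') \<phi>"
proof -
  interpret f: adj_arrow T T' F G \<zeta> by (rule adj_2arrowD[OF assms(1)])
  interpret f': adj_arrow T T' F' G' \<zeta>' by (rule adj_2arrowD[OF assms(1)])
  interpret \<phi>: nat_trans "adC T" "adC T'" F F' \<phi> by (rule adj_2arrowD[OF assms(1)])
  interpret \<psi>: nat_trans "adD T" "adD T'" G G' \<psi> by (rule adj_2arrowD[OF assms(1)])
  have e: "\<phi> (onO (adL T) A) \<cdot>\<^bsub>adC T'\<^esub> \<zeta> A = \<zeta>' A \<cdot>\<^bsub>adC T'\<^esub> onA (adL T') (\<psi> A)" if "A \<in> Ob (adD T)" for A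
    using adj_2arrowD(5)[OF assms] that .
  have m: "onA (adR T') (\<phi> X) \<cdot>\<^bsub>adD T'\<^esub> f.mt X = f'.mt X \<cdot>\<^bsub>adD T'\<^esub> \<psi> (onO (adR T) X)"
    if [simp]: "X \<in> Ob (adC T)" for X
  proof (rule f.T.transpose_cancel[of _ _ "onO F' X"])
    show "adeps T' (onO F' X) \<cdot>\<^bsub>adC T'\<^esub> onA (adL T') (onA (adR T') (\<phi> X) \<cdot>\<^bsub>adD T'\<^esub> f.mt X) =
      adeps T' (onO F' X) \<cdot>\<^bsub>adC T'\<^esub> onA (adL T') (f'.mt X \<cdot>\<^bsub>adD T'\<^esub> \<psi> (onO (adR T) X))"
      using \<phi>.natural[of "adeps T X"]
      by (simp add: reassoc[OF f.T.eps_natural] f.mate_eps reassoc[OF f'.mate_eps] e[symmetric] reassoc[OF \<phi>.natural])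
  qed simp_all
  have "onA (adL T') (onA (adR T') (\<phi> X)) \<cdot>\<^bsub>adC T'\<^esub> f.tht X = f'.tht X \<cdot>\<^bsub>adC T'\<^esub> \<phi> (onO (adL T) (onO (adR T) X))"
    if [simp]: "X \<in> Ob (adC T)" for X
  proof (rule category.iso_cancel_right[of "adC T'" _ "\<zeta> (onO (adR T) X)"])
    have "onA (adL T') (onA (adR T') (\<phi> X)) \<cdot>\<^bsub>adC T'\<^esub> onA (adL T') (f.mt X) = onA (adL T') (f'.mt X) \<cdot>\<^bsub>adC T'\<^esub> onA (adL T') (\<psi> (onO (adR T) X))"
      using m[of X] by (simp flip: f.T.L.onA_comp)
    then show "(onA (adL T') (onA (adR T') (\<phi> X)) \<cdot>\<^bsub>adC T'\<^esub> f.tht X) \<cdot>\<^bsub>adC T'\<^esub> \<zeta> (onO (adR T) X)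
      = (f'.tht X \<cdot>\<^bsub>adC T'\<^esub> \<phi> (onO (adL T) (onO (adR T) X))) \<cdot>\<^bsub>adC T'\<^esub> \<zeta> (onO (adR T) X)"
      by (simp add: f.theta_zeta e reassoc[OF f'.theta_zeta])
  qed simp_all
  then show ?thesis
    by (simp add: cmd_2arrow_def f.cmd_arrow_theta f'.cmd_arrow_theta)
qed

lemma C_1_simps [simp]:
  "Src (C_1 f) = adj_comonad (Src f)" "Tgt (C_1 f) = adj_comonad (Tgt f)" "cmH (C_1 f) = amF f"
  "cmth (C_1 f) = adj_theta (Src f) (Tgt f) (amF f) (amG f) (amz f)"
  by (simp_all add: C_1_eq)

lemma C_2_simps [simp]: "Src (C_2 \<alpha>) = C_1 (Src \<alpha>)" "Tgt (C_2 \<alpha>) = C_1 (Tgt \<alpha>)" "cmphi (C_2 \<alpha>) = amphi \<alpha>"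
  by (simp_all add: C_2_def)

lemma C_2fun_simps [simp]: "F0 C_2fun = adj_comonad" "F1 C_2fun = C_1" "F2 C_2fun = C_2"
  by (simp_all add: C_2fun_def)

lemma C_1_comp:
  assumes "f \<in> hom1 LAdj_iso x y" "g \<in> hom1 LAdj_iso y z"
  shows "C_1 (adj_comp1 g f) = cmd_comp1 (C_1 g) (C_1 f)"
proof -
  have f: "adj_arrow x y (amF f) (amG f) (amz f)" and g: "adj_arrow y z (amF g) (amG g) (amz g)"
    and [simp]: "Src f = x" "Tgt f = y" "Src g = y" "Tgt g = z"
    using assms by (simp_all add: hom1_LAdj)
  show ?thesis
    by (rule cmd_1cell.equality) (simp_all add: cmd_comp1_def adj_comp1_def adj_theta_comp[OF f g])
qed

lemma C_1_id: "adjunction T \<Longrightarrow> C_1 (adj_id1 T) = cmd_id1 (adj_comonad T)"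
  by (rule cmd_1cell.equality) (simp_all add: cmd_id1_def adj_id1_def adj_theta_id)

lemma two_functor_C: "two_functor LAdj_iso Cmd C_2fun"
proof -
  interpret A: two_category LAdj_iso by (rule two_category_LAdj_iso)
  interpret B: two_category Cmd by (rule two_category_Cmd)
  show ?thesis
  proof (unfold_locales, goal_cases)
    case (1 x) then show ?case by (simp add: is_adj_iff is_comonad_iff comonad_adj_comonad)
  next
    case (2 f x y) then show ?case by (auto simp: hom1_LAdj hom1_Cmd intro: adj_arrow.cmd_arrow_theta)
  next
    case (3 \<alpha> f g) then show ?case by (auto simp: hom2_LAdj hom2_Cmd intro: cmd_2arrow_of_adj)
  next
    case (4 x) then show ?case by (simp add: is_adj_iff C_1_id)
  next
    case (5 f x y g z) then show ?case by (simp add: C_1_comp)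
  next
    case (8 f x y g z \<alpha> f' \<beta> g')
    then have "f' \<in> hom1 LAdj_iso x y" "g' \<in> hom1 LAdj_iso y z" by (auto simp: hom1_LAdj hom2_LAdj dest: adj_2arrowD)
    with 8 have "C_1 (adj_comp1 g f) = cmd_comp1 (C_1 g) (C_1 f)" "C_1 (adj_comp1 g' f') = cmd_comp1 (C_1 g') (C_1 f')"
      by (simp_all add: C_1_comp)
    with 8 show ?case
      by (auto simp: C_2_def adj_hcomp_def cmd_hcomp_def Let_def hom1_LAdj hom2_LAdj)
  qed (auto simp: C_2_def adj_id2_def cmd_id2_def adj_vcomp_def cmd_vcomp_def Let_def hom2_LAdj)
qed

section \<open>Tight, pseudo and strict 1-cells\<close>

lemma closed_adj_tight: "closed_1cells LAdj_iso adj_tight"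
  unfolding closed_1cells_def
proof (intro conjI ballI allI impI)
  fix x :: "('a, 'b, 'c, 'd) adj" assume "x \<in> Zero LAdj_iso"
  then interpret adjunction x by (simp add: is_adj_iff)
  show "adj_tight (id1 LAdj_iso x)"
    by (simp add: adj_tight_def Let_def comp_fct_id_left[OF L.is_functor_axioms] comp_fct_id_right[OF L.is_functor_axioms])
      (simp add: adj_id1_def)
next
  fix x y z :: "('a, 'b, 'c, 'd) adj" and f g
  assume f: "f \<in> hom1 LAdj_iso x y" and g: "g \<in> hom1 LAdj_iso y z" and t: "adj_tight f" "adj_tight g"
  have [simp]: "Src f = x" "Tgt f = y" "Src g = y" "Tgt g = z" using f g by (simp_all add: hom1_LAdj)
  interpret f: adj_arrow x y "amF f" "amG f" "amz f" using f by (simp add: hom1_LAdj)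
  interpret g: adj_arrow y z "amF g" "amG g" "amz g" using g by (simp add: hom1_LAdj)
  have tf: "comp_fct (adD x) (adL y) (amG f) = comp_fct (adD x) (amF f) (adL x)" "amz f = id_nt (adD x) (adC y) (comp_fct (adD x) (amF f) (adL x))"
    and tg: "comp_fct (adD y) (adL z) (amG g) = comp_fct (adD y) (amF g) (adL y)" "amz g = id_nt (adD y) (adC z) (comp_fct (adD y) (amF g) (adL y))"
    using t by (simp_all add: adj_tight_def Let_def)
  have tf': "onO (adL y) (onO (amG f) A) = onO (amF f) (onO (adL x) A)" if "A \<in> Ob (adD x)" for A
    using comp_fct_simps(1)[OF that, of "adL y" "amG f"] that by (simp add: tf)
  have "comp_fct (adD x) (adL z) (comp_fct (adD x) (amG g) (amG f)) = comp_fct (adD x) (comp_fct (adC x) (amF g) (amF f)) (adL x)"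
    using tf(1) tg(1)
    by (metis comp_fct_assoc[OF f.G.is_functor_axioms] comp_fct_assoc[OF f.S.L.is_functor_axioms])
  moreover have "amz (adj_comp1 g f) = id_nt (adD x) (adC z) (comp_fct (adD x) (comp_fct (adC x) (amF g) (amF f)) (adL x))"
    by (rule nt_eqI[of _ "adD x"]) (simp_all add: adj_comp1_def tf(2) tg(2) tf')
  ultimately show "adj_tight (g \<odot>\<^bsub>LAdj_iso\<^esub> f)"
    by (simp add: adj_tight_def)
qed

lemma closed_adj_pseudo: "closed_1cells LAdj_iso adj_pseudo"
  unfolding closed_1cells_def
proof (intro conjI ballI allI impI)
  fix x :: "('a, 'b, 'c, 'd) adj" assume "x \<in> Zero LAdj_iso"
  then interpret adjunction x by (simp add: is_adj_iff)
  show "adj_pseudo (id1 LAdj_iso x)"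
    by (simp add: adj_pseudo_def mate_eq adj_id1_def adj_mate_id adjunction_axioms)
next
  fix x y z :: "('a, 'b, 'c, 'd) adj" and f g
  assume f: "f \<in> hom1 LAdj_iso x y" and g: "g \<in> hom1 LAdj_iso y z" and t: "adj_pseudo f" "adj_pseudo g"
  have [simp]: "Src f = x" "Tgt f = y" "Src g = y" "Tgt g = z" using f g by (simp_all add: hom1_LAdj)
  interpret f: adj_arrow x y "amF f" "amG f" "amz f" using f by (simp add: hom1_LAdj)
  interpret g: adj_arrow y z "amF g" "amG g" "amz g" using g by (simp add: hom1_LAdj)
  show "adj_pseudo (g \<odot>\<^bsub>LAdj_iso\<^esub> f)"
    using t
    by (simp add: adj_pseudo_def mate_eq)
      (simp add: adj_comp1_def adj_mate_comp[OF f.adj_arrow_axioms g.adj_arrow_axioms] category.iso_Comp)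
qed

lemma closed_adj_strict: "closed_1cells LAdj_iso adj_strict"
  unfolding closed_1cells_def
proof (intro conjI ballI allI impI)
  fix x :: "('a, 'b, 'c, 'd) adj" assume "x \<in> Zero LAdj_iso"
  then interpret adjunction x by (simp add: is_adj_iff)
  show "adj_strict (id1 LAdj_iso x)"
    by (simp add: adj_strict_def Let_def comp_fct_id_left[OF R.is_functor_axioms] comp_fct_id_right[OF R.is_functor_axioms])
      (simp add: mate_eq adj_id1_def adj_mate_id adjunction_axioms)
next
  fix x y z :: "('a, 'b, 'c, 'd) adj" and f g
  assume f: "f \<in> hom1 LAdj_iso x y" and g: "g \<in> hom1 LAdj_iso y z" and t: "adj_strict f" "adj_strict g"
  have [simp]: "Src f = x" "Tgt f = y" "Src g = y" "Tgt g = z" using f g by (simp_all add: hom1_LAdj)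
  interpret f: adj_arrow x y "amF f" "amG f" "amz f" using f by (simp add: hom1_LAdj)
  interpret g: adj_arrow y z "amF g" "amG g" "amz g" using g by (simp add: hom1_LAdj)
  have tf: "comp_fct (adC x) (amG f) (adR x) = comp_fct (adC x) (adR y) (amF f)" "f.mt = id_nt (adC x) (adD y) (comp_fct (adC x) (amG f) (adR x))"
    and tg: "comp_fct (adC y) (amG g) (adR y) = comp_fct (adC y) (adR z) (amF g)" "g.mt = id_nt (adC y) (adD z) (comp_fct (adC y) (amG g) (adR y))"
    using t by (simp_all add: adj_strict_def Let_def mate_eq)
  have tf': "onO (adR y) (onO (amF f) A) = onO (amG f) (onO (adR x) A)" if "A \<in> Ob (adC x)" for A
    using comp_fct_simps(1)[OF that, of "adR y" "amF f"] that by (simp add: tf(1)[symmetric])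
  have "comp_fct (adC x) (comp_fct (adD x) (amG g) (amG f)) (adR x) = comp_fct (adC x) (adR z) (comp_fct (adC x) (amF g) (amF f))"
    using tf(1) tg(1)
    by (metis comp_fct_assoc[OF f.F.is_functor_axioms] comp_fct_assoc[OF f.S.R.is_functor_axioms])
  moreover have "mate (adj_comp1 g f) = id_nt (adC x) (adD z) (comp_fct (adC x) (comp_fct (adD x) (amG g) (amG f)) (adR x))"
  proof (rule nt_eqI[of _ "adC x"])
    fix X assume [simp]: "X \<in> Ob (adC x)"
    have "mate (adj_comp1 g f) X = g.mt (onO (amF f) X) \<cdot>\<^bsub>adD z\<^esub> onA (amG g) (f.mt X)"
      by (simp add: mate_eq) (simp add: adj_comp1_def adj_mate_comp[OF f.adj_arrow_axioms g.adj_arrow_axioms])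
    then show "mate (adj_comp1 g f) X = id_nt (adC x) (adD z) (comp_fct (adC x) (comp_fct (adD x) (amG g) (amG f)) (adR x)) X"
      by (simp add: tf(2) tg(2) tf')
  qed (simp_all add: mate_def Let_def)
  ultimately show "adj_strict (g \<odot>\<^bsub>LAdj_iso\<^esub> f)"
    by (simp add: adj_strict_def)
qed

lemma closed_cmd_pseudo: "closed_1cells Cmd cmd_pseudo"
  unfolding closed_1cells_def
proof (intro conjI ballI allI impI)
  fix x :: "('a, 'b) comonad" assume "x \<in> Zero Cmd"
  then interpret comonad x by (simp add: is_comonad_iff)
  show "cmd_pseudo (id1 Cmd x)"
    by (simp add: cmd_pseudo_def cmd_id1_def)
next
  fix x y z :: "('a, 'b) comonad" and f g
  assume f: "f \<in> hom1 Cmd x y" and g: "g \<in> hom1 Cmd y z" and t: "cmd_pseudo f" "cmd_pseudo g"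
  have [simp]: "Src f = x" "Tgt f = y" "Src g = y" "Tgt g = z" using f g by (simp_all add: hom1_Cmd)
  interpret f: cmd_arrow x y "cmH f" "cmth f" using f by (simp add: hom1_Cmd)
  interpret g: cmd_arrow y z "cmH g" "cmth g" using g by (simp add: hom1_Cmd)
  show "cmd_pseudo (g \<odot>\<^bsub>Cmd\<^esub> f)"
    using t by (simp add: cmd_pseudo_def cmd_comp1_def category.iso_Comp)
qed

lemma closed_cmd_strict: "closed_1cells Cmd cmd_strict"
  unfolding closed_1cells_def
proof (intro conjI ballI allI impI)
  fix x :: "('a, 'b) comonad" assume "x \<in> Zero Cmd"
  then interpret comonad x by (simp add: is_comonad_iff)
  show "cmd_strict (id1 Cmd x)"
    by (simp add: cmd_strict_def Let_def comp_fct_id_left[OF K.is_functor_axioms] comp_fct_id_right[OF K.is_functor_axioms])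
      (simp add: cmd_id1_def)
next
  fix x y z :: "('a, 'b) comonad" and f g
  assume f: "f \<in> hom1 Cmd x y" and g: "g \<in> hom1 Cmd y z" and t: "cmd_strict f" "cmd_strict g"
  have [simp]: "Src f = x" "Tgt f = y" "Src g = y" "Tgt g = z" using f g by (simp_all add: hom1_Cmd)
  interpret f: cmd_arrow x y "cmH f" "cmth f" using f by (simp add: hom1_Cmd)
  interpret g: cmd_arrow y z "cmH g" "cmth g" using g by (simp add: hom1_Cmd)
  have tf: "comp_fct (cmC x) (cmH f) (cmK x) = comp_fct (cmC x) (cmK y) (cmH f)" "cmth f = id_nt (cmC x) (cmC y) (comp_fct (cmC x) (cmH f) (cmK x))"
    and tg: "comp_fct (cmC y) (cmH g) (cmK y) = comp_fct (cmC y) (cmK z) (cmH g)" "cmth g = id_nt (cmC y) (cmC z) (comp_fct (cmC y) (cmH g) (cmK y))"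
    using t by (simp_all add: cmd_strict_def Let_def)
  have tf': "onO (cmK y) (onO (cmH f) A) = onO (cmH f) (onO (cmK x) A)" if "A \<in> Ob (cmC x)" for A
    using comp_fct_simps(1)[OF that, of "cmK y" "cmH f"] that by (simp add: tf(1)[symmetric])
  have "comp_fct (cmC x) (comp_fct (cmC x) (cmH g) (cmH f)) (cmK x) = comp_fct (cmC x) (cmK z) (comp_fct (cmC x) (cmH g) (cmH f))"
    using tf(1) tg(1)
    by (metis comp_fct_assoc[OF f.H.is_functor_axioms] comp_fct_assoc[OF f.S.K.is_functor_axioms])
  moreover have "cmth (cmd_comp1 g f) = id_nt (cmC x) (cmC z) (comp_fct (cmC x) (comp_fct (cmC x) (cmH g) (cmH f)) (cmK x))"
    by (rule nt_eqI[of _ "cmC x"]) (simp_all add: cmd_comp1_def tf(2) tg(2) tf')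
  ultimately show "cmd_strict (g \<odot>\<^bsub>Cmd\<^esub> f)"
    by (simp add: cmd_strict_def)
qed

text \<open>\<open>\<theta>\<close> is \<open>L'\<close> of the mate composed with an inverse of
  \<open>\<zeta>\<close>, and functors preserve isomorphisms.\<close>

lemma C_1_pseudo:
  assumes "is_adj_1cell f" "adj_pseudo f" shows "cmd_pseudo (C_1 f)"
proof -
  interpret adj_arrow "Src f" "Tgt f" "amF f" "amG f" "amz f" using assms by (simp add: is_adj_1cell_iff)
  have "iso (adC (Tgt f)) (tht X)" if [simp]: "X \<in> Ob (adC (Src f))" for X
    using assms(2) by (auto simp: adj_theta_def adj_pseudo_def mate_eq intro!: category.iso_Comp category.iso_inv_ar)
  then show ?thesis by (simp add: cmd_pseudo_def)
qed

text \<open>If the mate is an identity, \<open>\<theta>\<close> is still the inverse of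
  \<open>\<zeta>\<close>; tightness makes this an identity as well. The strict case is therefore
  formulated over tight 1-cells.\<close>

lemma C_1_strict:
  assumes "is_adj_1cell f" "adj_tight f" "adj_strict f" shows "cmd_strict (C_1 f)"
proof -
  let ?x = "Src f" and ?y = "Tgt f"
  interpret adj_arrow ?x ?y "amF f" "amG f" "amz f" using assms by (simp add: is_adj_1cell_iff)
  have t: "comp_fct (adD ?x) (adL ?y) (amG f) = comp_fct (adD ?x) (amF f) (adL ?x)" "amz f = id_nt (adD ?x) (adC ?y) (comp_fct (adD ?x) (amF f) (adL ?x))"
    using assms by (simp_all add: adj_tight_def Let_def)
  have s: "comp_fct (adC ?x) (amG f) (adR ?x) = comp_fct (adC ?x) (adR ?y) (amF f)" "mt = id_nt (adC ?x) (adD ?y) (comp_fct (adC ?x) (amG f) (adR ?x))"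
    using assms by (simp_all add: adj_strict_def Let_def mate_eq)
  have e: "onO (adL ?y) (onO (amG f) A) = onO (amF f) (onO (adL ?x) A)" if "A \<in> Ob (adD ?x)" for A
    using comp_fct_simps(1)[OF that, of "adL ?y" "amG f"] that by (simp add: t)
  have z: "amz f A = Ident (adC ?y) (onO (amF f) (onO (adL ?x) A))" if "A \<in> Ob (adD ?x)" for A
    using that by (simp add: t(2))
  have "tht = id_nt (adC ?x) (adC ?y) (comp_fct (adC ?x) (amF f) (comp_fct (adC ?x) (adL ?x) (adR ?x)))"
    by (rule nt_eqI[of _ "adC ?x"]) (simp_all add: adj_theta_def s(2) z e)
  moreover have "comp_fct (adC ?x) (amF f) (comp_fct (adC ?x) (adL ?x) (adR ?x)) = comp_fct (adC ?x) (comp_fct (adC ?y) (adL ?y) (adR ?y)) (amF f)"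
    using t(1) s(1) by (metis comp_fct_assoc[OF F.is_functor_axioms] comp_fct_assoc[OF S.R.is_functor_axioms])
  ultimately show ?thesis by (simp add: cmd_strict_def)
qed

section \<open>Coalgebras of a comonad, assembled into a strict section of \<open>C\<close>\<close>

section \<open>The Eilenberg--Moore construction\<close>

locale coalg_codes =
  fixes eo :: "'o \<times> 'a \<Rightarrow> 'd" and ea :: "'d \<times> 'a \<times> 'd \<Rightarrow> 'e"
  assumes inj_eo: "inj eo" and inj_ea: "inj ea"
begin

abbreviation cr where "cr \<equiv> carrier_of eo"
abbreviation st where "st \<equiv> struct_of eo"
abbreviation ar where "ar \<equiv> mor_ar ea"
abbreviation EMc where "EMc \<equiv> CoAlg eo ea"

lemma decode [simp]:
  "cr (eo (A, a)) = A" "st (eo (A, a)) = a" "mor_src ea (ea (x, f, y)) = x" "ar (ea (x, f, y)) = f"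
  "mor_tgt ea (ea (x, f, y)) = y"
  using inj_eo inj_ea by (simp_all add: carrier_of_def struct_of_def mor_src_def mor_ar_def mor_tgt_def)

lemma code_eq [simp]: "eo X = eo Y \<longleftrightarrow> X = Y" "ea u = ea v \<longleftrightarrow> u = v"
  using inj_eo inj_ea by (auto dest: injD)

end

locale coalg_cat = coalg_codes eo ea + comonad T
  for eo :: "'o \<times> 'a \<Rightarrow> 'd" and ea :: "'d \<times> 'a \<times> 'd \<Rightarrow> 'e" and T :: "('o, 'a) comonad"
begin

lemma coalg_Ob [simp]: "eo (A, a) \<in> Ob (EMc T) \<longleftrightarrow> A \<in> Ob (cmC T) \<and> a \<in> Ar (cmC T) \<and> Dom (cmC T) a = A \<and>
    Cod (cmC T) a = onO (cmK T) A \<and> cmeps T A \<cdot>\<^bsub>cmC T\<^esub> a = Ident (cmC T) A \<and>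
    cmnu T A \<cdot>\<^bsub>cmC T\<^esub> a = onA (cmK T) a \<cdot>\<^bsub>cmC T\<^esub> a"
  by (auto simp: CoAlg_def coalg_def)

lemma obD [simp]:
  assumes "x \<in> Ob (EMc T)"
  shows "eo (cr x, st x) = x" "cr x \<in> Ob (cmC T)" "st x \<in> Ar (cmC T)" "Dom (cmC T) (st x) = cr x"
    "Cod (cmC T) (st x) = onO (cmK T) (cr x)" "cmeps T (cr x) \<cdot>\<^bsub>cmC T\<^esub> st x = Ident (cmC T) (cr x)"
  using assms by (auto simp: CoAlg_def coalg_def)

lemma st_coassoc: "x \<in> Ob (EMc T) \<Longrightarrow> cmnu T (cr x) \<cdot>\<^bsub>cmC T\<^esub> st x = onA (cmK T) (st x) \<cdot>\<^bsub>cmC T\<^esub> st x"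
  by (auto simp: CoAlg_def coalg_def)

lemma coalg_Ar [simp]: "ea (x, f, y) \<in> Ar (EMc T) \<longleftrightarrow> x \<in> Ob (EMc T) \<and> y \<in> Ob (EMc T) \<and> f \<in> Ar (cmC T) \<and>
    Dom (cmC T) f = cr x \<and> Cod (cmC T) f = cr y \<and> onA (cmK T) f \<cdot>\<^bsub>cmC T\<^esub> st x = st y \<cdot>\<^bsub>cmC T\<^esub> f"
  by (auto simp: CoAlg_def CoAlg_Ar_def coalg_mor_def)

lemma coalg_Dom [simp]: "ea (x, f, y) \<in> Ar (EMc T) \<Longrightarrow> Dom (EMc T) (ea (x, f, y)) = x"
  and coalg_Cod [simp]: "ea (x, f, y) \<in> Ar (EMc T) \<Longrightarrow> Cod (EMc T) (ea (x, f, y)) = y"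
  by (auto simp: CoAlg_def)

lemma coalg_Comp_code: "v \<cdot>\<^bsub>EMc T\<^esub> u = (if u \<in> Ar (EMc T) \<and> v \<in> Ar (EMc T) \<and> mor_tgt ea u = mor_src ea v
       then ea (mor_src ea u, ar v \<cdot>\<^bsub>cmC T\<^esub> ar u, mor_tgt ea v) else undefined)"
  and coalg_Ident: "x \<in> Ob (EMc T) \<Longrightarrow> Ident (EMc T) x = ea (x, Ident (cmC T) (cr x), x)"
  and coalg_ext: "Dom (EMc T) \<in> extensional (Ar (EMc T))" "Cod (EMc T) \<in> extensional (Ar (EMc T))"
    "Ident (EMc T) \<in> extensional (Ob (EMc T))"
  and CoAlg_Ar_eq: "CoAlg_Ar eo ea T = Ar (EMc T)" "eo ` coalg T = Ob (EMc T)"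
  by (simp_all add: CoAlg_def)

lemma arD:
  assumes "u \<in> Ar (EMc T)"
  shows ea_ar: "ea (Dom (EMc T) u, ar u, Cod (EMc T) u) = u"
    and src_Dom [simp]: "mor_src ea u = Dom (EMc T) u" and tgt_Cod [simp]: "mor_tgt ea u = Cod (EMc T) u"
    and Dom_coalg_Ob [simp]: "Dom (EMc T) u \<in> Ob (EMc T)" and Cod_coalg_Ob [simp]: "Cod (EMc T) u \<in> Ob (EMc T)"
    and ar_Ar [simp]: "ar u \<in> Ar (cmC T)" and Dom_ar [simp]: "Dom (cmC T) (ar u) = cr (Dom (EMc T) u)"
    and Cod_ar [simp]: "Cod (cmC T) (ar u) = cr (Cod (EMc T) u)"
    and ar_coalg: "onA (cmK T) (ar u) \<cdot>\<^bsub>cmC T\<^esub> st (Dom (EMc T) u) = st (Cod (EMc T) u) \<cdot>\<^bsub>cmC T\<^esub> ar u"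
proof -
  obtain x f y where u: "u = ea (x, f, y)" using assms by (auto simp: CoAlg_def CoAlg_Ar_def)
  note h = assms[unfolded u] and h' = assms[unfolded u coalg_Ar]
  show "ea (Dom (EMc T) u, ar u, Cod (EMc T) u) = u" "mor_src ea u = Dom (EMc T) u" "mor_tgt ea u = Cod (EMc T) u"
    "Dom (EMc T) u \<in> Ob (EMc T)" "Cod (EMc T) u \<in> Ob (EMc T)" "ar u \<in> Ar (cmC T)" "Dom (cmC T) (ar u) = cr (Dom (EMc T) u)"
    "Cod (cmC T) (ar u) = cr (Cod (EMc T) u)"
    "onA (cmK T) (ar u) \<cdot>\<^bsub>cmC T\<^esub> st (Dom (EMc T) u) = st (Cod (EMc T) u) \<cdot>\<^bsub>cmC T\<^esub> ar u"
    unfolding u coalg_Dom[OF h] coalg_Cod[OF h] using h' by simp_all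
qed

text \<open>Faithfulness of the forgetful functor, in coded form: endpoints and underlying arrow
  determine the code. Equations between coalgebra morphisms are reduced by it to equations in the
  category carrying the comonad.\<close>

lemma coalg_ar_eqI:
  assumes "u \<in> Ar (EMc T)" "v \<in> Ar (EMc T)" "Dom (EMc T) u = Dom (EMc T) v" "Cod (EMc T) u = Cod (EMc T) v" "ar u = ar v"
  shows "u = v"
  by (rule trans[OF ea_ar[OF assms(1), unfolded assms(3-5), symmetric] ea_ar[OF assms(2)]])

lemma coalg_Comp:
  assumes "u \<in> Ar (EMc T)" "v \<in> Ar (EMc T)" "Cod (EMc T) u = Dom (EMc T) v"
  shows "v \<cdot>\<^bsub>EMc T\<^esub> u = ea (Dom (EMc T) u, ar v \<cdot>\<^bsub>cmC T\<^esub> ar u, Cod (EMc T) v)"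
  using assms by (simp add: coalg_Comp_code)

lemma coalg_Comp_Ar:
  assumes "u \<in> Ar (EMc T)" "v \<in> Ar (EMc T)" "Cod (EMc T) u = Dom (EMc T) v"
  shows "ea (Dom (EMc T) u, ar v \<cdot>\<^bsub>cmC T\<^esub> ar u, Cod (EMc T) v) \<in> Ar (EMc T)"
  using assms ar_coalg[of u] ar_coalg[of v]
  by (simp add: reassoc[OF ar_coalg])

lemma ar_Comp [simp]:
  "\<lbrakk>u \<in> Ar (EMc T); v \<in> Ar (EMc T); Cod (EMc T) u = Dom (EMc T) v\<rbrakk> \<Longrightarrow> ar (v \<cdot>\<^bsub>EMc T\<^esub> u) = ar v \<cdot>\<^bsub>cmC T\<^esub> ar u"
  by (simp add: coalg_Comp)

lemma ar_Ident [simp]: "x \<in> Ob (EMc T) \<Longrightarrow> ar (Ident (EMc T) x) = Ident (cmC T) (cr x)"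
  by (simp add: coalg_Ident)

lemma category_CoAlg: "category (EMc T)"
proof (unfold_locales, goal_cases)
    case 1 show ?case using coalg_ext by (auto simp: PiE_iff)
  next
    case 2 show ?case using coalg_ext by (auto simp: PiE_iff)
  next
    case 3 show ?case by (rule coalg_ext)
  next
    case (4 A) then show ?case by (simp add: coalg_Ident)
  next
    case (5 f g)
    then show ?case by (auto simp: coalg_Comp_code)
  next
    case (6 f A B g D) then show ?case using coalg_Comp_Ar[of f g] coalg_Comp[of f g] by (auto simp del: coalg_Ar)
  next
    case (7 f A B)
    then show ?case using coalg_Comp[of "Ident (EMc T) A" f] ea_ar[of f] by (auto simp: coalg_Ident)
  next
    case (8 f A B)
    then show ?case using coalg_Comp[of f "Ident (EMc T) B"] ea_ar[of f] by (auto simp: coalg_Ident)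
  next
    case (9 f A B g D h E)
    then have [simp]: "f \<in> Ar (EMc T)" "g \<in> Ar (EMc T)" "h \<in> Ar (EMc T)" "Cod (EMc T) f = Dom (EMc T) g" "Cod (EMc T) g = Dom (EMc T) h"
      by simp_all
    show ?case using coalg_Comp_Ar[of f g] coalg_Comp_Ar[of g h]
      by (simp add: coalg_Comp del: coalg_Ar)
qed

sublocale EMc: category "EMc T" by (rule category_CoAlg)

text \<open>The forgetful functor reflects isomorphisms: the morphism equation for the inverse
  follows by cancelling the arrow itself. Invertibility of the unit 2-cells, of mates into
  coalgebras, and of one of the cells exhibiting the quasi-inverse is obtained in this way.\<close>

lemma coalg_iso:
  assumes [simp]: "u \<in> Ar (EMc T)" and i: "iso (cmC T) (ar u)"
  shows "iso (EMc T) u"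
proof -
  let ?g = "inv_ar (cmC T) (ar u)"
  let ?x = "Dom (EMc T) u" and ?y = "Cod (EMc T) u"
  have 1: "onA (cmK T) ?g \<cdot>\<^bsub>cmC T\<^esub> onA (cmK T) (ar u) = Ident (cmC T) (onO (cmK T) (cr ?x))"
    using i by (simp flip: K.onA_comp)
  have "onA (cmK T) ?g \<cdot>\<^bsub>cmC T\<^esub> st ?y = st ?x \<cdot>\<^bsub>cmC T\<^esub> ?g"
    by (rule K.C.iso_cancel_right[of _ "ar u"]) (use i in \<open>simp_all add: ar_coalg[symmetric] reassoc[OF 1]\<close>)
  then have A: "ea (?y, ?g, ?x) \<in> Ar (EMc T)" using i by simp
  have "is_inverse (EMc T) u (ea (?y, ?g, ?x))"
    unfolding is_inverse_def in_hom_iff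
    using coalg_Dom[OF A] coalg_Cod[OF A] A i
    by (auto intro!: coalg_ar_eqI simp del: coalg_Ar coalg_Dom coalg_Cod)
  then show ?thesis by (auto simp: iso_def)
qed

lemma EM_U_simps [simp]: "x \<in> Ob (EMc T) \<Longrightarrow> onO (EM_U eo ea T) x = cr x" "u \<in> Ar (EMc T) \<Longrightarrow> onA (EM_U eo ea T) u = ar u"
  by (simp_all add: EM_U_def CoAlg_Ar_eq)

lemma EM_U_functor: "is_functor (EMc T) (cmC T) (EM_U eo ea T)"
  by (rule is_functorI) (simp_all, simp_all add: EM_U_def CoAlg_Ar_eq)

lemma EM_R_simps [simp]: "A \<in> Ob (cmC T) \<Longrightarrow> onO (EM_R eo ea T) A = eo (onO (cmK T) A, cmnu T A)"
  "f \<in> Ar (cmC T) \<Longrightarrow> onA (EM_R eo ea T) f = ea (eo (onO (cmK T) (Dom (cmC T) f), cmnu T (Dom (cmC T) f)),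
     onA (cmK T) f, eo (onO (cmK T) (Cod (cmC T) f), cmnu T (Cod (cmC T) f)))"
  by (simp_all add: EM_R_def Let_def)

lemma cofree_Ar: "f \<in> Ar (cmC T) \<Longrightarrow> ea (eo (onO (cmK T) (Dom (cmC T) f), cmnu T (Dom (cmC T) f)),
     onA (cmK T) f, eo (onO (cmK T) (Cod (cmC T) f), cmnu T (Cod (cmC T) f))) \<in> Ar (EMc T)"
  by (simp add: nu_natural coassoc)

lemma EM_R_functor: "is_functor (cmC T) (EMc T) (EM_R eo ea T)"
proof (rule is_functorI)
  fix f g assume [simp]: "f \<in> Ar (cmC T)" "g \<in> Ar (cmC T)" "Cod (cmC T) f = Dom (cmC T) g"
  have "Cod (EMc T) (onA (EM_R eo ea T) f) = Dom (EMc T) (onA (EM_R eo ea T) g)"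
    using coalg_Cod[OF cofree_Ar[of f]] coalg_Dom[OF cofree_Ar[of g]] by (simp del: coalg_Ar)
  with coalg_Comp[of "onA (EM_R eo ea T) f" "onA (EM_R eo ea T) g"]
  show "onA (EM_R eo ea T) (g \<cdot>\<^bsub>cmC T\<^esub> f) = onA (EM_R eo ea T) g \<cdot>\<^bsub>EMc T\<^esub> onA (EM_R eo ea T) f"
    using cofree_Ar[of f] cofree_Ar[of g] coalg_Dom[OF cofree_Ar[of f]] coalg_Cod[OF cofree_Ar[of g]]
    by (simp del: coalg_Ar)
next
  fix f assume "f \<in> Ar (cmC T)"
  then show "onA (EM_R eo ea T) f \<in> Ar (EMc T) \<and> Dom (EMc T) (onA (EM_R eo ea T) f) = onO (EM_R eo ea T) (Dom (cmC T) f) \<and>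
         Cod (EMc T) (onA (EM_R eo ea T) f) = onO (EM_R eo ea T) (Cod (cmC T) f)"
    using cofree_Ar[of f] coalg_Dom[OF cofree_Ar[of f]] coalg_Cod[OF cofree_Ar[of f]] by (simp del: coalg_Ar)
qed (simp_all add: coalg_Ident coassoc, simp_all add: EM_R_def Let_def)

declare EM_R_simps [simp del]

lemma EM_R_parts [simp]:
  "A \<in> Ob (cmC T) \<Longrightarrow> cr (onO (EM_R eo ea T) A) = onO (cmK T) A" "A \<in> Ob (cmC T) \<Longrightarrow> st (onO (EM_R eo ea T) A) = cmnu T A"
  "f \<in> Ar (cmC T) \<Longrightarrow> ar (onA (EM_R eo ea T) f) = onA (cmK T) f"
  by (simp_all add: EM_R_simps)

lemma EM_adj_simps [simp]:
  "adC (EM_adj eo ea T) = cmC T" "adD (EM_adj eo ea T) = EMc T" "adL (EM_adj eo ea T) = EM_U eo ea T"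
  "adR (EM_adj eo ea T) = EM_R eo ea T" "adeps (EM_adj eo ea T) = cmeps T"
  by (simp_all add: EM_adj_def)

lemma EM_unit_eq: "x \<in> Ob (EMc T) \<Longrightarrow> adeta (EM_adj eo ea T) x = ea (x, st x, onO (EM_R eo ea T) (cr x))"
  by (simp add: EM_adj_def CoAlg_Ar_eq)

lemma EM_unit_parts [simp]:
  assumes "x \<in> Ob (EMc T)"
  shows "adeta (EM_adj eo ea T) x \<in> Ar (EMc T)" "Dom (EMc T) (adeta (EM_adj eo ea T) x) = x"
    "Cod (EMc T) (adeta (EM_adj eo ea T) x) = onO (EM_R eo ea T) (cr x)" "ar (adeta (EM_adj eo ea T) x) = st x"
proof -
  have "ea (x, st x, onO (EM_R eo ea T) (cr x)) \<in> Ar (EMc T)"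
    using assms by (simp add: EM_R_simps st_coassoc coassoc)
  from this coalg_Dom[OF this] coalg_Cod[OF this]
  show "adeta (EM_adj eo ea T) x \<in> Ar (EMc T)" "Dom (EMc T) (adeta (EM_adj eo ea T) x) = x"
    "Cod (EMc T) (adeta (EM_adj eo ea T) x) = onO (EM_R eo ea T) (cr x)" "ar (adeta (EM_adj eo ea T) x) = st x"
    using assms by (simp_all add: EM_unit_eq del: coalg_Ar)
qed

lemma EM_UR: "comp_fct (cmC T) (EM_U eo ea T) (EM_R eo ea T) = cmK T"
proof -
  interpret R: is_functor "cmC T" "EMc T" "EM_R eo ea T" by (rule EM_R_functor)
  show ?thesis
    by (rule fctr_eqI[OF is_functor_comp[OF EM_R_functor EM_U_functor] K.is_functor_axioms]) simp_all
qed

lemma adjunction_EM: "adjunction (EM_adj eo ea T)"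
proof -
  interpret U: is_functor "EMc T" "cmC T" "EM_U eo ea T" by (rule EM_U_functor)
  interpret R: is_functor "cmC T" "EMc T" "EM_R eo ea T" by (rule EM_R_functor)
  have "nat_trans (EMc T) (EMc T) (id_fct (EMc T)) (comp_fct (EMc T) (EM_R eo ea T) (EM_U eo ea T)) (adeta (EM_adj eo ea T))"
  proof (rule nat_transI[OF is_functor_id[OF category_CoAlg] is_functor_comp[OF U.is_functor_axioms R.is_functor_axioms]])
    fix f assume f [simp]: "f \<in> Ar (EMc T)"
    show "adeta (EM_adj eo ea T) (Cod (EMc T) f) \<cdot>\<^bsub>EMc T\<^esub> onA (id_fct (EMc T)) f =
         onA (comp_fct (EMc T) (EM_R eo ea T) (EM_U eo ea T)) f \<cdot>\<^bsub>EMc T\<^esub> adeta (EM_adj eo ea T) (Dom (EMc T) f)"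
      by (rule coalg_ar_eqI) (simp_all add: ar_coalg)
  qed (simp_all, simp add: EM_adj_def CoAlg_Ar_eq)
  moreover have "onA (EM_R eo ea T) (cmeps T A) \<cdot>\<^bsub>EMc T\<^esub> adeta (EM_adj eo ea T) (onO (EM_R eo ea T) A) = Ident (EMc T) (onO (EM_R eo ea T) A)"
    if [simp]: "A \<in> Ob (cmC T)" for A
    by (rule coalg_ar_eqI) simp_all
  ultimately show ?thesis
    unfolding adjunction_def adjunction_axioms_def EM_adj_simps by (simp add: EM_UR)
qed

text \<open>The rewrites let the facts of \<open>adjunction\<close> speak of \<open>T\<close> and
  its coalgebras directly instead of through record selectors.\<close>

sublocale EMa: adjunction "EM_adj eo ea T"
  rewrites "adC (EM_adj eo ea T) = cmC T" and "adD (EM_adj eo ea T) = EMc T" and "adL (EM_adj eo ea T) = EM_U eo ea T"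
    and "adR (EM_adj eo ea T) = EM_R eo ea T" and "adeps (EM_adj eo ea T) = cmeps T"
  by (rule adjunction_EM) simp_all

end

lemma (in coalg_cat) coalg_ob_eqI:
  assumes "x \<in> Ob (EMc T)" "y \<in> Ob (EMc T)" "cr x = cr y" "st x = st y" shows "x = y"
  by (rule trans[OF obD(1)[OF assms(1), unfolded assms(3,4), symmetric] obD(1)[OF assms(2)]])

text \<open>\<open>U R\<close> is \<open>K\<close> on the nose, and the unit at a cofree coalgebra
  has the comultiplication as its underlying arrow.\<close>

lemma (in coalg_cat) C_EM_0: "adj_comonad (EM_adj eo ea T) = T"
proof -
  have "cmnu (adj_comonad (EM_adj eo ea T)) = cmnu T"
    by (rule nt_eqI[of _ "cmC T"]) (simp_all add: nu.nt_ext, simp add: adj_comonad_def)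
  then show ?thesis by (intro comonad.equality) (simp_all add: EM_UR)
qed

locale EM_arrow = coalg_codes eo ea + cmd_arrow x y "cmH f" "cmth f"
  for eo :: "'o \<times> 'a \<Rightarrow> 'd" and ea :: "'d \<times> 'a \<times> 'd \<Rightarrow> 'e" and x y :: "('o, 'a) comonad" and f :: "('o, 'a) cmd_1cell" +
  assumes Src_f [simp]: "Src f = x" and Tgt_f [simp]: "Tgt f = y"
begin

sublocale X: coalg_cat eo ea x by unfold_locales
sublocale Y: coalg_cat eo ea y by unfold_locales

abbreviation EMf where "EMf \<equiv> CoAlg_fct eo ea f"

lemma EMf_code:
  "w \<in> Ob (EMc x) \<Longrightarrow> onO EMf w = eo (onO (cmH f) (cr w), cmth f (cr w) \<cdot>\<^bsub>cmC y\<^esub> onA (cmH f) (st w))"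
  "u \<in> Ar (EMc x) \<Longrightarrow> onA EMf u = ea (onO EMf (Dom (EMc x) u), onA (cmH f) (ar u), onO EMf (Cod (EMc x) u))"
  by (simp_all add: CoAlg_fct_def Let_def X.CoAlg_Ar_eq)

text \<open>The counit law for \<open>\<theta>\<close> gives the counit law of the new structure;
  its comultiplication law together with naturality at the old structure gives
  coassociativity.\<close>

lemma EMf_Ob [simp]:
  assumes [simp]: "w \<in> Ob (EMc x)"
  shows "onO EMf w \<in> Ob (EMc y)" "cr (onO EMf w) = onO (cmH f) (cr w)"
    "st (onO EMf w) = cmth f (cr w) \<cdot>\<^bsub>cmC y\<^esub> onA (cmH f) (st w)"
proof -
  have 1: "onA (cmH f) (cmeps x (cr w)) \<cdot>\<^bsub>cmC y\<^esub> onA (cmH f) (st w) = Ident (cmC y) (onO (cmH f) (cr w))"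
    by (simp flip: H.onA_comp)
  have 2: "onA (cmH f) (cmnu x (cr w)) \<cdot>\<^bsub>cmC y\<^esub> onA (cmH f) (st w) = onA (cmH f) (onA (cmK x) (st w)) \<cdot>\<^bsub>cmC y\<^esub> onA (cmH f) (st w)"
    using X.st_coassoc[of w] by (simp flip: H.onA_comp)
  show "onO EMf w \<in> Ob (EMc y)" "cr (onO EMf w) = onO (cmH f) (cr w)"
    "st (onO EMf w) = cmth f (cr w) \<cdot>\<^bsub>cmC y\<^esub> onA (cmH f) (st w)"
    by (simp_all add: EMf_code reassoc[OF theta_eps] 1 reassoc[OF theta_nu] 2 reassoc[OF theta_natural])
qed

lemma EMf_Ar [simp]:
  assumes [simp]: "u \<in> Ar (EMc x)"
  shows "onA EMf u \<in> Ar (EMc y)" "Dom (EMc y) (onA EMf u) = onO EMf (Dom (EMc x) u)"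
    "Cod (EMc y) (onA EMf u) = onO EMf (Cod (EMc x) u)" "ar (onA EMf u) = onA (cmH f) (ar u)"
proof -
  have 2: "onA (cmH f) (onA (cmK x) (ar u)) \<cdot>\<^bsub>cmC y\<^esub> onA (cmH f) (st (Dom (EMc x) u)) = onA (cmH f) (st (Cod (EMc x) u)) \<cdot>\<^bsub>cmC y\<^esub> onA (cmH f) (ar u)"
    using X.ar_coalg[of u] by (simp flip: H.onA_comp)
  have "ea (onO EMf (Dom (EMc x) u), onA (cmH f) (ar u), onO EMf (Cod (EMc x) u)) \<in> Ar (EMc y)"
    by (simp add: 2[symmetric] reassoc[OF theta_natural])
  from this Y.coalg_Dom[OF this] Y.coalg_Cod[OF this]
  show "onA EMf u \<in> Ar (EMc y)" "Dom (EMc y) (onA EMf u) = onO EMf (Dom (EMc x) u)"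
    "Cod (EMc y) (onA EMf u) = onO EMf (Cod (EMc x) u)" "ar (onA EMf u) = onA (cmH f) (ar u)"
    by (simp_all add: EMf_code(2) del: Y.coalg_Ar)
qed

sublocale EMf: is_functor "EMc x" "EMc y" EMf
proof (rule is_functorI)
  show "onO EMf \<in> extensional (Ob (EMc x))" "onA EMf \<in> extensional (Ar (EMc x))"
    by (simp_all add: CoAlg_fct_def Let_def X.CoAlg_Ar_eq)
qed (simp_all, (rule Y.coalg_ar_eqI; simp)+)

lemma U_EMf: "comp_fct (EMc x) (EM_U eo ea y) EMf = comp_fct (EMc x) (cmH f) (EM_U eo ea x)"
  by (rule fctr_eqI[OF is_functor_comp is_functor_comp,
      OF EMf.is_functor_axioms Y.EM_U_functor X.EM_U_functor H.is_functor_axioms]) simp_all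

lemma EM_1_simps [simp]:
  "Src (EM_1 eo ea f) = EM_adj eo ea x" "Tgt (EM_1 eo ea f) = EM_adj eo ea y" "amF (EM_1 eo ea f) = cmH f"
  "amG (EM_1 eo ea f) = EMf" "w \<in> Ob (EMc x) \<Longrightarrow> amz (EM_1 eo ea f) w = Ident (cmC y) (onO (cmH f) (cr w))"
  by (simp_all add: EM_1_def)

sublocale EM1: adj_arrow "EM_adj eo ea x" "EM_adj eo ea y" "cmH f" EMf "amz (EM_1 eo ea f)"
proof -
  have "nat_trans (EMc x) (cmC y) (comp_fct (EMc x) (EM_U eo ea y) EMf) (comp_fct (EMc x) (cmH f) (EM_U eo ea x)) (amz (EM_1 eo ea f))"
    by (simp add: U_EMf nat_trans_id is_functor_comp[OF X.EM_U_functor H.is_functor_axioms] EM_1_def)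
  then show "adj_arrow (EM_adj eo ea x) (EM_adj eo ea y) (cmH f) EMf (amz (EM_1 eo ea f))"
    by (simp add: adj_arrow_def adj_arrow_axioms_def X.adjunction_EM Y.adjunction_EM)
qed

lemma adj_tight_EM_1: "adj_tight (EM_1 eo ea f)"
  by (simp add: adj_tight_def U_EMf Let_def) (simp add: EM_1_def)

text \<open>With an identity \<open>\<zeta>\<close> the mate has as underlying arrow the structure
  map of the image of a cofree coalgebra followed by \<open>K' H \<epsilon>\<close>; naturality and
  a counit law collapse this to \<open>\<theta>\<close>. Pseudo and strict 1-cells thus pass from
  comonads to adjunctions, and \<open>C\<close> undoes \<open>EM\<close>.\<close>

lemma EM_mate [simp]:
  assumes [simp]: "A \<in> Ob (cmC x)"
  shows "EM1.mt A \<in> Ar (EMc y)" "Dom (EMc y) (EM1.mt A) = onO EMf (onO (EM_R eo ea x) A)"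
    "Cod (EMc y) (EM1.mt A) = onO (EM_R eo ea y) (onO (cmH f) A)" "ar (EM1.mt A) = cmth f A"
proof -
  have 1: "onA (cmK y) (onA (cmH f) (cmeps x A)) \<cdot>\<^bsub>cmC y\<^esub> cmth f (onO (cmK x) A)
      = cmth f A \<cdot>\<^bsub>cmC y\<^esub> onA (cmH f) (onA (cmK x) (cmeps x A))"
    using theta_natural[of "cmeps x A"] by simp
  have 2: "onA (cmH f) (onA (cmK x) (cmeps x A)) \<cdot>\<^bsub>cmC y\<^esub> onA (cmH f) (cmnu x A) = Ident (cmC y) (onO (cmH f) (onO (cmK x) A))"
    by (simp flip: H.onA_comp)
  show "ar (EM1.mt A) = cmth f A"
    by (simp add: adj_mate_def reassoc[OF 1] 2)
  show "EM1.mt A \<in> Ar (EMc y)" "Dom (EMc y) (EM1.mt A) = onO EMf (onO (EM_R eo ea x) A)"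
    "Cod (EMc y) (EM1.mt A) = onO (EM_R eo ea y) (onO (cmH f) A)"
    using EM1.mate_simps[of A] by simp_all
qed

lemma EM_1_pseudo: "cmd_pseudo f \<Longrightarrow> adj_pseudo (EM_1 eo ea f)"
  by (auto simp: adj_pseudo_def mate_eq cmd_pseudo_def intro!: Y.coalg_iso)

lemma EM_1_strict:
  assumes "cmd_strict f" shows "adj_strict (EM_1 eo ea f)"
proof -
  have s: "comp_fct (cmC x) (cmH f) (cmK x) = comp_fct (cmC x) (cmK y) (cmH f)"
    and "cmth f = id_nt (cmC x) (cmC y) (comp_fct (cmC x) (cmH f) (cmK x))"
    using assms by (simp_all add: cmd_strict_def Let_def)
  from this(2) have th: "A \<in> Ob (cmC x) \<Longrightarrow> cmth f A = Ident (cmC y) (onO (cmH f) (onO (cmK x) A))" for A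
    by simp
  have s0: "onO (cmK y) (onO (cmH f) A) = onO (cmH f) (onO (cmK x) A)" if "A \<in> Ob (cmC x)" for A
    using comp_fct_simps(1)[OF that, of "cmK y" "cmH f"] that by (simp add: s[symmetric])
  have s1: "onA (cmK y) (onA (cmH f) u) = onA (cmH f) (onA (cmK x) u)" if "u \<in> Ar (cmC x)" for u
    using comp_fct_simps(2)[OF that, of "cmK y" "cmH f"] that by (simp add: s[symmetric])
  \<comment> \<open>With \<open>\<theta>\<close> an identity its comultiplication law says that
    \<open>H\<close> preserves \<open>\<nu>\<close>; hence cofree coalgebras go to cofree
    coalgebras, not merely to isomorphic ones.\<close>
  have nu: "cmnu y (onO (cmH f) A) = onA (cmH f) (cmnu x A)" if [simp]: "A \<in> Ob (cmC x)" for A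
    using theta_nu[of A] by (simp add: th s0)
  have R0: "onO EMf (onO (EM_R eo ea x) A) = onO (EM_R eo ea y) (onO (cmH f) A)" if [simp]: "A \<in> Ob (cmC x)" for A
    by (rule Y.coalg_ob_eqI) (simp_all add: s0 nu th)
  have "comp_fct (cmC x) EMf (EM_R eo ea x) = comp_fct (cmC x) (EM_R eo ea y) (cmH f)"
  proof (rule fctr_eqI[OF is_functor_comp is_functor_comp, OF X.EM_R_functor EMf.is_functor_axioms H.is_functor_axioms Y.EM_R_functor])
    fix u assume [simp]: "u \<in> Ar (cmC x)"
    show "onA (comp_fct (cmC x) EMf (EM_R eo ea x)) u = onA (comp_fct (cmC x) (EM_R eo ea y) (cmH f)) u"
      by (rule Y.coalg_ar_eqI) (simp_all add: R0 s1)
  qed (simp add: R0)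
  moreover have "EM1.mt = id_nt (cmC x) (EMc y) (comp_fct (cmC x) EMf (EM_R eo ea x))"
  proof (rule nt_eqI[of _ "cmC x"])
    fix A assume [simp]: "A \<in> Ob (cmC x)"
    show "EM1.mt A = id_nt (cmC x) (EMc y) (comp_fct (cmC x) EMf (EM_R eo ea x)) A"
      by (rule Y.coalg_ar_eqI) (simp_all add: R0 th s0)
  qed (simp_all add: adj_mate_def)
  ultimately show ?thesis by (simp add: adj_strict_def mate_eq Let_def)
qed

lemma C_EM_1: "C_1 (EM_1 eo ea f) = f"
proof -
  have "EM1.tht = cmth f"
    by (rule nt_eqI[of _ "cmC x"]) (simp_all add: adj_theta_def th.nt_ext)
  then show ?thesis
    by (intro cmd_1cell.equality) (simp_all add: X.C_EM_0 Y.C_EM_0)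
qed

end

context coalg_codes
begin

lemma EM_arrowI: "f \<in> hom1 Cmd x y \<Longrightarrow> EM_arrow eo ea x y f"
  by (auto simp: hom1_Cmd EM_arrow_def EM_arrow_axioms_def coalg_codes_axioms)

lemma coalg_catI: "comonad T \<Longrightarrow> coalg_cat eo ea T"
  by (simp add: coalg_cat_def coalg_codes_axioms)

lemma EM_1_id:
  assumes "comonad x" shows "EM_1 eo ea (cmd_id1 x) = adj_id1 (EM_adj eo ea x)"
proof -
  interpret EM_arrow eo ea x x "cmd_id1 x" by (rule EM_arrowI) (rule cmd_id1_hom[OF assms])
  have th: "cmth (cmd_id1 x) A = Ident (cmC x) (onO (cmK x) A)" if "A \<in> Ob (cmC x)" for A
    using that by (simp add: cmd_id1_def)
  have e0: "onO EMf w = w" if [simp]: "w \<in> Ob (EMc x)" for w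
    by (rule X.coalg_ob_eqI) (simp_all add: th)
  have "EMf = id_fct (EMc x)"
  proof (rule fctr_eqI[OF EMf.is_functor_axioms is_functor_id])
    fix u assume [simp]: "u \<in> Ar (EMc x)"
    show "onA EMf u = onA (id_fct (EMc x)) u" by (rule X.coalg_ar_eqI) (simp_all add: e0)
  qed (simp_all add: e0)
  moreover have "amz (EM_1 eo ea (cmd_id1 x)) = amz (adj_id1 (EM_adj eo ea x))"
    by (simp add: EM_1_def adj_id1_def comp_fct_id_left[OF X.EM_U_functor])
  ultimately show ?thesis by (intro adj_1cell.equality) simp_all
qed

lemma EM_1_comp:
  assumes f: "f \<in> hom1 Cmd x y" and g: "g \<in> hom1 Cmd y z"
  shows "EM_1 eo ea (cmd_comp1 g f) = adj_comp1 (EM_1 eo ea g) (EM_1 eo ea f)"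
proof -
  interpret f: EM_arrow eo ea x y f by (rule EM_arrowI[OF f])
  interpret g: EM_arrow eo ea y z g by (rule EM_arrowI[OF g])
  interpret gf: EM_arrow eo ea x z "cmd_comp1 g f" by (rule EM_arrowI[OF cmd_comp1_hom[OF f g]])
  have th: "cmth (cmd_comp1 g f) A = cmth g (onO (cmH f) A) \<cdot>\<^bsub>cmC z\<^esub> onA (cmH g) (cmth f A)" if "A \<in> Ob (cmC x)" for A
    using that by (simp add: cmd_comp1_def)
  have e0: "onO gf.EMf w = onO g.EMf (onO f.EMf w)" if [simp]: "w \<in> Ob (EMc x)" for w
    by (rule g.Y.coalg_ob_eqI) (simp_all add: th)
  have "gf.EMf = comp_fct (EMc x) g.EMf f.EMf"
  proof (rule fctr_eqI[OF gf.EMf.is_functor_axioms is_functor_comp[OF f.EMf.is_functor_axioms g.EMf.is_functor_axioms]])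
    fix u assume [simp]: "u \<in> Ar (EMc x)"
    show "onA gf.EMf u = onA (comp_fct (EMc x) g.EMf f.EMf) u" by (rule g.Y.coalg_ar_eqI) (simp_all add: e0)
  qed (simp_all add: e0)
  moreover have "amz (EM_1 eo ea (cmd_comp1 g f)) = amz (adj_comp1 (EM_1 eo ea g) (EM_1 eo ea f))"
    by (rule nt_eqI[of _ "EMc x"]) (simp_all add: adj_comp1_def gf.EM1.ze.nt_ext[simplified])
  ultimately show ?thesis by (intro adj_1cell.equality) simp_all
qed

lemma EM_2_simps [simp]: "Src (EM_2 eo ea \<alpha>) = EM_1 eo ea (Src \<alpha>)" "Tgt (EM_2 eo ea \<alpha>) = EM_1 eo ea (Tgt \<alpha>)"
  "amphi (EM_2 eo ea \<alpha>) = cmphi \<alpha>"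
  by (simp_all add: EM_2_def)

lemma EM_2_ext: "Src (Src \<alpha>) = x \<Longrightarrow> comonad x \<Longrightarrow> ampsi (EM_2 eo ea \<alpha>) \<in> extensional (Ob (EMc x))"
  by (simp add: EM_2_def coalg_cat.CoAlg_Ar_eq(2)[OF coalg_catI])

text \<open>The equation of a \<open>Cmd\<close> 2-cell, combined with naturality of
  \<open>\<phi>\<close> at the structure map, says that \<open>\<phi>\<close> is a coalgebra
  morphism between the two images.\<close>

lemma EM_2_parts:
  assumes f: "f \<in> hom1 Cmd x y" and a: "\<alpha> \<in> hom2 Cmd f g" and w: "w \<in> Ob (EMc x)"
  shows "ampsi (EM_2 eo ea \<alpha>) w \<in> Ar (EMc y)" "Dom (EMc y) (ampsi (EM_2 eo ea \<alpha>) w) = onO (CoAlg_fct eo ea f) w"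
    "Cod (EMc y) (ampsi (EM_2 eo ea \<alpha>) w) = onO (CoAlg_fct eo ea g) w" "ar (ampsi (EM_2 eo ea \<alpha>) w) = cmphi \<alpha> (cr w)"
proof -
  interpret f: EM_arrow eo ea x y f by (rule EM_arrowI[OF f])
  have g: "g \<in> hom1 Cmd x y" using f a by (auto simp: hom1_Cmd hom2_Cmd dest: cmd_2arrowD)
  interpret g: EM_arrow eo ea x y g by (rule EM_arrowI[OF g])
  have a': "Src \<alpha> = f" "Tgt \<alpha> = g" and a2: "cmd_2arrow x y (cmH f) (cmth f) (cmH g) (cmth g) (cmphi \<alpha>)"
    using a by (auto simp: hom2_Cmd)
  interpret \<phi>: nat_trans "cmC x" "cmC y" "cmH f" "cmH g" "cmphi \<alpha>" by (rule cmd_2arrowD(3)[OF a2])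
  have e: "onA (cmK y) (cmphi \<alpha> A) \<cdot>\<^bsub>cmC y\<^esub> cmth f A = cmth g A \<cdot>\<^bsub>cmC y\<^esub> cmphi \<alpha> (onO (cmK x) A)" if "A \<in> Ob (cmC x)" for A
    using a2 that by (simp add: cmd_2arrow_def)
  note [simp] = w
  have n: "cmphi \<alpha> (onO (cmK x) (cr w)) \<cdot>\<^bsub>cmC y\<^esub> onA (cmH f) (st w) = onA (cmH g) (st w) \<cdot>\<^bsub>cmC y\<^esub> cmphi \<alpha> (cr w)"
    using \<phi>.natural[of "st w"] by simp
  have A: "ea (onO f.EMf w, cmphi \<alpha> (cr w), onO g.EMf w) \<in> Ar (EMc y)"
    by (simp add: reassoc[OF e] n)
  have c: "ampsi (EM_2 eo ea \<alpha>) w = ea (onO f.EMf w, cmphi \<alpha> (cr w), onO g.EMf w)"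
    by (simp add: EM_2_def f.X.CoAlg_Ar_eq a')
  show "ampsi (EM_2 eo ea \<alpha>) w \<in> Ar (EMc y)" "Dom (EMc y) (ampsi (EM_2 eo ea \<alpha>) w) = onO f.EMf w"
    "Cod (EMc y) (ampsi (EM_2 eo ea \<alpha>) w) = onO g.EMf w" "ar (ampsi (EM_2 eo ea \<alpha>) w) = cmphi \<alpha> (cr w)"
    unfolding c using A f.Y.coalg_Dom[OF A] f.Y.coalg_Cod[OF A] by (simp_all del: f.Y.coalg_Ar)
qed

lemma EM_2_hom:
  assumes f: "f \<in> hom1 Cmd x y" and a: "\<alpha> \<in> hom2 Cmd f g"
  shows "EM_2 eo ea \<alpha> \<in> hom2 LAdj_iso (EM_1 eo ea f) (EM_1 eo ea g)"
proof -
  interpret f: EM_arrow eo ea x y f by (rule EM_arrowI[OF f])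
  have g: "g \<in> hom1 Cmd x y" using f a by (auto simp: hom1_Cmd hom2_Cmd dest: cmd_2arrowD)
  interpret g: EM_arrow eo ea x y g by (rule EM_arrowI[OF g])
  have a': "Src \<alpha> = f" "Tgt \<alpha> = g" and a2: "cmd_2arrow x y (cmH f) (cmth f) (cmH g) (cmth g) (cmphi \<alpha>)"
    using a by (auto simp: hom2_Cmd)
  interpret \<phi>: nat_trans "cmC x" "cmC y" "cmH f" "cmH g" "cmphi \<alpha>" by (rule cmd_2arrowD(3)[OF a2])
  note p [simp] = EM_2_parts[OF f a]
  have "nat_trans (EMc x) (EMc y) f.EMf g.EMf (ampsi (EM_2 eo ea \<alpha>))"
  proof (rule nat_transI[OF f.EMf.is_functor_axioms g.EMf.is_functor_axioms])
    show "ampsi (EM_2 eo ea \<alpha>) \<in> extensional (Ob (EMc x))" by (rule EM_2_ext) (simp_all add: a' f.S.comonad_axioms)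
    fix u assume [simp]: "u \<in> Ar (EMc x)"
    show "ampsi (EM_2 eo ea \<alpha>) (Cod (EMc x) u) \<cdot>\<^bsub>EMc y\<^esub> onA f.EMf u = onA g.EMf u \<cdot>\<^bsub>EMc y\<^esub> ampsi (EM_2 eo ea \<alpha>) (Dom (EMc x) u)"
      by (rule f.Y.coalg_ar_eqI) (simp_all add: \<phi>.natural)
  qed simp
  then show ?thesis
    by (simp add: hom2_LAdj a' adj_2arrow_def f.EM1.adj_arrow_axioms g.EM1.adj_arrow_axioms)
qed

lemma two_functor_EM: "two_functor Cmd LAdj_iso (EM eo ea)"
proof -
  interpret A: two_category Cmd by (rule two_category_Cmd)
  interpret B: two_category LAdj_iso by (rule two_category_LAdj_iso)
  have EM: "F0 (EM eo ea) = EM_adj eo ea" "F1 (EM eo ea) = EM_1 eo ea" "F2 (EM eo ea) = EM_2 eo ea" by (simp_all add: EM_def)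
  have hom1: "f \<in> hom1 Cmd (Src f) (Tgt f)" if "is_cmd_1cell f" for f using that by (simp add: hom1_Cmd is_cmd_1cell_iff)
  have src: "f \<in> hom1 Cmd (Src f) (Tgt f)" "g \<in> hom1 Cmd (Src f) (Tgt f)" if "\<alpha> \<in> hom2 Cmd f g" for \<alpha> f g
    using that by (auto simp: hom1_Cmd hom2_Cmd dest: cmd_2arrowD)
  have EM1: "EM_1 eo ea f \<in> hom1 LAdj_iso (EM_adj eo ea x) (EM_adj eo ea y)" if "f \<in> hom1 Cmd x y" for f x y
  proof -
    interpret EM_arrow eo ea x y f by (rule EM_arrowI[OF that])
    show ?thesis by (simp add: hom1_LAdj EM1.adj_arrow_axioms)
  qed
  \<comment> \<open>Two 2-cells with the same boundary and the same \<open>\<phi>\<close> agree once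
    the underlying arrows of their \<open>\<psi>\<close> components do. The functor laws on 2-cells
    are checked in this form.\<close>
  have eqI: "\<beta> = \<gamma>" if "\<beta> \<in> hom2 LAdj_iso f' g'" "\<gamma> \<in> hom2 LAdj_iso f' g'" "amphi \<beta> = amphi \<gamma>"
    "f' \<in> hom1 LAdj_iso (EM_adj eo ea x) (EM_adj eo ea y)" "comonad x" "comonad y"
    "\<And>w. w \<in> Ob (EMc x) \<Longrightarrow> ar (ampsi \<beta> w) = ar (ampsi \<gamma> w)" for \<beta> \<gamma> f' g' x y
  proof -
    interpret X: coalg_cat eo ea x by (rule coalg_catI) fact
    interpret Y: coalg_cat eo ea y by (rule coalg_catI) fact
    interpret \<beta>: nat_trans "EMc x" "EMc y" "amG f'" "amG g'" "ampsi \<beta>"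
      using that(1,4) by (auto simp: hom1_LAdj hom2_LAdj adj_2arrow_def)
    interpret \<gamma>: nat_trans "EMc x" "EMc y" "amG f'" "amG g'" "ampsi \<gamma>"
      using that(2,4) by (auto simp: hom1_LAdj hom2_LAdj adj_2arrow_def)
    have "ampsi \<beta> = ampsi \<gamma>"
    proof (rule nt_eqI[OF \<beta>.nt_ext \<gamma>.nt_ext])
      fix w assume "w \<in> Ob (EMc x)"
      then show "ampsi \<beta> w = ampsi \<gamma> w" by (intro Y.coalg_ar_eqI) (simp_all add: that)
    qed
    then show ?thesis using that(1-3) by (auto simp: hom2_LAdj)
  qed
  show ?thesis
  proof (unfold_locales, unfold EM, goal_cases)
    case (1 x) then show ?case by (auto simp: is_adj_iff is_comonad_iff intro: coalg_cat.adjunction_EM coalg_catI)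
  next
    case (2 f x y) then show ?case by (rule EM1)
  next
    case (3 \<alpha> f g) then show ?case using EM_2_hom[OF src(1)] by blast
  next
    case (4 x) then show ?case by (simp add: EM_1_id is_comonad_iff)
  next
    case (5 f x y g z) then show ?case by (simp add: EM_1_comp)
  next
    case (6 f)
    then obtain x y where f: "f \<in> hom1 Cmd x y" using hom1 by auto
    then interpret EM_arrow eo ea x y f by (rule EM_arrowI)
    show ?case
    proof (rule eqI[OF EM_2_hom[OF f A.id2_hom] B.id2_hom])
      fix w assume [simp]: "w \<in> Ob (EMc x)"
      show "ar (ampsi (EM_2 eo ea (id2 Cmd f)) w) = ar (ampsi (id2 LAdj_iso (EM_1 eo ea f)) w)"
        using EM_2_parts(4)[OF f A.id2_hom, of w] 6 by (simp add: adj_id2_def cmd_id2_def)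
    qed (use 6 EM1[OF f] in \<open>auto simp: hom1_LAdj hom1_def S.comonad_axioms T.comonad_axioms cmd_id2_def adj_id2_def\<close>)
  next
    case (7 \<alpha> f g \<beta> h)
    then obtain x y where f: "f \<in> hom1 Cmd x y" and g: "g \<in> hom1 Cmd x y" using src by blast
    interpret EM_arrow eo ea x y f by (rule EM_arrowI[OF f])
    have e7: "Src \<alpha> = f" "Tgt \<alpha> = g" "Src \<beta> = g" "Tgt \<beta> = h" using 7 by (simp_all add: hom2_Cmd)
    show ?case
    proof (rule eqI[OF EM_2_hom[OF f A.vcomp_hom[OF 7]] B.vcomp_hom[OF EM_2_hom[OF f 7(1)] EM_2_hom[OF g 7(2)]]])
      fix w assume [simp]: "w \<in> Ob (EMc x)"
      show "ar (ampsi (EM_2 eo ea (\<beta> \<bullet>\<^bsub>Cmd\<^esub> \<alpha>)) w) = ar (ampsi (EM_2 eo ea \<beta> \<bullet>\<^bsub>LAdj_iso\<^esub> EM_2 eo ea \<alpha>) w)"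
        using EM_2_parts[OF f A.vcomp_hom[OF 7], of w] EM_2_parts[OF f 7(1), of w] EM_2_parts[OF g 7(2), of w] e7
        by (simp add: adj_vcomp_def cmd_vcomp_def Let_def)
    qed (simp add: cmd_vcomp_def adj_vcomp_def Let_def e7, rule EM1[OF f], rule S.comonad_axioms, rule T.comonad_axioms)
  next
    case (8 f x y g z \<alpha> f' \<beta> g')
    have f': "f' \<in> hom1 Cmd x y" and g': "g' \<in> hom1 Cmd y z" using 8 by (auto simp: hom1_Cmd hom2_Cmd dest: cmd_2arrowD)
    interpret f: EM_arrow eo ea x y f by (rule EM_arrowI) fact
    interpret f': EM_arrow eo ea x y f' by (rule EM_arrowI) fact
    interpret g: EM_arrow eo ea y z g by (rule EM_arrowI) fact
    interpret g': EM_arrow eo ea y z g' by (rule EM_arrowI) fact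
    have h: "EM_2 eo ea (\<beta> \<star>\<^bsub>Cmd\<^esub> \<alpha>) \<in> hom2 LAdj_iso (EM_1 eo ea g \<odot>\<^bsub>LAdj_iso\<^esub> EM_1 eo ea f) (EM_1 eo ea g' \<odot>\<^bsub>LAdj_iso\<^esub> EM_1 eo ea f')"
      using EM_2_hom[OF A.comp1_hom[OF 8(1,2)] A.hcomp_hom[OF 8]] by (simp add: EM_1_comp[OF 8(1,2)] EM_1_comp[OF f' g'])
    show ?case
    proof (rule eqI[OF h B.hcomp_hom[OF EM1[OF 8(1)] EM1[OF 8(2)] EM_2_hom[OF 8(1,3)] EM_2_hom[OF 8(2,4)]]])
      fix w assume [simp]: "w \<in> Ob (EMc x)"
      interpret \<phi>: nat_trans "cmC x" "cmC y" "cmH f" "cmH f'" "cmphi \<alpha>"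
        using 8 by (auto simp: hom1_Cmd hom2_Cmd cmd_2arrow_def)
      show "ar (ampsi (EM_2 eo ea (\<beta> \<star>\<^bsub>Cmd\<^esub> \<alpha>)) w) = ar (ampsi (EM_2 eo ea \<beta> \<star>\<^bsub>LAdj_iso\<^esub> EM_2 eo ea \<alpha>) w)"
        using EM_2_parts[OF A.comp1_hom[OF 8(1,2)] A.hcomp_hom[OF 8], of w] EM_2_parts[OF 8(1,3), of w]
          EM_2_parts[OF 8(2,4), of "onO f'.EMf w"] 8
        by (simp add: adj_hcomp_def cmd_hcomp_def Let_def hom2_Cmd)
    next
      show "amphi (EM_2 eo ea (\<beta> \<star>\<^bsub>Cmd\<^esub> \<alpha>)) = amphi (EM_2 eo ea \<beta> \<star>\<^bsub>LAdj_iso\<^esub> EM_2 eo ea \<alpha>)"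
        using 8 by (simp add: cmd_hcomp_def adj_hcomp_def Let_def hom2_Cmd)
    qed (use B.comp1_hom[OF EM1[OF 8(1)] EM1[OF 8(2)]] in \<open>auto simp: f.S.comonad_axioms g.T.comonad_axioms\<close>)
  qed
qed

end

section \<open>Comparison functors as the pseudo-natural unit of the base-level biadjunction\<close>

section \<open>The unit\<close>

lemma nat_trans_inverse:
  assumes "nat_trans C D F G \<tau>" and i: "\<And>A. A \<in> Ob C \<Longrightarrow> iso D (\<tau> A)"
  shows "nat_trans C D G F (\<lambda>A \<in> Ob C. inv_ar D (\<tau> A))"
proof -
  interpret nat_trans C D F G \<tau> by fact
  show ?thesis
  proof (rule nat_transI)
    fix f assume [simp]: "f \<in> Ar C"
    have "inv_ar D (\<tau> (Cod C f)) \<cdot>\<^bsub>D\<^esub> onA G f = onA F f \<cdot>\<^bsub>D\<^esub> inv_ar D (\<tau> (Dom C f))"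
    proof (rule category.iso_cancel_right[of D _ "\<tau> (Dom C f)"])
      show "(inv_ar D (\<tau> (Cod C f)) \<cdot>\<^bsub>D\<^esub> onA G f) \<cdot>\<^bsub>D\<^esub> \<tau> (Dom C f) = (onA F f \<cdot>\<^bsub>D\<^esub> inv_ar D (\<tau> (Dom C f))) \<cdot>\<^bsub>D\<^esub> \<tau> (Dom C f)"
        by (simp add: i natural[symmetric])
    qed (simp_all add: i)
    then show "(\<lambda>A \<in> Ob C. inv_ar D (\<tau> A)) (Cod C f) \<cdot>\<^bsub>D\<^esub> onA G f = onA F f \<cdot>\<^bsub>D\<^esub> (\<lambda>A \<in> Ob C. inv_ar D (\<tau> A)) (Dom C f)"
      by simp
  qed (simp_all add: i)
qed

lemma vcomp_nt_inverse:
  assumes "nat_trans C D F G \<tau>" and i: "\<And>A. A \<in> Ob C \<Longrightarrow> iso D (\<tau> A)"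
  shows "vcomp_nt C D (\<lambda>A \<in> Ob C. inv_ar D (\<tau> A)) \<tau> = id_nt C D F"
    "vcomp_nt C D \<tau> (\<lambda>A \<in> Ob C. inv_ar D (\<tau> A)) = id_nt C D G"
proof -
  interpret nat_trans C D F G \<tau> by fact
  show "vcomp_nt C D (\<lambda>A \<in> Ob C. inv_ar D (\<tau> A)) \<tau> = id_nt C D F"
    "vcomp_nt C D \<tau> (\<lambda>A \<in> Ob C. inv_ar D (\<tau> A)) = id_nt C D G"
    by (rule nt_eqI[of _ C]; simp add: i)+
qed

lemma adj_2cell_comps [simp]:
  "Src (adj_id2 f) = f" "Tgt (adj_id2 f) = f"
  "amphi (adj_id2 f) = id_nt (adC (Src f)) (adC (Tgt f)) (amF f)"
  "ampsi (adj_id2 f) = id_nt (adD (Src f)) (adD (Tgt f)) (amG f)"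
  "Src (adj_vcomp \<beta> \<alpha>) = Src \<alpha>" "Tgt (adj_vcomp \<beta> \<alpha>) = Tgt \<beta>"
  "amphi (adj_vcomp \<beta> \<alpha>) = vcomp_nt (adC (Src (Src \<alpha>))) (adC (Tgt (Src \<alpha>))) (amphi \<beta>) (amphi \<alpha>)"
  "ampsi (adj_vcomp \<beta> \<alpha>) = vcomp_nt (adD (Src (Src \<alpha>))) (adD (Tgt (Src \<alpha>))) (ampsi \<beta>) (ampsi \<alpha>)"
  "Src (adj_hcomp \<beta> \<alpha>) = adj_comp1 (Src \<beta>) (Src \<alpha>)" "Tgt (adj_hcomp \<beta> \<alpha>) = adj_comp1 (Tgt \<beta>) (Tgt \<alpha>)"
  "amphi (adj_hcomp \<beta> \<alpha>) = hcomp_nt (adC (Src (Src \<alpha>))) (adC (Tgt (Src \<beta>))) (amF (Src \<beta>)) (amF (Tgt \<alpha>)) (amphi \<beta>) (amphi \<alpha>)"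
  "ampsi (adj_hcomp \<beta> \<alpha>) = hcomp_nt (adD (Src (Src \<alpha>))) (adD (Tgt (Src \<beta>))) (amG (Src \<beta>)) (amG (Tgt \<alpha>)) (ampsi \<beta>) (ampsi \<alpha>)"
  by (simp_all add: adj_id2_def adj_vcomp_def adj_hcomp_def Let_def)

lemma adj_2arrow_inverse:
  assumes a: "adj_2arrow T T' F G \<zeta> F' G' \<zeta>' \<phi> \<psi>"
    and i1: "\<And>X. X \<in> Ob (adC T) \<Longrightarrow> iso (adC T') (\<phi> X)" and i2: "\<And>A. A \<in> Ob (adD T) \<Longrightarrow> iso (adD T') (\<psi> A)"
  shows "adj_2arrow T T' F' G' \<zeta>' F G \<zeta> (\<lambda>X \<in> Ob (adC T). inv_ar (adC T') (\<phi> X)) (\<lambda>A \<in> Ob (adD T). inv_ar (adD T') (\<psi> A))"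
proof -
  interpret f: adj_arrow T T' F G \<zeta> by (rule adj_2arrowD[OF a])
  interpret f': adj_arrow T T' F' G' \<zeta>' by (rule adj_2arrowD[OF a])
  interpret \<phi>: nat_trans "adC T" "adC T'" F F' \<phi> by (rule adj_2arrowD[OF a])
  interpret \<psi>: nat_trans "adD T" "adD T'" G G' \<psi> by (rule adj_2arrowD[OF a])
  have "inv_ar (adC T') (\<phi> (onO (adL T) A)) \<cdot>\<^bsub>adC T'\<^esub> \<zeta>' A = \<zeta> A \<cdot>\<^bsub>adC T'\<^esub> onA (adL T') (inv_ar (adD T') (\<psi> A))"
    if A [simp]: "A \<in> Ob (adD T)" for A
  proof (rule category.iso_cancel[of "adC T'" "\<phi> (onO (adL T) A)"])
    have "onA (adL T') (\<psi> A) \<cdot>\<^bsub>adC T'\<^esub> onA (adL T') (inv_ar (adD T') (\<psi> A)) = Ident (adC T') (onO (adL T') (onO G' A))"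
      using i2[OF A] by (simp flip: f.T.L.onA_comp)
    then show "\<phi> (onO (adL T) A) \<cdot>\<^bsub>adC T'\<^esub> inv_ar (adC T') (\<phi> (onO (adL T) A)) \<cdot>\<^bsub>adC T'\<^esub> \<zeta>' A =
        \<phi> (onO (adL T) A) \<cdot>\<^bsub>adC T'\<^esub> \<zeta> A \<cdot>\<^bsub>adC T'\<^esub> onA (adL T') (inv_ar (adD T') (\<psi> A))"
      using i1[of "onO (adL T) A"] i2[OF A] adj_2arrowD(5)[OF a, of A] by (simp add: reassoc[OF adj_2arrowD(5)[OF a]])
  qed (use i1[of "onO (adL T) A"] i2[OF A] in simp_all)
  then show ?thesis
    by (simp add: adj_2arrow_def f.adj_arrow_axioms f'.adj_arrow_axioms i1 i2 nat_trans_inverse[OF \<phi>.nat_trans_axioms]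
      nat_trans_inverse[OF \<psi>.nat_trans_axioms])
qed

text \<open>Componentwise inverses of \<open>\<phi>\<close> and \<open>\<psi>\<close> are natural
  and again compatible with the two \<open>\<zeta>\<close>, so invertibility of a 2-cell may be
  tested on components.\<close>

lemma invertible2_LAdj:
  assumes a: "\<alpha> \<in> hom2 LAdj_iso f g" and i1: "\<And>X. X \<in> Ob (adC (Src f)) \<Longrightarrow> iso (adC (Tgt f)) (amphi \<alpha> X)"
    and i2: "\<And>A. A \<in> Ob (adD (Src f)) \<Longrightarrow> iso (adD (Tgt f)) (ampsi \<alpha> A)"
  shows "invertible2 LAdj_iso \<alpha>"
proof -
  have e: "Src \<alpha> = f" "Tgt \<alpha> = g" "Src g = Src f" "Tgt g = Tgt f"
    and a2: "adj_2arrow (Src f) (Tgt f) (amF f) (amG f) (amz f) (amF g) (amG g) (amz g) (amphi \<alpha>) (ampsi \<alpha>)"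
    using a by (auto simp: hom2_LAdj)
  define \<beta> where "\<beta> = \<lparr>Src = g, Tgt = f, amphi = \<lambda>X \<in> Ob (adC (Src f)). inv_ar (adC (Tgt f)) (amphi \<alpha> X),
    ampsi = \<lambda>A \<in> Ob (adD (Src f)). inv_ar (adD (Tgt f)) (ampsi \<alpha> A)\<rparr>"
  have "\<beta> \<in> hom2 LAdj_iso g f"
    using adj_2arrow_inverse[OF a2 i1 i2] by (simp add: hom2_LAdj \<beta>_def e)
  moreover have "adj_vcomp \<beta> \<alpha> = adj_id2 f" "adj_vcomp \<alpha> \<beta> = adj_id2 g"
    using vcomp_nt_inverse[OF adj_2arrowD(3)[OF a2] i1] vcomp_nt_inverse[OF adj_2arrowD(4)[OF a2] i2]
    by (auto intro!: adj_2cell.equality simp: e \<beta>_def)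
  ultimately show ?thesis
    using a unfolding invertible2_def by (auto simp: hom2_def e)
qed

context coalg_codes
begin

text \<open>As the target is an Eilenberg-Moore adjunction, \<open>\<psi>\<close> is determined by
  underlying arrows. The axioms for the unit become equations in the category carrying the
  comonad.\<close>

lemma EM_2cell_eqI:
  assumes "\<beta> \<in> hom2 LAdj_iso f g" "\<gamma> \<in> hom2 LAdj_iso f g" "f \<in> hom1 LAdj_iso T (EM_adj eo ea y)" "comonad y"
    "\<And>X. X \<in> Ob (adC T) \<Longrightarrow> amphi \<beta> X = amphi \<gamma> X" "\<And>A. A \<in> Ob (adD T) \<Longrightarrow> ar (ampsi \<beta> A) = ar (ampsi \<gamma> A)"
  shows "\<beta> = \<gamma>"
proof -
  interpret Y: coalg_cat eo ea y by (rule coalg_catI) fact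
  interpret \<beta>: nat_trans "adD T" "EMc y" "amG f" "amG g" "ampsi \<beta>"
    using assms(1,3) by (auto simp: hom1_LAdj hom2_LAdj adj_2arrow_def)
  interpret \<gamma>: nat_trans "adD T" "EMc y" "amG f" "amG g" "ampsi \<gamma>"
    using assms(2,3) by (auto simp: hom1_LAdj hom2_LAdj adj_2arrow_def)
  interpret \<beta>': nat_trans "adC T" "cmC y" "amF f" "amF g" "amphi \<beta>"
    using assms(1,3) by (auto simp: hom1_LAdj hom2_LAdj adj_2arrow_def)
  interpret \<gamma>': nat_trans "adC T" "cmC y" "amF f" "amF g" "amphi \<gamma>"
    using assms(2,3) by (auto simp: hom1_LAdj hom2_LAdj adj_2arrow_def)
  have "ampsi \<beta> = ampsi \<gamma>"
    by (rule nt_eqI[OF \<beta>.nt_ext \<gamma>.nt_ext], rule Y.coalg_ar_eqI) (simp_all add: assms)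
  moreover have "amphi \<beta> = amphi \<gamma>" by (rule nt_eqI[OF \<beta>'.nt_ext \<gamma>'.nt_ext]) (rule assms)
  ultimately show ?thesis using assms(1,2) by (auto simp: hom2_LAdj)
qed

end

locale EM_unit_loc = coalg_codes eo ea + adjunction T
  for eo :: "'o \<times> 'a \<Rightarrow> 'd" and ea :: "'d \<times> 'a \<times> 'd \<Rightarrow> 'e" and T :: "('o, 'a, 'd, 'e) adj"
begin

lemma comonad_T: "comonad (adj_comonad T)" by (rule comonad_adj_comonad) (rule adjunction_axioms)

sublocale Q: coalg_cat eo ea "adj_comonad T"
  rewrites "cmC (adj_comonad T) = adC T" and "cmeps (adj_comonad T) = adeps T"
  by (rule coalg_catI[OF comonad_T]) simp_all

abbreviation KT where "KT \<equiv> comparison eo ea T"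
abbreviation cT where "cT \<equiv> adj_comonad T"

lemma L_eta_natural: "f \<in> Ar (adD T) \<Longrightarrow> onA (adL T) (adeta T (Cod (adD T) f)) \<cdot>\<^bsub>adC T\<^esub> onA (adL T) f
      = onA (adL T) (onA (adR T) (onA (adL T) f)) \<cdot>\<^bsub>adC T\<^esub> onA (adL T) (adeta T (Dom (adD T) f))"
  using eta_natural[of f] by (simp flip: L.onA_comp)

text \<open>The counit law is a triangle identity, and coassociativity is naturality of
  \<open>\<eta>\<close> at its own component.\<close>

lemma comparison_Ob [simp]:
  assumes [simp]: "A \<in> Ob (adD T)"
  shows "onO KT A \<in> Ob (EMc cT)" "cr (onO KT A) = onO (adL T) A" "st (onO KT A) = onA (adL T) (adeta T A)"
  using L_eta_natural[of "adeta T A"] by (simp_all add: comparison_def Let_def)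

lemma comparison_code: "f \<in> Ar (adD T) \<Longrightarrow> onA KT f = ea (onO KT (Dom (adD T) f), onA (adL T) f, onO KT (Cod (adD T) f))"
  by (simp add: comparison_def Let_def)

lemma comparison_Ar [simp]:
  assumes [simp]: "f \<in> Ar (adD T)"
  shows "onA KT f \<in> Ar (EMc cT)" "Dom (EMc cT) (onA KT f) = onO KT (Dom (adD T) f)"
    "Cod (EMc cT) (onA KT f) = onO KT (Cod (adD T) f)" "ar (onA KT f) = onA (adL T) f"
proof -
  have "ea (onO KT (Dom (adD T) f), onA (adL T) f, onO KT (Cod (adD T) f)) \<in> Ar (EMc cT)"
    by (simp add: L_eta_natural)
  from this Q.coalg_Dom[OF this] Q.coalg_Cod[OF this]
  show "onA KT f \<in> Ar (EMc cT)" "Dom (EMc cT) (onA KT f) = onO KT (Dom (adD T) f)"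
    "Cod (EMc cT) (onA KT f) = onO KT (Cod (adD T) f)" "ar (onA KT f) = onA (adL T) f"
    by (simp_all add: comparison_code del: Q.coalg_Ar)
qed

sublocale KT: is_functor "adD T" "EMc cT" KT
proof (rule is_functorI)
  show "onO KT \<in> extensional (Ob (adD T))" "onA KT \<in> extensional (Ar (adD T))"
    by (simp_all add: comparison_def Let_def)
qed (simp_all, (rule Q.coalg_ar_eqI; simp)+)

lemma U_KT: "comp_fct (adD T) (EM_U eo ea cT) KT = adL T"
proof -
  show ?thesis
    by (rule fctr_eqI[OF is_functor_comp[OF KT.is_functor_axioms Q.EM_U_functor] L.is_functor_axioms]) simp_all
qed

lemma EM_unit1_simps [simp]:
  "Src (EM_unit1 eo ea T) = T" "Tgt (EM_unit1 eo ea T) = EM_adj eo ea cT" "amF (EM_unit1 eo ea T) = id_fct (adC T)"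
  "amG (EM_unit1 eo ea T) = KT" "A \<in> Ob (adD T) \<Longrightarrow> amz (EM_unit1 eo ea T) A = Ident (adC T) (onO (adL T) A)"
  by (simp_all add: EM_unit1_def)

sublocale un: adj_arrow T "EM_adj eo ea cT" "id_fct (adC T)" KT "amz (EM_unit1 eo ea T)"
proof -
  have "adjunction (EM_adj eo ea cT)" by (rule coalg_cat.adjunction_EM) (rule coalg_catI[OF comonad_T])
  then show "adj_arrow T (EM_adj eo ea cT) (id_fct (adC T)) KT (amz (EM_unit1 eo ea T))"
    by (simp add: adj_arrow_def adj_arrow_axioms_def adjunction_axioms is_functor_id U_KT comp_fct_id_left[OF L.is_functor_axioms]
      EM_unit1_def nat_trans_id)
qed

lemma EM_unit1_hom: "EM_unit1 eo ea T \<in> hom1 LAdj_iso T (EM_adj eo ea cT)"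
  by (simp add: hom1_LAdj un.adj_arrow_axioms)

lemma EM_unit1_tight: "adj_tight (EM_unit1 eo ea T)"
  by (simp add: adj_tight_def Let_def U_KT comp_fct_id_left[OF L.is_functor_axioms]) (simp add: EM_unit1_def)

text \<open>The underlying arrow of the mate is \<open>L\<close> of a triangle identity. Unit
  components are therefore both pseudo and strict and stay inside every class of 1-cells
  considered.\<close>

lemma unit_mate [simp]:
  assumes [simp]: "A \<in> Ob (adC T)"
  shows "un.mt A \<in> Ar (EMc cT)" "Dom (EMc cT) (un.mt A) = onO KT (onO (adR T) A)"
    "Cod (EMc cT) (un.mt A) = onO (EM_R eo ea cT) A" "ar (un.mt A) = Ident (adC T) (onO (adL T) (onO (adR T) A))"
proof -
  have "onA (adL T) (onA (adR T) (adeps T A)) \<cdot>\<^bsub>adC T\<^esub> onA (adL T) (adeta T (onO (adR T) A)) = Ident (adC T) (onO (adL T) (onO (adR T) A))"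
    by (simp flip: L.onA_comp)
  then show "ar (un.mt A) = Ident (adC T) (onO (adL T) (onO (adR T) A))"
    by (simp add: adj_mate_def)
  show "un.mt A \<in> Ar (EMc cT)" "Dom (EMc cT) (un.mt A) = onO KT (onO (adR T) A)"
    "Cod (EMc cT) (un.mt A) = onO (EM_R eo ea cT) A"
    using un.mate_simps[of A] by simp_all
qed

text \<open>Both sides have carrier \<open>L R A\<close>, and the structure \<open>L \<eta>\<close>
  at \<open>R A\<close> is by definition the comultiplication of the induced comonad.\<close>

lemma KT_R: "A \<in> Ob (adC T) \<Longrightarrow> onO KT (onO (adR T) A) = onO (EM_R eo ea cT) A"
  by (rule Q.coalg_ob_eqI) simp_all

lemma EM_unit1_strict: "adj_strict (EM_unit1 eo ea T)"
proof -
  have "comp_fct (adC T) KT (adR T) = comp_fct (adC T) (EM_R eo ea cT) (id_fct (adC T))"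
    unfolding comp_fct_id_right[OF Q.EM_R_functor]
  proof (rule fctr_eqI[OF is_functor_comp[OF R.is_functor_axioms KT.is_functor_axioms] Q.EM_R_functor])
    fix u assume [simp]: "u \<in> Ar (adC T)"
    show "onA (comp_fct (adC T) KT (adR T)) u = onA (EM_R eo ea cT) u" by (rule Q.coalg_ar_eqI) (simp_all add: KT_R)
  qed (simp add: KT_R)
  moreover have "un.mt = id_nt (adC T) (EMc cT) (comp_fct (adC T) KT (adR T))"
  proof (rule nt_eqI[of _ "adC T"])
    fix A assume [simp]: "A \<in> Ob (adC T)"
    show "un.mt A = id_nt (adC T) (EMc cT) (comp_fct (adC T) KT (adR T)) A"
      by (rule Q.coalg_ar_eqI) (simp_all add: KT_R)
  qed (simp_all add: adj_mate_def)
  ultimately show ?thesis by (simp add: adj_strict_def mate_eq Let_def)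
qed

lemma EM_unit1_pseudo: "adj_pseudo (EM_unit1 eo ea T)"
  by (auto simp: adj_pseudo_def mate_eq intro!: Q.coalg_iso)

lemma C_unit1: "C_1 (EM_unit1 eo ea T) = cmd_id1 cT"
proof -
  have c: "adj_comonad (EM_adj eo ea cT) = cT" by (rule coalg_cat.C_EM_0) (rule coalg_catI[OF comonad_T])
  have "un.tht = id_nt (adC T) (adC T) (comp_fct (adC T) (adL T) (adR T))"
    by (rule nt_eqI[of _ "adC T"]) (simp_all add: adj_theta_def)
  then show ?thesis
    by (intro cmd_1cell.equality) (simp_all add: c cmd_id1_def)
qed

end


text \<open>The comparison functor rebuilds the code of a coalgebra from its carrier and structure,
  hence returns the same code. With coded coalgebras it is the identity functor, not just an
  isomorphism.\<close>

lemma (in coalg_codes) EM_unit1_EM: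
  assumes "comonad x" shows "EM_unit1 eo ea (EM_adj eo ea x) = adj_id1 (EM_adj eo ea x)"
proof -
  interpret X: coalg_cat eo ea x by (rule coalg_catI) fact
  have "comparison eo ea (EM_adj eo ea x) = id_fct (EMc x)"
  proof (rule fctr.equality)
    show "onO (comparison eo ea (EM_adj eo ea x)) = onO (id_fct (EMc x))"
      by (auto simp: comparison_def id_fct_def Let_def fun_eq_iff)
    show "onA (comparison eo ea (EM_adj eo ea x)) = onA (id_fct (EMc x))"
      by (auto simp: comparison_def id_fct_def Let_def fun_eq_iff X.ea_ar)
  qed simp
  then show ?thesis
    by (intro adj_1cell.equality) (simp_all add: EM_unit1_def adj_id1_def X.C_EM_0)
qed

locale EM_unit_cell = coalg_codes eo ea + adj_arrow T T' "amF f" "amG f" "amz f"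
  for eo :: "'o \<times> 'a \<Rightarrow> 'd" and ea :: "'d \<times> 'a \<times> 'd \<Rightarrow> 'e" and T T' :: "('o, 'a, 'd, 'e) adj"
    and f :: "('o, 'a, 'd, 'e) adj_1cell" +
  assumes Src_f [simp]: "Src f = T" and Tgt_f [simp]: "Tgt f = T'"
begin

sublocale S: EM_unit_loc eo ea T by unfold_locales
sublocale T: EM_unit_loc eo ea T' by unfold_locales

lemma hom_f: "f \<in> hom1 LAdj_iso T T'"
  by (simp add: hom1_LAdj adj_arrow_axioms)

lemma C_hom: "C_1 f \<in> hom1 Cmd S.cT T.cT"
  by (simp add: hom1_Cmd cmd_arrow_theta)

sublocale Cf: EM_arrow eo ea "adj_comonad T" "adj_comonad T'" "C_1 f"
  rewrites "cmC (adj_comonad T) = adC T" and "cmeps (adj_comonad T) = adeps T"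
    and "cmC (adj_comonad T') = adC T'" and "cmeps (adj_comonad T') = adeps T'"
    and "cmH (C_1 f) = amF f" and "cmth (C_1 f) = tht"
  by (rule EM_arrowI[OF C_hom]) simp_all

abbreviation src2c where "src2c \<equiv> adj_comp1 (EM_unit1 eo ea T') f"
abbreviation tgt2c where "tgt2c \<equiv> adj_comp1 (EM_1 eo ea (C_1 f)) (EM_unit1 eo ea T)"

lemma EM1_hom: "EM_1 eo ea (C_1 f) \<in> hom1 LAdj_iso (EM_adj eo ea S.cT) (EM_adj eo ea T.cT)"
  by (simp add: hom1_LAdj) (rule Cf.EM1.adj_arrow_axioms)

lemma src_tgt_hom: "src2c \<in> hom1 LAdj_iso T (EM_adj eo ea T.cT)" "tgt2c \<in> hom1 LAdj_iso T (EM_adj eo ea T.cT)"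
  by (rule adj_comp1_hom[OF hom_f T.EM_unit1_hom], rule adj_comp1_hom[OF S.EM_unit1_hom EM1_hom])

lemma EM_unit2_simps [simp]: "Src (EM_unit2 eo ea f) = src2c" "Tgt (EM_unit2 eo ea f) = tgt2c"
  "amphi (EM_unit2 eo ea f) = id_nt (adC T) (adC T') (amF f)"
  by (simp_all add: EM_unit2_def Let_def)

lemma EM_unit2_code: "A \<in> Ob (adD T)
    \<Longrightarrow> ampsi (EM_unit2 eo ea f) A = ea (onO T.KT (onO (amG f) A), amz f A, onO Cf.EMf (onO S.KT A))"
  by (simp add: EM_unit2_def Let_def)

lemma EM_unit2_psi [simp]:
  assumes [simp]: "A \<in> Ob (adD T)"
  shows "ampsi (EM_unit2 eo ea f) A \<in> Ar (EMc T.cT)" "Dom (EMc T.cT) (ampsi (EM_unit2 eo ea f) A) = onO T.KT (onO (amG f) A)"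
    "Cod (EMc T.cT) (ampsi (EM_unit2 eo ea f) A) = onO Cf.EMf (onO S.KT A)" "ar (ampsi (EM_unit2 eo ea f) A) = amz f A"
proof -
  have "ea (onO T.KT (onO (amG f) A), amz f A, onO Cf.EMf (onO S.KT A)) \<in> Ar (EMc T.cT)"
    by (simp add: theta_unit)
  from this T.Q.coalg_Dom[OF this] T.Q.coalg_Cod[OF this]
  show "ampsi (EM_unit2 eo ea f) A \<in> Ar (EMc T.cT)" "Dom (EMc T.cT) (ampsi (EM_unit2 eo ea f) A) = onO T.KT (onO (amG f) A)"
    "Cod (EMc T.cT) (ampsi (EM_unit2 eo ea f) A) = onO Cf.EMf (onO S.KT A)" "ar (ampsi (EM_unit2 eo ea f) A) = amz f A"
    by (simp_all add: EM_unit2_code del: T.Q.coalg_Ar)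
qed

lemma EM_unit2_hom: "EM_unit2 eo ea f \<in> hom2 LAdj_iso src2c tgt2c"
proof -
  have 1: "nat_trans (adD T) (EMc T.cT) (comp_fct (adD T) T.KT (amG f)) (comp_fct (adD T) Cf.EMf S.KT) (ampsi (EM_unit2 eo ea f))"
  proof (rule nat_transI[OF is_functor_comp is_functor_comp, OF G.is_functor_axioms T.KT.is_functor_axioms S.KT.is_functor_axioms Cf.EMf.is_functor_axioms])
    fix g assume [simp]: "g \<in> Ar (adD T)"
    show "ampsi (EM_unit2 eo ea f) (Cod (adD T) g) \<cdot>\<^bsub>EMc T.cT\<^esub> onA (comp_fct (adD T) T.KT (amG f)) g =
      onA (comp_fct (adD T) Cf.EMf S.KT) g \<cdot>\<^bsub>EMc T.cT\<^esub> ampsi (EM_unit2 eo ea f) (Dom (adD T) g)"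
      by (rule T.Q.coalg_ar_eqI) (simp_all add: zeta_natural)
  qed (simp_all, simp add: EM_unit2_def Let_def)
  show ?thesis
    using src_tgt_hom 1
    by (simp add: hom2_LAdj hom1_LAdj adj_2arrow_def comp_fct_id_left[OF F.is_functor_axioms] comp_fct_id_right[OF F.is_functor_axioms] nat_trans_id)
      (simp add: adj_comp1_def)
qed

lemma EM_unit2_invertible: "invertible2 LAdj_iso (EM_unit2 eo ea f)"
  by (rule invertible2_LAdj[OF EM_unit2_hom]) (auto intro!: T.Q.coalg_iso)

text \<open>When \<open>\<zeta>\<close> is an identity, \<open>theta_unit\<close> becomes an
  equality of coalgebra structures, so the two legs of the naturality square coincide and coded
  identity arrows fill it. This is the 2-naturality behind the reflection.\<close>

lemma EM_unit2_tight:
  assumes "adj_tight f" shows "EM_unit2 eo ea f = adj_id2 src2c"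
proof -
  have t: "comp_fct (adD T) (adL T') (amG f) = comp_fct (adD T) (amF f) (adL T)"
    and "amz f = id_nt (adD T) (adC T') (comp_fct (adD T) (amF f) (adL T))"
    using assms by (simp_all add: adj_tight_def Let_def)
  from this(2) have z: "amz f A = Ident (adC T') (onO (amF f) (onO (adL T) A))" if "A \<in> Ob (adD T)" for A
    using that by simp
  have t0: "onO (adL T') (onO (amG f) A) = onO (amF f) (onO (adL T) A)" if "A \<in> Ob (adD T)" for A
    using comp_fct_simps(1)[OF that, of "adL T'" "amG f"] that by (simp add: t)
  have t1: "onA (adL T') (onA (amG f) u) = onA (amF f) (onA (adL T) u)" if "u \<in> Ar (adD T)" for u
    using comp_fct_simps(2)[OF that, of "adL T'" "amG f"] that by (simp add: t)
  have u: "onA (adL T') (adeta T' (onO (amG f) A)) = tht (onO (adL T) A) \<cdot>\<^bsub>adC T'\<^esub> onA (amF f) (onA (adL T) (adeta T A))"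
    if [simp]: "A \<in> Ob (adD T)" for A
    using theta_unit[of A] by (simp add: z t0)
  have e0: "onO T.KT (onO (amG f) A) = onO Cf.EMf (onO S.KT A)" if [simp]: "A \<in> Ob (adD T)" for A
    by (rule T.Q.coalg_ob_eqI) (simp_all add: t0 u)
  have e: "comp_fct (adD T) T.KT (amG f) = comp_fct (adD T) Cf.EMf S.KT"
  proof (rule fctr_eqI[OF is_functor_comp is_functor_comp, OF G.is_functor_axioms T.KT.is_functor_axioms S.KT.is_functor_axioms Cf.EMf.is_functor_axioms])
    fix g assume [simp]: "g \<in> Ar (adD T)"
    show "onA (comp_fct (adD T) T.KT (amG f)) g = onA (comp_fct (adD T) Cf.EMf S.KT) g"
      by (rule T.Q.coalg_ar_eqI) (simp_all add: e0 t1)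
  qed (simp add: e0)
  have "amz src2c = amz tgt2c"
    by (rule nt_eqI[of _ "adD T"]) (simp_all add: adj_comp1_def z t0)
  then have st: "src2c = tgt2c"
    by (intro adj_1cell.equality) (simp_all add: e comp_fct_id_left[OF F.is_functor_axioms] comp_fct_id_right[OF F.is_functor_axioms])
  have i: "adj_id2 src2c \<in> hom2 LAdj_iso src2c src2c"
    using two_category.id2_hom[OF two_category_LAdj_iso, of src2c] src_tgt_hom by (simp add: hom1_def)
  show ?thesis
    by (rule EM_2cell_eqI[OF EM_unit2_hom[folded st] i src_tgt_hom(1) T.comonad_T]) (simp_all add: z t0)
qed

end

context coalg_codes
begin

lemma EM_unit_locI: "adjunction T \<Longrightarrow> EM_unit_loc eo ea T"
  by (simp add: EM_unit_loc_def coalg_codes_axioms)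

lemma EM_unit_cellI: "f \<in> hom1 LAdj_iso x y \<Longrightarrow> EM_unit_cell eo ea x y f"
  by (auto simp: hom1_LAdj EM_unit_cell_def EM_unit_cell_axioms_def coalg_codes_axioms)

lemma EM_simps [simp]: "F0 (EM eo ea) = EM_adj eo ea" "F1 (EM eo ea) = EM_1 eo ea" "F2 (EM eo ea) = EM_2 eo ea"
  "pn1 (EM_unit eo ea) = EM_unit1 eo ea" "pn2 (EM_unit eo ea) = EM_unit2 eo ea"
  by (simp_all add: EM_def EM_unit_def)

text \<open>On underlying arrows the square is the defining equation of the 2-cell
  \<open>(\<phi>, \<psi>)\<close>, relating it to the two \<open>\<zeta>\<close>.\<close>

lemma EM_unit2_natural:
  assumes f: "f \<in> hom1 LAdj_iso x y" and a: "\<alpha> \<in> hom2 LAdj_iso f g"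
  shows "adj_vcomp (EM_unit2 eo ea g) (adj_hcomp (adj_id2 (EM_unit1 eo ea y)) \<alpha>)
    = adj_vcomp (adj_hcomp (EM_2 eo ea (C_2 \<alpha>)) (adj_id2 (EM_unit1 eo ea x))) (EM_unit2 eo ea f)"
proof -
  interpret A: two_category LAdj_iso by (rule two_category_LAdj_iso)
  interpret C: two_functor LAdj_iso Cmd C_2fun by (rule two_functor_C)
  have g: "g \<in> hom1 LAdj_iso x y" using f a by (auto simp: hom1_LAdj hom2_LAdj dest: adj_2arrowD)
  interpret f: EM_unit_cell eo ea x y f by (rule EM_unit_cellI[OF f])
  interpret g: EM_unit_cell eo ea x y g by (rule EM_unit_cellI[OF g])
  have s [simp]: "Src \<alpha> = f" "Tgt \<alpha> = g" and a2: "adj_2arrow x y (amF f) (amG f) (amz f) (amF g) (amG g) (amz g) (amphi \<alpha>) (ampsi \<alpha>)"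
    using a by (auto simp: hom2_LAdj)
  interpret \<phi>: nat_trans "adC x" "adC y" "amF f" "amF g" "amphi \<alpha>" by (rule adj_2arrowD[OF a2])
  interpret \<psi>: nat_trans "adD x" "adD y" "amG f" "amG g" "ampsi \<alpha>" by (rule adj_2arrowD[OF a2])
  have Ca: "C_2 \<alpha> \<in> hom2 Cmd (C_1 f) (C_1 g)" using C.F2_hom[OF a] by simp
  note p [simp] = EM_2_parts[OF f.C_hom Ca]
  note ux = A.id2_hom[of "EM_unit1 eo ea x"] and uy = A.id2_hom[of "EM_unit1 eo ea y"]
  have ux1: "EM_unit1 eo ea x \<in> One LAdj_iso" "EM_unit1 eo ea y \<in> One LAdj_iso"
    using f.S.EM_unit1_hom f.T.EM_unit1_hom by (simp_all add: hom1_def)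
  have l: "adj_vcomp (EM_unit2 eo ea g) (adj_hcomp (adj_id2 (EM_unit1 eo ea y)) \<alpha>) \<in> hom2 LAdj_iso f.src2c g.tgt2c"
    using A.vcomp_hom[OF A.hcomp_hom[OF f f.T.EM_unit1_hom a uy[OF ux1(2)]] ] g.EM_unit2_hom by simp
  have r: "adj_vcomp (adj_hcomp (EM_2 eo ea (C_2 \<alpha>)) (adj_id2 (EM_unit1 eo ea x))) (EM_unit2 eo ea f) \<in> hom2 LAdj_iso f.src2c g.tgt2c"
    using A.vcomp_hom[OF f.EM_unit2_hom A.hcomp_hom[OF f.S.EM_unit1_hom f.EM1_hom ux[OF ux1(1)] EM_2_hom[OF f.C_hom Ca], simplified]] by simp
  show ?thesis
  proof (rule EM_2cell_eqI[OF l r f.src_tgt_hom(1) f.T.comonad_T])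
    fix X assume [simp]: "X \<in> Ob (adC x)"
    show "amphi (adj_vcomp (EM_unit2 eo ea g) (adj_hcomp (adj_id2 (EM_unit1 eo ea y)) \<alpha>)) X
      = amphi (adj_vcomp (adj_hcomp (EM_2 eo ea (C_2 \<alpha>)) (adj_id2 (EM_unit1 eo ea x))) (EM_unit2 eo ea f)) X"
      by simp
  next
    fix A assume [simp]: "A \<in> Ob (adD x)"
    show "ar (ampsi (adj_vcomp (EM_unit2 eo ea g) (adj_hcomp (adj_id2 (EM_unit1 eo ea y)) \<alpha>)) A)
      = ar (ampsi (adj_vcomp (adj_hcomp (EM_2 eo ea (C_2 \<alpha>)) (adj_id2 (EM_unit1 eo ea x))) (EM_unit2 eo ea f)) A)"
      using adj_2arrowD(5)[OF a2, of A] by simp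
  qed
qed

lemma EM_unit2_id:
  assumes "adjunction x" shows "EM_unit2 eo ea (adj_id1 x) = adj_id2 (EM_unit1 eo ea x)"
proof -
  interpret adjunction x by fact
  have "adj_tight (adj_id1 x)"
    using closed_adj_tight assms by (auto simp: closed_1cells_def is_adj_iff)
  then have "EM_unit2 eo ea (adj_id1 x) = adj_id2 (adj_comp1 (EM_unit1 eo ea x) (adj_id1 x))"
    using EM_unit_cell.EM_unit2_tight[OF EM_unit_cellI[OF adj_id1_hom[OF assms]]] by simp
  then show ?thesis
    using adj_comp1_id1(1)[OF EM_unit_loc.EM_unit1_hom[OF EM_unit_locI[OF assms]]] by simp
qed

text \<open>On underlying arrows this is the formula for the \<open>\<zeta>\<close> of a composite.
  The remaining work is on boundaries: the pasted cells become composable only after reassociating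
  1-cells and using that \<open>EM\<close> and \<open>C\<close> preserve composition.\<close>

lemma EM_unit2_comp:
  assumes f: "f \<in> hom1 LAdj_iso x y" and g: "g \<in> hom1 LAdj_iso y z"
  shows "EM_unit2 eo ea (adj_comp1 g f) = adj_vcomp (adj_hcomp (adj_id2 (EM_1 eo ea (C_1 g))) (EM_unit2 eo ea f))
    (adj_hcomp (EM_unit2 eo ea g) (adj_id2 f))"
proof -
  interpret A: two_category LAdj_iso by (rule two_category_LAdj_iso)
  interpret f: EM_unit_cell eo ea x y f by (rule EM_unit_cellI[OF f])
  interpret g: EM_unit_cell eo ea y z g by (rule EM_unit_cellI[OF g])
  interpret gf: EM_unit_cell eo ea x z "adj_comp1 g f" by (rule EM_unit_cellI[OF adj_comp1_hom[OF f g]])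
  have z: "amz (adj_comp1 g f) A = onA (amF g) (amz f A) \<cdot>\<^bsub>adC z\<^esub> amz g (onO (amG f) A)" if "A \<in> Ob (adD x)" for A
    using that by (simp add: adj_comp1_def)
  have 1: "adj_comp1 (EM_unit1 eo ea z) (adj_comp1 g f) = adj_comp1 g.src2c f"
    by (rule adj_comp1_assoc[OF f g g.T.EM_unit1_hom, symmetric])
  have 2: "gf.tgt2c = adj_comp1 (EM_1 eo ea (C_1 g)) f.tgt2c"
    using adj_comp1_assoc[OF f.S.EM_unit1_hom f.EM1_hom g.EM1_hom] by (simp add: C_1_comp[OF f g] EM_1_comp[OF f.C_hom g.C_hom])
  have 3: "adj_comp1 g.tgt2c f = adj_comp1 (EM_1 eo ea (C_1 g)) f.src2c"
    by (rule adj_comp1_assoc[OF f f.T.EM_unit1_hom g.EM1_hom])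
  have f2: "adj_id2 f \<in> hom2 LAdj_iso f f" using A.id2_hom[of f] f by (simp add: hom1_def)
  have g2: "adj_id2 (EM_1 eo ea (C_1 g)) \<in> hom2 LAdj_iso (EM_1 eo ea (C_1 g)) (EM_1 eo ea (C_1 g))"
    using A.id2_hom[of "EM_1 eo ea (C_1 g)"] g.EM1_hom by (simp add: hom1_def)
  have r: "adj_vcomp (adj_hcomp (adj_id2 (EM_1 eo ea (C_1 g))) (EM_unit2 eo ea f)) (adj_hcomp (EM_unit2 eo ea g) (adj_id2 f))
    \<in> hom2 LAdj_iso gf.src2c gf.tgt2c"
    using A.vcomp_hom[OF A.hcomp_hom[OF f g.src_tgt_hom(1) f2 g.EM_unit2_hom, simplified, unfolded 3]
      A.hcomp_hom[OF f.src_tgt_hom(1) g.EM1_hom f.EM_unit2_hom g2, simplified]] by (simp add: 1 2)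
  show ?thesis
  proof (rule EM_2cell_eqI[OF gf.EM_unit2_hom r gf.src_tgt_hom(1) g.T.comonad_T])
    fix X assume [simp]: "X \<in> Ob (adC x)"
    show "amphi (EM_unit2 eo ea (adj_comp1 g f)) X = amphi (adj_vcomp (adj_hcomp (adj_id2 (EM_1 eo ea (C_1 g))) (EM_unit2 eo ea f))
        (adj_hcomp (EM_unit2 eo ea g) (adj_id2 f))) X"
      by simp
  next
    fix A assume [simp]: "A \<in> Ob (adD x)"
    show "ar (ampsi (EM_unit2 eo ea (adj_comp1 g f)) A) = ar (ampsi (adj_vcomp (adj_hcomp (adj_id2 (EM_1 eo ea (C_1 g))) (EM_unit2 eo ea f))
        (adj_hcomp (EM_unit2 eo ea g) (adj_id2 f))) A)"
      by (simp add: z)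
  qed
qed

lemma pseudonat_unit: "pseudonat LAdj_iso LAdj_iso id_2fun (comp_2fun (EM eo ea) C_2fun) (EM_unit eo ea)"
proof -
  interpret C: two_functor LAdj_iso Cmd C_2fun by (rule two_functor_C)
  interpret I: two_functor LAdj_iso LAdj_iso id_2fun by (rule two_functor_id[OF two_category_LAdj_iso])
  interpret EC: two_functor LAdj_iso LAdj_iso "comp_2fun (EM eo ea) C_2fun"
    by (rule two_functor_comp[OF two_functor_C two_functor_EM])
  have cell: "f \<in> hom1 LAdj_iso (Src f) (Tgt f)" if "is_adj_1cell f" for f using that by (simp add: hom1_LAdj is_adj_1cell_iff)
  note s = id_2fun_def comp_2fun_def
  show ?thesis
  proof (unfold_locales, goal_cases)
    case (1 x) then show ?case by (simp add: s is_adj_iff EM_unit_loc.EM_unit1_hom EM_unit_locI)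
  next
    case (2 f x y)
    then interpret EM_unit_cell eo ea x y f by (rule EM_unit_cellI)
    show ?case using EM_unit2_hom by (simp add: s)
  next
    case (3 f)
    then obtain x y where "f \<in> hom1 LAdj_iso x y" using cell by auto
    then interpret EM_unit_cell eo ea x y f by (rule EM_unit_cellI)
    show ?case using EM_unit2_invertible by simp
  next
    case (4 f x y \<alpha> g) then show ?case using EM_unit2_natural[of f x y \<alpha> g] by (simp add: s)
  next
    case (5 x) then show ?case by (simp add: is_adj_iff EM_unit2_id)
  next
    case (6 f x y g z) then show ?case by (simp add: s EM_unit2_comp)
  qed
qed

lemma EM_unit2_EM:
  assumes f: "f \<in> hom1 Cmd x y" shows "EM_unit2 eo ea (EM_1 eo ea f) = adj_id2 (EM_1 eo ea f)"
proof -
  interpret EM_arrow eo ea x y f by (rule EM_arrowI[OF f])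
  have h: "EM_1 eo ea f \<in> hom1 LAdj_iso (EM_adj eo ea x) (EM_adj eo ea y)"
    by (simp add: hom1_LAdj EM1.adj_arrow_axioms)
  from EM_unit_cell.EM_unit2_tight[OF EM_unit_cellI[OF h] adj_tight_EM_1]
  show ?thesis by (simp add: EM_unit1_EM T.comonad_axioms adj_comp1_id1[OF h])
qed

text \<open>\<open>C\<close> keeps only \<open>\<phi>\<close>, which is an identity in every unit
  2-cell; the boundaries agree because \<open>C\<close> sends unit components to identities and
  undoes \<open>EM\<close>.\<close>

lemma C_unit2:
  assumes f: "f \<in> hom1 LAdj_iso x y" shows "C_2 (EM_unit2 eo ea f) = cmd_id2 (C_1 f)"
proof -
  interpret EM_unit_cell eo ea x y f by (rule EM_unit_cellI[OF f])
  interpret B: two_category Cmd by (rule two_category_Cmd)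
  have "C_1 src2c = C_1 f"
    using C_1_comp[OF f T.EM_unit1_hom] B.id1_comp1[OF C_hom] by (simp add: T.C_unit1)
  moreover have "C_1 tgt2c = C_1 f"
    using C_1_comp[OF S.EM_unit1_hom EM1_hom] B.comp1_id1[OF C_hom] by (simp add: S.C_unit1 Cf.C_EM_1)
  ultimately show ?thesis by (intro cmd_2cell.equality) (simp_all add: cmd_id2_def)
qed

lemma strict_biadjunction_EM:
  "strict_biadjunction LAdj_iso Cmd C_2fun (EM eo ea) (EM_unit eo ea) EM_counit"
proof -
  interpret C: two_functor LAdj_iso Cmd C_2fun by (rule two_functor_C)
  interpret E: two_functor Cmd LAdj_iso "EM eo ea" by (rule two_functor_EM)
  interpret u: pseudonat LAdj_iso LAdj_iso id_2fun "comp_2fun (EM eo ea) C_2fun" "EM_unit eo ea" by (rule pseudonat_unit)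
  have cell: "f \<in> hom1 Cmd (Src f) (Tgt f)" if "is_cmd_1cell f" for f using that by (simp add: hom1_Cmd is_cmd_1cell_iff)
  have cell': "f \<in> hom1 LAdj_iso (Src f) (Tgt f)" if "is_adj_1cell f" for f using that by (simp add: hom1_LAdj is_adj_1cell_iff)
  have CE1: "C_1 (EM_1 eo ea f) = f" if f: "is_cmd_1cell f" for f
  proof -
    obtain x y where "f \<in> hom1 Cmd x y" using cell[OF f] by blast
    then interpret EM_arrow eo ea x y f by (rule EM_arrowI)
    show ?thesis by (rule C_EM_1)
  qed
  show ?thesis
  proof (unfold_locales, goal_cases)
    case (1 x) then show ?case by (simp add: is_comonad_iff coalg_cat.C_EM_0 coalg_catI)
  next
    case (2 f) then show ?case by (simp add: CE1)
  next
    case (3 \<alpha>) then show ?case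
      by (intro cmd_2cell.equality) (simp_all add: CE1 is_cmd_2cell_def)
  next
    case (4 x) then show ?case by (simp add: is_adj_iff EM_unit_loc.C_unit1 EM_unit_locI)
  next
    case (5 f) then show ?case using C_unit2[OF cell', of f] by simp
  next
    case (6 x) then show ?case by (simp add: is_comonad_iff EM_unit1_EM)
  next
    case (7 f) then show ?case using EM_unit2_EM[OF cell, of f] by simp
  qed (simp_all add: EM_counit_def)
qed

lemma EM_unit2_tight_id:
  assumes "is_adj_1cell f" "adj_tight f"
  shows "EM_unit2 eo ea f = adj_id2 (adj_comp1 (EM_unit1 eo ea (Tgt f)) f)"
proof -
  have "f \<in> hom1 LAdj_iso (Src f) (Tgt f)" using assms by (simp add: hom1_LAdj is_adj_1cell_iff)
  from EM_unit_cell.EM_unit2_tight[OF EM_unit_cellI[OF this] assms(2)] show ?thesis .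
qed

lemma two_adjunction_EM: "two_adjunction LAdj Cmd C_2fun (EM eo ea) (EM_unit eo ea) EM_counit"
proof -
  interpret strict_biadjunction LAdj_iso Cmd C_2fun "EM eo ea" "EM_unit eo ea" EM_counit
    by (rule strict_biadjunction_EM)
  \<comment> \<open>\<open>Cmd\<close> is read as its own restriction to all 1-cells, so that
    restriction applies on both sides.\<close>
  have "strict_biadjunction LAdj (wide_full_sub Cmd (\<lambda>_. True)) C_2fun (EM eo ea) (EM_unit eo ea) EM_counit"
    unfolding LAdj_def
  proof (rule restrict[OF closed_adj_tight closed_1cells_True])
    fix f :: "('o, 'a) cmd_1cell" assume f: "f \<in> One Cmd"
    then obtain x y where "f \<in> hom1 Cmd x y" by (simp add: hom1_def)
    then interpret EM_arrow eo ea x y f by (rule EM_arrowI)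
    show "adj_tight (F1 (EM eo ea) f)" by (simp add: adj_tight_EM_1)
  next
    fix x :: "('o, 'a, 'd, 'e) adj" assume "x \<in> Zero LAdj_iso"
    then show "adj_tight (pn1 (EM_unit eo ea) x)" by (simp add: is_adj_iff EM_unit_loc.EM_unit1_tight EM_unit_locI)
  qed simp
  then interpret t: strict_biadjunction LAdj Cmd C_2fun "EM eo ea" "EM_unit eo ea" EM_counit
    by (simp add: wide_full_sub_True)
  show ?thesis
    by (rule t.two_reflection(1)) (simp add: LAdj_def EM_unit2_tight_id)
qed

end

section \<open>The fibred level: fibrations and the 2-categories of w-comonads and of gcwfs\<close>

section \<open>Fibrations\<close>

lemma is_fibrationD: "is_fibration p \<Longrightarrow> is_functor (fE p) (fB p) (fp p)"
  by (simp add: is_fibration_def)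

lemma is_fib_1cellD:
  assumes "is_fib_1cell p p' B E"
  shows "is_fibration p" "is_fibration p'" "is_functor (fB p) (fB p') B" "is_functor (fE p) (fE p') E"
    "cartesian p f \<Longrightarrow> cartesian p' (onA E f)"
  using assms by (simp_all add: is_fib_1cell_def)

lemma is_fib_1cell_over:
  assumes "is_fib_1cell p p' B E"
  shows "A \<in> Ob (fE p) \<Longrightarrow> onO (fp p') (onO E A) = onO B (onO (fp p) A)"
    "f \<in> Ar (fE p) \<Longrightarrow> onA (fp p') (onA E f) = onA B (onA (fp p) f)"
proof -
  have e: "comp_fct (fE p) (fp p') E = comp_fct (fE p) B (fp p)" using assms by (simp add: is_fib_1cell_def)
  show "A \<in> Ob (fE p) \<Longrightarrow> onO (fp p') (onO E A) = onO B (onO (fp p) A)"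
    using comp_fct_simps(1)[of A "fE p" "fp p'" E] by (simp add: e)
  show "f \<in> Ar (fE p) \<Longrightarrow> onA (fp p') (onA E f) = onA B (onA (fp p) f)"
    using comp_fct_simps(2)[of f "fE p" "fp p'" E] by (simp add: e)
qed

lemma cartesian_Ar: "cartesian p f \<Longrightarrow> f \<in> Ar (fE p)"
  by (simp add: cartesian_def)

lemma is_fib_1cell_id: "is_fibration p \<Longrightarrow> is_fib_1cell p p (id_fct (fB p)) (id_fct (fE p))"
  using is_fibrationD[of p]
  by (auto simp: is_fib_1cell_def is_functor_id is_functor_categories comp_fct_id_left comp_fct_id_right cartesian_Ar)

lemma is_fib_1cell_comp:
  assumes f: "is_fib_1cell p p' B E" and g: "is_fib_1cell p' p'' B' E'"
  shows "is_fib_1cell p p'' (comp_fct (fB p) B' B) (comp_fct (fE p) E' E)"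
proof -
  interpret P: is_functor "fE p" "fB p" "fp p" by (rule is_fibrationD) (rule is_fib_1cellD[OF f])
  interpret E: is_functor "fE p" "fE p'" E by (rule is_fib_1cellD[OF f])
  interpret B: is_functor "fB p" "fB p'" B by (rule is_fib_1cellD[OF f])
  interpret B': is_functor "fB p'" "fB p''" B' by (rule is_fib_1cellD[OF g])
  interpret E': is_functor "fE p'" "fE p''" E' by (rule is_fib_1cellD[OF g])
  interpret P'': is_functor "fE p''" "fB p''" "fp p''" by (rule is_fibrationD) (rule is_fib_1cellD[OF g])
  note c = is_functor_comp[OF B.is_functor_axioms B'.is_functor_axioms] is_functor_comp[OF E.is_functor_axioms E'.is_functor_axioms]
  have "comp_fct (fE p) (fp p'') (comp_fct (fE p) E' E) = comp_fct (fE p) (comp_fct (fB p) B' B) (fp p)"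
    by (rule fctr_eqI[OF is_functor_comp[OF c(2) P''.is_functor_axioms] is_functor_comp[OF P.is_functor_axioms c(1)]])
      (simp_all add: is_fib_1cell_over[OF f] is_fib_1cell_over[OF g])
  then show ?thesis
    using is_fib_1cellD[OF f] is_fib_1cellD[OF g] by (auto simp: is_fib_1cell_def c cartesian_Ar)
qed

lemma is_fib_2cellD:
  assumes "is_fib_2cell p p' B1 E1 B2 E2 \<psi> \<phi>"
  shows "is_fib_1cell p p' B1 E1" "is_fib_1cell p p' B2 E2" "nat_trans (fB p) (fB p') B1 B2 \<psi>"
    "nat_trans (fE p) (fE p') E1 E2 \<phi>" "A \<in> Ob (fE p) \<Longrightarrow> onA (fp p') (\<phi> A) = \<psi> (onO (fp p) A)"
  using assms by (simp_all add: is_fib_2cell_def)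

lemma is_fib_2cell_id:
  assumes "is_fib_1cell p p' B E"
  shows "is_fib_2cell p p' B E B E (id_nt (fB p) (fB p') B) (id_nt (fE p) (fE p') E)"
proof -
  interpret P: is_functor "fE p" "fB p" "fp p" by (rule is_fibrationD) (rule is_fib_1cellD[OF assms])
  interpret P': is_functor "fE p'" "fB p'" "fp p'" by (rule is_fibrationD) (rule is_fib_1cellD[OF assms])
  interpret E: is_functor "fE p" "fE p'" E by (rule is_fib_1cellD[OF assms])
  interpret B: is_functor "fB p" "fB p'" B by (rule is_fib_1cellD[OF assms])
  show ?thesis by (simp add: is_fib_2cell_def assms nat_trans_id is_fib_1cell_over[OF assms])
qed

lemma is_fib_2cell_vcomp:
  assumes a: "is_fib_2cell p p' B E B' E' \<psi> \<phi>" and b: "is_fib_2cell p p' B' E' B'' E'' \<psi>' \<phi>'"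
  shows "is_fib_2cell p p' B E B'' E'' (vcomp_nt (fB p) (fB p') \<psi>' \<psi>) (vcomp_nt (fE p) (fE p') \<phi>' \<phi>)"
proof -
  interpret P: is_functor "fE p" "fB p" "fp p" by (rule is_fibrationD) (rule is_fib_1cellD[OF is_fib_2cellD(1)[OF a]])
  interpret P': is_functor "fE p'" "fB p'" "fp p'" by (rule is_fibrationD) (rule is_fib_1cellD[OF is_fib_2cellD(1)[OF a]])
  interpret \<phi>: nat_trans "fE p" "fE p'" E E' \<phi> by (rule is_fib_2cellD[OF a])
  interpret \<phi>': nat_trans "fE p" "fE p'" E' E'' \<phi>' by (rule is_fib_2cellD[OF b])
  show ?thesis
    using is_fib_2cellD[OF a] is_fib_2cellD[OF b]
    by (simp add: is_fib_2cell_def nat_trans_vcomp[OF is_fib_2cellD(3)[OF a] is_fib_2cellD(3)[OF b]]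
       nat_trans_vcomp[OF is_fib_2cellD(4)[OF a] is_fib_2cellD(4)[OF b]])
qed

lemma is_fib_2cell_hcomp:
  assumes a: "is_fib_2cell p p' B E B' E' \<psi> \<phi>" and b: "is_fib_2cell p' p'' M N M' N' \<psi>' \<phi>'"
  shows "is_fib_2cell p p'' (comp_fct (fB p) M B) (comp_fct (fE p) N E) (comp_fct (fB p) M' B') (comp_fct (fE p) N' E')
    (hcomp_nt (fB p) (fB p'') M B' \<psi>' \<psi>) (hcomp_nt (fE p) (fE p'') N E' \<phi>' \<phi>)"
proof -
  interpret P: is_functor "fE p" "fB p" "fp p" by (rule is_fibrationD) (rule is_fib_1cellD[OF is_fib_2cellD(1)[OF a]])
  interpret P'': is_functor "fE p''" "fB p''" "fp p''" by (rule is_fibrationD) (rule is_fib_1cellD[OF is_fib_2cellD(1)[OF b]])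
  interpret \<phi>: nat_trans "fE p" "fE p'" E E' \<phi> by (rule is_fib_2cellD[OF a])
  interpret \<phi>': nat_trans "fE p'" "fE p''" N N' \<phi>' by (rule is_fib_2cellD[OF b])
  interpret \<psi>: nat_trans "fB p" "fB p'" B B' \<psi> by (rule is_fib_2cellD[OF a])
  interpret \<psi>': nat_trans "fB p'" "fB p''" M M' \<psi>' by (rule is_fib_2cellD[OF b])
  note o = is_fib_1cell_over[OF is_fib_2cellD(1)[OF b]] is_fib_1cell_over[OF is_fib_2cellD(2)[OF a]]
  show ?thesis
    using is_fib_2cellD[OF a] is_fib_2cellD[OF b]
    by (simp add: is_fib_2cell_def nat_trans_hcomp[OF is_fib_2cellD(3)[OF a] is_fib_2cellD(3)[OF b]]
       nat_trans_hcomp[OF is_fib_2cellD(4)[OF a] is_fib_2cellD(4)[OF b]] is_fib_1cell_comp o)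
qed

section \<open>The 2-category of w-comonads\<close>

lemma is_wcomonadD:
  assumes "is_wcomonad W"
  shows "is_fibration (wp W)" "comonad (wK W)" "cmC (wK W) = fE (wp W)"
    "A \<in> Ob (fE (wp W)) \<Longrightarrow> cartesian (wp W) (cmeps (wK W) A)"
  using assms by (simp_all add: is_wcomonad_def Let_def is_comonad_iff)

lemma wcmd_cell_simps [simp]:
  "Src (wcmd_to_cmd1 f) = wK (Src f)" "Tgt (wcmd_to_cmd1 f) = wK (Tgt f)" "cmH (wcmd_to_cmd1 f) = wmH f" "cmth (wcmd_to_cmd1 f) = wmth f"
  "Src (wcmd_to_cmd2 \<alpha>) = wcmd_to_cmd1 (Src \<alpha>)" "Tgt (wcmd_to_cmd2 \<alpha>) = wcmd_to_cmd1 (Tgt \<alpha>)" "cmphi (wcmd_to_cmd2 \<alpha>) = wmphi \<alpha>"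
  "Src (wcmd_id1 W) = W" "Tgt (wcmd_id1 W) = W" "wmC (wcmd_id1 W) = id_fct (fB (wp W))" "wmH (wcmd_id1 W) = id_fct (fE (wp W))"
  "wmth (wcmd_id1 W) = id_nt (fE (wp W)) (fE (wp W)) (cmK (wK W))"
  "Src (wcmd_comp1 g f) = Src f" "Tgt (wcmd_comp1 g f) = Tgt g" "wmC (wcmd_comp1 g f) = comp_fct (fB (wp (Src f))) (wmC g) (wmC f)"
  "wmH (wcmd_comp1 g f) = comp_fct (fE (wp (Src f))) (wmH g) (wmH f)"
  "wmth (wcmd_comp1 g f) = cmth (cmd_comp1 (wcmd_to_cmd1 g) (wcmd_to_cmd1 f))"
  by (simp_all add: wcmd_to_cmd1_def wcmd_to_cmd2_def wcmd_id1_def wcmd_comp1_def Let_def)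

lemma wcmd_2cell_simps [simp]:
  "Src (wcmd_id2 f) = f" "Tgt (wcmd_id2 f) = f" "wmpsi (wcmd_id2 f) = id_nt (fB (wp (Src f))) (fB (wp (Tgt f))) (wmC f)"
  "wmphi (wcmd_id2 f) = id_nt (fE (wp (Src f))) (fE (wp (Tgt f))) (wmH f)"
  "Src (wcmd_vcomp \<beta> \<alpha>) = Src \<alpha>" "Tgt (wcmd_vcomp \<beta> \<alpha>) = Tgt \<beta>"
  "wmpsi (wcmd_vcomp \<beta> \<alpha>) = vcomp_nt (fB (wp (Src (Src \<alpha>)))) (fB (wp (Tgt (Src \<alpha>)))) (wmpsi \<beta>) (wmpsi \<alpha>)"
  "wmphi (wcmd_vcomp \<beta> \<alpha>) = vcomp_nt (fE (wp (Src (Src \<alpha>)))) (fE (wp (Tgt (Src \<alpha>)))) (wmphi \<beta>) (wmphi \<alpha>)"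
  "Src (wcmd_hcomp \<beta> \<alpha>) = wcmd_comp1 (Src \<beta>) (Src \<alpha>)" "Tgt (wcmd_hcomp \<beta> \<alpha>) = wcmd_comp1 (Tgt \<beta>) (Tgt \<alpha>)"
  "wmpsi (wcmd_hcomp \<beta> \<alpha>) = hcomp_nt (fB (wp (Src (Src \<alpha>)))) (fB (wp (Tgt (Src \<beta>)))) (wmC (Src \<beta>)) (wmC (Tgt \<alpha>)) (wmpsi \<beta>) (wmpsi \<alpha>)"
  "wmphi (wcmd_hcomp \<beta> \<alpha>) = hcomp_nt (fE (wp (Src (Src \<alpha>)))) (fE (wp (Tgt (Src \<beta>)))) (wmH (Src \<beta>)) (wmH (Tgt \<alpha>)) (wmphi \<beta>) (wmphi \<alpha>)"
  by (simp_all add: wcmd_id2_def wcmd_vcomp_def wcmd_hcomp_def Let_def)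

lemma WCmd_simps [simp]:
  "Zero WCmd = Collect is_wcomonad" "One WCmd = Collect is_wcmd_1cell" "Two WCmd = Collect is_wcmd_2cell"
  "src1 WCmd = Src" "tgt1 WCmd = Tgt" "src2 WCmd = Src" "tgt2 WCmd = Tgt"
  "id1 WCmd = wcmd_id1" "id2 WCmd = wcmd_id2" "comp1 WCmd = wcmd_comp1" "vcomp WCmd = wcmd_vcomp" "hcomp WCmd = wcmd_hcomp"
  by (simp_all add: WCmd_def)

lemma hom1_WCmd: "f \<in> hom1 WCmd x y \<longleftrightarrow> Src f = x \<and> Tgt f = y \<and> is_wcomonad x \<and> is_wcomonad y \<and>
    is_fib_1cell (wp x) (wp y) (wmC f) (wmH f) \<and> wcmd_to_cmd1 f \<in> hom1 Cmd (wK x) (wK y)"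
  by (auto simp: hom1_def is_wcmd_1cell_def)

lemma hom2_WCmdD:
  assumes a: "\<alpha> \<in> hom2 WCmd f g" and f: "f \<in> hom1 WCmd x y"
  shows "Src \<alpha> = f" "Tgt \<alpha> = g" "g \<in> hom1 WCmd x y"
    "is_fib_2cell (wp x) (wp y) (wmC f) (wmH f) (wmC g) (wmH g) (wmpsi \<alpha>) (wmphi \<alpha>)"
    "wcmd_to_cmd2 \<alpha> \<in> hom2 Cmd (wcmd_to_cmd1 f) (wcmd_to_cmd1 g)"
proof -
  have a': "Src \<alpha> = f" "Tgt \<alpha> = g" "is_wcmd_2cell \<alpha>" and f': "Src f = x" "Tgt f = y"
    using a f by (simp_all add: hom2_def hom1_def)
  from a' show "Src \<alpha> = f" "Tgt \<alpha> = g" by blast+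
  from a'(3) have g: "Src f = Src g" "Tgt f = Tgt g" "is_wcmd_1cell g"
      "is_fib_2cell (wp (Src f)) (wp (Tgt f)) (wmC f) (wmH f) (wmC g) (wmH g) (wmpsi \<alpha>) (wmphi \<alpha>)"
      "is_cmd_2cell (wcmd_to_cmd2 \<alpha>)"
    unfolding is_wcmd_2cell_def a'(1,2) by blast+
  show "g \<in> hom1 WCmd x y" using g(1-3) by (simp add: hom1_def f')
  show "is_fib_2cell (wp x) (wp y) (wmC f) (wmH f) (wmC g) (wmH g) (wmpsi \<alpha>) (wmphi \<alpha>)" using g(4) by (simp add: f')
  show "wcmd_to_cmd2 \<alpha> \<in> hom2 Cmd (wcmd_to_cmd1 f) (wcmd_to_cmd1 g)" using g(5) a' by (simp add: hom2_def)
qed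

lemma hom2_WCmdI:
  assumes "f \<in> hom1 WCmd x y" "g \<in> hom1 WCmd x y" "Src \<alpha> = f" "Tgt \<alpha> = g"
    "is_fib_2cell (wp x) (wp y) (wmC f) (wmH f) (wmC g) (wmH g) (wmpsi \<alpha>) (wmphi \<alpha>)"
    "wcmd_to_cmd2 \<alpha> \<in> hom2 Cmd (wcmd_to_cmd1 f) (wcmd_to_cmd1 g)"
  shows "\<alpha> \<in> hom2 WCmd f g"
  using assms by (auto simp: hom2_def hom1_def is_wcmd_2cell_def)

lemma hom2_WCmd_obtain:
  assumes "\<alpha> \<in> hom2 WCmd f g" obtains x y where "f \<in> hom1 WCmd x y"
  using assms by (auto simp: hom2_def hom1_def is_wcmd_2cell_def)

lemma wcmd_to_cmd_ops:
  "is_wcomonad W \<Longrightarrow> wcmd_to_cmd1 (wcmd_id1 W) = cmd_id1 (wK W)"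
  "is_wcomonad (Src f) \<Longrightarrow> wcmd_to_cmd1 (wcmd_comp1 g f) = cmd_comp1 (wcmd_to_cmd1 g) (wcmd_to_cmd1 f)"
  "\<lbrakk>is_wcomonad (Src f); is_wcomonad (Tgt f)\<rbrakk> \<Longrightarrow> wcmd_to_cmd2 (wcmd_id2 f) = cmd_id2 (wcmd_to_cmd1 f)"
  by (auto intro!: cmd_1cell.equality cmd_2cell.equality simp: is_wcomonadD cmd_id1_def cmd_id2_def)

text \<open>A 1-cell is determined by its boundary, its base functor and its image in
  \<open>Cmd\<close>. The laws for 1-cells of \<open>WCmd\<close> split accordingly into laws of
  functors and laws already known in \<open>Cmd\<close>.\<close>

lemma wcmd_1cell_eqI:
  assumes "f \<in> hom1 WCmd x y" "g \<in> hom1 WCmd x y" "wmC f = wmC g" "wcmd_to_cmd1 f = wcmd_to_cmd1 g" shows "f = g"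
proof -
  have "wmH f = wmH g" "wmth f = wmth g" using arg_cong[OF assms(4), of cmH] arg_cong[OF assms(4), of cmth] by simp_all
  with assms show ?thesis by (intro wcmd_1cell.equality) (simp_all add: hom1_WCmd)
qed

lemma wcmd_id1_hom: "is_wcomonad x \<Longrightarrow> wcmd_id1 x \<in> hom1 WCmd x x"
  by (simp add: hom1_WCmd is_fib_1cell_id is_wcomonadD wcmd_to_cmd_ops cmd_id1_hom)

lemma wcmd_comp1_hom: "\<lbrakk>f \<in> hom1 WCmd x y; g \<in> hom1 WCmd y z\<rbrakk> \<Longrightarrow> wcmd_comp1 g f \<in> hom1 WCmd x z"
  by (auto simp: hom1_WCmd wcmd_to_cmd_ops intro: is_fib_1cell_comp cmd_comp1_hom)

lemma wcmd_comp1_id1: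
  assumes f: "f \<in> hom1 WCmd x y" shows "wcmd_comp1 f (wcmd_id1 x) = f" "wcmd_comp1 (wcmd_id1 y) f = f"
proof -
  have x: "is_wcomonad x" "is_wcomonad y" "is_functor (fB (wp x)) (fB (wp y)) (wmC f)" "Src f = x" "Tgt f = y"
    "wcmd_to_cmd1 f \<in> hom1 Cmd (wK x) (wK y)" using f by (auto simp: hom1_WCmd is_fib_1cellD)
  show "wcmd_comp1 f (wcmd_id1 x) = f"
    by (rule wcmd_1cell_eqI[OF wcmd_comp1_hom[OF wcmd_id1_hom[OF x(1)] f] f])
      (simp_all add: x comp_fct_id_right[OF x(3)] wcmd_to_cmd_ops cmd_comp1_id1[OF x(6)])
  show "wcmd_comp1 (wcmd_id1 y) f = f"
    by (rule wcmd_1cell_eqI[OF wcmd_comp1_hom[OF f wcmd_id1_hom[OF x(2)]] f])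
      (simp_all add: x comp_fct_id_left[OF x(3)] wcmd_to_cmd_ops cmd_comp1_id1[OF x(6)])
qed

lemma wcmd_comp1_assoc:
  assumes f: "f \<in> hom1 WCmd x y" and g: "g \<in> hom1 WCmd y z" and h: "h \<in> hom1 WCmd z w"
  shows "wcmd_comp1 (wcmd_comp1 h g) f = wcmd_comp1 h (wcmd_comp1 g f)"
proof -
  have x: "is_wcomonad x" "is_wcomonad y" "is_functor (fB (wp x)) (fB (wp y)) (wmC f)" "Src f = x" "Src g = y" "Src h = z"
    using f g h by (auto simp: hom1_WCmd is_fib_1cellD)
  have c: "wcmd_to_cmd1 f \<in> hom1 Cmd (wK x) (wK y)" "wcmd_to_cmd1 g \<in> hom1 Cmd (wK y) (wK z)" "wcmd_to_cmd1 h \<in> hom1 Cmd (wK z) (wK w)"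
    using f g h by (auto simp: hom1_WCmd)
  show ?thesis
    by (rule wcmd_1cell_eqI[OF wcmd_comp1_hom[OF f wcmd_comp1_hom[OF g h]] wcmd_comp1_hom[OF wcmd_comp1_hom[OF f g] h]])
      (simp_all add: x comp_fct_assoc[OF x(3)] wcmd_to_cmd_ops cmd_comp1_assoc[OF c])
qed

lemma hom2_WCmd_nt:
  assumes "\<alpha> \<in> hom2 WCmd f g" "f \<in> hom1 WCmd x y"
  shows "nat_trans (fB (wp x)) (fB (wp y)) (wmC f) (wmC g) (wmpsi \<alpha>)"
    "nat_trans (fE (wp x)) (fE (wp y)) (wmH f) (wmH g) (wmphi \<alpha>)"
  using is_fib_2cellD[OF hom2_WCmdD(4)[OF assms]] by blast+

lemma wcmd_id2_hom: assumes f: "f \<in> hom1 WCmd x y" shows "wcmd_id2 f \<in> hom2 WCmd f f"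
proof -
  have "wcmd_to_cmd1 f \<in> One Cmd" using f unfolding hom1_WCmd by (simp add: hom1_def)
  from two_category.id2_hom[OF two_category_Cmd this] f show ?thesis
    by (intro hom2_WCmdI[OF f f]) (simp_all add: is_fib_2cell_id wcmd_to_cmd_ops hom1_WCmd)
qed

lemma wcmd_vcomp_to_cmd:
  assumes "\<alpha> \<in> hom2 WCmd f g" "f \<in> hom1 WCmd x y"
  shows "wcmd_to_cmd2 (wcmd_vcomp \<beta> \<alpha>) = cmd_vcomp (wcmd_to_cmd2 \<beta>) (wcmd_to_cmd2 \<alpha>)"
  using hom2_WCmdD(1)[OF assms] assms(2) by (intro cmd_2cell.equality) (simp_all add: cmd_vcomp_def hom1_WCmd is_wcomonadD)

lemma wcmd_hcomp_to_cmd: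
  assumes "\<alpha> \<in> hom2 WCmd f f'" "\<beta> \<in> hom2 WCmd g g'" "f \<in> hom1 WCmd x y" "g \<in> hom1 WCmd y z"
  shows "wcmd_to_cmd2 (wcmd_hcomp \<beta> \<alpha>) = cmd_hcomp (wcmd_to_cmd2 \<beta>) (wcmd_to_cmd2 \<alpha>)"
  using hom2_WCmdD(1-3)[OF assms(1,3)] hom2_WCmdD(1-3)[OF assms(2,4)] assms(3,4)
  by (intro cmd_2cell.equality) (simp_all add: cmd_hcomp_def hom1_WCmd is_wcomonadD wcmd_to_cmd_ops)

lemma wcmd_vcomp_hom:
  assumes a: "\<alpha> \<in> hom2 WCmd f g" and b: "\<beta> \<in> hom2 WCmd g h" shows "wcmd_vcomp \<beta> \<alpha> \<in> hom2 WCmd f h"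
proof -
  obtain x y where f: "f \<in> hom1 WCmd x y" using a by (rule hom2_WCmd_obtain)
  note a' = hom2_WCmdD[OF a f] note b' = hom2_WCmdD[OF b a'(3)]
  have xy: "Src f = x" "Tgt f = y" using f by (simp_all add: hom1_WCmd)
  show ?thesis
    by (rule hom2_WCmdI[OF f b'(3)])
     (simp_all add: a'(1) b'(2) xy is_fib_2cell_vcomp[OF a'(4) b'(4)] wcmd_vcomp_to_cmd[OF a f]
      two_category.vcomp_hom[OF two_category_Cmd a'(5) b'(5), simplified])
qed

lemma wcmd_hcomp_hom:
  assumes f: "f \<in> hom1 WCmd x y" and g: "g \<in> hom1 WCmd y z" and a: "\<alpha> \<in> hom2 WCmd f f'" and b: "\<beta> \<in> hom2 WCmd g g'"
  shows "wcmd_hcomp \<beta> \<alpha> \<in> hom2 WCmd (wcmd_comp1 g f) (wcmd_comp1 g' f')"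
proof -
  note a' = hom2_WCmdD[OF a f] and b' = hom2_WCmdD[OF b g]
  have xy: "Src f = x" "Tgt f = y" "Src g = y" "Tgt g = z" "Src f' = x" "is_wcomonad x" using f g a'(3) by (simp_all add: hom1_WCmd)
  have fc: "wcmd_to_cmd1 f \<in> hom1 Cmd (wK x) (wK y)" "wcmd_to_cmd1 g \<in> hom1 Cmd (wK y) (wK z)"
    using f g by (simp_all add: hom1_WCmd)
  show ?thesis
    by (rule hom2_WCmdI[OF wcmd_comp1_hom[OF f g] wcmd_comp1_hom[OF a'(3) b'(3)]])
     (simp_all add: a'(1,2) b'(1,2) xy is_fib_2cell_hcomp[OF a'(4) b'(4)] wcmd_hcomp_to_cmd[OF a b f g] wcmd_to_cmd_ops
      two_category.hcomp_hom[OF two_category_Cmd fc a'(5) b'(5), simplified])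
qed

lemma two_category_WCmd: "two_category WCmd"
proof (unfold_locales, goal_cases)
  case (7 x) then show ?case by (simp add: wcmd_id1_hom)
next
  case (8 f) then show ?case using wcmd_id2_hom[of f "Src f" "Tgt f"] by (simp add: hom1_def)
next
  case (9 f x y g z) then show ?case by (simp add: wcmd_comp1_hom)
next
  case (10 f x y) then show ?case by (simp add: wcmd_comp1_id1)
next
  case (11 f x y) then show ?case by (simp add: wcmd_comp1_id1)
next
  case (12 f x y g z h w) then show ?case by (simp add: wcmd_comp1_assoc)
next
  case (13 \<alpha> f g \<beta> h) then show ?case by (simp add: wcmd_vcomp_hom)
next
  case (14 \<alpha> f g)
  then obtain x y where f: "f \<in> hom1 WCmd x y" by (rule hom2_WCmd_obtain)
  note n = hom2_WCmd_nt[OF 14 f]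
  show ?case using f hom2_WCmdD(1,2)[OF 14 f] vcomp_nt_id_right[OF n(1)] vcomp_nt_id_right[OF n(2)]
    by (intro wcmd_2cell.equality) (simp_all add: hom1_WCmd)
next
  case (15 \<alpha> f g)
  then obtain x y where f: "f \<in> hom1 WCmd x y" by (rule hom2_WCmd_obtain)
  note n = hom2_WCmd_nt[OF 15 f]
  show ?case using f hom2_WCmdD(1-3)[OF 15 f] vcomp_nt_id_left[OF n(1)] vcomp_nt_id_left[OF n(2)]
    by (intro wcmd_2cell.equality) (simp_all add: hom1_WCmd)
next
  case (16 \<alpha> f g \<beta> h \<gamma> k)
  then obtain x y where f: "f \<in> hom1 WCmd x y" using hom2_WCmd_obtain by blast
  note g = hom2_WCmdD[OF 16(1) f] note h = hom2_WCmdD[OF 16(2) g(3)]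
  have e: "Src f = x" "Tgt f = y" "Src g = x" "Tgt g = y" using f g(3) by (simp_all add: hom1_WCmd)
  note n = hom2_WCmd_nt[OF 16(1) f] hom2_WCmd_nt[OF 16(2) g(3)] hom2_WCmd_nt[OF 16(3) h(3)]
  show ?case using vcomp_nt_assoc[OF n(1) n(3) n(5)] vcomp_nt_assoc[OF n(2) n(4) n(6)]
    by (intro wcmd_2cell.equality) (simp_all add: e g(1) h(1))
next
  case (17 f x y g z \<alpha> f' \<beta> g') then show ?case by (simp add: wcmd_hcomp_hom)
next
  case (18 f x y \<alpha> f')
  note a = hom2_WCmdD[OF 18(2,1)] and n = hom2_WCmd_nt[OF 18(2,1)]
  have e: "Src f = x" "Tgt f = y" using 18(1) by (simp_all add: hom1_WCmd)
  show ?case using hcomp_nt_id_right[OF n(1)] hcomp_nt_id_right[OF n(2)]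
    by (intro wcmd_2cell.equality) (simp_all add: e a(1,2) wcmd_comp1_id1[OF 18(1)] wcmd_comp1_id1[OF a(3)])
next
  case (19 f x y \<alpha> f')
  note a = hom2_WCmdD[OF 19(2,1)] and n = hom2_WCmd_nt[OF 19(2,1)]
  have e: "Src f = x" "Tgt f = y" using 19(1) by (simp_all add: hom1_WCmd)
  show ?case using hcomp_nt_id_left[OF n(1)] hcomp_nt_id_left[OF n(2)]
    by (intro wcmd_2cell.equality) (simp_all add: e a(1,2) wcmd_comp1_id1[OF 19(1)] wcmd_comp1_id1[OF a(3)])
next
  case (20 f x y g z h w \<alpha> f' \<beta> g' \<gamma> h')
  note a = hom2_WCmdD[OF 20(4,1)] and b = hom2_WCmdD[OF 20(5,2)] and c = hom2_WCmdD[OF 20(6,3)]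
  have e: "Src f = x" "Tgt f = y" "Src g = y" "Tgt g = z" "Src h = z" "Tgt h = w" "Src f' = x" "Src g' = y" "Src h' = z"
    using 20(1-3) a(3) b(3) c(3) by (simp_all add: hom1_WCmd)
  note n = hom2_WCmd_nt[OF 20(4,1)] hom2_WCmd_nt[OF 20(5,2)] hom2_WCmd_nt[OF 20(6,3)]
  show ?case using hcomp_nt_assoc[OF n(1) n(3) n(5)] hcomp_nt_assoc[OF n(2) n(4) n(6)]
    by (intro wcmd_2cell.equality) (simp_all add: e a(1,2) b(1,2) c(1,2) wcmd_comp1_assoc[OF 20(1-3)] wcmd_comp1_assoc[OF a(3) b(3) c(3)])
next
  case (21 f x y g z)
  then show ?case
    by (intro wcmd_2cell.equality) (auto simp: hom1_WCmd hcomp_nt_id_id[OF is_fib_1cellD(3) is_fib_1cellD(3)]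
       hcomp_nt_id_id[OF is_fib_1cellD(4) is_fib_1cellD(4)])
next
  case (22 f x y g z \<alpha> f' \<alpha>' f'' \<beta> g' \<beta>' g'')
  note a = hom2_WCmdD[OF 22(3,1)] and b = hom2_WCmdD[OF 22(5,2)]
  note a' = hom2_WCmdD[OF 22(4) a(3)] and b' = hom2_WCmdD[OF 22(6) b(3)]
  have e: "Src f = x" "Tgt f = y" "Src g = y" "Tgt g = z" "Src f' = x" "Tgt f' = y" "Src g' = y" "Tgt g' = z"
    using 22(1,2) a(3) b(3) by (simp_all add: hom1_WCmd)
  note n = hom2_WCmd_nt[OF 22(3,1)] hom2_WCmd_nt[OF 22(4) a(3)] hom2_WCmd_nt[OF 22(5,2)] hom2_WCmd_nt[OF 22(6) b(3)]
  show ?case using hcomp_nt_interchange[OF n(1) n(3) n(5) n(7)] hcomp_nt_interchange[OF n(2) n(4) n(6) n(8)]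
    by (intro wcmd_2cell.equality) (simp_all add: e a(1,2) b(1,2) a'(1,2) b'(1,2))
qed (auto simp: is_wcmd_1cell_def is_wcmd_2cell_def)

lemma forget_WCmd_simps [simp]: "F0 forget_WCmd = wK" "F1 forget_WCmd = wcmd_to_cmd1" "F2 forget_WCmd = wcmd_to_cmd2"
  by (simp_all add: forget_WCmd_def)

lemma two_functor_forget_WCmd: "two_functor WCmd Cmd forget_WCmd"
proof -
  interpret A: two_category WCmd by (rule two_category_WCmd)
  interpret B: two_category Cmd by (rule two_category_Cmd)
  show ?thesis
  proof (unfold_locales, goal_cases)
    case (3 \<alpha> f g)
    then obtain x y where f: "f \<in> hom1 WCmd x y" by (rule hom2_WCmd_obtain)
    show ?case using hom2_WCmdD(5)[OF 3 f] by simp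
  next
    case (7 \<alpha> f g \<beta> h)
    obtain x y where f: "f \<in> hom1 WCmd x y" using 7(1) by (rule hom2_WCmd_obtain)
    show ?case using wcmd_vcomp_to_cmd[OF 7(1) f] by simp
  next
    case (8 f x y g z \<alpha> f' \<beta> g') then show ?case using wcmd_hcomp_to_cmd[OF 8(3,4,1,2)] by simp
  qed (auto simp: is_comonad_iff is_wcomonadD hom1_WCmd wcmd_to_cmd_ops is_wcmd_1cell_def)
qed

section \<open>The 2-category of generalised categories with families\<close>

lemma is_gcwfD:
  assumes "is_gcwf W"
  shows "is_fibration (gu W)" "is_fibration (gud W)" "adjunction (gadj W)" "fB (gud W) = fB (gu W)"
    "adC (gadj W) = fE (gu W)" "adD (gadj W) = fE (gud W)"
    "comp_fct (fE (gud W)) (fp (gu W)) (adL (gadj W)) = fp (gud W)"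
    "cartesian (gud W) f \<Longrightarrow> cartesian (gu W) (onA (adL (gadj W)) f)"
    "A \<in> Ob (fE (gud W)) \<Longrightarrow> cartesian (gud W) (adeta (gadj W) A)"
    "X \<in> Ob (fE (gu W)) \<Longrightarrow> cartesian (gu W) (adeps (gadj W) X)"
  using assms by (simp_all add: is_gcwf_def Let_def is_adj_iff)

lemma gcwf_1cell_simps [simp]:
  "Src (gcwf_to_adj1 f) = gadj (Src f)" "Tgt (gcwf_to_adj1 f) = gadj (Tgt f)" "amF (gcwf_to_adj1 f) = gmH f"
  "amG (gcwf_to_adj1 f) = gmHd f" "amz (gcwf_to_adj1 f) = gmz f"
  "Src (gcwf_to_adj2 \<alpha>) = gcwf_to_adj1 (Src \<alpha>)" "Tgt (gcwf_to_adj2 \<alpha>) = gcwf_to_adj1 (Tgt \<alpha>)"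
  "amphi (gcwf_to_adj2 \<alpha>) = gmphi \<alpha>" "ampsi (gcwf_to_adj2 \<alpha>) = gmphid \<alpha>"
  "Src (gcwf_id1 W) = W" "Tgt (gcwf_id1 W) = W" "gmC (gcwf_id1 W) = id_fct (fB (gu W))" "gmH (gcwf_id1 W) = id_fct (fE (gu W))"
  "gmHd (gcwf_id1 W) = id_fct (fE (gud W))" "gmz (gcwf_id1 W) = id_nt (fE (gud W)) (fE (gu W)) (adL (gadj W))"
  "Src (gcwf_comp1 g f) = Src f" "Tgt (gcwf_comp1 g f) = Tgt g" "gmC (gcwf_comp1 g f) = comp_fct (fB (gu (Src f))) (gmC g) (gmC f)"
  "gmH (gcwf_comp1 g f) = comp_fct (fE (gu (Src f))) (gmH g) (gmH f)" "gmHd (gcwf_comp1 g f) = comp_fct (fE (gud (Src f))) (gmHd g) (gmHd f)"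
  "gmz (gcwf_comp1 g f) = amz (adj_comp1 (gcwf_to_adj1 g) (gcwf_to_adj1 f))"
  by (simp_all add: gcwf_to_adj1_def gcwf_to_adj2_def gcwf_id1_def gcwf_comp1_def Let_def)

lemma gcwf_2cell_simps [simp]:
  "Src (gcwf_id2 f) = f" "Tgt (gcwf_id2 f) = f" "gmpsi (gcwf_id2 f) = id_nt (fB (gu (Src f))) (fB (gu (Tgt f))) (gmC f)"
  "gmphi (gcwf_id2 f) = id_nt (fE (gu (Src f))) (fE (gu (Tgt f))) (gmH f)"
  "gmphid (gcwf_id2 f) = id_nt (fE (gud (Src f))) (fE (gud (Tgt f))) (gmHd f)"
  "Src (gcwf_vcomp \<beta> \<alpha>) = Src \<alpha>" "Tgt (gcwf_vcomp \<beta> \<alpha>) = Tgt \<beta>"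
  "gmpsi (gcwf_vcomp \<beta> \<alpha>) = vcomp_nt (fB (gu (Src (Src \<alpha>)))) (fB (gu (Tgt (Src \<alpha>)))) (gmpsi \<beta>) (gmpsi \<alpha>)"
  "gmphi (gcwf_vcomp \<beta> \<alpha>) = vcomp_nt (fE (gu (Src (Src \<alpha>)))) (fE (gu (Tgt (Src \<alpha>)))) (gmphi \<beta>) (gmphi \<alpha>)"
  "gmphid (gcwf_vcomp \<beta> \<alpha>) = vcomp_nt (fE (gud (Src (Src \<alpha>)))) (fE (gud (Tgt (Src \<alpha>)))) (gmphid \<beta>) (gmphid \<alpha>)"
  "Src (gcwf_hcomp \<beta> \<alpha>) = gcwf_comp1 (Src \<beta>) (Src \<alpha>)" "Tgt (gcwf_hcomp \<beta> \<alpha>) = gcwf_comp1 (Tgt \<beta>) (Tgt \<alpha>)"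
  "gmpsi (gcwf_hcomp \<beta> \<alpha>) = hcomp_nt (fB (gu (Src (Src \<alpha>)))) (fB (gu (Tgt (Src \<beta>)))) (gmC (Src \<beta>)) (gmC (Tgt \<alpha>)) (gmpsi \<beta>) (gmpsi \<alpha>)"
  "gmphi (gcwf_hcomp \<beta> \<alpha>) = hcomp_nt (fE (gu (Src (Src \<alpha>)))) (fE (gu (Tgt (Src \<beta>)))) (gmH (Src \<beta>)) (gmH (Tgt \<alpha>)) (gmphi \<beta>) (gmphi \<alpha>)"
  "gmphid (gcwf_hcomp \<beta> \<alpha>) = hcomp_nt (fE (gud (Src (Src \<alpha>)))) (fE (gud (Tgt (Src \<beta>)))) (gmHd (Src \<beta>)) (gmHd (Tgt \<alpha>)) (gmphid \<beta>) (gmphid \<alpha>)"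
  by (simp_all add: gcwf_id2_def gcwf_vcomp_def gcwf_hcomp_def Let_def)

lemma GCwF_iso_simps [simp]:
  "Zero GCwF_iso = Collect is_gcwf" "One GCwF_iso = Collect is_gcwf_1cell" "Two GCwF_iso = Collect is_gcwf_2cell"
  "src1 GCwF_iso = Src" "tgt1 GCwF_iso = Tgt" "src2 GCwF_iso = Src" "tgt2 GCwF_iso = Tgt"
  "id1 GCwF_iso = gcwf_id1" "id2 GCwF_iso = gcwf_id2" "comp1 GCwF_iso = gcwf_comp1" "vcomp GCwF_iso = gcwf_vcomp" "hcomp GCwF_iso = gcwf_hcomp"
  by (simp_all add: GCwF_iso_def)

definition vertical where
  "vertical p f \<longleftrightarrow> onA (fp p) f = Ident (fB p) (onO (fp p) (Dom (fE p) f))"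

lemma hom1_GCwF: "f \<in> hom1 GCwF_iso x y \<longleftrightarrow> Src f = x \<and> Tgt f = y \<and> is_gcwf x \<and> is_gcwf y \<and>
    is_fib_1cell (gu x) (gu y) (gmC f) (gmH f) \<and> is_fib_1cell (gud x) (gud y) (gmC f) (gmHd f) \<and>
    gcwf_to_adj1 f \<in> hom1 LAdj_iso (gadj x) (gadj y) \<and> (\<forall>A \<in> Ob (fE (gud x)). vertical (gu y) (gmz f A))"
  by (auto simp: hom1_def is_gcwf_1cell_def Let_def vertical_def)

lemma hom2_GCwFD:
  assumes a: "\<alpha> \<in> hom2 GCwF_iso f g" and f: "f \<in> hom1 GCwF_iso x y"
  shows "Src \<alpha> = f" "Tgt \<alpha> = g" "g \<in> hom1 GCwF_iso x y"
    "is_fib_2cell (gu x) (gu y) (gmC f) (gmH f) (gmC g) (gmH g) (gmpsi \<alpha>) (gmphi \<alpha>)"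
    "is_fib_2cell (gud x) (gud y) (gmC f) (gmHd f) (gmC g) (gmHd g) (gmpsi \<alpha>) (gmphid \<alpha>)"
    "gcwf_to_adj2 \<alpha> \<in> hom2 LAdj_iso (gcwf_to_adj1 f) (gcwf_to_adj1 g)"
proof -
  have a': "Src \<alpha> = f" "Tgt \<alpha> = g" "is_gcwf_2cell \<alpha>" and f': "Src f = x" "Tgt f = y"
    using a f by (simp_all add: hom2_def hom1_def)
  from a' show "Src \<alpha> = f" "Tgt \<alpha> = g" by blast+
  from a'(3) have g: "Src f = Src g" "Tgt f = Tgt g" "is_gcwf_1cell g"
      "is_fib_2cell (gu (Src f)) (gu (Tgt f)) (gmC f) (gmH f) (gmC g) (gmH g) (gmpsi \<alpha>) (gmphi \<alpha>)"
      "is_fib_2cell (gud (Src f)) (gud (Tgt f)) (gmC f) (gmHd f) (gmC g) (gmHd g) (gmpsi \<alpha>) (gmphid \<alpha>)"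
      "is_adj_2cell (gcwf_to_adj2 \<alpha>)"
    unfolding is_gcwf_2cell_def a'(1,2) by blast+
  show "g \<in> hom1 GCwF_iso x y" using g(1-3) by (simp add: hom1_def f')
  show "is_fib_2cell (gu x) (gu y) (gmC f) (gmH f) (gmC g) (gmH g) (gmpsi \<alpha>) (gmphi \<alpha>)" using g(4) by (simp add: f')
  show "is_fib_2cell (gud x) (gud y) (gmC f) (gmHd f) (gmC g) (gmHd g) (gmpsi \<alpha>) (gmphid \<alpha>)" using g(5) by (simp add: f')
  show "gcwf_to_adj2 \<alpha> \<in> hom2 LAdj_iso (gcwf_to_adj1 f) (gcwf_to_adj1 g)" using g(6) a' by (simp add: hom2_def)
qed

lemma hom2_GCwFI:
  assumes "f \<in> hom1 GCwF_iso x y" "g \<in> hom1 GCwF_iso x y" "Src \<alpha> = f" "Tgt \<alpha> = g"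
    "is_fib_2cell (gu x) (gu y) (gmC f) (gmH f) (gmC g) (gmH g) (gmpsi \<alpha>) (gmphi \<alpha>)"
    "is_fib_2cell (gud x) (gud y) (gmC f) (gmHd f) (gmC g) (gmHd g) (gmpsi \<alpha>) (gmphid \<alpha>)"
    "gcwf_to_adj2 \<alpha> \<in> hom2 LAdj_iso (gcwf_to_adj1 f) (gcwf_to_adj1 g)"
  shows "\<alpha> \<in> hom2 GCwF_iso f g"
  using assms by (auto simp: hom2_def hom1_def is_gcwf_2cell_def)

lemma hom2_GCwF_obtain:
  assumes "\<alpha> \<in> hom2 GCwF_iso f g" obtains x y where "f \<in> hom1 GCwF_iso x y"
  using assms by (auto simp: hom2_def hom1_def is_gcwf_2cell_def)

lemma gcwf_to_adj_ops:
  "is_gcwf W \<Longrightarrow> gcwf_to_adj1 (gcwf_id1 W) = adj_id1 (gadj W)"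
  "is_gcwf (Src f) \<Longrightarrow> gcwf_to_adj1 (gcwf_comp1 g f) = adj_comp1 (gcwf_to_adj1 g) (gcwf_to_adj1 f)"
  "\<lbrakk>is_gcwf (Src f); is_gcwf (Tgt f)\<rbrakk> \<Longrightarrow> gcwf_to_adj2 (gcwf_id2 f) = adj_id2 (gcwf_to_adj1 f)"
  by (auto intro!: adj_1cell.equality adj_2cell.equality simp: is_gcwfD adj_id1_def)

lemma gcwf_1cell_eqI:
  assumes "f \<in> hom1 GCwF_iso x y" "g \<in> hom1 GCwF_iso x y" "gmC f = gmC g" "gcwf_to_adj1 f = gcwf_to_adj1 g" shows "f = g"
proof -
  have "gmH f = gmH g" "gmHd f = gmHd g" "gmz f = gmz g"
    using arg_cong[OF assms(4), of amF] arg_cong[OF assms(4), of amG] arg_cong[OF assms(4), of amz] by simp_all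
  with assms show ?thesis by (intro gcwf_1cell.equality) (simp_all add: hom1_GCwF)
qed

text \<open>Parallel 2-cells are detected by their base component and their underlying cell in
  \<open>LAdj_iso\<close>. Equations between 2-cells are thereby inherited from the base level, up
  to a calculation with transformations between base functors.\<close>

lemma gcwf_2cell_eqI:
  assumes "\<alpha> \<in> hom2 GCwF_iso f g" "\<beta> \<in> hom2 GCwF_iso f g" "gmpsi \<alpha> = gmpsi \<beta>" "gcwf_to_adj2 \<alpha> = gcwf_to_adj2 \<beta>" shows "\<alpha> = \<beta>"
proof -
  have "gmphi \<alpha> = gmphi \<beta>" "gmphid \<alpha> = gmphid \<beta>"
    using arg_cong[OF assms(4), of amphi] arg_cong[OF assms(4), of ampsi] by simp_all
  with assms show ?thesis by (intro gcwf_2cell.equality) (simp_all add: hom2_def)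
qed

lemma gcwf_id1_hom:
  assumes x: "is_gcwf x" shows "gcwf_id1 x \<in> hom1 GCwF_iso x x"
proof -
  interpret P: is_functor "fE (gu x)" "fB (gu x)" "fp (gu x)" by (rule is_fibrationD) (rule is_gcwfD[OF x])
  interpret T: adjunction "gadj x" by (rule is_gcwfD[OF x])
  have "onO (adL (gadj x)) A \<in> Ob (fE (gu x))" if "A \<in> Ob (fE (gud x))" for A
    using T.L.onO_Ob[of A] that x by (simp add: is_gcwfD)
  then show ?thesis
    using is_fib_1cell_id[OF is_gcwfD(1)[OF x]] is_fib_1cell_id[OF is_gcwfD(2)[OF x]] x
    by (simp add: hom1_GCwF gcwf_to_adj_ops adj_id1_hom is_gcwfD vertical_def)
qed

lemma gcwf_comp1_hom:
  assumes f: "f \<in> hom1 GCwF_iso x y" and g: "g \<in> hom1 GCwF_iso y z" shows "gcwf_comp1 g f \<in> hom1 GCwF_iso x z"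
proof -
  have [simp]: "Src f = x" "Tgt f = y" "Src g = y" "Tgt g = z" and x: "is_gcwf x" "is_gcwf y" "is_gcwf z"
    using f g by (simp_all add: hom1_GCwF)
  have c: "gcwf_to_adj1 f \<in> hom1 LAdj_iso (gadj x) (gadj y)" "gcwf_to_adj1 g \<in> hom1 LAdj_iso (gadj y) (gadj z)"
    and fu: "is_fib_1cell (gu x) (gu y) (gmC f) (gmH f)" "is_fib_1cell (gu y) (gu z) (gmC g) (gmH g)"
      "is_fib_1cell (gud x) (gud y) (gmC f) (gmHd f)" "is_fib_1cell (gud y) (gud z) (gmC g) (gmHd g)"
    using f g by (simp_all add: hom1_GCwF)
  interpret f: adj_arrow "gadj x" "gadj y" "gmH f" "gmHd f" "gmz f"
    rewrites "adC (gadj x) = fE (gu x)" and "adD (gadj x) = fE (gud x)" and "adC (gadj y) = fE (gu y)" and "adD (gadj y) = fE (gud y)"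
    using c by (simp_all add: hom1_LAdj is_gcwfD x)
  interpret g: adj_arrow "gadj y" "gadj z" "gmH g" "gmHd g" "gmz g"
    rewrites "adC (gadj y) = fE (gu y)" and "adD (gadj y) = fE (gud y)" and "adC (gadj z) = fE (gu z)" and "adD (gadj z) = fE (gud z)"
    using c by (simp_all add: hom1_LAdj is_gcwfD x)
  interpret Py: is_functor "fE (gu y)" "fB (gu y)" "fp (gu y)" by (rule is_fibrationD) (rule is_gcwfD[OF x(2)])
  interpret Pz: is_functor "fE (gu z)" "fB (gu z)" "fp (gu z)" by (rule is_fibrationD) (rule is_gcwfD[OF x(3)])
  interpret B: is_functor "fB (gu y)" "fB (gu z)" "gmC g" by (rule is_fib_1cellD[OF fu(2)])
  have v: "onA (fp (gu y)) (gmz f A) = Ident (fB (gu y)) (onO (fp (gu y)) (onO (adL (gadj y)) (onO (gmHd f) A)))"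
    if "A \<in> Ob (fE (gud x))" for A
    using f that by (simp add: hom1_GCwF vertical_def)
  have v': "onA (fp (gu z)) (gmz g A) = Ident (fB (gu z)) (onO (fp (gu z)) (onO (adL (gadj z)) (onO (gmHd g) A)))"
    if "A \<in> Ob (fE (gud y))" for A
    using g that by (simp add: hom1_GCwF vertical_def)
  \<comment> \<open>Verticality is expressed at the domain of \<open>\<zeta>\<close>. Reading the
    codomain off the same equation shows that its endpoints lie over the same object, so that the
    two identities to be composed in the base coincide.\<close>
  have "onO (fp (gu z)) (onO (gmH g) (onO (adL (gadj y)) (onO (gmHd f) A))) = onO (fp (gu z)) (onO (adL (gadj z)) (onO (gmHd g) (onO (gmHd f) A)))"
    if A: "A \<in> Ob (fE (gud x))" for A
    using arg_cong[OF v'[OF f.G.onO_Ob[OF A]], of "Cod (fB (gu z))"] A by simp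
  then have "vertical (gu z) (gmz (gcwf_comp1 g f) A)" if A: "A \<in> Ob (fE (gud x))" for A
    using A is_gcwfD[OF x(1)] is_gcwfD[OF x(3)]
    by (simp add: vertical_def adj_comp1_def is_fib_1cell_over[OF fu(2)] v v')
  then show ?thesis
    using is_fib_1cell_comp[OF fu(1,2)] is_fib_1cell_comp[OF fu(3,4)] adj_comp1_hom[OF c] x
    by (simp add: hom1_GCwF gcwf_to_adj_ops is_gcwfD)
qed

lemma gcwf_comp1_id1:
  assumes f: "f \<in> hom1 GCwF_iso x y" shows "gcwf_comp1 f (gcwf_id1 x) = f" "gcwf_comp1 (gcwf_id1 y) f = f"
proof -
  have x: "is_gcwf x" "is_gcwf y" "is_functor (fB (gu x)) (fB (gu y)) (gmC f)" "Src f = x" "Tgt f = y"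
    "gcwf_to_adj1 f \<in> hom1 LAdj_iso (gadj x) (gadj y)" using f by (auto simp: hom1_GCwF is_fib_1cellD)
  show "gcwf_comp1 f (gcwf_id1 x) = f"
    by (rule gcwf_1cell_eqI[OF gcwf_comp1_hom[OF gcwf_id1_hom[OF x(1)] f] f])
      (simp_all add: x comp_fct_id_right[OF x(3)] gcwf_to_adj_ops adj_comp1_id1[OF x(6)])
  show "gcwf_comp1 (gcwf_id1 y) f = f"
    by (rule gcwf_1cell_eqI[OF gcwf_comp1_hom[OF f gcwf_id1_hom[OF x(2)]] f])
      (simp_all add: x comp_fct_id_left[OF x(3)] gcwf_to_adj_ops adj_comp1_id1[OF x(6)])
qed

lemma gcwf_comp1_assoc:
  assumes f: "f \<in> hom1 GCwF_iso x y" and g: "g \<in> hom1 GCwF_iso y z" and h: "h \<in> hom1 GCwF_iso z w"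
  shows "gcwf_comp1 (gcwf_comp1 h g) f = gcwf_comp1 h (gcwf_comp1 g f)"
proof -
  have x: "is_gcwf x" "is_gcwf y" "is_functor (fB (gu x)) (fB (gu y)) (gmC f)" "Src f = x" "Src g = y" "Src h = z"
    using f g h by (auto simp: hom1_GCwF is_fib_1cellD)
  have c: "gcwf_to_adj1 f \<in> hom1 LAdj_iso (gadj x) (gadj y)" "gcwf_to_adj1 g \<in> hom1 LAdj_iso (gadj y) (gadj z)"
      "gcwf_to_adj1 h \<in> hom1 LAdj_iso (gadj z) (gadj w)"
    using f g h by (auto simp: hom1_GCwF)
  show ?thesis
    by (rule gcwf_1cell_eqI[OF gcwf_comp1_hom[OF f gcwf_comp1_hom[OF g h]] gcwf_comp1_hom[OF gcwf_comp1_hom[OF f g] h]])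
      (simp_all add: x comp_fct_assoc[OF x(3)] gcwf_to_adj_ops adj_comp1_assoc[OF c])
qed

lemma hom2_GCwF_nt:
  assumes "\<alpha> \<in> hom2 GCwF_iso f g" "f \<in> hom1 GCwF_iso x y"
  shows "nat_trans (fB (gu x)) (fB (gu y)) (gmC f) (gmC g) (gmpsi \<alpha>)"
  using is_fib_2cellD[OF hom2_GCwFD(4)[OF assms]] by blast

lemma gcwf_id2_hom: assumes f: "f \<in> hom1 GCwF_iso x y" shows "gcwf_id2 f \<in> hom2 GCwF_iso f f"
proof -
  have "gcwf_to_adj1 f \<in> One LAdj_iso" using f unfolding hom1_GCwF by (simp add: hom1_def)
  from two_category.id2_hom[OF two_category_LAdj_iso this] f
    is_fib_2cell_id[of "gu x" "gu y" "gmC f" "gmH f"] is_fib_2cell_id[of "gud x" "gud y" "gmC f" "gmHd f"]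
  show ?thesis
    by (intro hom2_GCwFI[OF f f]) (simp_all add: gcwf_to_adj_ops hom1_GCwF is_gcwfD)
qed

lemma gcwf_vcomp_to_adj:
  assumes "\<alpha> \<in> hom2 GCwF_iso f g" "f \<in> hom1 GCwF_iso x y"
  shows "gcwf_to_adj2 (gcwf_vcomp \<beta> \<alpha>) = adj_vcomp (gcwf_to_adj2 \<beta>) (gcwf_to_adj2 \<alpha>)"
  using hom2_GCwFD(1)[OF assms] assms(2) by (intro adj_2cell.equality) (simp_all add: hom1_GCwF is_gcwfD)

lemma gcwf_hcomp_to_adj:
  assumes "\<alpha> \<in> hom2 GCwF_iso f f'" "\<beta> \<in> hom2 GCwF_iso g g'" "f \<in> hom1 GCwF_iso x y" "g \<in> hom1 GCwF_iso y z"
  shows "gcwf_to_adj2 (gcwf_hcomp \<beta> \<alpha>) = adj_hcomp (gcwf_to_adj2 \<beta>) (gcwf_to_adj2 \<alpha>)"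
  using hom2_GCwFD(1-3)[OF assms(1,3)] hom2_GCwFD(1-3)[OF assms(2,4)] assms(3,4)
  by (intro adj_2cell.equality) (simp_all add: hom1_GCwF is_gcwfD gcwf_to_adj_ops)

lemma gcwf_vcomp_hom:
  assumes a: "\<alpha> \<in> hom2 GCwF_iso f g" and b: "\<beta> \<in> hom2 GCwF_iso g h" shows "gcwf_vcomp \<beta> \<alpha> \<in> hom2 GCwF_iso f h"
proof -
  obtain x y where f: "f \<in> hom1 GCwF_iso x y" using a by (rule hom2_GCwF_obtain)
  note a' = hom2_GCwFD[OF a f] note b' = hom2_GCwFD[OF b a'(3)]
  have xy: "Src f = x" "Tgt f = y" and e: "fB (gud x) = fB (gu x)" "fB (gud y) = fB (gu y)" using f by (simp_all add: hom1_GCwF is_gcwfD)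
  show ?thesis
    by (rule hom2_GCwFI[OF f b'(3)])
     (simp_all add: a'(1) b'(2) xy is_fib_2cell_vcomp[OF a'(4) b'(4)] is_fib_2cell_vcomp[OF a'(5) b'(5), unfolded e] gcwf_vcomp_to_adj[OF a f]
      two_category.vcomp_hom[OF two_category_LAdj_iso a'(6) b'(6), simplified])
qed

lemma gcwf_hcomp_hom:
  assumes f: "f \<in> hom1 GCwF_iso x y" and g: "g \<in> hom1 GCwF_iso y z" and a: "\<alpha> \<in> hom2 GCwF_iso f f'" and b: "\<beta> \<in> hom2 GCwF_iso g g'"
  shows "gcwf_hcomp \<beta> \<alpha> \<in> hom2 GCwF_iso (gcwf_comp1 g f) (gcwf_comp1 g' f')"
proof -
  note a' = hom2_GCwFD[OF a f] and b' = hom2_GCwFD[OF b g]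
  have xy: "Src f = x" "Tgt f = y" "Src g = y" "Tgt g = z" "Src f' = x" "is_gcwf x" using f g a'(3) by (simp_all add: hom1_GCwF)
  have e: "fB (gud x) = fB (gu x)" "fB (gud z) = fB (gu z)" using f g by (simp_all add: hom1_GCwF is_gcwfD)
  have fc: "gcwf_to_adj1 f \<in> hom1 LAdj_iso (gadj x) (gadj y)" "gcwf_to_adj1 g \<in> hom1 LAdj_iso (gadj y) (gadj z)"
    using f g by (simp_all add: hom1_GCwF)
  show ?thesis
    by (rule hom2_GCwFI[OF gcwf_comp1_hom[OF f g] gcwf_comp1_hom[OF a'(3) b'(3)]])
     (simp_all add: a'(1,2) b'(1,2) xy is_fib_2cell_hcomp[OF a'(4) b'(4)] is_fib_2cell_hcomp[OF a'(5) b'(5), unfolded e]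
      gcwf_hcomp_to_adj[OF a b f g] gcwf_to_adj_ops
      two_category.hcomp_hom[OF two_category_LAdj_iso fc a'(6) b'(6), simplified])
qed

lemma gcwf_forget_hom1: "f \<in> hom1 GCwF_iso x y \<Longrightarrow> gcwf_to_adj1 f \<in> hom1 LAdj_iso (gadj x) (gadj y)"
  by (simp add: hom1_GCwF)

lemma two_category_GCwF_iso: "two_category GCwF_iso"
proof -
  interpret L: two_category LAdj_iso by (rule two_category_LAdj_iso)
  show ?thesis
  proof (unfold_locales, goal_cases)
    case (7 x) then show ?case by (simp add: gcwf_id1_hom)
  next
    case (8 f) then show ?case using gcwf_id2_hom[of f "Src f" "Tgt f"] by (simp add: hom1_def)
  next
    case (9 f x y g z) then show ?case by (simp add: gcwf_comp1_hom)
  next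
    case (10 f x y) then show ?case by (simp add: gcwf_comp1_id1)
  next
    case (11 f x y) then show ?case by (simp add: gcwf_comp1_id1)
  next
    case (12 f x y g z h w) then show ?case by (simp add: gcwf_comp1_assoc)
  next
    case (13 \<alpha> f g \<beta> h) then show ?case by (simp add: gcwf_vcomp_hom)
  next
    case (14 \<alpha> f g)
    then obtain x y where f: "f \<in> hom1 GCwF_iso x y" by (rule hom2_GCwF_obtain)
    note a = hom2_GCwFD[OF 14 f]
    have e: "Src f = x" "Tgt f = y" "is_gcwf x" "is_gcwf y" using f by (simp_all add: hom1_GCwF)
    show ?case
      unfolding GCwF_iso_simps
      by (rule gcwf_2cell_eqI[OF gcwf_vcomp_hom[OF gcwf_id2_hom[OF f] 14] 14])
        (simp_all add: e gcwf_vcomp_to_adj[OF gcwf_id2_hom[OF f] f] gcwf_to_adj_ops L.vcomp_id2[OF a(6), simplified]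
          vcomp_nt_id_right[OF hom2_GCwF_nt[OF 14 f]])
  next
    case (15 \<alpha> f g)
    then obtain x y where f: "f \<in> hom1 GCwF_iso x y" by (rule hom2_GCwF_obtain)
    note a = hom2_GCwFD[OF 15 f]
    have e: "Src f = x" "Tgt f = y" "Src g = x" "Tgt g = y" "is_gcwf x" "is_gcwf y" using f a(3) by (simp_all add: hom1_GCwF)
    show ?case
      unfolding GCwF_iso_simps
      by (rule gcwf_2cell_eqI[OF gcwf_vcomp_hom[OF 15 gcwf_id2_hom[OF a(3)]] 15])
        (simp_all add: e a(1) gcwf_vcomp_to_adj[OF 15 f] gcwf_to_adj_ops L.id2_vcomp[OF a(6), simplified]
          vcomp_nt_id_left[OF hom2_GCwF_nt[OF 15 f]])
  next
    case (16 \<alpha> f g \<beta> h \<gamma> k)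
    then obtain x y where f: "f \<in> hom1 GCwF_iso x y" using hom2_GCwF_obtain by blast
    note g = hom2_GCwFD[OF 16(1) f] note h = hom2_GCwFD[OF 16(2) g(3)] note k = hom2_GCwFD[OF 16(3) h(3)]
    have e: "Src f = x" "Tgt f = y" "Src g = x" "Tgt g = y" using f g(3) by (simp_all add: hom1_GCwF)
    note n = hom2_GCwF_nt[OF 16(1) f] hom2_GCwF_nt[OF 16(2) g(3)] hom2_GCwF_nt[OF 16(3) h(3)]
    note v = gcwf_vcomp_hom[OF 16(1,2)] gcwf_vcomp_hom[OF 16(2,3)]
    show ?case
      unfolding GCwF_iso_simps
      by (rule gcwf_2cell_eqI[OF gcwf_vcomp_hom[OF 16(1) v(2)] gcwf_vcomp_hom[OF v(1) 16(3)]])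
        (simp_all add: e g(1) h(1) vcomp_nt_assoc[OF n] gcwf_vcomp_to_adj[OF 16(1) f] gcwf_vcomp_to_adj[OF 16(2) g(3)]
          gcwf_vcomp_to_adj[OF v(1) f] L.vcomp_assoc[OF g(6) h(6) k(6), simplified])
  next
    case (17 f x y g z \<alpha> f' \<beta> g') then show ?case by (simp add: gcwf_hcomp_hom)
  next
    case (18 f x y \<alpha> f')
    note a = hom2_GCwFD[OF 18(2,1)] and n = hom2_GCwF_nt[OF 18(2,1)]
    have e: "Src f = x" "Tgt f = y" "is_gcwf x" "is_gcwf y" using 18(1) by (simp_all add: hom1_GCwF)
    note i1 = gcwf_id1_hom[OF e(3)] and i2 = gcwf_id2_hom[OF gcwf_id1_hom[OF e(3)]]
    show ?case
      unfolding GCwF_iso_simps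
      by (rule gcwf_2cell_eqI[OF gcwf_hcomp_hom[OF i1 18(1) i2 18(2), unfolded gcwf_comp1_id1[OF 18(1)] gcwf_comp1_id1[OF a(3)]] 18(2)])
        (simp_all add: e a(1,2) gcwf_hcomp_to_adj[OF i2 18(2) i1 18(1)] gcwf_to_adj_ops hcomp_nt_id_right[OF n]
          L.hcomp_id1[OF gcwf_forget_hom1[OF 18(1)] a(6), simplified])
  next
    case (19 f x y \<alpha> f')
    note a = hom2_GCwFD[OF 19(2,1)] and n = hom2_GCwF_nt[OF 19(2,1)]
    have e: "Src f = x" "Tgt f = y" "is_gcwf y" "is_gcwf x" using 19(1) by (simp_all add: hom1_GCwF)
    note i1 = gcwf_id1_hom[OF e(3)] and i2 = gcwf_id2_hom[OF gcwf_id1_hom[OF e(3)]]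
    show ?case
      unfolding GCwF_iso_simps
      by (rule gcwf_2cell_eqI[OF gcwf_hcomp_hom[OF 19(1) i1 19(2) i2, unfolded gcwf_comp1_id1[OF 19(1)] gcwf_comp1_id1[OF a(3)]] 19(2)])
        (simp_all add: e a(1,2) gcwf_hcomp_to_adj[OF 19(2) i2 19(1) i1] gcwf_to_adj_ops hcomp_nt_id_left[OF n]
          L.id1_hcomp[OF gcwf_forget_hom1[OF 19(1)] a(6), simplified])
  next
    case (20 f x y g z h w \<alpha> f' \<beta> g' \<gamma> h')
    note a = hom2_GCwFD[OF 20(4,1)] and b = hom2_GCwFD[OF 20(5,2)] and c = hom2_GCwFD[OF 20(6,3)]
    have e: "Src f = x" "Tgt f = y" "Src g = y" "Tgt g = z" "Src h = z" "Tgt h = w" "Src f' = x" "Src g' = y" "Src h' = z"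
      using 20(1-3) a(3) b(3) c(3) by (simp_all add: hom1_GCwF)
    note n = hom2_GCwF_nt[OF 20(4,1)] hom2_GCwF_nt[OF 20(5,2)] hom2_GCwF_nt[OF 20(6,3)]
    note gf = gcwf_comp1_hom[OF 20(1,2)] gcwf_hcomp_hom[OF 20(1,2,4,5)] and hg = gcwf_comp1_hom[OF 20(2,3)] gcwf_hcomp_hom[OF 20(2,3,5,6)]
    note as = gcwf_comp1_assoc[OF 20(1-3)] gcwf_comp1_assoc[OF a(3) b(3) c(3)]
    show ?case
      unfolding GCwF_iso_simps
      by (rule gcwf_2cell_eqI[OF gcwf_hcomp_hom[OF 20(1) hg(1) 20(4) hg(2), unfolded as] gcwf_hcomp_hom[OF gf(1) 20(3) gf(2) 20(6)]])
        (simp_all add: e a(1,2) b(1,2) c(1,2) hcomp_nt_assoc[OF n] gcwf_hcomp_to_adj[OF 20(4) hg(2) 20(1) hg(1)] gcwf_hcomp_to_adj[OF 20(5,6,2,3)]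
          gcwf_hcomp_to_adj[OF gf(2) 20(6) gf(1) 20(3)] gcwf_hcomp_to_adj[OF 20(4,5,1,2)]
          L.hcomp_assoc[OF gcwf_forget_hom1[OF 20(1)] gcwf_forget_hom1[OF 20(2)] gcwf_forget_hom1[OF 20(3)] a(6) b(6) c(6), simplified])
  next
    case (21 f x y g z)
    note i = gcwf_id2_hom[OF 21(1)] gcwf_id2_hom[OF 21(2)]
    have e: "Src f = x" "Tgt f = y" "Src g = y" "Tgt g = z" "is_gcwf x" "is_gcwf y" "is_gcwf z"
      and c: "is_functor (fB (gu x)) (fB (gu y)) (gmC f)" "is_functor (fB (gu y)) (fB (gu z)) (gmC g)"
      using 21 by (auto simp: hom1_GCwF is_fib_1cellD)
    show ?case
      unfolding GCwF_iso_simps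
      by (rule gcwf_2cell_eqI[OF gcwf_hcomp_hom[OF 21 i] gcwf_id2_hom[OF gcwf_comp1_hom[OF 21]]])
        (simp_all add: e hcomp_nt_id_id[OF c] gcwf_hcomp_to_adj[OF i 21] gcwf_to_adj_ops
          L.hcomp_id2[OF gcwf_forget_hom1[OF 21(1)] gcwf_forget_hom1[OF 21(2)], simplified])
  next
    case (22 f x y g z \<alpha> f' \<alpha>' f'' \<beta> g' \<beta>' g'')
    note a = hom2_GCwFD[OF 22(3,1)] and b = hom2_GCwFD[OF 22(5,2)]
    note a' = hom2_GCwFD[OF 22(4) a(3)] and b' = hom2_GCwFD[OF 22(6) b(3)]
    have e: "Src f = x" "Tgt f = y" "Src g = y" "Tgt g = z" "Src f' = x" "Tgt f' = y" "Src g' = y" "Tgt g' = z"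
      using 22(1,2) a(3) b(3) by (simp_all add: hom1_GCwF)
    note n = hom2_GCwF_nt[OF 22(3,1)] hom2_GCwF_nt[OF 22(4) a(3)] hom2_GCwF_nt[OF 22(5,2)] hom2_GCwF_nt[OF 22(6) b(3)]
    note v = gcwf_vcomp_hom[OF 22(3,4)] gcwf_vcomp_hom[OF 22(5,6)]
    note h = gcwf_hcomp_hom[OF 22(1,2,3,5)] gcwf_hcomp_hom[OF a(3) b(3) 22(4,6)]
    show ?case
      unfolding GCwF_iso_simps
      by (rule gcwf_2cell_eqI[OF gcwf_hcomp_hom[OF 22(1,2) v] gcwf_vcomp_hom[OF h]])
        (simp_all add: e a(1,2) b(1,2) a'(1,2) b'(1,2) hcomp_nt_interchange[OF n] gcwf_hcomp_to_adj[OF v 22(1,2)]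
          gcwf_vcomp_to_adj[OF 22(3,1)] gcwf_vcomp_to_adj[OF 22(5,2)] gcwf_vcomp_to_adj[OF h(1) gcwf_comp1_hom[OF 22(1,2)]]
          gcwf_hcomp_to_adj[OF 22(3,5,1,2)] gcwf_hcomp_to_adj[OF 22(4,6) a(3) b(3)]
          L.interchange[OF gcwf_forget_hom1[OF 22(1)] gcwf_forget_hom1[OF 22(2)] a(6) a'(6) b(6) b'(6), simplified])
  qed (auto simp: is_gcwf_1cell_def is_gcwf_2cell_def)
qed

lemma forget_GCwF_simps [simp]: "F0 forget_GCwF = gadj" "F1 forget_GCwF = gcwf_to_adj1" "F2 forget_GCwF = gcwf_to_adj2"
  by (simp_all add: forget_GCwF_def)

lemma two_functor_forget_GCwF: "two_functor GCwF_iso LAdj_iso forget_GCwF"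
proof -
  interpret A: two_category GCwF_iso by (rule two_category_GCwF_iso)
  interpret B: two_category LAdj_iso by (rule two_category_LAdj_iso)
  show ?thesis
  proof (unfold_locales, goal_cases)
    case (3 \<alpha> f g)
    then obtain x y where f: "f \<in> hom1 GCwF_iso x y" by (rule hom2_GCwF_obtain)
    show ?case using hom2_GCwFD(6)[OF 3 f] by simp
  next
    case (7 \<alpha> f g \<beta> h)
    obtain x y where f: "f \<in> hom1 GCwF_iso x y" using 7(1) by (rule hom2_GCwF_obtain)
    show ?case using gcwf_vcomp_to_adj[OF 7(1) f] by simp
  next
    case (8 f x y g z \<alpha> f' \<beta> g') then show ?case using gcwf_hcomp_to_adj[OF 8(3,4,1,2)] by simp
  qed (auto simp: is_adj_iff is_gcwfD hom1_GCwF gcwf_to_adj_ops is_gcwf_1cell_def)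
qed

lemma closed_1cells_pullback:
  assumes "two_functor A B F" "closed_1cells B P" shows "closed_1cells A (\<lambda>f. P (F1 F f))"
proof -
  interpret two_functor A B F by fact
  show ?thesis
    using assms(2) F0_Zero F1_hom F1_id F1_comp unfolding closed_1cells_def by metis
qed

section \<open>Cartesian arrows, and the passage between gcwfs and w-comonads on 0-cells\<close>

section \<open>Cartesian arrows\<close>

text \<open>The universal property split into existence and joint monicity of the projections, with
  typing given by equations on domains and codomains; the two halves are used at different
  places.\<close>

lemma is_pullbackD:
  assumes "is_pullback C p q f g" "category C"
  shows "{p, q, f, g} \<subseteq> Ar C" "f \<cdot>\<^bsub>C\<^esub> p = g \<cdot>\<^bsub>C\<^esub> q"
    "\<lbrakk>x \<in> Ar C; y \<in> Ar C; Dom C x = Dom C y; Cod C x = Dom C f; Cod C y = Dom C g; f \<cdot>\<^bsub>C\<^esub> x = g \<cdot>\<^bsub>C\<^esub> y\<rbrakk>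
      \<Longrightarrow> \<exists>z. z \<in> Ar C \<and> Dom C z = Dom C x \<and> Cod C z = Dom C p \<and> p \<cdot>\<^bsub>C\<^esub> z = x \<and> q \<cdot>\<^bsub>C\<^esub> z = y"
    "\<lbrakk>z \<in> Ar C; z' \<in> Ar C; Dom C z = Dom C z'; Cod C z = Dom C p; Cod C z' = Dom C p;
      p \<cdot>\<^bsub>C\<^esub> z = p \<cdot>\<^bsub>C\<^esub> z'; q \<cdot>\<^bsub>C\<^esub> z = q \<cdot>\<^bsub>C\<^esub> z'\<rbrakk> \<Longrightarrow> z = z'"
proof -
  interpret category C by fact
  have b: "{p, q, f, g} \<subseteq> Ar C" "Dom C p = Dom C q" "Cod C p = Dom C f" "Cod C q = Dom C g" "Cod C f = Cod C g" "f \<cdot>\<^bsub>C\<^esub> p = g \<cdot>\<^bsub>C\<^esub> q"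
    and u: "\<And>X x y. \<lbrakk>X \<in> Ob C; x \<in> hom C X (Dom C f); y \<in> hom C X (Dom C g); f \<cdot>\<^bsub>C\<^esub> x = g \<cdot>\<^bsub>C\<^esub> y\<rbrakk> \<Longrightarrow>
      \<exists>!z. z \<in> hom C X (Dom C p) \<and> p \<cdot>\<^bsub>C\<^esub> z = x \<and> q \<cdot>\<^bsub>C\<^esub> z = y"
    using assms(1) unfolding is_pullback_def by blast+
  show "{p, q, f, g} \<subseteq> Ar C" "f \<cdot>\<^bsub>C\<^esub> p = g \<cdot>\<^bsub>C\<^esub> q" by fact+
  show "\<exists>z. z \<in> Ar C \<and> Dom C z = Dom C x \<and> Cod C z = Dom C p \<and> p \<cdot>\<^bsub>C\<^esub> z = x \<and> q \<cdot>\<^bsub>C\<^esub> z = y"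
    if "x \<in> Ar C" "y \<in> Ar C" "Dom C x = Dom C y" "Cod C x = Dom C f" "Cod C y = Dom C g" "f \<cdot>\<^bsub>C\<^esub> x = g \<cdot>\<^bsub>C\<^esub> y"
    using u[of "Dom C x" x y] that by auto
  show "z = z'" if z: "z \<in> Ar C" "z' \<in> Ar C" "Dom C z = Dom C z'" "Cod C z = Dom C p" "Cod C z' = Dom C p"
      "p \<cdot>\<^bsub>C\<^esub> z = p \<cdot>\<^bsub>C\<^esub> z'" "q \<cdot>\<^bsub>C\<^esub> z = q \<cdot>\<^bsub>C\<^esub> z'"
  proof -
    have a: "p \<in> Ar C" "q \<in> Ar C" "f \<in> Ar C" "g \<in> Ar C" using b by auto
    have s: "f \<cdot>\<^bsub>C\<^esub> (p \<cdot>\<^bsub>C\<^esub> z) = g \<cdot>\<^bsub>C\<^esub> (q \<cdot>\<^bsub>C\<^esub> z)"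
      using a z(1,4) b reassoc[OF b(6), of z] by simp
    have h: "p \<cdot>\<^bsub>C\<^esub> z \<in> hom C (Dom C z) (Dom C f)" "q \<cdot>\<^bsub>C\<^esub> z \<in> hom C (Dom C z) (Dom C g)"
      using a z(1,4) b by simp_all
    from u[OF Dom_Ob[OF z(1)] h s] show ?thesis using z by auto
  qed
qed

text \<open>Cartesianness for an arbitrary functor: it must be available for \<open>p U\<close> on
  coalgebras before any cleavage turns that functor into a fibration.\<close>

definition cart :: "('o, 'a) cat \<Rightarrow> ('p, 'c) cat \<Rightarrow> ('o, 'a, 'p, 'c) fctr \<Rightarrow> 'a \<Rightarrow> bool" where
  "cart E B P f \<longleftrightarrow> f \<in> Ar E \<and> (\<forall>X \<in> Ob E. \<forall>g \<in> hom E X (Cod E f). \<forall>w \<in> hom B (onO P X) (onO P (Dom E f)).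
    onA P f \<cdot>\<^bsub>B\<^esub> w = onA P g \<longrightarrow> (\<exists>!h. h \<in> hom E X (Dom E f) \<and> onA P h = w \<and> f \<cdot>\<^bsub>E\<^esub> h = g))"

lemma cartesian_iff: "cartesian p f \<longleftrightarrow> cart (fE p) (fB p) (fp p) f"
  by (simp only: cartesian_def cart_def)

locale over = is_functor E B P for E :: "('o, 'a) cat" and B :: "('p, 'c) cat" and P
begin

abbreviation crt where "crt \<equiv> cart E B P"

lemma cart_Ar [simp]: "crt f \<Longrightarrow> f \<in> Ar E"
  by (simp add: cart_def)

lemma cart_factor:
  assumes "crt f" "g \<in> Ar E" "Cod E g = Cod E f" "w \<in> Ar B" "Dom B w = onO P (Dom E g)" "Cod B w = onO P (Dom E f)"
    "onA P f \<cdot>\<^bsub>B\<^esub> w = onA P g"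
  obtains h where "h \<in> Ar E" "Dom E h = Dom E g" "Cod E h = Dom E f" "onA P h = w" "f \<cdot>\<^bsub>E\<^esub> h = g"
proof -
  have g: "Dom E g \<in> Ob E" "g \<in> hom E (Dom E g) (Cod E f)" "w \<in> hom B (onO P (Dom E g)) (onO P (Dom E f))"
    using assms by auto
  from assms(1) have "\<exists>!h. h \<in> hom E (Dom E g) (Dom E f) \<and> onA P h = w \<and> f \<cdot>\<^bsub>E\<^esub> h = g"
    unfolding cart_def using g assms(7) by blast
  then show thesis using that by auto
qed

lemma cart_cancel:
  assumes "crt f" "h \<in> Ar E" "k \<in> Ar E" "Dom E h = Dom E k" "Cod E h = Dom E f" "Cod E k = Dom E f"
    "onA P h = onA P k" "f \<cdot>\<^bsub>E\<^esub> h = f \<cdot>\<^bsub>E\<^esub> k"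
  shows "h = k"
proof -
  have [simp]: "f \<in> Ar E" using assms(1) by simp
  have g: "Dom E h \<in> Ob E" "f \<cdot>\<^bsub>E\<^esub> h \<in> hom E (Dom E h) (Cod E f)" "onA P h \<in> hom B (onO P (Dom E h)) (onO P (Dom E f))"
    "onA P f \<cdot>\<^bsub>B\<^esub> onA P h = onA P (f \<cdot>\<^bsub>E\<^esub> h)"
    using assms by auto
  from assms(1) have "\<exists>!l. l \<in> hom E (Dom E h) (Dom E f) \<and> onA P l = onA P h \<and> f \<cdot>\<^bsub>E\<^esub> l = f \<cdot>\<^bsub>E\<^esub> h"
    unfolding cart_def using g by blast
  then show ?thesis using assms by auto
qed

lemma cartI:
  assumes f: "f \<in> Ar E"
    and ex: "\<And>g w. \<lbrakk>g \<in> Ar E; Cod E g = Cod E f; w \<in> Ar B; Dom B w = onO P (Dom E g); Cod B w = onO P (Dom E f);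
       onA P f \<cdot>\<^bsub>B\<^esub> w = onA P g\<rbrakk> \<Longrightarrow> \<exists>h. h \<in> Ar E \<and> Dom E h = Dom E g \<and> Cod E h = Dom E f \<and> onA P h = w \<and> f \<cdot>\<^bsub>E\<^esub> h = g"
    and uq: "\<And>h k. \<lbrakk>h \<in> Ar E; k \<in> Ar E; Dom E h = Dom E k; Cod E h = Dom E f; Cod E k = Dom E f; onA P h = onA P k;
       f \<cdot>\<^bsub>E\<^esub> h = f \<cdot>\<^bsub>E\<^esub> k\<rbrakk> \<Longrightarrow> h = k"
  shows "crt f"
  unfolding cart_def
proof (intro conjI ballI impI f)
  fix X g w assume h: "X \<in> Ob E" "g \<in> hom E X (Cod E f)" "w \<in> hom B (onO P X) (onO P (Dom E f))" "onA P f \<cdot>\<^bsub>B\<^esub> w = onA P g"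
  from h ex[of g w] obtain k where k: "k \<in> Ar E" "Dom E k = Dom E g" "Cod E k = Dom E f" "onA P k = w" "f \<cdot>\<^bsub>E\<^esub> k = g" by auto
  show "\<exists>!h. h \<in> hom E X (Dom E f) \<and> onA P h = w \<and> f \<cdot>\<^bsub>E\<^esub> h = g"
  proof (rule ex1I[of _ k])
    show "k \<in> hom E X (Dom E f) \<and> onA P k = w \<and> f \<cdot>\<^bsub>E\<^esub> k = g" using k h by simp
    fix l assume "l \<in> hom E X (Dom E f) \<and> onA P l = w \<and> f \<cdot>\<^bsub>E\<^esub> l = g"
    with k h show "l = k" by - (rule uq; simp)
  qed
qed

lemma cart_Comp:
  assumes f: "crt f" and g: "crt g" and c [simp]: "Cod E f = Dom E g"
  shows "crt (g \<cdot>\<^bsub>E\<^esub> f)"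
proof (rule cartI)
  have [simp]: "f \<in> Ar E" "g \<in> Ar E" using f g by simp_all
  show "g \<cdot>\<^bsub>E\<^esub> f \<in> Ar E" by simp
  fix k w assume k: "k \<in> Ar E" "Cod E k = Cod E (g \<cdot>\<^bsub>E\<^esub> f)" "w \<in> Ar B" "Dom B w = onO P (Dom E k)"
    "Cod B w = onO P (Dom E (g \<cdot>\<^bsub>E\<^esub> f))" "onA P (g \<cdot>\<^bsub>E\<^esub> f) \<cdot>\<^bsub>B\<^esub> w = onA P k"
  obtain l where l: "l \<in> Ar E" "Dom E l = Dom E k" "Cod E l = Dom E g" "onA P l = onA P f \<cdot>\<^bsub>B\<^esub> w" "g \<cdot>\<^bsub>E\<^esub> l = k"
    by (rule cart_factor[OF g, of k "onA P f \<cdot>\<^bsub>B\<^esub> w"]) (use k in simp_all)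
  obtain h where h: "h \<in> Ar E" "Dom E h = Dom E l" "Cod E h = Dom E f" "onA P h = w" "f \<cdot>\<^bsub>E\<^esub> h = l"
    by (rule cart_factor[OF f, of l w]) (use k l in simp_all)
  show "\<exists>h. h \<in> Ar E \<and> Dom E h = Dom E k \<and> Cod E h = Dom E (g \<cdot>\<^bsub>E\<^esub> f) \<and> onA P h = w \<and> (g \<cdot>\<^bsub>E\<^esub> f) \<cdot>\<^bsub>E\<^esub> h = k"
    using h l by (intro exI[of _ h]) simp
next
  have [simp]: "f \<in> Ar E" "g \<in> Ar E" using f g by simp_all
  fix h k assume k: "h \<in> Ar E" "k \<in> Ar E" "Dom E h = Dom E k" "Cod E h = Dom E (g \<cdot>\<^bsub>E\<^esub> f)" "Cod E k = Dom E (g \<cdot>\<^bsub>E\<^esub> f)"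
    "onA P h = onA P k" "(g \<cdot>\<^bsub>E\<^esub> f) \<cdot>\<^bsub>E\<^esub> h = (g \<cdot>\<^bsub>E\<^esub> f) \<cdot>\<^bsub>E\<^esub> k"
  have "f \<cdot>\<^bsub>E\<^esub> h = f \<cdot>\<^bsub>E\<^esub> k" by (rule cart_cancel[OF g]) (use k in simp_all)
  show "h = k" by (rule cart_cancel[OF f]) (use k \<open>f \<cdot>\<^bsub>E\<^esub> h = f \<cdot>\<^bsub>E\<^esub> k\<close> in simp_all)
qed

lemma cart_left_cancel:
  assumes g: "crt g" and gf: "crt (g \<cdot>\<^bsub>E\<^esub> f)" and f [simp]: "f \<in> Ar E" and c [simp]: "Cod E f = Dom E g"
  shows "crt f"
proof (rule cartI)
  have [simp]: "g \<in> Ar E" using g by simp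
  fix k w assume k: "k \<in> Ar E" "Cod E k = Cod E f" "w \<in> Ar B" "Dom B w = onO P (Dom E k)"
    "Cod B w = onO P (Dom E f)" "onA P f \<cdot>\<^bsub>B\<^esub> w = onA P k"
  obtain h where h: "h \<in> Ar E" "Dom E h = Dom E k" "Cod E h = Dom E f" "onA P h = w" "(g \<cdot>\<^bsub>E\<^esub> f) \<cdot>\<^bsub>E\<^esub> h = g \<cdot>\<^bsub>E\<^esub> k"
    by (rule cart_factor[OF gf, of "g \<cdot>\<^bsub>E\<^esub> k" w]) (use k in simp_all)
  have "f \<cdot>\<^bsub>E\<^esub> h = k" by (rule cart_cancel[OF g]) (use h k in simp_all)
  with h show "\<exists>h. h \<in> Ar E \<and> Dom E h = Dom E k \<and> Cod E h = Dom E f \<and> onA P h = w \<and> f \<cdot>\<^bsub>E\<^esub> h = k" by blast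
next
  have [simp]: "g \<in> Ar E" using g by simp
  fix h k assume k: "h \<in> Ar E" "k \<in> Ar E" "Dom E h = Dom E k" "Cod E h = Dom E f" "Cod E k = Dom E f"
    "onA P h = onA P k" "f \<cdot>\<^bsub>E\<^esub> h = f \<cdot>\<^bsub>E\<^esub> k"
  then show "h = k" by - (rule cart_cancel[OF gf]; simp)
qed fact

lemma cart_iso: assumes f: "iso E f" shows "crt f"
proof (rule cartI)
  show [simp]: "f \<in> Ar E" using C.iso_Ar[OF f] .
  fix k w assume k: "k \<in> Ar E" "Cod E k = Cod E f" "w \<in> Ar B" "Dom B w = onO P (Dom E k)"
    "Cod B w = onO P (Dom E f)" "onA P f \<cdot>\<^bsub>B\<^esub> w = onA P k"
  have e: "onA P (inv_ar E f) \<cdot>\<^bsub>B\<^esub> onA P f = Ident B (onO P (Dom E f))" using f by (simp flip: onA_comp)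
  have "onA P (inv_ar E f) \<cdot>\<^bsub>B\<^esub> onA P k = w"
    using reassoc[OF e, of w] k f by simp
  then show "\<exists>h. h \<in> Ar E \<and> Dom E h = Dom E k \<and> Cod E h = Dom E f \<and> onA P h = w \<and> f \<cdot>\<^bsub>E\<^esub> h = k"
    using k f by (intro exI[of _ "inv_ar E f \<cdot>\<^bsub>E\<^esub> k"]) simp
next
  fix h k assume "h \<in> Ar E" "k \<in> Ar E" "Dom E h = Dom E k" "Cod E h = Dom E f" "Cod E k = Dom E f"
    "onA P h = onA P k" "f \<cdot>\<^bsub>E\<^esub> h = f \<cdot>\<^bsub>E\<^esub> k"
  then show "h = k" using C.iso_cancel[OF f] by simp
qed

text \<open>The identity of the codomain factors through \<open>f\<close> over an identity of the
  base; uniqueness of factorisations makes the factor a two-sided inverse.\<close>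

lemma cart_vertical_iso:
  assumes f: "crt f" and v: "onA P f = Ident B (onO P (Dom E f))"
  shows "iso E f"
proof -
  have [simp]: "f \<in> Ar E" using f by simp
  have d [simp]: "onO P (Cod E f) = onO P (Dom E f)" using arg_cong[OF v, of "Cod B"] by simp
  obtain h where h: "h \<in> Ar E" "Dom E h = Cod E f" "Cod E h = Dom E f" "onA P h = Ident B (onO P (Dom E f))" "f \<cdot>\<^bsub>E\<^esub> h = Ident E (Cod E f)"
    by (rule cart_factor[OF f, of "Ident E (Cod E f)" "Ident B (onO P (Dom E f))"]) (simp_all add: v)
  have "h \<cdot>\<^bsub>E\<^esub> f = Ident E (Dom E f)"
    by (rule cart_cancel[OF f]) (simp_all add: h v reassoc[OF h(5)])
  then show ?thesis using h by (auto simp: iso_def is_inverse_def)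
qed

text \<open>The factorisation of \<open>f\<close> through \<open>g\<close> is vertical by
  construction and cartesian by cancellation, hence invertible. The isomorphisms exhibiting the
  quasi-inverse arise in this way.\<close>

lemma cart_comparison:
  assumes f: "crt f" and g: "crt g" and c: "Cod E f = Cod E g" and b: "onA P f = onA P g"
  obtains h where "iso E h" "Dom E h = Dom E f" "Cod E h = Dom E g" "g \<cdot>\<^bsub>E\<^esub> h = f"
    "onA P h = Ident B (onO P (Dom E f))"
proof -
  have [simp]: "f \<in> Ar E" "g \<in> Ar E" using f g by simp_all
  have d: "onO P (Dom E f) = onO P (Dom E g)" using arg_cong[OF b, of "Dom B"] by simp
  obtain h where h: "h \<in> Ar E" "Dom E h = Dom E f" "Cod E h = Dom E g" "onA P h = Ident B (onO P (Dom E f))" "g \<cdot>\<^bsub>E\<^esub> h = f"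
    by (rule cart_factor[OF g, of f "Ident B (onO P (Dom E f))"]) (simp_all add: c b d)
  have "crt h" by (rule cart_left_cancel[OF g]) (simp_all add: h f)
  then have "iso E h" by (rule cart_vertical_iso) (simp add: h)
  with h show thesis using that by blast
qed

end

section \<open>From generalised categories with families to w-comonads\<close>

text \<open>The cleavage of \<open>q\<close> is reduced to mere existence of lifts, and the base
  \<open>B\<close> is a single parameter for both fibrations.\<close>

locale gcwf_core = adjunction T + p: over "adC T" B p + q: over "adD T" B q
  for T :: "('o, 'a, 'd, 'e) adj" and B :: "('b, 'n) cat" and p q +
  assumes pL_Ob [simp]: "A \<in> Ob (adD T) \<Longrightarrow> onO p (onO (adL T) A) = onO q A"
    and pL_Ar [simp]: "f \<in> Ar (adD T) \<Longrightarrow> onA p (onA (adL T) f) = onA q f"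
    and L_cart: "q.crt f \<Longrightarrow> p.crt (onA (adL T) f)"
    and eta_cart: "A \<in> Ob (adD T) \<Longrightarrow> q.crt (adeta T A)"
    and eps_cart: "X \<in> Ob (adC T) \<Longrightarrow> p.crt (adeps T X)"
    and q_lift: "\<lbrakk>A \<in> Ob (adD T); s \<in> Ar B; Cod B s = onO q A\<rbrakk> \<Longrightarrow> \<exists>f. q.crt f \<and> Cod (adD T) f = A \<and> onA q f = s"
begin

text \<open>\<open>\<epsilon> (L R f) = f \<epsilon>\<close> is a composite of cartesian arrows, and
  the cartesian \<open>\<epsilon>\<close> on the left cancels.\<close>

lemma LR_cart:
  assumes f: "p.crt f" shows "p.crt (onA (adL T) (onA (adR T) f))"
proof -
  have [simp]: "f \<in> Ar (adC T)" using f by simp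
  show ?thesis
    by (rule p.cart_left_cancel[OF eps_cart[of "Cod (adC T) f"]])
      (use p.cart_Comp[OF eps_cart[of "Dom (adC T) f"] f] in \<open>simp_all add: eps_natural\<close>)
qed

text \<open>Factor \<open>R f\<close> as a vertical arrow \<open>v\<close> followed by a cartesian one.  Then \<open>L v\<close> is cartesian
  and vertical, hence invertible, and naturality of the cartesian unit transports this back to \<open>v\<close>.\<close>

lemma R_cart:
  assumes f: "p.crt f" shows "q.crt (onA (adR T) f)"
proof -
  have [simp]: "f \<in> Ar (adC T)" using f by simp
  let ?g = "onA (adR T) f"
  have "\<exists>c. q.crt c \<and> Cod (adD T) c = onO (adR T) (Cod (adC T) f) \<and> onA q c = onA q ?g" by (rule q_lift) simp_all
  then obtain c where c: "q.crt c" "Cod (adD T) c = onO (adR T) (Cod (adC T) f)" "onA q c = onA q ?g" by blast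
  have [simp]: "c \<in> Ar (adD T)" using c by simp
  have d: "onO q (Dom (adD T) c) = onO q (onO (adR T) (Dom (adC T) f))" using arg_cong[OF c(3), of "Dom B"] by simp
  obtain v where v: "v \<in> Ar (adD T)" "Dom (adD T) v = Dom (adD T) ?g" "Cod (adD T) v = Dom (adD T) c"
      "onA q v = Ident B (onO q (Dom (adD T) c))" "c \<cdot>\<^bsub>adD T\<^esub> v = ?g"
    by (rule q.cart_factor[OF c(1), of ?g "Ident B (onO q (Dom (adD T) c))"]) (simp_all add: c(2,3) d)
  \<comment> \<open>\<open>L c\<close> composed with \<open>L v\<close> is \<open>L R f\<close>;
    both \<open>L c\<close> and \<open>L R f\<close> are cartesian.\<close>
  have "p.crt (onA (adL T) v)"
    by (rule p.cart_left_cancel[OF L_cart[OF c(1)]]) (use LR_cart[OF f] v in \<open>simp_all flip: L.onA_comp\<close>)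
  then have "iso (adC T) (onA (adL T) v)" by (rule p.cart_vertical_iso) (simp add: v d)
  then have "q.crt (onA (adR T) (onA (adL T) v))" by (intro q.cart_iso) simp
  then have ev: "q.crt (adeta T (Cod (adD T) v) \<cdot>\<^bsub>adD T\<^esub> v)"
    using q.cart_Comp[OF eta_cart[of "Dom (adD T) v"]] by (simp add: eta_natural v)
  have "q.crt v" by (rule q.cart_left_cancel[OF eta_cart[of "Cod (adD T) v"] ev]) (simp_all add: v)
  from q.cart_Comp[OF this c(1)] show ?thesis by (simp add: v)
qed

text \<open>A cone with apex \<open>X\<close> is lifted to arrows \<open>g : L D \<rightarrow> A\<close> and \<open>k : D \<rightarrow> R B\<close> with \<open>f g\<close> the
  transpose of \<open>k\<close>; the mediating arrow is the image of the transpose of \<open>g\<close>.\<close>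

lemma pullback:
  assumes f: "p.crt f"
  shows "is_pullback B (onA p (adeps T (Dom (adC T) f))) (onA p (onA (adL T) (onA (adR T) f)))
    (onA p f) (onA p (adeps T (Cod (adC T) f)))"
proof -
  have [simp]: "f \<in> Ar (adC T)" using f by simp
  let ?A = "Dom (adC T) f" and ?B = "Cod (adC T) f"
  let ?LRf = "onA (adL T) (onA (adR T) f)"
  have comm: "onA p f \<cdot>\<^bsub>B\<^esub> onA p (adeps T ?A) = onA p (adeps T ?B) \<cdot>\<^bsub>B\<^esub> onA q (onA (adR T) f)"
    using arg_cong[OF eps_natural[of f ?B], of "onA p"] by simp
  have *: "\<exists>!z. z \<in> hom B X (onO p (onO (adL T) (onO (adR T) ?A))) \<and> onA p (adeps T ?A) \<cdot>\<^bsub>B\<^esub> z = x \<and> onA p ?LRf \<cdot>\<^bsub>B\<^esub> z = y"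
    if X: "X \<in> Ob B" and x: "x \<in> hom B X (onO p ?A)" and y: "y \<in> hom B X (onO p (onO (adL T) (onO (adR T) ?B)))"
      and xy: "onA p f \<cdot>\<^bsub>B\<^esub> x = onA p (adeps T ?B) \<cdot>\<^bsub>B\<^esub> y" for X x y
  proof -
    have "\<exists>k. q.crt k \<and> Cod (adD T) k = onO (adR T) ?B \<and> onA q k = y" by (rule q_lift) (use y in simp_all)
    then obtain k where k: "q.crt k" "Cod (adD T) k = onO (adR T) ?B" "onA q k = y" by blast
    have [simp]: "k \<in> Ar (adD T)" using k by simp
    have X': "onO q (Dom (adD T) k) = X" using arg_cong[OF k(3), of "Dom B"] y by simp
    let ?D = "Dom (adD T) k"
    let ?t = "adeps T ?B \<cdot>\<^bsub>adC T\<^esub> onA (adL T) k"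
    obtain g where g: "g \<in> Ar (adC T)" "Dom (adC T) g = onO (adL T) ?D" "Cod (adC T) g = ?A" "onA p g = x" "f \<cdot>\<^bsub>adC T\<^esub> g = ?t"
      by (rule p.cart_factor[OF f, of ?t x]) (use x xy k(2,3) X' in simp_all)
    define h where "h = onA (adR T) g \<cdot>\<^bsub>adD T\<^esub> adeta T ?D"
    have h: "h \<in> Ar (adD T)" "Dom (adD T) h = ?D" "Cod (adD T) h = onO (adR T) ?A" "adeps T ?A \<cdot>\<^bsub>adC T\<^esub> onA (adL T) h = g"
      using eps_transpose[of ?D g ?A] g by (simp_all add: h_def)
    \<comment> \<open>The transpose of the left-hand side is \<open>f g\<close>, and
      \<open>g\<close> was chosen so that this equals the transpose of \<open>k\<close>.\<close>
    have hk: "onA (adR T) f \<cdot>\<^bsub>adD T\<^esub> h = k"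
      by (rule transpose_cancel[of _ _ ?B]) (simp_all add: h k reassoc[OF eps_natural] g)
    show ?thesis
    proof (rule ex1I[of _ "onA q h"])
      have "onA p (adeps T ?A) \<cdot>\<^bsub>B\<^esub> onA q h = x"
        using arg_cong[OF h(4), of "onA p"] h(1-3) g by simp
      moreover have "onA q (onA (adR T) f) \<cdot>\<^bsub>B\<^esub> onA q h = y"
        using arg_cong[OF hk, of "onA q"] h k by simp
      ultimately show "onA q h \<in> hom B X (onO p (onO (adL T) (onO (adR T) ?A))) \<and> onA p (adeps T ?A) \<cdot>\<^bsub>B\<^esub> onA q h = x \<and> onA p ?LRf \<cdot>\<^bsub>B\<^esub> onA q h = y"
        using h by (simp add: X')
    next
      \<comment> \<open>Uniqueness: a second mediator \<open>z\<close> lifts along the cartesian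
        \<open>R f\<close> to an arrow \<open>n\<close> with \<open>R f n = k\<close>. Its transpose
        and \<open>g\<close> have the same composite with \<open>f\<close> and the same image in the
        base, so \<open>n = h\<close>.\<close>
      fix z assume z: "z \<in> hom B X (onO p (onO (adL T) (onO (adR T) ?A))) \<and> onA p (adeps T ?A) \<cdot>\<^bsub>B\<^esub> z = x \<and> onA p ?LRf \<cdot>\<^bsub>B\<^esub> z = y"
      obtain n where n: "n \<in> Ar (adD T)" "Dom (adD T) n = ?D" "Cod (adD T) n = onO (adR T) ?A" "onA q n = z" "onA (adR T) f \<cdot>\<^bsub>adD T\<^esub> n = k"
        by (rule q.cart_factor[OF R_cart[OF f], of k z]) (use z k X' in simp_all)
      have fn: "f \<cdot>\<^bsub>adC T\<^esub> adeps T ?A \<cdot>\<^bsub>adC T\<^esub> onA (adL T) n = ?t"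
      proof -
        have "adeps T ?B \<cdot>\<^bsub>adC T\<^esub> onA (adL T) (onA (adR T) f \<cdot>\<^bsub>adD T\<^esub> n) = f \<cdot>\<^bsub>adC T\<^esub> adeps T ?A \<cdot>\<^bsub>adC T\<^esub> onA (adL T) n"
          using n(1-3) by (simp add: reassoc[OF eps_natural])
        then show ?thesis by (simp only: n(5))
      qed
      have "adeps T ?A \<cdot>\<^bsub>adC T\<^esub> onA (adL T) n = g"
        by (rule p.cart_cancel[OF f]) (use n g z fn in simp_all)
      then have "n = h" using transpose_eps[of n ?A] n by (simp add: h_def)
      then show "z = onA q h" using n by simp
    qed
  qed
  show ?thesis
    unfolding is_pullback_def
  proof (intro conjI ballI impI)
    fix X x y assume a: "X \<in> Ob B" "x \<in> hom B X (Dom B (onA p f))" "y \<in> hom B X (Dom B (onA p (adeps T ?B)))"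
      "onA p f \<cdot>\<^bsub>B\<^esub> x = onA p (adeps T ?B) \<cdot>\<^bsub>B\<^esub> y"
    from a(2,3) have "x \<in> hom B X (onO p ?A)" "y \<in> hom B X (onO p (onO (adL T) (onO (adR T) ?B)))"
      by simp_all
    from *[OF a(1) this a(4)]
    show "\<exists>!z. z \<in> hom B X (Dom B (onA p (adeps T ?A))) \<and> onA p (adeps T ?A) \<cdot>\<^bsub>B\<^esub> z = x \<and> onA p ?LRf \<cdot>\<^bsub>B\<^esub> z = y"
      by (simp del: in_hom_iff)
  qed (simp_all add: comm)
qed

end

section \<open>From w-comonads to generalised categories with families\<close>

locale wcmd_core = coalg_cat eo ea T + p: over "cmC T" B p
  for eo :: "'o \<times> 'a \<Rightarrow> 'd" and ea :: "'d \<times> 'a \<times> 'd \<Rightarrow> 'e" and T :: "('o, 'a) comonad" and B :: "('b, 'n) cat" and p +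
  assumes eps_cart: "A \<in> Ob (cmC T) \<Longrightarrow> p.crt (cmeps T A)"
    and pb: "p.crt f \<Longrightarrow> is_pullback B (onA p (cmeps T (Dom (cmC T) f))) (onA p (onA (cmK T) f)) (onA p f) (onA p (cmeps T (Cod (cmC T) f)))"
    and p_lift: "\<lbrakk>A \<in> Ob (cmC T); s \<in> Ar B; Cod B s = onO p A\<rbrakk> \<Longrightarrow> \<exists>f. p.crt f \<and> Cod (cmC T) f = A \<and> onA p f = s"
begin

abbreviation q where "q \<equiv> comp_fct (EMc T) p (EM_U eo ea T)"

sublocale q: over "EMc T" B q
  by (simp add: over_def is_functor_comp[OF EM_U_functor p.is_functor_axioms])

lemma K_cart:
  assumes f: "p.crt f" shows "p.crt (onA (cmK T) f)"
proof -
  have [simp]: "f \<in> Ar (cmC T)" using f by simp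
  show ?thesis
    by (rule p.cart_left_cancel[OF eps_cart[of "Cod (cmC T) f"]])
      (use p.cart_Comp[OF eps_cart[of "Dom (cmC T) f"] f] in \<open>simp_all add: eps_natural\<close>)
qed

text \<open>The projections of the base pullback are jointly monic and \<open>K f\<close> is
  cartesian; hence \<open>\<epsilon>\<close> and \<open>K f\<close> are jointly monic upstairs.
  Morphism equations and coassociativity of transported structures are verified against these two
  legs.\<close>

lemma K_cancel:
  assumes f: "p.crt f" and h: "h \<in> Ar (cmC T)" "k \<in> Ar (cmC T)" "Dom (cmC T) h = Dom (cmC T) k"
    "Cod (cmC T) h = onO (cmK T) (Dom (cmC T) f)" "Cod (cmC T) k = onO (cmK T) (Dom (cmC T) f)"
    and e: "cmeps T (Dom (cmC T) f) \<cdot>\<^bsub>cmC T\<^esub> h = cmeps T (Dom (cmC T) f) \<cdot>\<^bsub>cmC T\<^esub> k"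
    and K: "onA (cmK T) f \<cdot>\<^bsub>cmC T\<^esub> h = onA (cmK T) f \<cdot>\<^bsub>cmC T\<^esub> k"
  shows "h = k"
proof -
  have [simp]: "f \<in> Ar (cmC T)" using f by simp
  have "onA p h = onA p k"
  proof (rule is_pullbackD(4)[OF pb[OF f]])
    show "onA p (cmeps T (Dom (cmC T) f)) \<cdot>\<^bsub>B\<^esub> onA p h = onA p (cmeps T (Dom (cmC T) f)) \<cdot>\<^bsub>B\<^esub> onA p k"
      using arg_cong[OF e, of "onA p"] h by simp
    show "onA p (onA (cmK T) f) \<cdot>\<^bsub>B\<^esub> onA p h = onA p (onA (cmK T) f) \<cdot>\<^bsub>B\<^esub> onA p k"
      using arg_cong[OF K, of "onA p"] h by simp
  qed (use h in simp_all)
  then show ?thesis using h K by - (rule p.cart_cancel[OF K_cart[OF f]]; simp)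
qed

text \<open>The cartesian factorisation of underlying arrows is automatically a coalgebra morphism:
  both sides of its equation agree after \<open>\<epsilon>\<close> and after
  \<open>K (ar u)\<close>, so \<open>K_cancel\<close> applies.\<close>

lemma coalg_cart:
  assumes u [simp]: "u \<in> Ar (EMc T)" and c: "p.crt (ar u)" shows "q.crt u"
proof (rule q.cartI)
  fix g w assume g: "g \<in> Ar (EMc T)" "Cod (EMc T) g = Cod (EMc T) u" "w \<in> Ar B" "Dom B w = onO q (Dom (EMc T) g)"
    "Cod B w = onO q (Dom (EMc T) u)" "onA q u \<cdot>\<^bsub>B\<^esub> w = onA q g"
  obtain h where h: "h \<in> Ar (cmC T)" "Dom (cmC T) h = cr (Dom (EMc T) g)" "Cod (cmC T) h = cr (Dom (EMc T) u)" "onA p h = w" "ar u \<cdot>\<^bsub>cmC T\<^esub> h = ar g"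
    by (rule p.cart_factor[OF c, of "ar g" w]) (use g in simp_all)
  have Ku: "onA (cmK T) (ar u) \<cdot>\<^bsub>cmC T\<^esub> onA (cmK T) h = onA (cmK T) (ar g)"
    using h by (simp flip: K.onA_comp)
  have "onA (cmK T) h \<cdot>\<^bsub>cmC T\<^esub> st (Dom (EMc T) g) = st (Dom (EMc T) u) \<cdot>\<^bsub>cmC T\<^esub> h"
    by (rule K_cancel[OF c]) (use g h in \<open>simp_all add: reassoc[OF eps_natural] reassoc[OF Ku] ar_coalg reassoc[OF ar_coalg]
       reassoc[OF obD(6)]\<close>)
  then have A: "ea (Dom (EMc T) g, h, Dom (EMc T) u) \<in> Ar (EMc T)" using h g by simp
  have D: "Dom (EMc T) (ea (Dom (EMc T) g, h, Dom (EMc T) u)) = Dom (EMc T) g" "Cod (EMc T) (ea (Dom (EMc T) g, h, Dom (EMc T) u)) = Dom (EMc T) u"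
    using coalg_Dom[OF A] coalg_Cod[OF A] by auto
  show "\<exists>h. h \<in> Ar (EMc T) \<and> Dom (EMc T) h = Dom (EMc T) g \<and> Cod (EMc T) h = Dom (EMc T) u \<and> onA q h = w \<and> u \<cdot>\<^bsub>EMc T\<^esub> h = g"
  proof (intro exI conjI)
    show "u \<cdot>\<^bsub>EMc T\<^esub> ea (Dom (EMc T) g, h, Dom (EMc T) u) = g"
      by (rule coalg_ar_eqI) (use A D h g in \<open>simp_all del: coalg_Ar coalg_Dom coalg_Cod\<close>)
  qed (use A D h g in \<open>simp_all del: coalg_Ar coalg_Dom coalg_Cod\<close>)
next
  fix h k assume k: "h \<in> Ar (EMc T)" "k \<in> Ar (EMc T)" "Dom (EMc T) h = Dom (EMc T) k" "Cod (EMc T) h = Dom (EMc T) u" "Cod (EMc T) k = Dom (EMc T) u"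
    "onA q h = onA q k" "u \<cdot>\<^bsub>EMc T\<^esub> h = u \<cdot>\<^bsub>EMc T\<^esub> k"
  have "ar h = ar k"
    by (rule p.cart_cancel[OF c]) (use k(1-6) arg_cong[OF k(7), of ar] in simp_all)
  then show "h = k" by (intro coalg_ar_eqI) (use k in simp_all)
qed simp

text \<open>The coalgebra structure is transported along a cartesian \<open>f : A \<rightarrow> B\<close> by the pullback property.\<close>

lemma coalg_lift:
  assumes y [simp]: "y \<in> Ob (EMc T)" and s: "s \<in> Ar B" "Cod B s = onO p (cr y)"
  obtains u where "u \<in> Ar (EMc T)" "Cod (EMc T) u = y" "p.crt (ar u)" "onA p (ar u) = s"
proof -
  obtain f where f: "p.crt f" "Cod (cmC T) f = cr y" "onA p f = s" using p_lift[of "cr y" s] s by auto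
  have [simp]: "f \<in> Ar (cmC T)" using f by simp
  let ?A = "Dom (cmC T) f"
  have e1: "onA p (cmeps T (cr y)) \<cdot>\<^bsub>B\<^esub> onA p (st y) = Ident B (onO p (cr y))" by (simp flip: p.onA_comp)
  \<comment> \<open>The cone consists of the identity of \<open>p A\<close> and
    \<open>p (st y \<cdot> f)\<close>; it commutes because \<open>st y\<close> is a section of
    \<open>\<epsilon>\<close>. The mediator is the base image of the structure to be built.\<close>
  have "\<exists>z. z \<in> Ar B \<and> Dom B z = Dom B (Ident B (onO p ?A)) \<and> Cod B z = Dom B (onA p (cmeps T ?A)) \<and>
      onA p (cmeps T ?A) \<cdot>\<^bsub>B\<^esub> z = Ident B (onO p ?A) \<and> onA p (onA (cmK T) f) \<cdot>\<^bsub>B\<^esub> z = onA p (st y \<cdot>\<^bsub>cmC T\<^esub> f)"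
    by (rule is_pullbackD(3)[OF pb[OF f(1)]]) (simp_all add: f(2) reassoc[OF e1])
  then obtain z where z: "z \<in> Ar B" "Dom B z = onO p ?A" "Cod B z = onO p (onO (cmK T) ?A)"
      "onA p (cmeps T ?A) \<cdot>\<^bsub>B\<^esub> z = Ident B (onO p ?A)" "onA p (onA (cmK T) f) \<cdot>\<^bsub>B\<^esub> z = onA p (st y \<cdot>\<^bsub>cmC T\<^esub> f)" by auto
  obtain a where a: "a \<in> Ar (cmC T)" "Dom (cmC T) a = ?A" "Cod (cmC T) a = onO (cmK T) ?A" "onA p a = z" "onA (cmK T) f \<cdot>\<^bsub>cmC T\<^esub> a = st y \<cdot>\<^bsub>cmC T\<^esub> f"
    by (rule p.cart_factor[OF K_cart[OF f(1)], of "st y \<cdot>\<^bsub>cmC T\<^esub> f" z]) (use z f in simp_all)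
  \<comment> \<open>Over the base this is the choice of \<open>z\<close>; upstairs it suffices to
    compare after the cartesian \<open>f\<close>.\<close>
  have counit: "cmeps T ?A \<cdot>\<^bsub>cmC T\<^esub> a = Ident (cmC T) ?A"
  proof (rule p.cart_cancel[OF f(1)])
    have "f \<cdot>\<^bsub>cmC T\<^esub> cmeps T ?A \<cdot>\<^bsub>cmC T\<^esub> a = cmeps T (cr y) \<cdot>\<^bsub>cmC T\<^esub> onA (cmK T) f \<cdot>\<^bsub>cmC T\<^esub> a"
      using f a(1-4) by (simp add: reassoc[OF eps_natural])
    also have "\<dots> = f" using f by (simp add: a(5) reassoc[OF obD(6)])
    finally show "f \<cdot>\<^bsub>cmC T\<^esub> cmeps T ?A \<cdot>\<^bsub>cmC T\<^esub> a = f \<cdot>\<^bsub>cmC T\<^esub> Ident (cmC T) ?A" by simp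
  qed (use a z in simp_all)
  have Ka: "onA (cmK T) (onA (cmK T) f) \<cdot>\<^bsub>cmC T\<^esub> onA (cmK T) a = onA (cmK T) (st y) \<cdot>\<^bsub>cmC T\<^esub> onA (cmK T) f"
    using arg_cong[OF a(5), of "onA (cmK T)"] a(1-4) f by simp
  \<comment> \<open>Both sides end in \<open>K (K A)\<close>, so the cancellation is performed with
    the cartesian arrow \<open>K f\<close> in place of \<open>f\<close>.\<close>
  have coassoc': "cmnu T ?A \<cdot>\<^bsub>cmC T\<^esub> a = onA (cmK T) a \<cdot>\<^bsub>cmC T\<^esub> a"
  proof (rule K_cancel[OF K_cart[OF f(1)]])
    have "onA (cmK T) (onA (cmK T) f) \<cdot>\<^bsub>cmC T\<^esub> cmnu T ?A \<cdot>\<^bsub>cmC T\<^esub> a = cmnu T (cr y) \<cdot>\<^bsub>cmC T\<^esub> onA (cmK T) f \<cdot>\<^bsub>cmC T\<^esub> a"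
      using f a(1-4) by (simp add: reassoc[OF nu_natural])
    also have "\<dots> = onA (cmK T) (st y) \<cdot>\<^bsub>cmC T\<^esub> onA (cmK T) f \<cdot>\<^bsub>cmC T\<^esub> a"
      using f by (simp add: a(5) reassoc[OF st_coassoc])
    also have "\<dots> = onA (cmK T) (onA (cmK T) f) \<cdot>\<^bsub>cmC T\<^esub> onA (cmK T) a \<cdot>\<^bsub>cmC T\<^esub> a"
      using f a by (simp add: reassoc[OF Ka])
    finally show "onA (cmK T) (onA (cmK T) f) \<cdot>\<^bsub>cmC T\<^esub> cmnu T ?A \<cdot>\<^bsub>cmC T\<^esub> a = onA (cmK T) (onA (cmK T) f) \<cdot>\<^bsub>cmC T\<^esub> onA (cmK T) a \<cdot>\<^bsub>cmC T\<^esub> a" .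
  qed (use a counit in \<open>simp_all add: reassoc[OF eps_natural] reassoc[OF counit_left]\<close>)
  have x: "eo (?A, a) \<in> Ob (EMc T)" using a counit coassoc' by simp
  have A: "ea (eo (?A, a), f, y) \<in> Ar (EMc T)" using x a f by (simp del: coalg_Ob)
  show thesis
    by (rule that[of "ea (eo (?A, a), f, y)"]) (use A coalg_Cod[OF A] f in \<open>simp_all del: coalg_Ar coalg_Cod\<close>)
qed

text \<open>For the converse, \<open>u\<close> is compared with the lift \<open>v\<close> from
  \<open>coalg_lift\<close>, whose underlying arrow is cartesian by construction. They differ by an
  isomorphism of coalgebras, and isomorphisms are cartesian.\<close>

lemma coalg_cart_iff:
  assumes u [simp]: "u \<in> Ar (EMc T)" shows "q.crt u \<longleftrightarrow> p.crt (ar u)"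
proof
  assume c: "q.crt u"
  obtain v where v: "v \<in> Ar (EMc T)" "Cod (EMc T) v = Cod (EMc T) u" "p.crt (ar v)" "onA p (ar v) = onA p (ar u)"
    by (rule coalg_lift[of "Cod (EMc T) u" "onA p (ar u)"]) simp_all
  obtain h where h: "iso (EMc T) h" "Dom (EMc T) h = Dom (EMc T) u" "Cod (EMc T) h = Dom (EMc T) v" "v \<cdot>\<^bsub>EMc T\<^esub> h = u"
    by (rule q.cart_comparison[OF c coalg_cart[OF v(1,3)]]) (use v in simp_all)
  have [simp]: "h \<in> Ar (EMc T)" using EMc.iso_Ar[OF h(1)] .
  have "iso (cmC T) (ar h)" using is_functor.onA_iso[OF EM_U_functor h(1)] by simp
  then have "p.crt (ar v \<cdot>\<^bsub>cmC T\<^esub> ar h)" by (intro p.cart_Comp[OF p.cart_iso v(3)]) (simp_all add: h v)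
  then show "p.crt (ar u)" using arg_cong[OF h(4), of ar] h(2,3) v by simp
qed (rule coalg_cart[OF u])

text \<open>\<open>\<epsilon>\<close> after \<open>st x\<close> is an identity, so cancelling the
  cartesian \<open>\<epsilon>\<close> leaves a cartesian arrow. Cartesian unit components follow,
  and the construction of the quasi-inverse rests on it.\<close>

lemma st_cart: "x \<in> Ob (EMc T) \<Longrightarrow> p.crt (st x)"
  by (rule p.cart_left_cancel[OF eps_cart[of "cr x"]]) (simp_all add: p.cart_iso)

lemma unit_cart: "x \<in> Ob (EMc T) \<Longrightarrow> q.crt (adeta (EM_adj eo ea T) x)"
  by (simp add: coalg_cart_iff st_cart)

end

section \<open>Lifting the 2-functors and the unit along the forgetful 2-functors\<close>

section \<open>The lifted biadjunction\<close>

lemma fibration_lift: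
  assumes "is_fibration p" "A \<in> Ob (fE p)" "s \<in> Ar (fB p)" "Cod (fB p) s = onO (fp p) A"
  shows "cart (fE p) (fB p) (fp p) (fcl p A s)" "Cod (fE p) (fcl p A s) = A" "onA (fp p) (fcl p A s) = s"
proof -
  have "if A \<in> Ob (fE p) \<and> s \<in> Ar (fB p) \<and> Cod (fB p) s = onO (fp p) A
      then cartesian p (fcl p A s) \<and> Cod (fE p) (fcl p A s) = A \<and> onA (fp p) (fcl p A s) = s
      else fcl p A s = undefined"
    using assms(1) unfolding is_fibration_def by blast
  with assms(2-4) show "cart (fE p) (fB p) (fp p) (fcl p A s)" "Cod (fE p) (fcl p A s) = A" "onA (fp p) (fcl p A s) = s"
    by (simp_all add: cartesian_iff)
qed

lemma gcwf_coreI: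
  assumes W: "is_gcwf W" shows "gcwf_core (gadj W) (fB (gu W)) (fp (gu W)) (fp (gud W))"
proof -
  interpret adjunction "gadj W" by (rule is_gcwfD[OF W])
  note e = is_gcwfD(4-6)[OF W]
  interpret p: over "adC (gadj W)" "fB (gu W)" "fp (gu W)"
    using is_fibrationD[OF is_gcwfD(1)[OF W]] by (simp add: over_def e)
  interpret q: over "adD (gadj W)" "fB (gu W)" "fp (gud W)"
    using is_fibrationD[OF is_gcwfD(2)[OF W]] by (simp add: over_def e)
  show ?thesis
  proof unfold_locales
    fix A assume A: "A \<in> Ob (adD (gadj W))"
    show "onO (fp (gu W)) (onO (adL (gadj W)) A) = onO (fp (gud W)) A"
      using comp_fct_simps(1)[of A "fE (gud W)" "fp (gu W)" "adL (gadj W)"] A by (simp add: is_gcwfD[OF W])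
    show "cart (adD (gadj W)) (fB (gu W)) (fp (gud W)) (adeta (gadj W) A)"
      using is_gcwfD(9)[OF W, of A] A by (simp add: cartesian_iff e)
    fix s assume "s \<in> Ar (fB (gu W))" "Cod (fB (gu W)) s = onO (fp (gud W)) A"
    then show "\<exists>f. cart (adD (gadj W)) (fB (gu W)) (fp (gud W)) f \<and> Cod (adD (gadj W)) f = A \<and> onA (fp (gud W)) f = s"
      using fibration_lift[OF is_gcwfD(2)[OF W], of A s] A by (auto simp: e)
  next
    fix f assume f: "f \<in> Ar (adD (gadj W))"
    show "onA (fp (gu W)) (onA (adL (gadj W)) f) = onA (fp (gud W)) f"
      using comp_fct_simps(2)[of f "fE (gud W)" "fp (gu W)" "adL (gadj W)"] f by (simp add: is_gcwfD[OF W])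
  next
    fix f assume "cart (adD (gadj W)) (fB (gu W)) (fp (gud W)) f"
    then show "cart (adC (gadj W)) (fB (gu W)) (fp (gu W)) (onA (adL (gadj W)) f)"
      using is_gcwfD(8)[OF W, of f] by (simp add: cartesian_iff e)
  next
    fix X assume "X \<in> Ob (adC (gadj W))"
    then show "cart (adC (gadj W)) (fB (gu W)) (fp (gu W)) (adeps (gadj W) X)"
      using is_gcwfD(10)[OF W, of X] by (simp add: cartesian_iff e)
  qed
qed

definition Chat_0 where "Chat_0 W = \<lparr>wp = gu W, wK = adj_comonad (gadj W)\<rparr>"

definition Chat_1 where
  "Chat_1 f = \<lparr>Src = Chat_0 (Src f), Tgt = Chat_0 (Tgt f), wmC = gmC f, wmH = gmH f, wmth = cmth (C_1 (gcwf_to_adj1 f))\<rparr>"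

definition Chat_2 where
  "Chat_2 \<alpha> = \<lparr>Src = Chat_1 (Src \<alpha>), Tgt = Chat_1 (Tgt \<alpha>), wmpsi = gmpsi \<alpha>, wmphi = gmphi \<alpha>\<rparr>"

definition Chat where "Chat = \<lparr>F0 = Chat_0, F1 = Chat_1, F2 = Chat_2\<rparr>"

lemma Chat_simps [simp]:
  "wp (Chat_0 W) = gu W" "wK (Chat_0 W) = adj_comonad (gadj W)"
  "Src (Chat_1 f) = Chat_0 (Src f)" "Tgt (Chat_1 f) = Chat_0 (Tgt f)" "wmC (Chat_1 f) = gmC f" "wmH (Chat_1 f) = gmH f"
  "Src (Chat_2 \<alpha>) = Chat_1 (Src \<alpha>)" "Tgt (Chat_2 \<alpha>) = Chat_1 (Tgt \<alpha>)" "wmpsi (Chat_2 \<alpha>) = gmpsi \<alpha>" "wmphi (Chat_2 \<alpha>) = gmphi \<alpha>"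
  "F0 Chat = Chat_0" "F1 Chat = Chat_1" "F2 Chat = Chat_2"
  by (simp_all add: Chat_0_def Chat_1_def Chat_2_def Chat_def)

lemma Chat_forget [simp]: "wcmd_to_cmd1 (Chat_1 f) = C_1 (gcwf_to_adj1 f)" "wcmd_to_cmd2 (Chat_2 \<alpha>) = C_2 (gcwf_to_adj2 \<alpha>)"
proof -
  show 1: "wcmd_to_cmd1 (Chat_1 f) = C_1 (gcwf_to_adj1 f)" for f
    by (rule cmd_1cell.equality) (simp_all add: Chat_1_def)
  show "wcmd_to_cmd2 (Chat_2 \<alpha>) = C_2 (gcwf_to_adj2 \<alpha>)"
    by (rule cmd_2cell.equality) (simp_all add: 1)
qed

lemma is_wcomonad_Chat_0: assumes W: "is_gcwf W" shows "is_wcomonad (Chat_0 W)"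
proof -
  interpret gcwf_core "gadj W" "fB (gu W)" "fp (gu W)" "fp (gud W)" by (rule gcwf_coreI[OF W])
  have c: "cartesian (gu W) f \<longleftrightarrow> p.crt f" for f by (simp add: cartesian_iff is_gcwfD[OF W])
  show ?thesis
    using pullback comonad_adj_comonad[OF adjunction_axioms] is_gcwfD(1)[OF W] eps_cart is_gcwfD(5)[OF W, symmetric]
    by (simp add: is_wcomonad_def Let_def is_comonad_iff c)
qed

lemma wcmd_2cell_eqI:
  assumes "\<alpha> \<in> hom2 WCmd f g" "\<beta> \<in> hom2 WCmd f g" "wmpsi \<alpha> = wmpsi \<beta>" "wcmd_to_cmd2 \<alpha> = wcmd_to_cmd2 \<beta>" shows "\<alpha> = \<beta>"
proof -
  have "wmphi \<alpha> = wmphi \<beta>" using arg_cong[OF assms(4), of cmphi] by simp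
  with assms show ?thesis by (intro wcmd_2cell.equality) (simp_all add: hom2_def)
qed

lemma Chat_1_hom: assumes f: "f \<in> hom1 GCwF_iso x y" shows "Chat_1 f \<in> hom1 WCmd (Chat_0 x) (Chat_0 y)"
proof -
  have "C_1 (gcwf_to_adj1 f) \<in> hom1 Cmd (adj_comonad (gadj x)) (adj_comonad (gadj y))"
    using two_functor.F1_hom[OF two_functor_C gcwf_forget_hom1[OF f]] by simp
  with f show ?thesis by (simp add: hom1_GCwF hom1_WCmd is_wcomonad_Chat_0)
qed

lemma Chat_2_hom: assumes a: "\<alpha> \<in> hom2 GCwF_iso f g" and f: "f \<in> hom1 GCwF_iso x y" shows "Chat_2 \<alpha> \<in> hom2 WCmd (Chat_1 f) (Chat_1 g)"
proof -
  note a' = hom2_GCwFD[OF a f]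
  have "C_2 (gcwf_to_adj2 \<alpha>) \<in> hom2 Cmd (C_1 (gcwf_to_adj1 f)) (C_1 (gcwf_to_adj1 g))"
    using two_functor.F2_hom[OF two_functor_C a'(6)] by simp
  then show ?thesis
    by (intro hom2_WCmdI[OF Chat_1_hom[OF f] Chat_1_hom[OF a'(3)]]) (simp_all add: a'(1,2,4))
qed

lemma two_functor_Chat: "two_functor GCwF_iso WCmd Chat"
proof -
  interpret A: two_category GCwF_iso by (rule two_category_GCwF_iso)
  interpret B: two_category WCmd by (rule two_category_WCmd)
  interpret C: two_functor LAdj_iso Cmd C_2fun by (rule two_functor_C)
  show ?thesis
  proof (unfold_locales, goal_cases)
    case (1 x) then show ?case by (simp add: is_wcomonad_Chat_0)
  next
    case (2 f x y) then show ?case by (simp add: Chat_1_hom)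
  next
    case (3 \<alpha> f g)
    then obtain x y where f: "f \<in> hom1 GCwF_iso x y" by (rule hom2_GCwF_obtain)
    show ?case using Chat_2_hom[OF 3 f] by simp
  next
    case (4 x)
    then have x: "is_gcwf x" by simp
    have "Chat_1 (gcwf_id1 x) = wcmd_id1 (Chat_0 x)"
      by (rule wcmd_1cell_eqI[OF Chat_1_hom[OF gcwf_id1_hom[OF x]] wcmd_id1_hom[OF is_wcomonad_Chat_0[OF x]]])
        (simp_all add: x gcwf_to_adj_ops wcmd_to_cmd_ops is_wcomonad_Chat_0 C_1_id is_gcwfD)
    then show ?case by simp
  next
    case (5 f x y g z)
    have e: "Src f = x" "is_gcwf x" using 5 by (simp_all add: hom1_GCwF)
    have "Chat_1 (gcwf_comp1 g f) = wcmd_comp1 (Chat_1 g) (Chat_1 f)"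
      by (rule wcmd_1cell_eqI[OF Chat_1_hom[OF gcwf_comp1_hom[OF 5]] wcmd_comp1_hom[OF Chat_1_hom[OF 5(1)] Chat_1_hom[OF 5(2)]]])
        (simp_all add: e gcwf_to_adj_ops wcmd_to_cmd_ops is_wcomonad_Chat_0 C_1_comp[OF gcwf_forget_hom1[OF 5(1)] gcwf_forget_hom1[OF 5(2)]])
    then show ?case by simp
  next
    case (6 f)
    then have f: "f \<in> hom1 GCwF_iso (Src f) (Tgt f)" by (simp add: hom1_def)
    have e: "is_gcwf (Src f)" "is_gcwf (Tgt f)" using f by (simp_all add: hom1_GCwF)
    have "C_2 (adj_id2 (gcwf_to_adj1 f)) = cmd_id2 (C_1 (gcwf_to_adj1 f))"
      using C.F2_id[of "gcwf_to_adj1 f"] gcwf_forget_hom1[OF f] by (simp add: hom1_def)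
    then have "Chat_2 (gcwf_id2 f) = wcmd_id2 (Chat_1 f)"
      by (intro wcmd_2cell_eqI[OF Chat_2_hom[OF gcwf_id2_hom[OF f] f] wcmd_id2_hom[OF Chat_1_hom[OF f]]])
        (simp_all add: e gcwf_to_adj_ops wcmd_to_cmd_ops is_wcomonad_Chat_0)
    then show ?case by simp
  next
    case (7 \<alpha> f g \<beta> h)
    obtain x y where f: "f \<in> hom1 GCwF_iso x y" using 7(1) by (rule hom2_GCwF_obtain)
    note a = hom2_GCwFD[OF 7(1) f] and b = hom2_GCwFD[OF 7(2) hom2_GCwFD(3)[OF 7(1) f]]
    have "Chat_2 (gcwf_vcomp \<beta> \<alpha>) = wcmd_vcomp (Chat_2 \<beta>) (Chat_2 \<alpha>)"
      by (rule wcmd_2cell_eqI[OF Chat_2_hom[OF gcwf_vcomp_hom[OF 7] f] wcmd_vcomp_hom[OF Chat_2_hom[OF 7(1) f] Chat_2_hom[OF 7(2) a(3)]]])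
        (simp_all add: gcwf_vcomp_to_adj[OF 7(1) f] wcmd_vcomp_to_cmd[OF Chat_2_hom[OF 7(1) f] Chat_1_hom[OF f]] C.F2_vcomp[OF a(6) b(6), simplified])
    then show ?case by simp
  next
    case (8 f x y g z \<alpha> f' \<beta> g')
    note a = hom2_GCwFD[OF 8(3,1)] and b = hom2_GCwFD[OF 8(4,2)]
    note C2 = Chat_2_hom[OF 8(3,1)] Chat_2_hom[OF 8(4,2)] and C1 = Chat_1_hom[OF 8(1)] Chat_1_hom[OF 8(2)]
    \<comment> \<open>The two 2-cells can be compared only when their boundaries are the same
      composites; this is needed for the targets \<open>f'\<close>, \<open>g'\<close> as well as for
      \<open>f\<close>, \<open>g\<close>.\<close>
    have C5: "Chat_1 (gcwf_comp1 v u) = wcmd_comp1 (Chat_1 v) (Chat_1 u)" if "u \<in> hom1 GCwF_iso x y" "v \<in> hom1 GCwF_iso y z" for u v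
    proof -
      have e: "Src u = x" "is_gcwf x" using that by (simp_all add: hom1_GCwF)
      show ?thesis
      by (rule wcmd_1cell_eqI[OF Chat_1_hom[OF gcwf_comp1_hom[OF that]] wcmd_comp1_hom[OF Chat_1_hom[OF that(1)] Chat_1_hom[OF that(2)]]])
        (simp_all add: e gcwf_to_adj_ops wcmd_to_cmd_ops is_wcomonad_Chat_0 C_1_comp[OF gcwf_forget_hom1[OF that(1)] gcwf_forget_hom1[OF that(2)]])
    qed
    have "Chat_2 (gcwf_hcomp \<beta> \<alpha>) = wcmd_hcomp (Chat_2 \<beta>) (Chat_2 \<alpha>)"
      by (rule wcmd_2cell_eqI[OF Chat_2_hom[OF gcwf_hcomp_hom[OF 8] gcwf_comp1_hom[OF 8(1,2)], unfolded C5[OF 8(1,2)] C5[OF a(3) b(3)]]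
            wcmd_hcomp_hom[OF C1 C2]])
        (simp_all add: a(1,2) b(1,2) gcwf_hcomp_to_adj[OF 8(3,4,1,2)] wcmd_hcomp_to_cmd[OF C2 C1]
          C.F2_hcomp[OF gcwf_forget_hom1[OF 8(1)] gcwf_forget_hom1[OF 8(2)] a(6) b(6), simplified])
    then show ?case by simp
  qed
qed

context coalg_codes
begin

lemma wcmd_coreI:
  assumes V: "is_wcomonad V" shows "wcmd_core eo ea (wK V) (fB (wp V)) (fp (wp V))"
proof -
  interpret coalg_cat eo ea "wK V" by (rule coalg_catI[OF is_wcomonadD(2)[OF V]])
  note e = is_wcomonadD(3)[OF V]
  interpret p: over "cmC (wK V)" "fB (wp V)" "fp (wp V)"
    using is_fibrationD[OF is_wcomonadD(1)[OF V]] by (simp add: over_def e)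
  show ?thesis
  proof unfold_locales
    fix A assume A: "A \<in> Ob (cmC (wK V))"
    show "p.crt (cmeps (wK V) A)" using is_wcomonadD(4)[OF V, of A] A by (simp add: e cartesian_iff)
    fix s assume "s \<in> Ar (fB (wp V))" "Cod (fB (wp V)) s = onO (fp (wp V)) A"
    then show "\<exists>f. p.crt f \<and> Cod (cmC (wK V)) f = A \<and> onA (fp (wp V)) f = s"
      using fibration_lift[OF is_wcomonadD(1)[OF V], of A s] A by (auto simp: e)
  next
    fix f assume "p.crt f"
    then show "is_pullback (fB (wp V)) (onA (fp (wp V)) (cmeps (wK V) (Dom (cmC (wK V)) f))) (onA (fp (wp V)) (onA (cmK (wK V)) f))
      (onA (fp (wp V)) f) (onA (fp (wp V)) (cmeps (wK V) (Cod (cmC (wK V)) f)))"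
      using V by (simp add: is_wcomonad_def Let_def cartesian_iff e)
  qed
qed

text \<open>Any choice of lifts serves as a cleavage, since morphisms need not preserve it. The
  choice depends only on \<open>V\<close>, so equal w-comonads give equal records.\<close>

definition coalg_fib :: "('b, 'n, 'o, 'a) wcomonad \<Rightarrow> ('b, 'n, 'd, 'e) fibr" where
  "coalg_fib V = (let E = EMc (wK V); B = fB (wp V); q = comp_fct E (fp (wp V)) (EM_U eo ea (wK V)) in
    \<lparr>fB = B, fE = E, fp = q, fcl = \<lambda>y s. if y \<in> Ob E \<and> s \<in> Ar B \<and> Cod B s = onO q y
      then SOME u. cart E B q u \<and> Cod E u = y \<and> onA q u = s else undefined\<rparr>)"

lemma coalg_fib_simps [simp]: "fB (coalg_fib V) = fB (wp V)" "fE (coalg_fib V) = EMc (wK V)"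
  "fp (coalg_fib V) = comp_fct (EMc (wK V)) (fp (wp V)) (EM_U eo ea (wK V))"
  by (simp_all add: coalg_fib_def Let_def)

lemma is_fibration_coalg_fib: assumes V: "is_wcomonad V" shows "is_fibration (coalg_fib V)"
proof -
  interpret wcmd_core eo ea "wK V" "fB (wp V)" "fp (wp V)" by (rule wcmd_coreI[OF V])
  have "q.crt (fcl (coalg_fib V) y s) \<and> Cod (EMc (wK V)) (fcl (coalg_fib V) y s) = y \<and> onA q (fcl (coalg_fib V) y s) = s"
    if y: "y \<in> Ob (EMc (wK V))" and s: "s \<in> Ar (fB (wp V))" "Cod (fB (wp V)) s = onO q y" for y s
  proof -
    obtain u where u: "u \<in> Ar (EMc (wK V))" "Cod (EMc (wK V)) u = y" "p.crt (ar u)" "onA (fp (wp V)) (ar u) = s"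
      by (rule coalg_lift[of y s]) (use y s in simp_all)
    have "\<exists>u. q.crt u \<and> Cod (EMc (wK V)) u = y \<and> onA q u = s"
      by (rule exI[of _ u]) (use u coalg_cart in simp_all)
    then have "q.crt (SOME u. q.crt u \<and> Cod (EMc (wK V)) u = y \<and> onA q u = s) \<and>
      Cod (EMc (wK V)) (SOME u. q.crt u \<and> Cod (EMc (wK V)) u = y \<and> onA q u = s) = y \<and>
      onA q (SOME u. q.crt u \<and> Cod (EMc (wK V)) u = y \<and> onA q u = s) = s" by (rule someI_ex)
    moreover have "fcl (coalg_fib V) y s = (SOME u. q.crt u \<and> Cod (EMc (wK V)) u = y \<and> onA q u = s)"
      using y s by (simp add: coalg_fib_def Let_def)
    ultimately show ?thesis by simp
  qed
  moreover have "fcl (coalg_fib V) y s = undefined"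
    if "\<not> (y \<in> Ob (EMc (wK V)) \<and> s \<in> Ar (fB (wp V)) \<and> Cod (fB (wp V)) s = onO q y)" for y s
    using that by (auto simp: coalg_fib_def Let_def)
  ultimately show ?thesis
    unfolding is_fibration_def cartesian_iff coalg_fib_simps using q.is_functor_axioms by presburger
qed

definition Ehat_0 where "Ehat_0 V = \<lparr>gu = wp V, gud = coalg_fib V, gadj = EM_adj eo ea (wK V)\<rparr>"

definition Ehat_1 where
  "Ehat_1 f = \<lparr>Src = Ehat_0 (Src f), Tgt = Ehat_0 (Tgt f), gmC = wmC f, gmH = wmH f,
    gmHd = CoAlg_fct eo ea (wcmd_to_cmd1 f), gmz = amz (EM_1 eo ea (wcmd_to_cmd1 f))\<rparr>"

definition Ehat_2 where
  "Ehat_2 \<alpha> = \<lparr>Src = Ehat_1 (Src \<alpha>), Tgt = Ehat_1 (Tgt \<alpha>), gmpsi = wmpsi \<alpha>, gmphi = wmphi \<alpha>,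
    gmphid = ampsi (EM_2 eo ea (wcmd_to_cmd2 \<alpha>))\<rparr>"

definition Ehat where "Ehat = \<lparr>F0 = Ehat_0, F1 = Ehat_1, F2 = Ehat_2\<rparr>"

lemma Ehat_simps [simp]:
  "gu (Ehat_0 V) = wp V" "gud (Ehat_0 V) = coalg_fib V" "gadj (Ehat_0 V) = EM_adj eo ea (wK V)"
  "Src (Ehat_1 f) = Ehat_0 (Src f)" "Tgt (Ehat_1 f) = Ehat_0 (Tgt f)" "gmC (Ehat_1 f) = wmC f" "gmH (Ehat_1 f) = wmH f"
  "gmHd (Ehat_1 f) = CoAlg_fct eo ea (wcmd_to_cmd1 f)" "gmz (Ehat_1 f) = amz (EM_1 eo ea (wcmd_to_cmd1 f))"
  "Src (Ehat_2 \<alpha>) = Ehat_1 (Src \<alpha>)" "Tgt (Ehat_2 \<alpha>) = Ehat_1 (Tgt \<alpha>)" "gmpsi (Ehat_2 \<alpha>) = wmpsi \<alpha>" "gmphi (Ehat_2 \<alpha>) = wmphi \<alpha>"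
  "gmphid (Ehat_2 \<alpha>) = ampsi (EM_2 eo ea (wcmd_to_cmd2 \<alpha>))"
  "F0 Ehat = Ehat_0" "F1 Ehat = Ehat_1" "F2 Ehat = Ehat_2"
  by (simp_all add: Ehat_0_def Ehat_1_def Ehat_2_def Ehat_def)

lemma Ehat_forget [simp]: "gcwf_to_adj1 (Ehat_1 f) = EM_1 eo ea (wcmd_to_cmd1 f)" "gcwf_to_adj2 (Ehat_2 \<alpha>) = EM_2 eo ea (wcmd_to_cmd2 \<alpha>)"
proof -
  show 1: "gcwf_to_adj1 (Ehat_1 f) = EM_1 eo ea (wcmd_to_cmd1 f)" for f
    by (rule adj_1cell.equality) (simp_all add: EM_1_def)
  show "gcwf_to_adj2 (Ehat_2 \<alpha>) = EM_2 eo ea (wcmd_to_cmd2 \<alpha>)"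
    by (rule adj_2cell.equality) (simp_all add: 1)
qed

lemma is_gcwf_Ehat_0: assumes V: "is_wcomonad V" shows "is_gcwf (Ehat_0 V)"
proof -
  interpret wcmd_core eo ea "wK V" "fB (wp V)" "fp (wp V)" by (rule wcmd_coreI[OF V])
  note e = is_wcomonadD(3)[OF V]
  \<comment> \<open>That \<open>U\<close> preserves cartesian arrows is the direction of
    \<open>coalg_cart_iff\<close> that relies on the existence of lifts.\<close>
  have "cartesian (wp V) (onA (EM_U eo ea (wK V)) f)" if c: "cartesian (coalg_fib V) f" for f
  proof -
    have c': "q.crt f" using c by (simp add: cartesian_iff)
    then have "f \<in> Ar (EMc (wK V))" by simp
    with c' show ?thesis by (simp add: cartesian_iff coalg_cart_iff flip: e)
  qed
  then show ?thesis
    using is_wcomonadD[OF V] unit_cart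
    by (simp add: is_gcwf_def Let_def is_fibration_coalg_fib V is_adj_iff adjunction_EM cartesian_iff)
qed

text \<open>Cartesian arrows of coalgebras are detected on underlying arrows, where the functor on
  coalgebras acts as \<open>H\<close>; so it preserves them because \<open>H\<close> does.\<close>

lemma Ehat_1_hom: assumes f: "f \<in> hom1 WCmd x y" shows "Ehat_1 f \<in> hom1 GCwF_iso (Ehat_0 x) (Ehat_0 y)"
proof -
  have x: "is_wcomonad x" "is_wcomonad y" and c: "wcmd_to_cmd1 f \<in> hom1 Cmd (wK x) (wK y)"
    and u: "is_fib_1cell (wp x) (wp y) (wmC f) (wmH f)" and xy: "Src f = x" "Tgt f = y" using f by (simp_all add: hom1_WCmd)
  note e = is_wcomonadD(3)[OF x(1)] is_wcomonadD(3)[OF x(2)]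
  interpret X: wcmd_core eo ea "wK x" "fB (wp x)" "fp (wp x)" by (rule wcmd_coreI[OF x(1)])
  interpret Y: wcmd_core eo ea "wK y" "fB (wp y)" "fp (wp y)" by (rule wcmd_coreI[OF x(2)])
  interpret f: EM_arrow eo ea "wK x" "wK y" "wcmd_to_cmd1 f"
    rewrites "cmH (wcmd_to_cmd1 f) = wmH f" by (rule EM_arrowI[OF c]) simp
  interpret C: is_functor "fB (wp x)" "fB (wp y)" "wmC f" by (rule is_fib_1cellD[OF u])
  have ov: "A \<in> Ob (cmC (wK x)) \<Longrightarrow> onO (fp (wp y)) (onO (wmH f) A) = onO (wmC f) (onO (fp (wp x)) A)"
    "v \<in> Ar (cmC (wK x)) \<Longrightarrow> onA (fp (wp y)) (onA (wmH f) v) = onA (wmC f) (onA (fp (wp x)) v)" for A v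
    using is_fib_1cell_over[OF u] by (simp_all add: e)
  have "comp_fct (EMc (wK x)) Y.q f.EMf = comp_fct (EMc (wK x)) (wmC f) X.q"
    by (rule fctr_eqI[OF is_functor_comp[OF f.EMf.is_functor_axioms Y.q.is_functor_axioms]
          is_functor_comp[OF X.q.is_functor_axioms C.is_functor_axioms]]) (simp_all add: ov)
  moreover have "cartesian (coalg_fib y) (onA f.EMf v)" if c: "cartesian (coalg_fib x) v" for v
  proof -
    have c': "X.q.crt v" using c by (simp add: cartesian_iff)
    then have v [simp]: "v \<in> Ar (EMc (wK x))" by simp
    have "cartesian (wp x) (ar v)" using c' by (simp add: cartesian_iff X.coalg_cart_iff flip: e)
    then have "cartesian (wp y) (onA (wmH f) (ar v))" by (rule is_fib_1cellD[OF u])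
    then show ?thesis by (simp add: cartesian_iff Y.coalg_cart_iff flip: e)
  qed
  ultimately have "is_fib_1cell (coalg_fib x) (coalg_fib y) (wmC f) f.EMf"
    by (simp add: is_fib_1cell_def is_fibration_coalg_fib x)
  moreover have "vertical (wp y) (amz (EM_1 eo ea (wcmd_to_cmd1 f)) A)" if "A \<in> Ob (EMc (wK x))" for A
    using that by (simp add: vertical_def flip: e)
  ultimately show ?thesis
    using x u xy by (simp add: hom1_GCwF is_gcwf_Ehat_0 hom1_LAdj) (rule f.EM1.adj_arrow_axioms)
qed

lemma Ehat_2_hom:
  assumes a: "\<alpha> \<in> hom2 WCmd f g" and f: "f \<in> hom1 WCmd x y" shows "Ehat_2 \<alpha> \<in> hom2 GCwF_iso (Ehat_1 f) (Ehat_1 g)"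
proof -
  note a' = hom2_WCmdD[OF a f]
  have x: "is_wcomonad x" "is_wcomonad y" and c: "wcmd_to_cmd1 f \<in> hom1 Cmd (wK x) (wK y)" using f by (simp_all add: hom1_WCmd)
  note e = is_wcomonadD(3)[OF x(1)] is_wcomonadD(3)[OF x(2)]
  interpret X: wcmd_core eo ea "wK x" "fB (wp x)" "fp (wp x)" by (rule wcmd_coreI[OF x(1)])
  interpret Y: wcmd_core eo ea "wK y" "fB (wp y)" "fp (wp y)" by (rule wcmd_coreI[OF x(2)])
  note E2 = EM_2_hom[OF c a'(5)] and p = EM_2_parts[OF c a'(5)]
  note E1 = Ehat_1_hom[OF f] Ehat_1_hom[OF a'(3)]
  have xy: "Src f = x" "Tgt f = y" using f by (simp_all add: hom1_WCmd)
  have nt: "nat_trans (EMc (wK x)) (EMc (wK y)) (CoAlg_fct eo ea (wcmd_to_cmd1 f)) (CoAlg_fct eo ea (wcmd_to_cmd1 g)) (ampsi (EM_2 eo ea (wcmd_to_cmd2 \<alpha>)))"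
    using E2 by (auto simp: hom2_LAdj adj_2arrow_def EM_1_def EM_adj_def xy)
  have "is_fib_2cell (coalg_fib x) (coalg_fib y) (wmC f) (CoAlg_fct eo ea (wcmd_to_cmd1 f)) (wmC g) (CoAlg_fct eo ea (wcmd_to_cmd1 g))
     (wmpsi \<alpha>) (ampsi (EM_2 eo ea (wcmd_to_cmd2 \<alpha>)))"
    using E1 nt is_fib_2cellD(3)[OF a'(4)] is_fib_2cellD(5)[OF a'(4)] p
    by (simp add: is_fib_2cell_def hom1_GCwF flip: e)
  then show ?thesis
    using a' E2 by (intro hom2_GCwFI[OF E1]) simp_all
qed

lemma Ehat_1_id:
  assumes V: "is_wcomonad V" shows "Ehat_1 (wcmd_id1 V) = gcwf_id1 (Ehat_0 V)"
  by (rule gcwf_1cell_eqI[OF Ehat_1_hom[OF wcmd_id1_hom[OF V]] gcwf_id1_hom[OF is_gcwf_Ehat_0[OF V]]])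
    (simp_all add: V gcwf_to_adj_ops wcmd_to_cmd_ops is_gcwf_Ehat_0 EM_1_id is_wcomonadD)

lemma Ehat_1_comp:
  assumes f: "f \<in> hom1 WCmd x y" and g: "g \<in> hom1 WCmd y z" shows "Ehat_1 (wcmd_comp1 g f) = gcwf_comp1 (Ehat_1 g) (Ehat_1 f)"
proof -
  have e: "Src f = x" "is_wcomonad x" and c: "wcmd_to_cmd1 f \<in> hom1 Cmd (wK x) (wK y)" "wcmd_to_cmd1 g \<in> hom1 Cmd (wK y) (wK z)"
    using f g by (simp_all add: hom1_WCmd)
  show ?thesis
    by (rule gcwf_1cell_eqI[OF Ehat_1_hom[OF wcmd_comp1_hom[OF f g]] gcwf_comp1_hom[OF Ehat_1_hom[OF f] Ehat_1_hom[OF g]]])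
      (simp_all add: e gcwf_to_adj_ops wcmd_to_cmd_ops is_gcwf_Ehat_0 EM_1_comp[OF c])
qed

lemma two_functor_Ehat: "two_functor WCmd GCwF_iso Ehat"
proof -
  interpret A: two_category GCwF_iso by (rule two_category_GCwF_iso)
  interpret B: two_category WCmd by (rule two_category_WCmd)
  interpret E: two_functor Cmd LAdj_iso "EM eo ea" by (rule two_functor_EM)
  show ?thesis
  proof (unfold_locales, goal_cases)
    case (1 x) then show ?case by (simp add: is_gcwf_Ehat_0)
  next
    case (2 f x y) then show ?case by (simp add: Ehat_1_hom)
  next
    case (3 \<alpha> f g)
    then obtain x y where f: "f \<in> hom1 WCmd x y" by (rule hom2_WCmd_obtain)
    show ?case using Ehat_2_hom[OF 3 f] by simp
  next
    case (4 x) then show ?case by (simp add: Ehat_1_id)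
  next
    case (5 f x y g z) then show ?case by (simp add: Ehat_1_comp)
  next
    case (6 f)
    then have f: "f \<in> hom1 WCmd (Src f) (Tgt f)" by (simp add: hom1_def)
    then have e: "is_wcomonad (Src f)" "is_wcomonad (Tgt f)" and c: "wcmd_to_cmd1 f \<in> hom1 Cmd (wK (Src f)) (wK (Tgt f))"
      by (simp_all add: hom1_WCmd)
    have "EM_2 eo ea (cmd_id2 (wcmd_to_cmd1 f)) = adj_id2 (EM_1 eo ea (wcmd_to_cmd1 f))"
      using E.F2_id[of "wcmd_to_cmd1 f"] c by (simp add: hom1_def)
    then have "Ehat_2 (wcmd_id2 f) = gcwf_id2 (Ehat_1 f)"
      by (intro gcwf_2cell_eqI[OF Ehat_2_hom[OF wcmd_id2_hom[OF f] f] gcwf_id2_hom[OF Ehat_1_hom[OF f]]])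
        (simp_all add: e gcwf_to_adj_ops wcmd_to_cmd_ops is_gcwf_Ehat_0)
    then show ?case by simp
  next
    case (7 \<alpha> f g \<beta> h)
    obtain x y where f: "f \<in> hom1 WCmd x y" using 7(1) by (rule hom2_WCmd_obtain)
    note a = hom2_WCmdD[OF 7(1) f] and b = hom2_WCmdD[OF 7(2) hom2_WCmdD(3)[OF 7(1) f]]
    have "Ehat_2 (wcmd_vcomp \<beta> \<alpha>) = gcwf_vcomp (Ehat_2 \<beta>) (Ehat_2 \<alpha>)"
      by (rule gcwf_2cell_eqI[OF Ehat_2_hom[OF wcmd_vcomp_hom[OF 7] f] gcwf_vcomp_hom[OF Ehat_2_hom[OF 7(1) f] Ehat_2_hom[OF 7(2) a(3)]]])
        (simp_all add: wcmd_vcomp_to_cmd[OF 7(1) f] gcwf_vcomp_to_adj[OF Ehat_2_hom[OF 7(1) f] Ehat_1_hom[OF f]] E.F2_vcomp[OF a(5) b(5), simplified])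
    then show ?case by simp
  next
    case (8 f x y g z \<alpha> f' \<beta> g')
    note a = hom2_WCmdD[OF 8(3,1)] and b = hom2_WCmdD[OF 8(4,2)]
    note E2 = Ehat_2_hom[OF 8(3,1)] Ehat_2_hom[OF 8(4,2)] and E1 = Ehat_1_hom[OF 8(1)] Ehat_1_hom[OF 8(2)]
    have c: "wcmd_to_cmd1 f \<in> hom1 Cmd (wK x) (wK y)" "wcmd_to_cmd1 g \<in> hom1 Cmd (wK y) (wK z)" using 8 by (simp_all add: hom1_WCmd)
    have "Ehat_2 (wcmd_hcomp \<beta> \<alpha>) = gcwf_hcomp (Ehat_2 \<beta>) (Ehat_2 \<alpha>)"
      by (rule gcwf_2cell_eqI[OF Ehat_2_hom[OF wcmd_hcomp_hom[OF 8] wcmd_comp1_hom[OF 8(1,2)], unfolded Ehat_1_comp[OF 8(1,2)] Ehat_1_comp[OF a(3) b(3)]]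
            gcwf_hcomp_hom[OF E1 E2]])
        (simp_all add: a(1,2) b(1,2) wcmd_hcomp_to_cmd[OF 8(3,4,1,2)] gcwf_hcomp_to_adj[OF E2 E1]
          E.F2_hcomp[OF c a(5) b(5), simplified])
    then show ?case by simp
  qed
qed

end

text \<open>Functors preserve inverses, so the componentwise inverse upstairs lies over the
  componentwise inverse in the base.\<close>

lemma is_fib_2cell_inverse:
  assumes a: "is_fib_2cell p p' B E B' E' \<psi> \<phi>" and i1: "\<And>X. X \<in> Ob (fB p) \<Longrightarrow> iso (fB p') (\<psi> X)"
    and i2: "\<And>A. A \<in> Ob (fE p) \<Longrightarrow> iso (fE p') (\<phi> A)"
  shows "is_fib_2cell p p' B' E' B E (\<lambda>X \<in> Ob (fB p). inv_ar (fB p') (\<psi> X)) (\<lambda>A \<in> Ob (fE p). inv_ar (fE p') (\<phi> A))"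
proof -
  note a' = is_fib_2cellD[OF a]
  interpret p: is_functor "fE p" "fB p" "fp p" by (rule is_fibrationD) (rule is_fib_1cellD[OF a'(1)])
  interpret p': is_functor "fE p'" "fB p'" "fp p'" by (rule is_fibrationD) (rule is_fib_1cellD[OF a'(1)])
  have "onA (fp p') (inv_ar (fE p') (\<phi> A)) = inv_ar (fB p') (\<psi> (onO (fp p) A))" if A: "A \<in> Ob (fE p)" for A
    using category.inv_ar_eqI[OF p'.D.category_axioms p'.onA_inverse[OF p'.C.inv_ar_inverse[OF i2[OF A]]]] a'(5)[OF A] by simp
  then show ?thesis
    using a' nat_trans_inverse[OF a'(3) i1] nat_trans_inverse[OF a'(4) i2] by (simp add: is_fib_2cell_def)
qed

lemma invertible2_GCwF:
  assumes a: "\<alpha> \<in> hom2 GCwF_iso f g" and f: "f \<in> hom1 GCwF_iso x y"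
    and i: "\<And>X. X \<in> Ob (fB (gu x)) \<Longrightarrow> iso (fB (gu y)) (gmpsi \<alpha> X)"
      "\<And>X. X \<in> Ob (fE (gu x)) \<Longrightarrow> iso (fE (gu y)) (gmphi \<alpha> X)"
      "\<And>A. A \<in> Ob (fE (gud x)) \<Longrightarrow> iso (fE (gud y)) (gmphid \<alpha> A)"
  shows "invertible2 GCwF_iso \<alpha>"
proof -
  note a' = hom2_GCwFD[OF a f]
  have x: "is_gcwf x" "is_gcwf y" "Src f = x" "Tgt f = y" "Src g = x" "Tgt g = y" using f a'(3) by (simp_all add: hom1_GCwF)
  note e = is_gcwfD(4-6)[OF x(1)] is_gcwfD(4-6)[OF x(2)]
  define \<beta> where "\<beta> = \<lparr>Src = g, Tgt = f, gmpsi = \<lambda>X \<in> Ob (fB (gu x)). inv_ar (fB (gu y)) (gmpsi \<alpha> X),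
    gmphi = \<lambda>X \<in> Ob (fE (gu x)). inv_ar (fE (gu y)) (gmphi \<alpha> X), gmphid = \<lambda>A \<in> Ob (fE (gud x)). inv_ar (fE (gud y)) (gmphid \<alpha> A)\<rparr>"
  have a2: "adj_2arrow (gadj x) (gadj y) (gmH f) (gmHd f) (gmz f) (gmH g) (gmHd g) (gmz g) (gmphi \<alpha>) (gmphid \<alpha>)"
    using a'(6) by (simp add: hom2_LAdj x)
  have "adj_2arrow (gadj x) (gadj y) (gmH g) (gmHd g) (gmz g) (gmH f) (gmHd f) (gmz f) (gmphi \<beta>) (gmphid \<beta>)"
    using adj_2arrow_inverse[OF a2] i by (simp add: e \<beta>_def)
  then have b: "gcwf_to_adj2 \<beta> \<in> hom2 LAdj_iso (gcwf_to_adj1 g) (gcwf_to_adj1 f)"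
    by (simp add: hom2_LAdj x, simp add: \<beta>_def)
  have ud: "is_fib_2cell (gud x) (gud y) (gmC g) (gmHd g) (gmC f) (gmHd f) (gmpsi \<beta>) (gmphid \<beta>)"
    using is_fib_2cell_inverse[OF a'(5)] i by (simp add: e \<beta>_def)
  have u: "is_fib_2cell (gu x) (gu y) (gmC g) (gmH g) (gmC f) (gmH f) (gmpsi \<beta>) (gmphi \<beta>)"
    using is_fib_2cell_inverse[OF a'(4)] i by (simp add: \<beta>_def)
  have "\<beta> \<in> hom2 GCwF_iso g f" by (rule hom2_GCwFI[OF a'(3) f _ _ u ud b]) (simp_all add: \<beta>_def)
  moreover have "gcwf_vcomp \<beta> \<alpha> = gcwf_id2 f" "gcwf_vcomp \<alpha> \<beta> = gcwf_id2 g"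
    using vcomp_nt_inverse[OF is_fib_2cellD(3)[OF a'(4)] i(1)] vcomp_nt_inverse[OF is_fib_2cellD(4)[OF a'(4)] i(2)]
       vcomp_nt_inverse[OF is_fib_2cellD(4)[OF a'(5)] i(3)]
    by (auto intro!: gcwf_2cell.equality simp: a'(1,2) x \<beta>_def)
  ultimately show ?thesis
    using a unfolding invertible2_def by (auto simp: hom2_def a'(1,2))
qed

context coalg_codes
begin

definition etahat1 where
  "etahat1 W = \<lparr>Src = W, Tgt = Ehat_0 (Chat_0 W), gmC = id_fct (fB (gu W)), gmH = id_fct (fE (gu W)),
    gmHd = comparison eo ea (gadj W), gmz = amz (EM_unit1 eo ea (gadj W))\<rparr>"

definition etahat2 where
  "etahat2 f = \<lparr>Src = gcwf_comp1 (etahat1 (Tgt f)) f, Tgt = gcwf_comp1 (Ehat_1 (Chat_1 f)) (etahat1 (Src f)),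
    gmpsi = id_nt (fB (gu (Src f))) (fB (gu (Tgt f))) (gmC f), gmphi = id_nt (fE (gu (Src f))) (fE (gu (Tgt f))) (gmH f),
    gmphid = ampsi (EM_unit2 eo ea (gcwf_to_adj1 f))\<rparr>"

definition etahat where "etahat = \<lparr>pn1 = etahat1, pn2 = etahat2\<rparr>"

lemma etahat_simps [simp]:
  "Src (etahat1 W) = W" "Tgt (etahat1 W) = Ehat_0 (Chat_0 W)" "gmC (etahat1 W) = id_fct (fB (gu W))" "gmH (etahat1 W) = id_fct (fE (gu W))"
  "gmHd (etahat1 W) = comparison eo ea (gadj W)" "gmz (etahat1 W) = amz (EM_unit1 eo ea (gadj W))"
  "Src (etahat2 f) = gcwf_comp1 (etahat1 (Tgt f)) f" "Tgt (etahat2 f) = gcwf_comp1 (Ehat_1 (Chat_1 f)) (etahat1 (Src f))"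
  "gmpsi (etahat2 f) = id_nt (fB (gu (Src f))) (fB (gu (Tgt f))) (gmC f)"
  "gmphi (etahat2 f) = id_nt (fE (gu (Src f))) (fE (gu (Tgt f))) (gmH f)"
  "gmphid (etahat2 f) = ampsi (EM_unit2 eo ea (gcwf_to_adj1 f))"
  "pn1 etahat = etahat1" "pn2 etahat = etahat2"
  by (simp_all add: etahat1_def etahat2_def etahat_def)

lemma etahat1_forget: "is_gcwf W \<Longrightarrow> gcwf_to_adj1 (etahat1 W) = EM_unit1 eo ea (gadj W)"
  by (rule adj_1cell.equality) (simp_all add: EM_unit1_def is_gcwfD)

lemma etahat1_hom: assumes W: "is_gcwf W" shows "etahat1 W \<in> hom1 GCwF_iso W (Ehat_0 (Chat_0 W))"
proof -
  interpret gcwf_core "gadj W" "fB (gu W)" "fp (gu W)" "fp (gud W)" by (rule gcwf_coreI[OF W])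
  interpret N: EM_unit_loc eo ea "gadj W" by (rule EM_unit_loc.intro) unfold_locales
  note C = is_wcomonad_Chat_0[OF W] and e = is_gcwfD(4-6)[OF W]
  interpret Y: wcmd_core eo ea "adj_comonad (gadj W)" "fB (gu W)" "fp (gu W)"
    rewrites "cmC (adj_comonad (gadj W)) = adC (gadj W)" and "cmeps (adj_comonad (gadj W)) = adeps (gadj W)"
    using wcmd_coreI[OF C] by simp_all
  have "comp_fct (adD (gadj W)) Y.q N.KT = comp_fct (adD (gadj W)) (id_fct (fB (gu W))) (fp (gud W))"
    unfolding comp_fct_id_left[OF q.is_functor_axioms]
    by (rule fctr_eqI[OF is_functor_comp[OF N.KT.is_functor_axioms Y.q.is_functor_axioms] q.is_functor_axioms]) simp_all
  moreover have "cartesian (coalg_fib (Chat_0 W)) (onA N.KT f)" if "cartesian (gud W) f" for f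
  proof -
    have f: "q.crt f" using that by (simp add: cartesian_iff e)
    then have [simp]: "f \<in> Ar (adD (gadj W))" by simp
    \<comment> \<open>The underlying arrow of the comparison functor at \<open>f\<close> is
      \<open>L f\<close>, cartesian by the axioms of a gcwf.\<close>
    have "Y.q.crt (onA N.KT f)" using L_cart[OF f] by (simp add: Y.coalg_cart_iff)
    then show ?thesis by (simp add: cartesian_iff)
  qed
  ultimately have "is_fib_1cell (gud W) (coalg_fib (Chat_0 W)) (id_fct (fB (gu W))) N.KT"
    using N.KT.is_functor_axioms is_gcwfD[OF W]
    by (simp add: is_fib_1cell_def is_fibration_coalg_fib C e is_functor_id)
  moreover have "gcwf_to_adj1 (etahat1 W) \<in> hom1 LAdj_iso (gadj W) (EM_adj eo ea (adj_comonad (gadj W)))"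
    using N.EM_unit1_hom by (simp add: etahat1_forget W)
  moreover have "vertical (gu W) (amz (EM_unit1 eo ea (gadj W)) A)" if "A \<in> Ob (adD (gadj W))" for A
    using that by (simp add: vertical_def flip: e)
  ultimately show ?thesis
    using is_fib_1cell_id[OF is_gcwfD(1)[OF W]] by (simp add: hom1_GCwF W is_gcwf_Ehat_0 C flip: e)
qed

lemma etahat2_forget:
  assumes f: "f \<in> hom1 GCwF_iso x y" shows "gcwf_to_adj2 (etahat2 f) = EM_unit2 eo ea (gcwf_to_adj1 f)"
proof -
  have x: "is_gcwf x" "is_gcwf y" "Src f = x" "Tgt f = y" using f by (simp_all add: hom1_GCwF)
  interpret EM_unit_cell eo ea "gadj x" "gadj y" "gcwf_to_adj1 f" by (rule EM_unit_cellI[OF gcwf_forget_hom1[OF f]])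
  show ?thesis
    by (rule adj_2cell.equality) (simp_all add: x gcwf_to_adj_ops etahat1_forget is_gcwfD)
qed

lemma etahat_src_tgt:
  assumes f: "f \<in> hom1 GCwF_iso x y"
  shows "gcwf_comp1 (etahat1 y) f \<in> hom1 GCwF_iso x (Ehat_0 (Chat_0 y))"
    "gcwf_comp1 (Ehat_1 (Chat_1 f)) (etahat1 x) \<in> hom1 GCwF_iso x (Ehat_0 (Chat_0 y))"
proof -
  have x: "is_gcwf x" "is_gcwf y" using f by (simp_all add: hom1_GCwF)
  show "gcwf_comp1 (etahat1 y) f \<in> hom1 GCwF_iso x (Ehat_0 (Chat_0 y))"
    by (rule gcwf_comp1_hom[OF f etahat1_hom[OF x(2)]])
  show "gcwf_comp1 (Ehat_1 (Chat_1 f)) (etahat1 x) \<in> hom1 GCwF_iso x (Ehat_0 (Chat_0 y))"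
    by (rule gcwf_comp1_hom[OF etahat1_hom[OF x(1)] Ehat_1_hom[OF Chat_1_hom[OF f]]])
qed

lemma etahat2_hom:
  assumes f: "f \<in> hom1 GCwF_iso x y"
  shows "etahat2 f \<in> hom2 GCwF_iso (gcwf_comp1 (etahat1 y) f) (gcwf_comp1 (Ehat_1 (Chat_1 f)) (etahat1 x))"
proof -
  have x [simp]: "is_gcwf x" "is_gcwf y" "Src f = x" "Tgt f = y" and u: "is_fib_1cell (gu x) (gu y) (gmC f) (gmH f)"
    and ud: "is_fib_1cell (gud x) (gud y) (gmC f) (gmHd f)"
    and v: "A \<in> Ob (fE (gud x)) \<Longrightarrow> vertical (gu y) (gmz f A)" for A using f by (simp_all add: hom1_GCwF)
  note e = is_gcwfD(4-6)[OF x(1)] is_gcwfD(4-6)[OF x(2)]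
  note st = etahat_src_tgt[OF f]
  have b: "is_functor (fB (gu x)) (fB (gu y)) (gmC f)" "is_functor (fE (gu x)) (fE (gu y)) (gmH f)" using is_fib_1cellD[OF u] by simp_all
  note ids = comp_fct_id_left[OF b(1)] comp_fct_id_right[OF b(1)] comp_fct_id_left[OF b(2)] comp_fct_id_right[OF b(2)]
  interpret c: EM_unit_cell eo ea "gadj x" "gadj y" "gcwf_to_adj1 f"
    rewrites "amz (gcwf_to_adj1 f) = gmz f" and "amG (gcwf_to_adj1 f) = gmHd f" and "amF (gcwf_to_adj1 f) = gmH f"
    by (rule EM_unit_cellI[OF gcwf_forget_hom1[OF f]]) simp_all
  interpret X: gcwf_core "gadj x" "fB (gu x)" "fp (gu x)" "fp (gud x)" by (rule gcwf_coreI[OF x(1)])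
  interpret Y: gcwf_core "gadj y" "fB (gu y)" "fp (gu y)" "fp (gud y)" by (rule gcwf_coreI[OF x(2)])
  have adj: "gcwf_to_adj2 (etahat2 f) \<in> hom2 LAdj_iso (gcwf_to_adj1 (gcwf_comp1 (etahat1 y) f)) (gcwf_to_adj1 (gcwf_comp1 (Ehat_1 (Chat_1 f)) (etahat1 x)))"
    using c.EM_unit2_hom by (simp add: etahat2_forget[OF f] gcwf_to_adj_ops etahat1_forget)
  have fu: "is_fib_2cell (gu x) (gu y) (gmC (gcwf_comp1 (etahat1 y) f)) (gmH (gcwf_comp1 (etahat1 y) f))
     (gmC (gcwf_comp1 (Ehat_1 (Chat_1 f)) (etahat1 x))) (gmH (gcwf_comp1 (Ehat_1 (Chat_1 f)) (etahat1 x))) (gmpsi (etahat2 f)) (gmphi (etahat2 f))"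
    using is_fib_2cell_id[OF u] by (simp add: ids)
  have nt: "nat_trans (adD (gadj x)) (EMc (adj_comonad (gadj y))) (comp_fct (adD (gadj x)) (comparison eo ea (gadj y)) (gmHd f))
    (comp_fct (adD (gadj x)) (CoAlg_fct eo ea (C_1 (gcwf_to_adj1 f))) (comparison eo ea (gadj x))) (ampsi (EM_unit2 eo ea (gcwf_to_adj1 f)))"
    using c.EM_unit2_hom by (auto simp: hom2_LAdj adj_2arrow_def EM_adj_def EM_1_def)
  \<comment> \<open>The component of the 2-cell on coalgebras is \<open>\<zeta>\<close>, which must
    lie over the identity transformation of the base functor; the verticality required of loose
    morphisms supplies this.\<close>
  have ov: "onA (fp (gu y)) (gmz f A) = Ident (fB (gu y)) (onO (gmC f) (onO (fp (gud x)) A))" if A: "A \<in> Ob (adD (gadj x))" for A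
    using v[of A] A is_fib_1cell_over(1)[OF ud, of A] by (simp add: vertical_def flip: e)
  have "is_fib_2cell (gud x) (coalg_fib (Chat_0 y)) (gmC (gcwf_comp1 (etahat1 y) f)) (gmHd (gcwf_comp1 (etahat1 y) f))
     (gmC (gcwf_comp1 (Ehat_1 (Chat_1 f)) (etahat1 x))) (gmHd (gcwf_comp1 (Ehat_1 (Chat_1 f)) (etahat1 x))) (gmpsi (etahat2 f)) (gmphid (etahat2 f))"
    unfolding is_fib_2cell_def
  proof (intro conjI ballI)
    show "is_fib_1cell (gud x) (coalg_fib (Chat_0 y)) (gmC (gcwf_comp1 (etahat1 y) f)) (gmHd (gcwf_comp1 (etahat1 y) f))"
      "is_fib_1cell (gud x) (coalg_fib (Chat_0 y)) (gmC (gcwf_comp1 (Ehat_1 (Chat_1 f)) (etahat1 x))) (gmHd (gcwf_comp1 (Ehat_1 (Chat_1 f)) (etahat1 x)))"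
      using st unfolding hom1_GCwF by simp_all
    show "nat_trans (fB (gud x)) (fB (coalg_fib (Chat_0 y))) (gmC (gcwf_comp1 (etahat1 y) f)) (gmC (gcwf_comp1 (Ehat_1 (Chat_1 f)) (etahat1 x))) (gmpsi (etahat2 f))"
      using nat_trans_id[OF b(1)] by (simp add: ids e(1))
    show "nat_trans (fE (gud x)) (fE (coalg_fib (Chat_0 y))) (gmHd (gcwf_comp1 (etahat1 y) f)) (gmHd (gcwf_comp1 (Ehat_1 (Chat_1 f)) (etahat1 x))) (gmphid (etahat2 f))"
      using nt by (simp add: e(3))
    fix A assume "A \<in> Ob (fE (gud x))"
    then have A: "A \<in> Ob (adD (gadj x))" by (simp add: e)
    then show "onA (fp (coalg_fib (Chat_0 y))) (gmphid (etahat2 f) A) = gmpsi (etahat2 f) (onO (fp (gud x)) A)"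
      by (simp add: ov)
  qed
  then show ?thesis
    by (intro hom2_GCwFI[OF st _ _ _ _ adj]) (use fu in simp_all)
qed

lemma etahat2_invertible:
  assumes f: "f \<in> hom1 GCwF_iso x y" shows "invertible2 GCwF_iso (etahat2 f)"
proof (rule invertible2_GCwF[OF etahat2_hom[OF f] etahat_src_tgt(1)[OF f]])
  have x [simp]: "is_gcwf x" "is_gcwf y" "Src f = x" "Tgt f = y" and u: "is_fib_1cell (gu x) (gu y) (gmC f) (gmH f)"
    using f by (simp_all add: hom1_GCwF)
  note e = is_gcwfD(4-6)[OF x(1)] is_gcwfD(4-6)[OF x(2)]
  interpret B: is_functor "fB (gu x)" "fB (gu y)" "gmC f" by (rule is_fib_1cellD[OF u])
  interpret H: is_functor "fE (gu x)" "fE (gu y)" "gmH f" by (rule is_fib_1cellD[OF u])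
  interpret c: EM_unit_cell eo ea "gadj x" "gadj y" "gcwf_to_adj1 f" by (rule EM_unit_cellI[OF gcwf_forget_hom1[OF f]])
  show "iso (fB (gu (Ehat_0 (Chat_0 y)))) (gmpsi (etahat2 f) X)" if "X \<in> Ob (fB (gu x))" for X using that by simp
  show "iso (fE (gu (Ehat_0 (Chat_0 y)))) (gmphi (etahat2 f) X)" if "X \<in> Ob (fE (gu x))" for X using that by simp
  fix A assume "A \<in> Ob (fE (gud x))"
  then have A: "A \<in> Ob (adD (gadj x))" by (simp add: e)
  then have "iso (EMc (adj_comonad (gadj y))) (ampsi (EM_unit2 eo ea (gcwf_to_adj1 f)) A)"
    using c.ze_iso[OF A] by (intro c.T.Q.coalg_iso) simp_all
  then show "iso (fE (gud (Ehat_0 (Chat_0 y)))) (gmphid (etahat2 f) A)" by simp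
qed

text \<open>\<open>Ehat\<close> keeps the fibration \<open>p\<close> and \<open>Chat\<close>
  discards the fibration of coalgebras, so what remains is that \<open>C\<close> undoes
  \<open>EM\<close> at the base level.\<close>

lemma Chat_Ehat:
  "is_wcomonad V \<Longrightarrow> Chat_0 (Ehat_0 V) = V"
  "is_wcmd_1cell f \<Longrightarrow> Chat_1 (Ehat_1 f) = f"
  "is_wcmd_2cell \<alpha> \<Longrightarrow> Chat_2 (Ehat_2 \<alpha>) = \<alpha>"
proof -
  interpret S: strict_biadjunction LAdj_iso Cmd C_2fun "EM eo ea" "EM_unit eo ea" EM_counit by (rule strict_biadjunction_EM)
  show 0: "Chat_0 (Ehat_0 V) = V" if "is_wcomonad V" for V
    using S.FG0[of "wK V"] is_wcomonadD(2)[OF that] by (simp add: Chat_0_def is_comonad_iff)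
  show 1: "Chat_1 (Ehat_1 f) = f" if f: "is_wcmd_1cell f" for f
  proof -
    have h: "f \<in> hom1 WCmd (Src f) (Tgt f)" using f by (simp add: hom1_def)
    then have w: "is_wcomonad (Src f)" "is_wcomonad (Tgt f)" "is_cmd_1cell (wcmd_to_cmd1 f)"
      unfolding hom1_WCmd by (simp_all add: hom1_def)
    have "Chat_1 (Ehat_1 f) \<in> hom1 WCmd (Src f) (Tgt f)" using Chat_1_hom[OF Ehat_1_hom[OF h]] by (simp add: 0 w)
    then show ?thesis
      by (rule wcmd_1cell_eqI[OF _ h]) (use S.FG1[of "wcmd_to_cmd1 f"] w in simp_all)
  qed
  show "Chat_2 (Ehat_2 \<alpha>) = \<alpha>" if a: "is_wcmd_2cell \<alpha>" for \<alpha>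
    using a by (intro wcmd_2cell.equality) (simp_all add: 1 is_wcmd_2cell_def)
qed

lemma Chat_etahat1: assumes W: "is_gcwf W" shows "Chat_1 (etahat1 W) = wcmd_id1 (Chat_0 W)"
proof -
  interpret N: EM_unit_loc eo ea "gadj W" by (rule EM_unit_locI[OF is_gcwfD(3)[OF W]])
  note C = is_wcomonad_Chat_0[OF W]
  have "Chat_1 (etahat1 W) \<in> hom1 WCmd (Chat_0 W) (Chat_0 W)"
    using Chat_1_hom[OF etahat1_hom[OF W]] by (simp add: Chat_Ehat C)
  then show ?thesis
    by (rule wcmd_1cell_eqI[OF _ wcmd_id1_hom[OF C]]) (simp_all add: etahat1_forget W wcmd_to_cmd_ops C N.C_unit1)
qed

text \<open>\<open>Chat_Ehat\<close> makes the codomain literally \<open>Ehat_0 V\<close>, including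
  the chosen cleavage, so both sides are endomorphisms and the base-level equation decides.\<close>

lemma etahat1_Ehat: assumes V: "is_wcomonad V" shows "etahat1 (Ehat_0 V) = gcwf_id1 (Ehat_0 V)"
proof -
  note E = is_gcwf_Ehat_0[OF V]
  have "etahat1 (Ehat_0 V) \<in> hom1 GCwF_iso (Ehat_0 V) (Ehat_0 V)"
    using etahat1_hom[OF E] by (simp add: Chat_Ehat V)
  then show ?thesis
    by (rule gcwf_1cell_eqI[OF _ gcwf_id1_hom[OF E]])
      (simp_all add: etahat1_forget E gcwf_to_adj_ops EM_unit1_EM is_wcomonadD(2)[OF V])
qed

text \<open>Bookkeeping of boundaries for the composition law of the lifted unit: its 2-cells can be
  compared only once these composites are the same 1-cells.\<close>

lemma GCwF_comp_assocs:
  assumes f: "f \<in> hom1 GCwF_iso x y" and g: "g \<in> hom1 GCwF_iso y z"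
  shows "gcwf_comp1 (etahat1 z) (gcwf_comp1 g f) = gcwf_comp1 (gcwf_comp1 (etahat1 z) g) f"
    "gcwf_comp1 (gcwf_comp1 (Ehat_1 (Chat_1 g)) (etahat1 y)) f = gcwf_comp1 (Ehat_1 (Chat_1 g)) (gcwf_comp1 (etahat1 y) f)"
    "gcwf_comp1 (Ehat_1 (Chat_1 g)) (gcwf_comp1 (Ehat_1 (Chat_1 f)) (etahat1 x)) = gcwf_comp1 (Ehat_1 (Chat_1 (gcwf_comp1 g f))) (etahat1 x)"
proof -
  have x: "is_gcwf x" "is_gcwf y" "is_gcwf z" using f g by (simp_all add: hom1_GCwF)
  note E = Ehat_1_hom[OF Chat_1_hom[OF f]] Ehat_1_hom[OF Chat_1_hom[OF g]]
  show "gcwf_comp1 (etahat1 z) (gcwf_comp1 g f) = gcwf_comp1 (gcwf_comp1 (etahat1 z) g) f"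
    by (rule gcwf_comp1_assoc[OF f g etahat1_hom[OF x(3)], symmetric])
  show "gcwf_comp1 (gcwf_comp1 (Ehat_1 (Chat_1 g)) (etahat1 y)) f = gcwf_comp1 (Ehat_1 (Chat_1 g)) (gcwf_comp1 (etahat1 y) f)"
    by (rule gcwf_comp1_assoc[OF f etahat1_hom[OF x(2)] E(2)])
  have "Chat_1 (gcwf_comp1 g f) = wcmd_comp1 (Chat_1 g) (Chat_1 f)"
    using two_functor.F1_comp[OF two_functor_Chat f g] by simp
  then show "gcwf_comp1 (Ehat_1 (Chat_1 g)) (gcwf_comp1 (Ehat_1 (Chat_1 f)) (etahat1 x)) = gcwf_comp1 (Ehat_1 (Chat_1 (gcwf_comp1 g f))) (etahat1 x)"
    using gcwf_comp1_assoc[OF etahat1_hom[OF x(1)] E] by (simp add: Ehat_1_comp[OF Chat_1_hom[OF f] Chat_1_hom[OF g]])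
qed

lemma pseudonat_etahat: "pseudonat GCwF_iso GCwF_iso id_2fun (comp_2fun Ehat Chat) etahat"
proof -
  interpret C: two_functor GCwF_iso WCmd Chat by (rule two_functor_Chat)
  interpret I: two_functor GCwF_iso GCwF_iso id_2fun by (rule two_functor_id[OF two_category_GCwF_iso])
  interpret EC: two_functor GCwF_iso GCwF_iso "comp_2fun Ehat Chat" by (rule two_functor_comp[OF two_functor_Chat two_functor_Ehat])
  have s: "F0 (comp_2fun Ehat Chat) W = Ehat_0 (Chat_0 W)" "F1 (comp_2fun Ehat Chat) f = Ehat_1 (Chat_1 f)" "F2 (comp_2fun Ehat Chat) \<alpha> = Ehat_2 (Chat_2 \<alpha>)"
    for W f \<alpha> by (simp_all add: comp_2fun_def)
  show ?thesis
  proof (unfold_locales, goal_cases)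
    case (1 x) then show ?case by (simp add: s id_2fun_def etahat1_hom)
  next
    case (2 f x y) then show ?case by (simp add: s id_2fun_def etahat2_hom)
  next
    case (3 f) then show ?case using etahat2_invertible[of f "Src f" "Tgt f"] by (simp add: hom1_def)
  next
    case (4 f x y \<alpha> g)
    note a = hom2_GCwFD[OF 4(2,1)]
    have x [simp]: "is_gcwf x" "is_gcwf y" "Src f = x" "Tgt f = y" "Src g = x" "Tgt g = y" using 4(1) a(3) by (simp_all add: hom1_GCwF)
    note hx = etahat1_hom[OF x(1)] and hy = etahat1_hom[OF x(2)]
    note ix = gcwf_id2_hom[OF hx] and iy = gcwf_id2_hom[OF hy]
    note Ea = Ehat_2_hom[OF Chat_2_hom[OF 4(2,1)] Chat_1_hom[OF 4(1)]] and Ef = Ehat_1_hom[OF Chat_1_hom[OF 4(1)]]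
    note l1 = gcwf_hcomp_hom[OF 4(1) hy 4(2) iy] and r1 = gcwf_hcomp_hom[OF hx Ef ix Ea]
    note l = gcwf_vcomp_hom[OF l1 etahat2_hom[OF a(3)]] and r = gcwf_vcomp_hom[OF etahat2_hom[OF 4(1)] r1]
    interpret \<psi>: nat_trans "fB (gu x)" "fB (gu y)" "gmC f" "gmC g" "gmpsi \<alpha>" by (rule hom2_GCwF_nt[OF 4(2,1)])
    have "gcwf_vcomp (etahat2 g) (gcwf_hcomp (gcwf_id2 (etahat1 y)) \<alpha>) = gcwf_vcomp (gcwf_hcomp (Ehat_2 (Chat_2 \<alpha>)) (gcwf_id2 (etahat1 x))) (etahat2 f)"
    proof (rule gcwf_2cell_eqI[OF l r])
      show "gmpsi (gcwf_vcomp (etahat2 g) (gcwf_hcomp (gcwf_id2 (etahat1 y)) \<alpha>)) = gmpsi (gcwf_vcomp (gcwf_hcomp (Ehat_2 (Chat_2 \<alpha>)) (gcwf_id2 (etahat1 x))) (etahat2 f))"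
        by (rule nt_eqI[of _ "fB (gu x)"]) (simp_all add: a(1,2))
      show "gcwf_to_adj2 (gcwf_vcomp (etahat2 g) (gcwf_hcomp (gcwf_id2 (etahat1 y)) \<alpha>)) = gcwf_to_adj2 (gcwf_vcomp (gcwf_hcomp (Ehat_2 (Chat_2 \<alpha>)) (gcwf_id2 (etahat1 x))) (etahat2 f))"
        using EM_unit2_natural[OF gcwf_forget_hom1[OF 4(1)] a(6)]
        by (simp add: gcwf_vcomp_to_adj[OF l1 etahat_src_tgt(1)[OF 4(1)]] gcwf_vcomp_to_adj[OF etahat2_hom[OF 4(1)] etahat_src_tgt(1)[OF 4(1)]]
          gcwf_hcomp_to_adj[OF 4(2) iy 4(1) hy] gcwf_hcomp_to_adj[OF ix Ea hx Ef] etahat2_forget[OF 4(1)] etahat2_forget[OF a(3)]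
          gcwf_to_adj_ops etahat1_forget is_gcwf_Ehat_0 is_wcomonad_Chat_0)
    qed
    then show ?case by (simp add: s id_2fun_def)
  next
    case (5 x)
    then have x: "is_gcwf x" by simp
    note h = gcwf_id1_hom[OF x] and hx = etahat1_hom[OF x]
    have "gcwf_comp1 (etahat1 x) (gcwf_id1 x) = etahat1 x" by (rule gcwf_comp1_id1[OF hx])
    moreover have "gcwf_comp1 (Ehat_1 (Chat_1 (gcwf_id1 x))) (etahat1 x) = etahat1 x"
      using gcwf_comp1_id1(2)[OF hx] EC.F1_id[of x] x by (simp add: s)
    ultimately have hh: "etahat2 (gcwf_id1 x) \<in> hom2 GCwF_iso (etahat1 x) (etahat1 x)" using etahat2_hom[OF h] by simp
    have "etahat2 (gcwf_id1 x) = gcwf_id2 (etahat1 x)"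
      by (rule gcwf_2cell_eqI[OF hh gcwf_id2_hom[OF hx]])
        (simp_all add: x etahat2_forget[OF h] gcwf_to_adj_ops EM_unit2_id is_gcwfD etahat1_forget is_gcwf_Ehat_0 is_wcomonad_Chat_0)
    then show ?case by simp
  next
    case (6 f x y g z)
    have x [simp]: "is_gcwf x" "is_gcwf y" "is_gcwf z" "Src f = x" "Tgt f = y" "Src g = y" "Tgt g = z" using 6 by (simp_all add: hom1_GCwF)
    have bf: "is_functor (fB (gu x)) (fB (gu y)) (gmC f)" and bg: "is_functor (fB (gu y)) (fB (gu z)) (gmC g)"
      using 6 by (auto simp: hom1_GCwF is_fib_1cellD)
    interpret bf: is_functor "fB (gu x)" "fB (gu y)" "gmC f" by (rule bf)
    interpret bg: is_functor "fB (gu y)" "fB (gu z)" "gmC g" by (rule bg)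
    note gf = gcwf_comp1_hom[OF 6] and Eg = Ehat_1_hom[OF Chat_1_hom[OF 6(2)]]
    note as = GCwF_comp_assocs[OF 6]
    note r1 = gcwf_hcomp_hom[OF 6(1) etahat_src_tgt(1)[OF 6(2)] gcwf_id2_hom[OF 6(1)] etahat2_hom[OF 6(2)]]
    note r2 = gcwf_hcomp_hom[OF etahat_src_tgt(1)[OF 6(1)] Eg etahat2_hom[OF 6(1)] gcwf_id2_hom[OF Eg]]
    note r = gcwf_vcomp_hom[OF r1[unfolded as] r2, unfolded as, folded as(1)]
    note src = gcwf_comp1_hom[OF 6(1) etahat_src_tgt(1)[OF 6(2)]]
    have "etahat2 (gcwf_comp1 g f) = gcwf_vcomp (gcwf_hcomp (gcwf_id2 (Ehat_1 (Chat_1 g))) (etahat2 f)) (gcwf_hcomp (etahat2 g) (gcwf_id2 f))"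
    proof (rule gcwf_2cell_eqI[OF etahat2_hom[OF gf] r])
      show "gmpsi (etahat2 (gcwf_comp1 g f)) = gmpsi (gcwf_vcomp (gcwf_hcomp (gcwf_id2 (Ehat_1 (Chat_1 g))) (etahat2 f)) (gcwf_hcomp (etahat2 g) (gcwf_id2 f)))"
        by (rule nt_eqI[of _ "fB (gu x)"]) simp_all
      show "gcwf_to_adj2 (etahat2 (gcwf_comp1 g f)) = gcwf_to_adj2 (gcwf_vcomp (gcwf_hcomp (gcwf_id2 (Ehat_1 (Chat_1 g))) (etahat2 f)) (gcwf_hcomp (etahat2 g) (gcwf_id2 f)))"
        using EM_unit2_comp[OF gcwf_forget_hom1[OF 6(1)] gcwf_forget_hom1[OF 6(2)]]
        by (simp add: etahat2_forget[OF gf] gcwf_vcomp_to_adj[OF r1 src] gcwf_hcomp_to_adj[OF etahat2_hom[OF 6(1)] gcwf_id2_hom[OF Eg] etahat_src_tgt(1)[OF 6(1)] Eg]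
          gcwf_hcomp_to_adj[OF gcwf_id2_hom[OF 6(1)] etahat2_hom[OF 6(2)] 6(1) etahat_src_tgt(1)[OF 6(2)]] etahat2_forget[OF 6(1)] etahat2_forget[OF 6(2)]
          gcwf_to_adj_ops is_gcwf_Ehat_0 is_wcomonad_Chat_0)
    qed
    then show ?case by (simp add: s id_2fun_def)
  qed
qed

definition epshat :: "(('b, 'n, 'o, 'a) wcomonad, ('b, 'n, 'o, 'a) wcmd_1cell, ('b, 'n, 'o, 'a) wcmd_1cell, ('b, 'n, 'o, 'a) wcmd_2cell) pnat" where
  "epshat = \<lparr>pn1 = id1 WCmd, pn2 = id2 WCmd\<rparr>"

lemma Chat_etahat2:
  assumes f: "f \<in> hom1 GCwF_iso x y" shows "Chat_2 (etahat2 f) = wcmd_id2 (Chat_1 f)"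
proof -
  have x: "is_gcwf x" "is_gcwf y" "Src f = x" "Tgt f = y" using f by (simp_all add: hom1_GCwF)
  note Cf = Chat_1_hom[OF f]
  have w: "is_wcmd_1cell (Chat_1 f)" using Cf by (simp add: hom1_def)
  have "Chat_1 (gcwf_comp1 (etahat1 y) f) = Chat_1 f"
    using two_functor.F1_comp[OF two_functor_Chat f etahat1_hom[OF x(2)]] wcmd_comp1_id1(2)[OF Cf] by (simp add: Chat_etahat1 x)
  moreover have "Chat_1 (gcwf_comp1 (Ehat_1 (Chat_1 f)) (etahat1 x)) = Chat_1 f"
    using two_functor.F1_comp[OF two_functor_Chat etahat1_hom[OF x(1)] Ehat_1_hom[OF Cf]] wcmd_comp1_id1(1)[OF Cf]
    by (simp add: Chat_etahat1 x Chat_Ehat(2)[OF w])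
  ultimately show ?thesis by (intro wcmd_2cell.equality) (simp_all add: x)
qed

lemma etahat2_tight:
  assumes f: "f \<in> hom1 GCwF_iso x y" and t: "adj_tight (gcwf_to_adj1 f)"
  shows "etahat2 f = gcwf_id2 (gcwf_comp1 (etahat1 y) f)"
proof -
  have x: "is_gcwf x" "is_gcwf y" "Src f = x" "Tgt f = y" and u: "is_fib_1cell (gu x) (gu y) (gmC f) (gmH f)"
    using f by (simp_all add: hom1_GCwF)
  note b = comp_fct_id_left[OF is_fib_1cellD(3)[OF u]] comp_fct_id_right[OF is_fib_1cellD(3)[OF u]]
  have E: "EM_unit2 eo ea (gcwf_to_adj1 f) = adj_id2 (gcwf_to_adj1 (gcwf_comp1 (etahat1 y) f))"
    using EM_unit_cell.EM_unit2_tight[OF EM_unit_cellI[OF gcwf_forget_hom1[OF f]] t] by (simp add: gcwf_to_adj_ops x etahat1_forget)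
  \<comment> \<open>The base-level equation between 2-cells also identifies their targets; reading
    off \<open>Tgt\<close> gives the underlying equality of the two legs of the square.\<close>
  have "gcwf_to_adj1 (gcwf_comp1 (Ehat_1 (Chat_1 f)) (etahat1 x)) = gcwf_to_adj1 (gcwf_comp1 (etahat1 y) f)"
    using arg_cong[OF etahat2_forget[OF f], of Tgt] by (simp add: E x)
  then have "gcwf_comp1 (Ehat_1 (Chat_1 f)) (etahat1 x) = gcwf_comp1 (etahat1 y) f"
    by (intro gcwf_1cell_eqI[OF etahat_src_tgt(2,1)[OF f]]) (simp_all add: x b)
  then have h: "etahat2 f \<in> hom2 GCwF_iso (gcwf_comp1 (etahat1 y) f) (gcwf_comp1 (etahat1 y) f)"
    using etahat2_hom[OF f] by simp
  show ?thesis
    by (rule gcwf_2cell_eqI[OF h gcwf_id2_hom[OF etahat_src_tgt(1)[OF f]]])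
      (simp_all add: x b etahat2_forget[OF f] gcwf_to_adj_ops E is_gcwf_Ehat_0 is_wcomonad_Chat_0)
qed

lemma adj_tight_Ehat: assumes f: "is_wcmd_1cell f" shows "adj_tight (gcwf_to_adj1 (Ehat_1 f))"
proof -
  have c: "wcmd_to_cmd1 f \<in> hom1 Cmd (wK (Src f)) (wK (Tgt f))" using f by (simp add: hom1_def is_wcmd_1cell_def)
  interpret EM_arrow eo ea "wK (Src f)" "wK (Tgt f)" "wcmd_to_cmd1 f" by (rule EM_arrowI[OF c])
  show ?thesis by (simp add: adj_tight_EM_1)
qed

lemma etahat2_Ehat:
  assumes f: "f \<in> hom1 WCmd x y" shows "etahat2 (Ehat_1 f) = gcwf_id2 (Ehat_1 f)"
proof -
  have x: "is_wcomonad x" "is_wcomonad y" and w: "is_wcmd_1cell f" using f by (simp add: hom1_WCmd, simp add: hom1_WCmd, simp add: hom1_def)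
  show ?thesis
    using etahat2_tight[OF Ehat_1_hom[OF f] adj_tight_Ehat[OF w]] gcwf_comp1_id1(2)[OF Ehat_1_hom[OF f]]
    by (simp add: etahat1_Ehat x)
qed

lemma strict_biadjunction_hat: "strict_biadjunction GCwF_iso WCmd Chat Ehat etahat epshat"
proof -
  interpret C: two_functor GCwF_iso WCmd Chat by (rule two_functor_Chat)
  interpret E: two_functor WCmd GCwF_iso Ehat by (rule two_functor_Ehat)
  interpret u: pseudonat GCwF_iso GCwF_iso id_2fun "comp_2fun Ehat Chat" etahat by (rule pseudonat_etahat)
  show ?thesis
  proof (unfold_locales, goal_cases)
    case (5 f) then show ?case using Chat_etahat2[of f "Src f" "Tgt f"] by (simp add: hom1_def)
  next
    case (7 f) then show ?case using etahat2_Ehat[of f "Src f" "Tgt f"] by (simp add: hom1_def)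
  qed (simp_all add: Chat_Ehat Chat_etahat1 etahat1_Ehat epshat_def)
qed

end

section \<open>A quasi-inverse of the comparison functor from cartesian lifts\<close>

section \<open>The unit is an equivalence\<close>

text \<open>Lifts along \<open>p\<close> are added so that the induced comonad satisfies the
  assumptions of \<open>wcmd_core\<close>; its coalgebras then have cartesian structure maps and
  detect cartesian arrows on underlying arrows.\<close>

locale gcwf_inverse = coalg_codes eo ea + gcwf_core T B p q
  for eo :: "'o \<times> 'a \<Rightarrow> 'd" and ea :: "'d \<times> 'a \<times> 'd \<Rightarrow> 'e" and T :: "('o, 'a, 'd, 'e) adj" and B :: "('b, 'n) cat" and p q +
  assumes p_lift: "\<lbrakk>A \<in> Ob (adC T); s \<in> Ar B; Cod B s = onO p A\<rbrakk> \<Longrightarrow> \<exists>f. p.crt f \<and> Cod (adC T) f = A \<and> onA p f = s"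
begin

sublocale N: EM_unit_loc eo ea T by unfold_locales

sublocale Y: wcmd_core eo ea "adj_comonad T" B p
  rewrites "cmC (adj_comonad T) = adC T" and "cmeps (adj_comonad T) = adeps T"
proof -
  have "coalg_cat eo ea (adj_comonad T)" by (rule coalg_catI[OF N.comonad_T])
  moreover have "over (cmC (adj_comonad T)) B p" by (simp add: p.over_axioms)
  moreover have "wcmd_core_axioms (adj_comonad T) B p"
    by unfold_locales (use eps_cart pullback p_lift in simp_all)
  ultimately show "wcmd_core eo ea (adj_comonad T) B p" by (rule wcmd_core.intro)
qed simp_all

abbreviation DT where "DT \<equiv> EMc (adj_comonad T)"

text \<open>The lift makes sense because \<open>p (st x)\<close> ends at \<open>p L R A\<close>,
  which is \<open>q R A\<close>, for \<open>A\<close> the carrier of \<open>x\<close>. It is chosen,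
  as the locale knows only that lifts exist.\<close>

definition cc where
  "cc x = (SOME c. q.crt c \<and> Cod (adD T) c = onO (adR T) (cr x) \<and> onA q c = onA p (st x))"

lemma cc:
  assumes "x \<in> Ob DT"
  shows "q.crt (cc x)" "Cod (adD T) (cc x) = onO (adR T) (cr x)" "onA q (cc x) = onA p (st x)"
proof -
  have "\<exists>c. q.crt c \<and> Cod (adD T) c = onO (adR T) (cr x) \<and> onA q c = onA p (st x)"
    by (rule q_lift) (use assms in simp_all)
  from someI_ex[OF this]
  show "q.crt (cc x)" "Cod (adD T) (cc x) = onO (adR T) (cr x)" "onA q (cc x) = onA p (st x)"
    by (simp_all add: cc_def)
qed

lemma cc_Ar [simp]: "x \<in> Ob DT \<Longrightarrow> cc x \<in> Ar (adD T)"
  using cc(1) by simp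

declare cc(2,3) [simp]

lemma q_Dom_cc [simp]:
  assumes [simp]: "x \<in> Ob DT"
  shows "onO q (Dom (adD T) (cc x)) = onO p (cr x)"
proof -
  have "onO q (Dom (adD T) (cc x)) = Dom B (onA q (cc x))" by (simp del: cc(3))
  also have "\<dots> = onO p (cr x)" by simp
  finally show ?thesis .
qed

definition zt where
  "zt x = (SOME h. iso (adC T) h \<and> Dom (adC T) h = onO (adL T) (Dom (adD T) (cc x)) \<and> Cod (adC T) h = cr x \<and>
    st x \<cdot>\<^bsub>adC T\<^esub> h = onA (adL T) (cc x) \<and> onA p h = Ident B (onO p (cr x)))"

lemma zt:
  assumes x [simp]: "x \<in> Ob DT"
  shows zt_iso [simp]: "iso (adC T) (zt x)" and Dom_zt [simp]: "Dom (adC T) (zt x) = onO (adL T) (Dom (adD T) (cc x))"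
    and Cod_zt [simp]: "Cod (adC T) (zt x) = cr x" and st_zt: "st x \<cdot>\<^bsub>adC T\<^esub> zt x = onA (adL T) (cc x)"
    and p_zt [simp]: "onA p (zt x) = Ident B (onO p (cr x))"
proof -
  obtain h where "iso (adC T) h" "Dom (adC T) h = Dom (adC T) (onA (adL T) (cc x))" "Cod (adC T) h = Dom (adC T) (st x)"
    "st x \<cdot>\<^bsub>adC T\<^esub> h = onA (adL T) (cc x)" "onA p h = Ident B (onO p (Dom (adC T) (onA (adL T) (cc x))))"
    by (rule p.cart_comparison[OF L_cart[OF cc(1)[OF x]] Y.st_cart[OF x]]) simp_all
  then have "iso (adC T) h \<and> Dom (adC T) h = onO (adL T) (Dom (adD T) (cc x)) \<and> Cod (adC T) h = cr x \<and>
    st x \<cdot>\<^bsub>adC T\<^esub> h = onA (adL T) (cc x) \<and> onA p h = Ident B (onO p (cr x))" by simp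
  from someI[of "\<lambda>h. iso (adC T) h \<and> Dom (adC T) h = onO (adL T) (Dom (adD T) (cc x)) \<and> Cod (adC T) h = cr x \<and>
    st x \<cdot>\<^bsub>adC T\<^esub> h = onA (adL T) (cc x) \<and> onA p h = Ident B (onO p (cr x))", OF this]
  show "iso (adC T) (zt x)" "Dom (adC T) (zt x) = onO (adL T) (Dom (adD T) (cc x))" "Cod (adC T) (zt x) = cr x"
    "st x \<cdot>\<^bsub>adC T\<^esub> zt x = onA (adL T) (cc x)" "onA p (zt x) = Ident B (onO p (cr x))"
    by (simp_all add: zt_def)
qed

lemma zt_Ar [simp]: "x \<in> Ob DT \<Longrightarrow> zt x \<in> Ar (adC T)"
  by (rule L.D.iso_Ar) simp

text \<open>\<open>cc x\<close> is the transpose of \<open>zt x\<close>: since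
  \<open>L (cc x)\<close> is \<open>st x \<cdot> zt x\<close> and \<open>st x\<close> is a section
  of \<open>\<epsilon>\<close>, composing with \<open>\<epsilon>\<close> returns
  \<open>zt x\<close>.\<close>

lemma R_zt:
  assumes [simp]: "x \<in> Ob DT"
  shows "onA (adR T) (zt x) \<cdot>\<^bsub>adD T\<^esub> adeta T (Dom (adD T) (cc x)) = cc x"
proof (rule transpose_cancel[of _ _ "cr x"])
  have "adeps T (cr x) \<cdot>\<^bsub>adC T\<^esub> st x \<cdot>\<^bsub>adC T\<^esub> zt x = zt x"
    using reassoc[OF N.Q.obD(6), of x "zt x"] by simp
  then show "adeps T (cr x) \<cdot>\<^bsub>adC T\<^esub> onA (adL T) (onA (adR T) (zt x) \<cdot>\<^bsub>adD T\<^esub> adeta T (Dom (adD T) (cc x))) =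
    adeps T (cr x) \<cdot>\<^bsub>adC T\<^esub> onA (adL T) (cc x)"
    using eps_transpose[of "Dom (adD T) (cc x)" "zt x" "cr x"] by (simp add: st_zt)
qed simp_all

text \<open>For \<open>u : x \<rightarrow> y\<close>, the factorisation of
  \<open>R (ar u) \<cdot> cc x\<close> through the cartesian \<open>cc y\<close> over
  \<open>p (ar u)\<close>. It is unique, which gives the functor laws despite the use of
  choice.\<close>

definition Ga where
  "Ga u = (SOME g. g \<in> Ar (adD T) \<and> Dom (adD T) g = Dom (adD T) (cc (Dom DT u)) \<and> Cod (adD T) g = Dom (adD T) (cc (Cod DT u)) \<and>
    onA q g = onA p (ar u) \<and> cc (Cod DT u) \<cdot>\<^bsub>adD T\<^esub> g = onA (adR T) (ar u) \<cdot>\<^bsub>adD T\<^esub> cc (Dom DT u))"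

lemma Ga:
  assumes u [simp]: "u \<in> Ar DT"
  shows Ga_Ar [simp]: "Ga u \<in> Ar (adD T)" and Dom_Ga [simp]: "Dom (adD T) (Ga u) = Dom (adD T) (cc (Dom DT u))"
    and Cod_Ga [simp]: "Cod (adD T) (Ga u) = Dom (adD T) (cc (Cod DT u))" and q_Ga [simp]: "onA q (Ga u) = onA p (ar u)"
    and cc_Ga: "cc (Cod DT u) \<cdot>\<^bsub>adD T\<^esub> Ga u = onA (adR T) (ar u) \<cdot>\<^bsub>adD T\<^esub> cc (Dom DT u)"
proof -
  have e: "onA p (st (Cod DT u)) \<cdot>\<^bsub>B\<^esub> onA p (ar u) = onA q (onA (adR T) (ar u)) \<cdot>\<^bsub>B\<^esub> onA p (st (Dom DT u))"
    using arg_cong[OF N.Q.ar_coalg[OF u], of "onA p"] by simp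
  obtain g where "g \<in> Ar (adD T)" "Dom (adD T) g = Dom (adD T) (onA (adR T) (ar u) \<cdot>\<^bsub>adD T\<^esub> cc (Dom DT u))"
    "Cod (adD T) g = Dom (adD T) (cc (Cod DT u))" "onA q g = onA p (ar u)"
    "cc (Cod DT u) \<cdot>\<^bsub>adD T\<^esub> g = onA (adR T) (ar u) \<cdot>\<^bsub>adD T\<^esub> cc (Dom DT u)"
    by (rule q.cart_factor[OF cc(1)[of "Cod DT u"], of "onA (adR T) (ar u) \<cdot>\<^bsub>adD T\<^esub> cc (Dom DT u)" "onA p (ar u)"]) (simp_all add: e)
  then have "g \<in> Ar (adD T) \<and> Dom (adD T) g = Dom (adD T) (cc (Dom DT u)) \<and> Cod (adD T) g = Dom (adD T) (cc (Cod DT u)) \<and>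
    onA q g = onA p (ar u) \<and> cc (Cod DT u) \<cdot>\<^bsub>adD T\<^esub> g = onA (adR T) (ar u) \<cdot>\<^bsub>adD T\<^esub> cc (Dom DT u)" by simp
  from someI[of "\<lambda>g. g \<in> Ar (adD T) \<and> Dom (adD T) g = Dom (adD T) (cc (Dom DT u)) \<and> Cod (adD T) g = Dom (adD T) (cc (Cod DT u)) \<and>
    onA q g = onA p (ar u) \<and> cc (Cod DT u) \<cdot>\<^bsub>adD T\<^esub> g = onA (adR T) (ar u) \<cdot>\<^bsub>adD T\<^esub> cc (Dom DT u)", OF this]
  show "Ga u \<in> Ar (adD T)" "Dom (adD T) (Ga u) = Dom (adD T) (cc (Dom DT u))" "Cod (adD T) (Ga u) = Dom (adD T) (cc (Cod DT u))"
    "onA q (Ga u) = onA p (ar u)" "cc (Cod DT u) \<cdot>\<^bsub>adD T\<^esub> Ga u = onA (adR T) (ar u) \<cdot>\<^bsub>adD T\<^esub> cc (Dom DT u)"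
    by (simp_all add: Ga_def)
qed

definition GG where "GG = \<lparr>onO = \<lambda>x \<in> Ob DT. Dom (adD T) (cc x), onA = \<lambda>u \<in> Ar DT. Ga u\<rparr>"

lemma GG_simps [simp]: "x \<in> Ob DT \<Longrightarrow> onO GG x = Dom (adD T) (cc x)" "u \<in> Ar DT \<Longrightarrow> onA GG u = Ga u"
  by (simp_all add: GG_def)

sublocale GG: is_functor DT "adD T" GG
proof (rule is_functorI)
  show "onO GG \<in> extensional (Ob DT)" "onA GG \<in> extensional (Ar DT)" by (simp_all add: GG_def)
next
  fix x assume [simp]: "x \<in> Ob DT"
  show "onA GG (Ident DT x) = Ident (adD T) (onO GG x)"
  proof -
    have "cc x \<cdot>\<^bsub>adD T\<^esub> Ga (Ident DT x) = cc x \<cdot>\<^bsub>adD T\<^esub> Ident (adD T) (Dom (adD T) (cc x))"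
      using cc_Ga[of "Ident DT x"] by simp
    then have "Ga (Ident DT x) = Ident (adD T) (Dom (adD T) (cc x))"
      by - (rule q.cart_cancel[OF cc(1)[of x]]; simp)
    then show ?thesis by simp
  qed
next
  fix u v assume [simp]: "u \<in> Ar DT" "v \<in> Ar DT" "Cod DT u = Dom DT v"
  have "Ga (v \<cdot>\<^bsub>DT\<^esub> u) = Ga v \<cdot>\<^bsub>adD T\<^esub> Ga u"
  proof (rule q.cart_cancel[OF cc(1)[of "Cod DT v"]])
    show "cc (Cod DT v) \<cdot>\<^bsub>adD T\<^esub> Ga (v \<cdot>\<^bsub>DT\<^esub> u) = cc (Cod DT v) \<cdot>\<^bsub>adD T\<^esub> Ga v \<cdot>\<^bsub>adD T\<^esub> Ga u"
      using cc_Ga[of "v \<cdot>\<^bsub>DT\<^esub> u"] cc_Ga[of u] by (simp add: reassoc[OF cc_Ga])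
  qed simp_all
  then show "onA GG (v \<cdot>\<^bsub>DT\<^esub> u) = onA GG v \<cdot>\<^bsub>adD T\<^esub> onA GG u" by simp
qed simp_all

text \<open>Tested after the cartesian \<open>st\<close>, where it becomes \<open>L\<close> of the
  defining equation of \<open>Ga\<close> combined with the morphism equation of
  \<open>u\<close>.\<close>

lemma zt_natural:
  assumes u [simp]: "u \<in> Ar DT"
  shows "zt (Cod DT u) \<cdot>\<^bsub>adC T\<^esub> onA (adL T) (Ga u) = ar u \<cdot>\<^bsub>adC T\<^esub> zt (Dom DT u)"
proof (rule p.cart_cancel[OF Y.st_cart[of "Cod DT u"]])
  have 1: "onA (adL T) (cc (Cod DT u)) \<cdot>\<^bsub>adC T\<^esub> onA (adL T) (Ga u) = onA (adL T) (onA (adR T) (ar u)) \<cdot>\<^bsub>adC T\<^esub> onA (adL T) (cc (Dom DT u))"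
    using cc_Ga[of u] by (simp flip: L.onA_comp)
  have 2: "st (Cod DT u) \<cdot>\<^bsub>adC T\<^esub> ar u = onA (adL T) (onA (adR T) (ar u)) \<cdot>\<^bsub>adC T\<^esub> st (Dom DT u)"
    using N.Q.ar_coalg[OF u] by simp
  show "st (Cod DT u) \<cdot>\<^bsub>adC T\<^esub> zt (Cod DT u) \<cdot>\<^bsub>adC T\<^esub> onA (adL T) (Ga u) = st (Cod DT u) \<cdot>\<^bsub>adC T\<^esub> ar u \<cdot>\<^bsub>adC T\<^esub> zt (Dom DT u)"
    by (simp add: reassoc[OF st_zt] 1 reassoc[OF 2] st_zt)
qed simp_all

text \<open>\<open>\<eta> A\<close> and \<open>cc\<close> at the comparison coalgebra of
  \<open>A\<close> are cartesian with common codomain \<open>R L A\<close> and common base image,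
  because the structure of that coalgebra is \<open>L \<eta>\<close>. Their comparison is a
  component of the isomorphism from the identity to \<open>GG\<close> after the comparison
  functor.\<close>

definition ia where
  "ia A = (SOME h. iso (adD T) h \<and> Dom (adD T) h = A \<and> Cod (adD T) h = Dom (adD T) (cc (onO N.KT A)) \<and>
    cc (onO N.KT A) \<cdot>\<^bsub>adD T\<^esub> h = adeta T A \<and> onA q h = Ident B (onO q A))"

lemma ia:
  assumes A [simp]: "A \<in> Ob (adD T)"
  shows ia_iso [simp]: "iso (adD T) (ia A)" and Dom_ia [simp]: "Dom (adD T) (ia A) = A"
    and Cod_ia [simp]: "Cod (adD T) (ia A) = Dom (adD T) (cc (onO N.KT A))"
    and cc_ia: "cc (onO N.KT A) \<cdot>\<^bsub>adD T\<^esub> ia A = adeta T A" and q_ia [simp]: "onA q (ia A) = Ident B (onO q A)"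
proof -
  obtain h where "iso (adD T) h" "Dom (adD T) h = Dom (adD T) (adeta T A)" "Cod (adD T) h = Dom (adD T) (cc (onO N.KT A))"
    "cc (onO N.KT A) \<cdot>\<^bsub>adD T\<^esub> h = adeta T A" "onA q h = Ident B (onO q (Dom (adD T) (adeta T A)))"
    by (rule q.cart_comparison[OF eta_cart[OF A] cc(1)[of "onO N.KT A"]]) simp_all
  then have "iso (adD T) h \<and> Dom (adD T) h = A \<and> Cod (adD T) h = Dom (adD T) (cc (onO N.KT A)) \<and>
    cc (onO N.KT A) \<cdot>\<^bsub>adD T\<^esub> h = adeta T A \<and> onA q h = Ident B (onO q A)" by simp
  from someI[of "\<lambda>h. iso (adD T) h \<and> Dom (adD T) h = A \<and> Cod (adD T) h = Dom (adD T) (cc (onO N.KT A)) \<and>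
    cc (onO N.KT A) \<cdot>\<^bsub>adD T\<^esub> h = adeta T A \<and> onA q h = Ident B (onO q A)", OF this]
  show "iso (adD T) (ia A)" "Dom (adD T) (ia A) = A" "Cod (adD T) (ia A) = Dom (adD T) (cc (onO N.KT A))"
    "cc (onO N.KT A) \<cdot>\<^bsub>adD T\<^esub> ia A = adeta T A" "onA q (ia A) = Ident B (onO q A)"
    by (simp_all add: ia_def)
qed

lemma ia_Ar [simp]: "A \<in> Ob (adD T) \<Longrightarrow> ia A \<in> Ar (adD T)"
  by (rule L.C.iso_Ar) simp

lemma ia_natural:
  assumes f [simp]: "f \<in> Ar (adD T)"
  shows "ia (Cod (adD T) f) \<cdot>\<^bsub>adD T\<^esub> f = Ga (onA N.KT f) \<cdot>\<^bsub>adD T\<^esub> ia (Dom (adD T) f)"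
proof (rule q.cart_cancel[OF cc(1)[of "onO N.KT (Cod (adD T) f)"]])
  show "cc (onO N.KT (Cod (adD T) f)) \<cdot>\<^bsub>adD T\<^esub> ia (Cod (adD T) f) \<cdot>\<^bsub>adD T\<^esub> f =
    cc (onO N.KT (Cod (adD T) f)) \<cdot>\<^bsub>adD T\<^esub> Ga (onA N.KT f) \<cdot>\<^bsub>adD T\<^esub> ia (Dom (adD T) f)"
    using reassoc[OF cc_Ga, of "onA N.KT f" "ia (Dom (adD T) f)"] by (simp add: reassoc[OF cc_ia] cc_ia eta_natural)
qed simp_all

text \<open>The compatibility with \<open>\<zeta>\<close> that makes \<open>ia\<close>, paired with
  an identity transformation, a 2-cell of \<open>LAdj_iso\<close>.\<close>

lemma zt_ia:
  assumes A [simp]: "A \<in> Ob (adD T)"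
  shows "zt (onO N.KT A) \<cdot>\<^bsub>adC T\<^esub> onA (adL T) (ia A) = Ident (adC T) (onO (adL T) A)"
proof (rule p.cart_cancel[OF Y.st_cart[of "onO N.KT A"]])
  have "onA (adL T) (cc (onO N.KT A)) \<cdot>\<^bsub>adC T\<^esub> onA (adL T) (ia A) = onA (adL T) (adeta T A)"
    by (simp add: cc_ia flip: L.onA_comp)
  then show "st (onO N.KT A) \<cdot>\<^bsub>adC T\<^esub> zt (onO N.KT A) \<cdot>\<^bsub>adC T\<^esub> onA (adL T) (ia A) = st (onO N.KT A) \<cdot>\<^bsub>adC T\<^esub> Ident (adC T) (onO (adL T) A)"
    using reassoc[OF st_zt, of "onO N.KT A" "onA (adL T) (ia A)"] by simp
qed simp_all

definition zz where "zz = (\<lambda>x \<in> Ob DT. zt x)"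

lemma zz_simps [simp]: "x \<in> Ob DT \<Longrightarrow> zz x = zt x"
  by (simp add: zz_def)

sublocale inv: adj_arrow "EM_adj eo ea (adj_comonad T)" T "id_fct (adC T)" GG zz
proof -
  have a: "adjunction (EM_adj eo ea (adj_comonad T))" by (rule coalg_cat.adjunction_EM) (rule coalg_catI[OF N.comonad_T])
  have "nat_trans DT (adC T) (comp_fct DT (adL T) GG) (comp_fct DT (id_fct (adC T)) (EM_U eo ea (adj_comonad T))) zz"
    by (rule nat_transI[OF is_functor_comp[OF GG.is_functor_axioms L.is_functor_axioms]
         is_functor_comp[OF N.Q.EM_U_functor is_functor_id[OF L.D.category_axioms]]])
      (simp_all add: zt_natural, simp add: zz_def)
  then show "adj_arrow (EM_adj eo ea (adj_comonad T)) T (id_fct (adC T)) GG zz"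
    by (simp add: adj_arrow_def adj_arrow_axioms_def a adjunction_axioms is_functor_id)
qed

text \<open>At a cofree coalgebra, \<open>cc\<close> and \<open>\<eta> (R X)\<close> are cartesian
  over the same arrow, so \<open>cc\<close> is an isomorphism \<open>h\<close> followed by
  \<open>\<eta> (R X)\<close>; the mate is \<open>R \<epsilon>\<close> after \<open>cc\<close>,
  which is \<open>h\<close> by a triangle identity. The quasi-inverse is thus pseudo, as needed to
  restrict the biequivalence.\<close>

lemma inv_mate_iso:
  assumes X [simp]: "X \<in> Ob (adC T)" shows "iso (adD T) (inv.mt X)"
proof -
  let ?x = "onO (EM_R eo ea (adj_comonad T)) X"
  have x [simp]: "?x \<in> Ob DT" by simp
  obtain h where h: "iso (adD T) h" "Dom (adD T) h = Dom (adD T) (cc ?x)" "Cod (adD T) h = Dom (adD T) (adeta T (onO (adR T) X))"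
    "adeta T (onO (adR T) X) \<cdot>\<^bsub>adD T\<^esub> h = cc ?x"
    by (rule q.cart_comparison[OF cc(1)[OF x] eta_cart[of "onO (adR T) X"]]) simp_all
  have h' [simp]: "h \<in> Ar (adD T)" using h(1) by (rule L.C.iso_Ar)
  have "inv.mt X = onA (adR T) (adeps T X) \<cdot>\<^bsub>adD T\<^esub> cc ?x"
    using R_zt[of ?x] by (simp add: adj_mate_def)
  also have "\<dots> = h"
    using reassoc[OF triangle_R, of X h] h by simp
  finally show ?thesis using h(1) by simp
qed

text \<open>\<open>R\<close> preserves cartesian arrows, so the composite of \<open>Ga u\<close>
  with \<open>cc\<close>, equal to \<open>R (ar u)\<close> after \<open>cc\<close>, is cartesian;
  the cartesian \<open>cc\<close> on the left cancels.\<close>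

lemma GG_cart:
  assumes u: "u \<in> Ar DT" and c: "p.crt (ar u)" shows "q.crt (Ga u)"
proof (rule q.cart_left_cancel[OF cc(1)[of "Cod DT u"]])
  show "q.crt (cc (Cod DT u) \<cdot>\<^bsub>adD T\<^esub> Ga u)"
    unfolding cc_Ga[OF u] using u by (intro q.cart_Comp[OF cc(1) R_cart[OF c]]) simp_all
qed (use u in simp_all)

end

lemma (in coalg_codes) gcwf_inverseI:
  assumes W: "is_gcwf W" shows "gcwf_inverse eo ea (gadj W) (fB (gu W)) (fp (gu W)) (fp (gud W))"
proof (intro gcwf_inverse.intro gcwf_inverse_axioms.intro coalg_codes_axioms gcwf_coreI[OF W])
  note e = is_gcwfD(4-6)[OF W]
  fix A s assume A: "A \<in> Ob (adC (gadj W))" "s \<in> Ar (fB (gu W))" "Cod (fB (gu W)) s = onO (fp (gu W)) A"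
  show "\<exists>f. cart (adC (gadj W)) (fB (gu W)) (fp (gu W)) f \<and> Cod (adC (gadj W)) f = A \<and> onA (fp (gu W)) f = s"
    unfolding e by (intro exI conjI) (rule fibration_lift[OF is_gcwfD(1)[OF W]]; use A e in simp)+
qed

context gcwf_inverse
begin

definition ial where "ial = (\<lambda>A \<in> Ob (adD T). ia A)"

text \<open>\<open>zt x\<close> read as a coalgebra morphism from the comparison functor at
  \<open>GG x\<close> back to \<open>x\<close>.\<close>

definition ibe where "ibe = (\<lambda>x \<in> Ob DT. ea (onO N.KT (Dom (adD T) (cc x)), zt x, x))"

lemma ial_nat: "nat_trans (adD T) (adD T) (id_fct (adD T)) (comp_fct (adD T) GG N.KT) ial"
  by (rule nat_transI[OF is_functor_id[OF L.C.category_axioms] is_functor_comp[OF N.KT.is_functor_axioms GG.is_functor_axioms]])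
    (simp_all add: ial_def ia_natural)

text \<open>The morphism equation is \<open>L\<close> applied to \<open>R_zt\<close>, rewritten by
  \<open>st_zt\<close>.\<close>

lemma ibe:
  assumes x [simp]: "x \<in> Ob DT"
  shows ibe_Ar [simp]: "ibe x \<in> Ar DT" and Dom_ibe [simp]: "Dom DT (ibe x) = onO N.KT (Dom (adD T) (cc x))"
    and Cod_ibe [simp]: "Cod DT (ibe x) = x" and ar_ibe [simp]: "ar (ibe x) = zt x"
proof -
  have "onA (adL T) (onA (adR T) (zt x)) \<cdot>\<^bsub>adC T\<^esub> onA (adL T) (adeta T (Dom (adD T) (cc x))) = st x \<cdot>\<^bsub>adC T\<^esub> zt x"
    using arg_cong[OF R_zt[OF x], of "onA (adL T)"] by (simp add: st_zt)
  then have a: "ea (onO N.KT (Dom (adD T) (cc x)), zt x, x) \<in> Ar DT" by simp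
  show "ibe x \<in> Ar DT" "Dom DT (ibe x) = onO N.KT (Dom (adD T) (cc x))" "Cod DT (ibe x) = x" "ar (ibe x) = zt x"
    using a N.Q.coalg_Dom[OF a] N.Q.coalg_Cod[OF a] by (simp_all add: ibe_def del: N.Q.coalg_Ar)
qed

lemma ibe_nat: "nat_trans DT DT (comp_fct DT N.KT GG) (id_fct DT) ibe"
proof (rule nat_transI[OF is_functor_comp[OF GG.is_functor_axioms N.KT.is_functor_axioms] is_functor_id[OF N.Q.category_CoAlg]])
  fix u assume [simp]: "u \<in> Ar DT"
  show "ibe (Cod DT u) \<cdot>\<^bsub>DT\<^esub> onA (comp_fct DT N.KT GG) u = onA (id_fct DT) u \<cdot>\<^bsub>DT\<^esub> ibe (Dom DT u)"
    by (rule N.Q.coalg_ar_eqI) (simp_all add: zt_natural)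
qed (simp_all, simp add: ibe_def)

lemma ibe_iso: "x \<in> Ob DT \<Longrightarrow> iso DT (ibe x)"
  by (rule N.Q.coalg_iso) simp_all

end

text \<open>The data are exposed, instead of the bare statement that the unit is an equivalence, so
  that the same quasi-inverse, with its invertible mate, can be reused among pseudo
  morphisms.\<close>

lemma (in coalg_codes) etahat1_equivalence:
  assumes W: "is_gcwf W"
  obtains g \<alpha> \<beta> where "g \<in> hom1 GCwF_iso (Ehat_0 (Chat_0 W)) W" "adj_pseudo (gcwf_to_adj1 g)"
    "\<alpha> \<in> hom2 GCwF_iso (gcwf_id1 W) (gcwf_comp1 g (etahat1 W))" "invertible2 GCwF_iso \<alpha>"
    "\<beta> \<in> hom2 GCwF_iso (gcwf_comp1 (etahat1 W) g) (gcwf_id1 (Ehat_0 (Chat_0 W)))" "invertible2 GCwF_iso \<beta>"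
proof -
  interpret gcwf_inverse eo ea "gadj W" "fB (gu W)" "fp (gu W)" "fp (gud W)" by (rule gcwf_inverseI[OF W])
  let ?T = "gadj W" and ?E = "Ehat_0 (Chat_0 W)" and ?h = "etahat1 W"
  note C = is_wcomonad_Chat_0[OF W] and e = is_gcwfD(4-6)[OF W]
  note E = is_gcwf_Ehat_0[OF C] and h = etahat1_hom[OF W]
  define g where "g = \<lparr>Src = ?E, Tgt = W, gmC = id_fct (fB (gu W)), gmH = id_fct (fE (gu W)), gmHd = GG, gmz = zz\<rparr>"
  have gs [simp]: "Src g = ?E" "Tgt g = W" "gmC g = id_fct (fB (gu W))" "gmH g = id_fct (fE (gu W))" "gmHd g = GG" "gmz g = zz"
    by (simp_all add: g_def)
  have "comp_fct DT (fp (gud W)) GG = comp_fct DT (id_fct (fB (gu W))) Y.q"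
    unfolding comp_fct_id_left[OF Y.q.is_functor_axioms]
    by (rule fctr_eqI[OF is_functor_comp[OF GG.is_functor_axioms q.is_functor_axioms] Y.q.is_functor_axioms]) simp_all
  moreover have "cartesian (gud W) (onA GG u)" if "cartesian (coalg_fib (Chat_0 W)) u" for u
  proof -
    have u: "Y.q.crt u" using that by (simp add: cartesian_iff)
    then have [simp]: "u \<in> Ar DT" by simp
    show ?thesis using GG_cart[of u] u by (simp add: Y.coalg_cart_iff cartesian_iff e)
  qed
  ultimately have gud: "is_fib_1cell (coalg_fib (Chat_0 W)) (gud W) (id_fct (fB (gu W))) GG"
    using GG.is_functor_axioms is_gcwfD[OF W]
    by (simp add: is_fib_1cell_def is_fibration_coalg_fib C e is_functor_id)
  have ga: "gcwf_to_adj1 g \<in> hom1 LAdj_iso (EM_adj eo ea (adj_comonad ?T)) ?T"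
    using inv.adj_arrow_axioms by (simp add: hom1_LAdj e(1) flip: e(2,3))
  have "vertical (gu W) (zz x)" if "x \<in> Ob DT" for x
    using that by (simp add: vertical_def e(1) flip: e(2,3))
  then have g: "g \<in> hom1 GCwF_iso ?E W"
    using gud ga is_fib_1cell_id[OF is_gcwfD(1)[OF W]] by (simp add: hom1_GCwF W E e(1) flip: e(2,3))
  have gp: "adj_pseudo (gcwf_to_adj1 g)"
    using inv_mate_iso by (simp add: adj_pseudo_def mate_eq e(1) flip: e(2,3))
  have idB: "comp_fct (fB (gu W)) (id_fct (fB (gu W))) (id_fct (fB (gu W))) = id_fct (fB (gu W))"
    by (rule comp_fct_id_left[OF is_functor_id[OF p.D.category_axioms]])
  have idC: "comp_fct (adC ?T) (id_fct (adC ?T)) (id_fct (adC ?T)) = id_fct (adC ?T)"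
    by (rule comp_fct_id_left[OF is_functor_id[OF L.D.category_axioms]])
  note gh = gcwf_comp1_hom[OF h g] and hg = gcwf_comp1_hom[OF g h]
  note i1 = gcwf_id1_hom[OF W] and i2 = gcwf_id1_hom[OF E]
  \<comment> \<open>The functors on the base and on the total category of \<open>u\<close> are
    identities on both sides, so only the component on the total category of \<open>u\<close>-dot
    carries information.\<close>
  define \<alpha> where "\<alpha> = \<lparr>Src = gcwf_id1 W, Tgt = gcwf_comp1 g ?h, gmpsi = id_nt (fB (gu W)) (fB (gu W)) (id_fct (fB (gu W))),
    gmphi = id_nt (fE (gu W)) (fE (gu W)) (id_fct (fE (gu W))), gmphid = ial\<rparr>"
  have as [simp]: "Src \<alpha> = gcwf_id1 W" "Tgt \<alpha> = gcwf_comp1 g ?h" "gmpsi \<alpha> = id_nt (fB (gu W)) (fB (gu W)) (id_fct (fB (gu W)))"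
    "gmphi \<alpha> = id_nt (fE (gu W)) (fE (gu W)) (id_fct (fE (gu W)))" "gmphid \<alpha> = ial" by (simp_all add: \<alpha>_def)
  have a: "\<alpha> \<in> hom2 GCwF_iso (gcwf_id1 W) (gcwf_comp1 g ?h)"
  proof (rule hom2_GCwFI[OF i1 gh])
    show "is_fib_2cell (gu W) (gu W) (gmC (gcwf_id1 W)) (gmH (gcwf_id1 W)) (gmC (gcwf_comp1 g ?h)) (gmH (gcwf_comp1 g ?h)) (gmpsi \<alpha>) (gmphi \<alpha>)"
      using is_fib_2cell_id[OF is_fib_1cell_id[OF is_gcwfD(1)[OF W]]] idC by (simp add: idB e)
    show "is_fib_2cell (gud W) (gud W) (gmC (gcwf_id1 W)) (gmHd (gcwf_id1 W)) (gmC (gcwf_comp1 g ?h)) (gmHd (gcwf_comp1 g ?h)) (gmpsi \<alpha>) (gmphid \<alpha>)"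
    proof -
      have "is_fib_1cell (gud W) (gud W) (gmC (gcwf_id1 W)) (gmHd (gcwf_id1 W))"
        "is_fib_1cell (gud W) (gud W) (gmC (gcwf_comp1 g ?h)) (gmHd (gcwf_comp1 g ?h))"
        using i1 gh unfolding hom1_GCwF by blast+
      then show ?thesis
        using ial_nat nat_trans_id[OF is_functor_id[OF p.D.category_axioms]]
        by (simp add: is_fib_2cell_def idB e(1) flip: e(2,3)) (simp add: ial_def)
    qed
    show "gcwf_to_adj2 \<alpha> \<in> hom2 LAdj_iso (gcwf_to_adj1 (gcwf_id1 W)) (gcwf_to_adj1 (gcwf_comp1 g ?h))"
    proof -
      have 1: "adj_arrow ?T ?T (id_fct (adC ?T)) (id_fct (adD ?T)) (gmz (gcwf_id1 W))"
        using gcwf_forget_hom1[OF i1] by (simp add: hom1_LAdj flip: e(2,3))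
      have 2: "adj_arrow ?T ?T (id_fct (adC ?T)) (comp_fct (adD ?T) GG N.KT) (gmz (gcwf_comp1 g ?h))"
        using gcwf_forget_hom1[OF gh] idC by (simp add: hom1_LAdj flip: e(2,3))
      show ?thesis
        using 1 2 ial_nat nat_trans_id[OF is_functor_id[OF L.D.category_axioms]] idC
        by (simp add: hom2_LAdj adj_2arrow_def flip: e(2,3)) (simp add: ial_def zt_ia adj_comp1_def flip: e(2,3))
    qed
  qed simp_all
  have ai: "invertible2 GCwF_iso \<alpha>"
    by (rule invertible2_GCwF[OF a i1]) (simp_all add: ial_def e(1) flip: e(2,3))
  define \<beta> where "\<beta> = \<lparr>Src = gcwf_comp1 ?h g, Tgt = gcwf_id1 ?E, gmpsi = id_nt (fB (gu W)) (fB (gu W)) (id_fct (fB (gu W))),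
    gmphi = id_nt (fE (gu W)) (fE (gu W)) (id_fct (fE (gu W))), gmphid = ibe\<rparr>"
  have bs [simp]: "Src \<beta> = gcwf_comp1 ?h g" "Tgt \<beta> = gcwf_id1 ?E" "gmpsi \<beta> = id_nt (fB (gu W)) (fB (gu W)) (id_fct (fB (gu W)))"
    "gmphi \<beta> = id_nt (fE (gu W)) (fE (gu W)) (id_fct (fE (gu W)))" "gmphid \<beta> = ibe" by (simp_all add: \<beta>_def)
  have b: "\<beta> \<in> hom2 GCwF_iso (gcwf_comp1 ?h g) (gcwf_id1 ?E)"
  proof (rule hom2_GCwFI[OF hg i2])
    show "is_fib_2cell (gu ?E) (gu ?E) (gmC (gcwf_comp1 ?h g)) (gmH (gcwf_comp1 ?h g)) (gmC (gcwf_id1 ?E)) (gmH (gcwf_id1 ?E)) (gmpsi \<beta>) (gmphi \<beta>)"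
      using is_fib_2cell_id[OF is_fib_1cell_id[OF is_gcwfD(1)[OF W]]] idC by (simp add: idB e)
    show "is_fib_2cell (gud ?E) (gud ?E) (gmC (gcwf_comp1 ?h g)) (gmHd (gcwf_comp1 ?h g)) (gmC (gcwf_id1 ?E)) (gmHd (gcwf_id1 ?E)) (gmpsi \<beta>) (gmphid \<beta>)"
    proof -
      have "is_fib_1cell (gud ?E) (gud ?E) (gmC (gcwf_id1 ?E)) (gmHd (gcwf_id1 ?E))"
        "is_fib_1cell (gud ?E) (gud ?E) (gmC (gcwf_comp1 ?h g)) (gmHd (gcwf_comp1 ?h g))"
        using i2 hg unfolding hom1_GCwF by blast+
      then show ?thesis
        using ibe_nat nat_trans_id[OF is_functor_id[OF p.D.category_axioms]]
        by (simp add: is_fib_2cell_def idB)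
    qed
    show "gcwf_to_adj2 \<beta> \<in> hom2 LAdj_iso (gcwf_to_adj1 (gcwf_comp1 ?h g)) (gcwf_to_adj1 (gcwf_id1 ?E))"
    proof -
      have 1: "adj_arrow (gadj ?E) (gadj ?E) (id_fct (adC ?T)) (id_fct DT) (gmz (gcwf_id1 ?E))"
        using gcwf_forget_hom1[OF i2] by (simp add: hom1_LAdj flip: e(2,3))
      have 2: "adj_arrow (gadj ?E) (gadj ?E) (id_fct (adC ?T)) (comp_fct DT N.KT GG) (gmz (gcwf_comp1 ?h g))"
        using gcwf_forget_hom1[OF hg] idC by (simp add: hom1_LAdj flip: e(2,3))
      show ?thesis
        using 1 2 ibe_nat nat_trans_id[OF is_functor_id[OF L.D.category_axioms]] idC
        by (simp add: hom2_LAdj adj_2arrow_def flip: e(2,3)) (simp add: adj_comp1_def flip: e(2,3))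
    qed
  qed simp_all
  have bi: "invertible2 GCwF_iso \<beta>"
    by (rule invertible2_GCwF[OF b hg]) (simp_all add: ibe_iso e(1) flip: e(2,3))
  show thesis by (rule that[OF g gp a ai b bi])
qed

section \<open>Assembling the equivalence, its restrictions and the lifting statements\<close>

section \<open>The biequivalence and its restrictions\<close>

lemma closed_GCwF:
  "closed_1cells LAdj_iso P \<Longrightarrow> closed_1cells GCwF_iso (\<lambda>f. P (gcwf_to_adj1 f))"
  using closed_1cells_pullback[OF two_functor_forget_GCwF] by simp

lemma closed_WCmd:
  "closed_1cells Cmd Q \<Longrightarrow> closed_1cells WCmd (\<lambda>f. Q (wcmd_to_cmd1 f))"
  using closed_1cells_pullback[OF two_functor_forget_WCmd] by simp

context coalg_codes
begin

lemma etahat_equivalence: assumes W: "is_gcwf W" shows "equivalence1 GCwF_iso (etahat1 W)"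
proof -
  obtain g \<alpha> \<beta> where "g \<in> hom1 GCwF_iso (Ehat_0 (Chat_0 W)) W"
    "\<alpha> \<in> hom2 GCwF_iso (gcwf_id1 W) (gcwf_comp1 g (etahat1 W))" "invertible2 GCwF_iso \<alpha>"
    "\<beta> \<in> hom2 GCwF_iso (gcwf_comp1 (etahat1 W) g) (gcwf_id1 (Ehat_0 (Chat_0 W)))" "invertible2 GCwF_iso \<beta>"
    using etahat1_equivalence[OF W] by metis
  then show ?thesis using etahat1_hom[OF W] by (auto simp: equivalence1_def hom1_def)
qed

lemma etahat_pseudo: "is_gcwf W \<Longrightarrow> adj_pseudo (gcwf_to_adj1 (etahat1 W))"
  by (simp add: etahat1_forget EM_unit_loc.EM_unit1_pseudo EM_unit_locI is_gcwfD)

text \<open>To restrict the equivalence its quasi-inverse has to be retained as well, and it is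
  pseudo. The 2-cells then come along by 2-fullness.\<close>

lemma etahat_equivalence_ps: assumes W: "is_gcwf W" shows "equivalence1 GCwF_iso_ps (etahat1 W)"
proof -
  let ?P = "\<lambda>f :: ('b, 'n, 'o, 'a, 'd, 'e) gcwf_1cell. adj_pseudo (gcwf_to_adj1 f)"
  obtain g \<alpha> \<beta> where g: "g \<in> hom1 GCwF_iso (Ehat_0 (Chat_0 W)) W" "?P g"
    and a: "\<alpha> \<in> hom2 GCwF_iso (gcwf_id1 W) (gcwf_comp1 g (etahat1 W))" "invertible2 GCwF_iso \<alpha>"
    and b: "\<beta> \<in> hom2 GCwF_iso (gcwf_comp1 (etahat1 W) g) (gcwf_id1 (Ehat_0 (Chat_0 W)))" "invertible2 GCwF_iso \<beta>"
    by (rule etahat1_equivalence[OF W])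
  note h = etahat1_hom[OF W] etahat_pseudo[OF W]
  interpret S: two_category "wide_full_sub GCwF_iso ?P"
    by (rule two_category_sub[OF two_category_GCwF_iso closed_GCwF[OF closed_adj_pseudo]])
  have E: "is_gcwf (Ehat_0 (Chat_0 W))" using W by (simp add: is_gcwf_Ehat_0 is_wcomonad_Chat_0)
  have p: "?P (gcwf_id1 W)" "?P (gcwf_id1 (Ehat_0 (Chat_0 W)))" "?P (gcwf_comp1 g (etahat1 W))" "?P (gcwf_comp1 (etahat1 W) g)"
    using S.id1_hom[of W] S.id1_hom[of "Ehat_0 (Chat_0 W)"] S.comp1_hom[of "etahat1 W" W _ g] S.comp1_hom[of g _ W "etahat1 W"] W E g h
    by simp_all
  have "invertible2 (wide_full_sub GCwF_iso ?P) \<alpha>" "invertible2 (wide_full_sub GCwF_iso ?P) \<beta>"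
    using a b p by (auto intro!: invertible2_sub simp: hom2_def)
  moreover have "\<alpha> \<in> hom2 (wide_full_sub GCwF_iso ?P) (gcwf_id1 W) (gcwf_comp1 g (etahat1 W))"
    "\<beta> \<in> hom2 (wide_full_sub GCwF_iso ?P) (gcwf_comp1 (etahat1 W) g) (gcwf_id1 (Ehat_0 (Chat_0 W)))"
    using a b p by simp_all
  moreover have "g \<in> hom1 (wide_full_sub GCwF_iso ?P) (Ehat_0 (Chat_0 W)) W" using g by simp
  moreover have "etahat1 W \<in> One (wide_full_sub GCwF_iso ?P)" using h by (simp add: hom1_def)
  ultimately show ?thesis
    unfolding equivalence1_def GCwF_iso_ps_def by (intro conjI bexI[of _ g] bexI[of _ \<alpha>] bexI[of _ \<beta>]) simp_all
qed

lemma EM_1_cells: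
  assumes "is_cmd_1cell f"
  shows "adj_tight (EM_1 eo ea f)" "cmd_pseudo f \<Longrightarrow> adj_pseudo (EM_1 eo ea f)" "cmd_strict f \<Longrightarrow> adj_strict (EM_1 eo ea f)"
proof -
  interpret EM_arrow eo ea "Src f" "Tgt f" f by (rule EM_arrowI) (use assms in \<open>simp add: hom1_def\<close>)
  show "adj_tight (EM_1 eo ea f)" "cmd_pseudo f \<Longrightarrow> adj_pseudo (EM_1 eo ea f)" "cmd_strict f \<Longrightarrow> adj_strict (EM_1 eo ea f)"
    by (rule adj_tight_EM_1 EM_1_pseudo EM_1_strict; assumption)+
qed

text \<open>All conditions can be checked at the base level: the classes of 1-cells are inverse
  images along the forgetful 2-functors, and the lifted data lie strictly over the base-level
  data.\<close>

lemma restrict_hat: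
  assumes P: "closed_1cells LAdj_iso P" and Q: "closed_1cells Cmd Q"
    and "\<And>f. \<lbrakk>is_adj_1cell f; P f\<rbrakk> \<Longrightarrow> Q (C_1 f)"
    and "\<And>f. \<lbrakk>is_cmd_1cell f; Q f\<rbrakk> \<Longrightarrow> P (EM_1 eo ea f)"
    and "\<And>T. adjunction T \<Longrightarrow> P (EM_unit1 eo ea T)"
  shows "strict_biadjunction (wide_full_sub GCwF_iso (\<lambda>f. P (gcwf_to_adj1 f))) (wide_full_sub WCmd (\<lambda>f. Q (wcmd_to_cmd1 f)))
    Chat Ehat etahat epshat"
proof -
  interpret strict_biadjunction GCwF_iso WCmd Chat Ehat etahat epshat by (rule strict_biadjunction_hat)
  show ?thesis
    by (rule restrict[OF closed_GCwF[OF P] closed_WCmd[OF Q]])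
      (use assms in \<open>simp_all add: is_gcwf_1cell_def is_wcmd_1cell_def etahat1_forget is_gcwfD\<close>)
qed

text \<open>Tightness is part of the predicate on \<open>GCwF_iso\<close> from the start, so
  \<open>P\<close> has to yield \<open>Q\<close> under \<open>C\<close> only for tight 1-cells; the
  strict case depends on this. Tightness itself is automatic for images of \<open>Ehat\<close> and
  for the unit.\<close>

lemma two_reflection_hat:
  assumes "closed_1cells LAdj_iso P" and "closed_1cells Cmd Q"
    and "\<And>f. \<lbrakk>is_adj_1cell f; adj_tight f; P f\<rbrakk> \<Longrightarrow> Q (C_1 f)"
    and "\<And>f. \<lbrakk>is_cmd_1cell f; Q f\<rbrakk> \<Longrightarrow> P (EM_1 eo ea f)"
    and "\<And>T. adjunction T \<Longrightarrow> P (EM_unit1 eo ea T)"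
  shows "two_reflection (wide_full_sub GCwF (\<lambda>f. P (gcwf_to_adj1 f))) (wide_full_sub WCmd (\<lambda>f. Q (wcmd_to_cmd1 f)))
    Chat Ehat etahat epshat"
proof -
  interpret strict_biadjunction "wide_full_sub GCwF_iso (\<lambda>f. adj_tight (gcwf_to_adj1 f) \<and> P (gcwf_to_adj1 f))"
      "wide_full_sub WCmd (\<lambda>f. Q (wcmd_to_cmd1 f))" Chat Ehat etahat epshat
    by (rule restrict_hat[OF closed_1cells_conj[OF closed_adj_tight assms(1)] assms(2)])
      (use assms in \<open>simp_all add: EM_1_cells EM_unit_loc.EM_unit1_tight EM_unit_locI\<close>)
  show ?thesis
    unfolding GCwF_def wide_full_sub_twice
    by (rule two_reflection(2)) (simp add: etahat2_tight[of _ _ "Tgt _"] hom1_def)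
qed

lemma adjoint_biequivalence_hat: "adjoint_biequivalence GCwF_iso WCmd Chat Ehat etahat epshat"
proof -
  interpret strict_biadjunction GCwF_iso WCmd Chat Ehat etahat epshat by (rule strict_biadjunction_hat)
  show ?thesis by (rule adjoint_biequivalence) (simp add: etahat_equivalence)
qed

lemma adjoint_biequivalence_hat_ps: "adjoint_biequivalence GCwF_iso_ps WCmd_ps Chat Ehat etahat epshat"
proof -
  interpret strict_biadjunction GCwF_iso_ps WCmd_ps Chat Ehat etahat epshat
    unfolding GCwF_iso_ps_def WCmd_ps_def
    by (rule restrict_hat[OF closed_adj_pseudo closed_cmd_pseudo])
      (simp_all add: C_1_pseudo EM_1_cells EM_unit_loc.EM_unit1_pseudo EM_unit_locI)
  show ?thesis by (rule adjoint_biequivalence) (use etahat_equivalence_ps in \<open>simp add: GCwF_iso_ps_def\<close>)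
qed

lemma lifts_hat:
  "lifts GCwF_iso WCmd forget_GCwF forget_WCmd LAdj_iso Cmd Chat Ehat etahat epshat C_2fun (EM eo ea) (EM_unit eo ea) EM_counit"
  by (auto simp: lifts_def two_functor_forget_GCwF two_functor_forget_WCmd eq_2fun_def eq_pn_def comp_2fun_def whisker_left_def
     whisker_right_def C_2fun_def EM_def EM_unit_def EM_counit_def epshat_def etahat1_forget wcmd_to_cmd_ops is_wcmd_1cell_def
     is_gcwf_1cell_def hom1_def intro!: etahat2_forget)

text \<open>Cells of \<open>GCwF\<close> are cells of \<open>GCwF_iso\<close>, so the required
  equalities are inherited; what has to be added is that the forgetful 2-functor lands in
  \<open>LAdj\<close>.\<close>

lemma lifts_hat_tight:
  "lifts GCwF WCmd forget_GCwF forget_WCmd LAdj Cmd Chat Ehat etahat epshat C_2fun (EM eo ea) (EM_unit eo ea) EM_counit"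
proof -
  have "two_functor GCwF LAdj forget_GCwF"
    unfolding GCwF_def LAdj_def
    by (rule two_functor_sub[OF two_functor_forget_GCwF closed_GCwF[OF closed_adj_tight] closed_adj_tight]) simp
  then show ?thesis
    using lifts_hat by (auto simp: lifts_def eq_2fun_def eq_pn_def GCwF_def)
qed

end

theorem theorem4p9:
  fixes eo :: "'o \<times> 'a \<Rightarrow> 'd" and ea :: "'d \<times> 'a \<times> 'd \<Rightarrow> 'e"
  assumes "inj eo" and "inj ea"
  shows "\<exists>(C :: (('b, 'n, 'o, 'a, 'd, 'e) gcwf, ('b, 'n, 'o, 'a, 'd, 'e) gcwf_1cell,
              ('b, 'n, 'o, 'a, 'd, 'e) gcwf_2cell, ('b, 'n, 'o, 'a) wcomonad,
              ('b, 'n, 'o, 'a) wcmd_1cell, ('b, 'n, 'o, 'a) wcmd_2cell) twofun) E \<eta> \<epsilon>.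
    \<comment> \<open>(1)\<close>
    adjoint_biequivalence GCwF_iso WCmd C E \<eta> \<epsilon> \<and>
    biadjunction LAdj_iso Cmd C_2fun (EM eo ea) (EM_unit eo ea) EM_counit \<and>
    lifts GCwF_iso WCmd forget_GCwF forget_WCmd LAdj_iso Cmd
      C E \<eta> \<epsilon> C_2fun (EM eo ea) (EM_unit eo ea) EM_counit \<and>
    eq_2fun WCmd (comp_2fun C E) id_2fun \<and>
    (\<forall>x \<in> Zero WCmd. pn1 \<epsilon> x = id1 WCmd x) \<and>
    \<comment> \<open>(2)\<close>
    two_reflection GCwF WCmd C E \<eta> \<epsilon> \<and>
    two_adjunction LAdj Cmd C_2fun (EM eo ea) (EM_unit eo ea) EM_counit \<and>
    lifts GCwF WCmd forget_GCwF forget_WCmd LAdj Cmd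
      C E \<eta> \<epsilon> C_2fun (EM eo ea) (EM_unit eo ea) EM_counit \<and>
    \<comment> \<open>(3)\<close>
    adjoint_biequivalence GCwF_iso_ps WCmd_ps C E \<eta> \<epsilon> \<and>
    two_reflection GCwF_ps WCmd_ps C E \<eta> \<epsilon> \<and>
    two_reflection GCwF_str WCmd_str C E \<eta> \<epsilon>"
proof -
  interpret coalg_codes eo ea by (rule coalg_codes.intro[OF assms])
  \<comment> \<open>The unrestricted reflection is the case of predicates that hold of every
    1-cell.\<close>
  have "two_reflection GCwF WCmd Chat Ehat etahat epshat"
    using two_reflection_hat[OF closed_1cells_True closed_1cells_True] by (simp add: wide_full_sub_True)
  moreover have "two_reflection GCwF_ps WCmd_ps Chat Ehat etahat epshat"
    unfolding GCwF_ps_def WCmd_ps_def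
    by (rule two_reflection_hat[OF closed_adj_pseudo closed_cmd_pseudo])
      (simp_all add: C_1_pseudo EM_1_cells EM_unit_loc.EM_unit1_pseudo EM_unit_locI)
  moreover have "two_reflection GCwF_str WCmd_str Chat Ehat etahat epshat"
    unfolding GCwF_str_def WCmd_str_def
    by (rule two_reflection_hat[OF closed_adj_strict closed_cmd_strict])
      (simp_all add: C_1_strict EM_1_cells EM_unit_loc.EM_unit1_strict EM_unit_locI)
  moreover have "eq_2fun WCmd (comp_2fun Chat Ehat) id_2fun"
    by (rule strict_biadjunction.eq_2fun_FG[OF strict_biadjunction_hat])
  moreover have "biadjunction LAdj_iso Cmd C_2fun (EM eo ea) (EM_unit eo ea) EM_counit"
    by (rule strict_biadjunction.biadjunction[OF strict_biadjunction_EM])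
  moreover have "\<forall>x \<in> Zero WCmd. pn1 epshat x = id1 WCmd x" by (simp add: epshat_def)
  ultimately show ?thesis
    using adjoint_biequivalence_hat lifts_hat two_adjunction_EM lifts_hat_tight adjoint_biequivalence_hat_ps
    by (intro exI[of _ Chat] exI[of _ Ehat] exI[of _ etahat] exI[of _ epshat] conjI)
qed

end
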